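(* Let $k$ be a positive integer. There is a data structure for maintaining an approximate rank-$k$ truncated SVD $[\mathbf{U}_k,\mathbf{\Sigma}_k,\mathbf{V}_k]$ of a matrix $\mathbf{A}\in\mathbb{R}^{m\times n}$ that supports the following operations in the following time, where at each moment $m\times n$ is the current size of the matrix, $[\mathbf{U}_k,\mathbf{\Sigma}_k,\mathbf{V}_k]$ is the currently maintained triple, and $\widetilde{\mathbf{A}}_k=\mathbf{U}_k\mathbf{\Sigma}_k\mathbf{V}_k^\top$. (1) Add rows: given $\mathbf{E}_r\in\mathbb{R}^{s\times n}$, update $\mathbf{U}_k,\mathbf{\Sigma}_k,\mathbf{V}_k\gets \mathrm{SVD}_k\left(\begin{bmatrix}\widetilde{\mathbf{A}}_k\\ \mathbf{E}_r\end{bmatrix}\right)$ in $O\left(nnz(\mathbf{E}_r)(s+k)^2+(s+k)^3\right)$ time. (2) Add columns: given $\mathbf{E}_c\in\mathbb{R}^{m\times s}$, update $\mathbf{U}_k,\mathbf{\Sigma}_k,\mathbf{V}_k\gets \mathrm{SVD}_k\left(\begin{bmatrix}\widetilde{\mathbf{A}}_k & \mathbf{E}_c\end{bmatrix}\right)$ in $O\left(nnz(\mathbf{E}_c)(s+k)^2+(s+k)^3\right)$ time. (3) Update weights: given $\mathbf{D}\in\mathbb{R}^{m\times s}$ and $\mathbf{E}_m\in\mathbb{R}^{n\times s}$, update $\mathbf{U}_k,\mathbf{\Sigma}_k,\mathbf{V}_k\gets \mathrm{SVD}_k\left(\widetilde{\mathbf{A}}_k+\mathbf{D}\mathbf{E}_m^\top\right)$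 in $O\left((nnz(\mathbf{D})+nnz(\mathbf{E}_m))(s+k)^2+(s+k)^3\right)$ time. (4) Query: given an index $i$, return the $i$-th row $\mathbf{U}_k[i]$ of $\mathbf{U}_k$ (or the $i$-th row $\mathbf{V}_k[i]$ of $\mathbf{V}_k$) and $\mathbf{\Sigma}_k$ in $O(k^2)$ time.
   Context: For a real matrix $\mathbf{X}\in\mathbb{R}^{m\times n}$ with singular value decomposition $\mathbf{X}=\mathbf{U}\mathbf{\Sigma}\mathbf{V}^\top$ (singular values sorted in nonincreasing order), $\mathrm{SVD}_k(\mathbf{X})$ denotes a rank-$k$ truncated SVD of $\mathbf{X}$: the triple $\mathbf{U}_k\in\mathbb{R}^{m\times k}$, $\mathbf{\Sigma}_k\in\mathbb{R}^{k\times k}$, $\mathbf{V}_k\in\mathbb{R}^{n\times k}$ obtained by keeping the $k$ largest singular values (as the diagonal matrix $\mathbf{\Sigma}_k$) and the corresponding $k$ columns of $\mathbf{U}$ and $\mathbf{V}$. $nnz(\mathbf{X})$ is the number of nonzero entries of $\mathbf{X}$; update matrices are given in sparse form. The parameter $s$ is the size of the update (number of added rows, number of added columns, or number of columns of $\mathbf{D}$ and $\mathbf{E}_m$). Maintaining an approximate rank-$k$ truncated SVD: the data structure starts from a given (approximate) rank-$k$ truncated SVD $[\mathbf{U}_k,\mathbf{\Sigma}_k,\mathbf{V}_k]$ of $\mathbf{A}$. Whenever a modification (adding rows, adding columns, or adding a low-rank matrix $\mathbf{D}\mathbf{E}_m^\top$) is applied to $\mathbf{A}$, the triple is updated to the rank-$k$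 truncated SVD of the matrix obtained by applying that same modification to $\widetilde{\mathbf{A}}_k=\mathbf{U}_k\mathbf{\Sigma}_k\mathbf{V}_k^\top$. The triple need not be stored explicitly; for instance, $\mathbf{U}_k$ and $\mathbf{V}_k$ may each be stored as a product of two matrices, with rows recovered by Query. Time is the number of operations, with arithmetic operations on real numbers having unit cost and a (truncated) SVD of a dense $p\times p$ matrix counted as $O(p^3)$. *)

theory Defs
  imports Complex_Main "Jordan_Normal_Form.Matrix"
begin

section \<open>Truncated singular value decompositions\<close>

definition is_svd :: "real mat \<Rightarrow> real mat \<Rightarrow> real mat \<Rightarrow> real mat \<Rightarrow> bool" where
  "is_svd X U S V \<longleftrightarrow>
     (let m = dim_row X; n = dim_col X in
       U \<in> carrier_mat m m \<and> U\<^sup>T * U = 1\<^sub>m m \<and>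
       V \<in> carrier_mat n n \<and> V\<^sup>T * V = 1\<^sub>m n \<and>
       S \<in> carrier_mat m n \<and> diagonal_mat S \<and>
       (\<forall>i < min m n. 0 \<le> S $$ (i,i)) \<and>
       (\<forall>j < min m n. \<forall>i \<le> j. S $$ (j,j) \<le> S $$ (i,i)) \<and>
       X = U * S * V\<^sup>T)"

definition first_cols :: "nat \<Rightarrow> real mat \<Rightarrow> real mat" where
  "first_cols k U = mat (dim_row U) k (\<lambda>(i,j). U $$ (i,j))"

text \<open>
  A relation rather than a function, since neither the singular vectors nor (for repeated
  singular values) the retained columns are unique.
\<close>

definition is_truncated_svd ::
    "nat \<Rightarrow> real mat \<Rightarrow> real mat \<Rightarrow> real mat \<Rightarrow> real mat \<Rightarrow> bool" where
  "is_truncated_svd k X Uk Sk Vk \<longleftrightarrow>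
     k \<le> min (dim_row X) (dim_col X) \<and>
     (\<exists>U S V. is_svd X U S V \<and>
        Uk = first_cols k U \<and> Sk = mat k k (\<lambda>(i,j). S $$ (i,j)) \<and> Vk = first_cols k V)"

text \<open>
  The triples from which the data structure may be started: everything that has the shape of
  a rank-\<open>k\<close> truncated SVD of some \<open>m \<times> n\<close> matrix. How well its product approximates
  a matrix \<open>A\<close> plays no role. The lemma \<open>is_truncated_svd_imp_svd_triple\<close> shows that the exact truncated
  SVD of every matrix is included.
\<close>

definition svd_triple ::
    "nat \<Rightarrow> nat \<Rightarrow> nat \<Rightarrow> real mat \<Rightarrow> real mat \<Rightarrow> real mat \<Rightarrow> bool" where
  "svd_triple k m n U S V \<longleftrightarrow>
     k \<le> min m n \<and>
     U \<in> carrier_mat m k \<and> U\<^sup>T * U = 1\<^sub>m k \<and>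
     V \<in> carrier_mat n k \<and> V\<^sup>T * V = 1\<^sub>m k \<and>
     S \<in> carrier_mat k k \<and> diagonal_mat S \<and>
     (\<forall>i < k. 0 \<le> S $$ (i,i)) \<and>
     (\<forall>j < k. \<forall>i \<le> j. S $$ (j,j) \<le> S $$ (i,i))"

lemma first_cols_orthonormal:
  assumes U: "U \<in> carrier_mat m m" "U\<^sup>T * U = 1\<^sub>m m" and k: "k \<le> m"
  shows "(first_cols k U)\<^sup>T * first_cols k U = 1\<^sub>m k"
proof (rule eq_matI)
  fix i j assume "i < dim_row (1\<^sub>m k :: real mat)" "j < dim_col (1\<^sub>m k :: real mat)"
  then have ij: "i < k" "j < k" by auto
  have col: "col (first_cols k U) l = col U l" if "l < k" for l
    using that U(1) k by (intro eq_vecI) (auto simp: first_cols_def)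
  have "((first_cols k U)\<^sup>T * first_cols k U) $$ (i,j)
      = col (first_cols k U) i \<bullet> col (first_cols k U) j"
    using ij by (simp add: first_cols_def)
  also have "\<dots> = col U i \<bullet> col U j"
    using ij by (simp add: col)
  also have "\<dots> = (U\<^sup>T * U) $$ (i,j)"
    using ij k U(1) by auto
  also have "\<dots> = 1\<^sub>m k $$ (i,j)"
    using ij k by (simp add: U(2))
  finally show "((first_cols k U)\<^sup>T * first_cols k U) $$ (i,j) = 1\<^sub>m k $$ (i,j)" .
qed (auto simp: first_cols_def)

lemma is_truncated_svd_imp_svd_triple:
  assumes "is_truncated_svd k X U S V"
  shows "svd_triple k (dim_row X) (dim_col X) U S V"
proof -
  let ?m = "dim_row X" and ?n = "dim_col X"
  obtain U' S' V' where k: "k \<le> min ?m ?n" and svd: "is_svd X U' S' V'"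
    and eqs: "U = first_cols k U'" "S = mat k k (\<lambda>(i,j). S' $$ (i,j))" "V = first_cols k V'"
    using assms unfolding is_truncated_svd_def by blast
  have U': "U' \<in> carrier_mat ?m ?m" "U'\<^sup>T * U' = 1\<^sub>m ?m"
    and V': "V' \<in> carrier_mat ?n ?n" "V'\<^sup>T * V' = 1\<^sub>m ?n"
    and S': "S' \<in> carrier_mat ?m ?n" "diagonal_mat S'"
      "\<forall>i < min ?m ?n. 0 \<le> S' $$ (i,i)"
      "\<forall>j < min ?m ?n. \<forall>i \<le> j. S' $$ (j,j) \<le> S' $$ (i,i)"
    using svd unfolding is_svd_def Let_def by blast+
  have "U\<^sup>T * U = 1\<^sub>m k" "V\<^sup>T * V = 1\<^sub>m k"
    unfolding eqs using k by (auto intro: first_cols_orthonormal[OF U'] first_cols_orthonormal[OF V'])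
  moreover have "U \<in> carrier_mat ?m k" "V \<in> carrier_mat ?n k"
    using U'(1) V'(1) by (auto simp: eqs first_cols_def)
  moreover have "S \<in> carrier_mat k k" "diagonal_mat S"
    "\<forall>i < k. 0 \<le> S $$ (i,i)" "\<forall>j < k. \<forall>i \<le> j. S $$ (j,j) \<le> S $$ (i,i)"
    using S' k by (auto simp: eqs diagonal_mat_def)
  ultimately show ?thesis
    using k unfolding svd_triple_def by blast
qed

text \<open>\<open>[A B]\<close>; the counterpart \<open>A @\<^sub>r B\<close> for rows is in the library.\<close>

definition append_cols :: "real mat \<Rightarrow> real mat \<Rightarrow> real mat" where
  "append_cols A B = four_block_mat A B (0\<^sub>m 0 (dim_col A)) (0\<^sub>m 0 (dim_col B))"

definition nnz :: "real mat \<Rightarrow> nat" where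
  "nnz X = card {(i,j). i < dim_row X \<and> j < dim_col X \<and> X $$ (i,j) \<noteq> 0}"

text \<open>Sparse form: every nonzero entry listed exactly once, in any order.\<close>

type_synonym sparse = "(nat \<times> nat \<times> real) list"

definition is_sparse_form :: "sparse \<Rightarrow> real mat \<Rightarrow> bool" where
  "is_sparse_form es X \<longleftrightarrow>
     distinct es \<and>
     set es = {(i, j, X $$ (i,j)) | i j. i < dim_row X \<and> j < dim_col X \<and> X $$ (i,j) \<noteq> 0}"

section \<open>A real random access machine with an SVD instruction\<close>

text \<open>
  Programs are finite syntactic objects that do not depend on any input size. The machine has
  integer and real registers and two-dimensional integer and real arrays of unbounded extent, all
  addressed by name. Integer arithmetic is limited to addition and truncated subtraction, which
  suffices because array cells are addressed by two indices; there is no conversion from reals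
  to integers, and real literals are integers.
\<close>

record state =
  nvar :: "string \<Rightarrow> nat"
  rvar :: "string \<Rightarrow> real"
  narr :: "string \<Rightarrow> nat \<Rightarrow> nat \<Rightarrow> nat"
  rarr :: "string \<Rightarrow> nat \<Rightarrow> nat \<Rightarrow> real"

datatype nexp =
    NLit nat
  | NVar string
  | NRead string nexp nexp
  | NAdd nexp nexp
  | NSub nexp nexp

datatype rexp =
    RLit int
  | RVar string
  | RRead string nexp nexp
  | RAdd rexp rexp
  | RSub rexp rexp
  | RMul rexp rexp
  | RDiv rexp rexp
  | RSqrt rexp

datatype bexp =
    NLess nexp nexp
  | RLess rexp rexp
  | BNot bexp
  | BAnd bexp bexp

datatype com =
    Skip
  | NAssign string nexp
  | RAssign string rexp
  | NWrite string nexp nexp nexp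
  | RWrite string nexp nexp rexp
  | Seq com com
  | If bexp com com
  | While bexp com
  | SVD nexp string string string string

fun neval :: "nexp \<Rightarrow> state \<Rightarrow> nat" where
  "neval (NLit c) st = c"
| "neval (NVar x) st = nvar st x"
| "neval (NRead a i j) st = narr st a (neval i st) (neval j st)"
| "neval (NAdd e f) st = neval e st + neval f st"
| "neval (NSub e f) st = neval e st - neval f st"

fun reval :: "rexp \<Rightarrow> state \<Rightarrow> real" where
  "reval (RLit c) st = real_of_int c"
| "reval (RVar x) st = rvar st x"
| "reval (RRead a i j) st = rarr st a (neval i st) (neval j st)"
| "reval (RAdd e f) st = reval e st + reval f st"
| "reval (RSub e f) st = reval e st - reval f st"
| "reval (RMul e f) st = reval e st * reval f st"
| "reval (RDiv e f) st = reval e st / reval f st"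
| "reval (RSqrt e) st = sqrt (reval e st)"

fun beval :: "bexp \<Rightarrow> state \<Rightarrow> bool" where
  "beval (NLess e f) st \<longleftrightarrow> neval e st < neval f st"
| "beval (RLess e f) st \<longleftrightarrow> reval e st < reval f st"
| "beval (BNot b) st \<longleftrightarrow> \<not> beval b st"
| "beval (BAnd b c) st \<longleftrightarrow> beval b st \<and> beval c st"

text \<open>Evaluating an expression costs one unit per node of its syntax tree.\<close>

fun ncost :: "nexp \<Rightarrow> nat" where
  "ncost (NLit c) = 1"
| "ncost (NVar x) = 1"
| "ncost (NRead a i j) = 1 + ncost i + ncost j"
| "ncost (NAdd e f) = 1 + ncost e + ncost f"
| "ncost (NSub e f) = 1 + ncost e + ncost f"

fun rcost :: "rexp \<Rightarrow> nat" where
  "rcost (RLit c) = 1"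
| "rcost (RVar x) = 1"
| "rcost (RRead a i j) = 1 + ncost i + ncost j"
| "rcost (RAdd e f) = 1 + rcost e + rcost f"
| "rcost (RSub e f) = 1 + rcost e + rcost f"
| "rcost (RMul e f) = 1 + rcost e + rcost f"
| "rcost (RDiv e f) = 1 + rcost e + rcost f"
| "rcost (RSqrt e) = 1 + rcost e"

fun bcost :: "bexp \<Rightarrow> nat" where
  "bcost (NLess e f) = 1 + ncost e + ncost f"
| "bcost (RLess e f) = 1 + rcost e + rcost f"
| "bcost (BNot b) = 1 + bcost b"
| "bcost (BAnd b c) = 1 + bcost b + bcost c"

definition set_cell ::
    "string \<Rightarrow> nat \<Rightarrow> nat \<Rightarrow> 'v \<Rightarrow> (string \<Rightarrow> nat \<Rightarrow> nat \<Rightarrow> 'v) \<Rightarrow> string \<Rightarrow> nat \<Rightarrow> nat \<Rightarrow> 'v" where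
  "set_cell a i j v h = h(a := (h a)(i := (h a i)(j := v)))"

definition read_block :: "string \<Rightarrow> nat \<Rightarrow> nat \<Rightarrow> state \<Rightarrow> real mat" where
  "read_block a p q st = mat p q (\<lambda>(i,j). rarr st a i j)"

definition write_block :: "string \<Rightarrow> real mat \<Rightarrow> state \<Rightarrow> state" where
  "write_block a M st = st\<lparr>rarr := (rarr st)(a :=
     (\<lambda>i j. if i < dim_row M \<and> j < dim_col M then M $$ (i,j) else rarr st a i j))\<rparr>"

text \<open>
  The SVD routine of the machine is an arbitrary function returning some SVD of every square
  matrix; on a \<open>p \<times> p\<close> matrix it is charged \<open>p\<^sup>3\<close>.
\<close>

type_synonym svd_routine = "real mat \<Rightarrow> real mat \<times> real mat \<times> real mat"

definition valid_svd_routine :: "svd_routine \<Rightarrow> bool" where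
  "valid_svd_routine svd \<longleftrightarrow>
     (\<forall>p. \<forall>X \<in> carrier_mat p p. case svd X of (U, S, V) \<Rightarrow> is_svd X U S V)"

definition apply_svd ::
    "svd_routine \<Rightarrow> nat \<Rightarrow> string \<Rightarrow> string \<Rightarrow> string \<Rightarrow> string \<Rightarrow> state \<Rightarrow> state" where
  "apply_svd svd p a u s v st =
     (case svd (read_block a p p st) of (U, S, V) \<Rightarrow>
        write_block v V (write_block s S (write_block u U st)))"

text \<open>\<open>exec svd c st t st'\<close>: started in \<open>st\<close>, program \<open>c\<close> terminates in \<open>st'\<close>
  after time \<open>t\<close>.\<close>

inductive exec :: "svd_routine \<Rightarrow> com \<Rightarrow> state \<Rightarrow> nat \<Rightarrow> state \<Rightarrow> bool" for svd where
  Skip: "exec svd Skip st 1 st"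
| NAssign: "exec svd (NAssign x e) st (1 + ncost e)
     (st\<lparr>nvar := (nvar st)(x := neval e st)\<rparr>)"
| RAssign: "exec svd (RAssign x e) st (1 + rcost e)
     (st\<lparr>rvar := (rvar st)(x := reval e st)\<rparr>)"
| NWrite: "exec svd (NWrite a i j e) st (1 + ncost i + ncost j + ncost e)
     (st\<lparr>narr := set_cell a (neval i st) (neval j st) (neval e st) (narr st)\<rparr>)"
| RWrite: "exec svd (RWrite a i j e) st (1 + ncost i + ncost j + rcost e)
     (st\<lparr>rarr := set_cell a (neval i st) (neval j st) (reval e st) (rarr st)\<rparr>)"
| Seq: "exec svd c st t st' \<Longrightarrow> exec svd d st' t' st'' \<Longrightarrow>
     exec svd (Seq c d) st (t + t') st''"
| IfTrue: "beval b st \<Longrightarrow> exec svd c st t st' \<Longrightarrow>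
     exec svd (If b c d) st (1 + bcost b + t) st'"
| IfFalse: "\<not> beval b st \<Longrightarrow> exec svd d st t st' \<Longrightarrow>
     exec svd (If b c d) st (1 + bcost b + t) st'"
| WhileFalse: "\<not> beval b st \<Longrightarrow> exec svd (While b c) st (1 + bcost b) st"
| WhileTrue: "beval b st \<Longrightarrow> exec svd c st t st' \<Longrightarrow> exec svd (While b c) st' t' st'' \<Longrightarrow>
     exec svd (While b c) st (1 + bcost b + t + t') st''"
| SVD: "exec svd (SVD e a u s v) st (1 + ncost e + neval e st ^ 3)
     (apply_svd svd (neval e st) a u s v st)"

lemma exec_deterministic:
  "exec svd c st t st' \<Longrightarrow> exec svd c st u st'' \<Longrightarrow> t = u \<and> st' = st''"
proof (induction arbitrary: u st'' rule: exec.induct)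
  case (Seq c st t st' d t' st3)
  from Seq.prems show ?case by (cases) (use Seq.IH in blast)
next
  case (IfTrue b st c t st' d)
  from IfTrue.prems show ?case by (cases) (use IfTrue in blast)+
next
  case (IfFalse b st d t st' c)
  from IfFalse.prems show ?case by (cases) (use IfFalse in blast)+
next
  case (WhileTrue b st c t st' t' st3)
  from WhileTrue.prems show ?case by (cases) (use WhileTrue in blast)+
qed (auto elim: exec.cases)

section \<open>Input and output conventions\<close>

text \<open>
  Before an operation the environment places its arguments in the memory, leaving all other
  cells as the previous operations left them. An argument in sparse form occupies, under its name,
  an integer register (number of nonzero entries), the first two columns of an integer array (row
  and column indices) and the first column of a real array (values).
\<close>

definition set_nvar :: "string \<Rightarrow> nat \<Rightarrow> state \<Rightarrow> state" where
  "set_nvar x v st = st\<lparr>nvar := (nvar st)(x := v)\<rparr>"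

definition load_sparse :: "string \<Rightarrow> sparse \<Rightarrow> state \<Rightarrow> state" where
  "load_sparse x es st = st\<lparr>
     nvar := (nvar st)(x := length es),
     narr := (narr st)(x := (\<lambda>l c.
       if l < length es \<and> c = 0 then fst (es ! l)
       else if l < length es \<and> c = 1 then fst (snd (es ! l))
       else narr st x l c)),
     rarr := (rarr st)(x := (\<lambda>l c.
       if l < length es \<and> c = 0 then snd (snd (es ! l)) else rarr st x l c))\<rparr>"

definition blank_state :: state where
  "blank_state = \<lparr>nvar = (\<lambda>_. 0), rvar = (\<lambda>_. 0), narr = (\<lambda>_ _ _. 0), rarr = (\<lambda>_ _ _. 0)\<rparr>"

definition start_state :: "nat \<Rightarrow> nat \<Rightarrow> nat \<Rightarrow> real mat \<Rightarrow> real mat \<Rightarrow> real mat \<Rightarrow> state" where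
  "start_state k m n U S V =
     write_block ''U'' U (write_block ''Sigma'' S (write_block ''V'' V
       (set_nvar ''k'' k (set_nvar ''m'' m (set_nvar ''n'' n blank_state)))))"

text \<open>
  A query leaves the requested row in row \<open>0\<close> of the array \<open>row\<close> and the matrix of
  singular values in the array \<open>Sigma\<close>.
\<close>

definition query_answer :: "nat \<Rightarrow> state \<Rightarrow> real vec \<times> real mat" where
  "query_answer k st = (row (read_block ''row'' 1 k st) 0, read_block ''Sigma'' k k st)"

section \<open>The operations\<close>

text \<open>
  \<open>Rep st U S V\<close> is the representation relation of the data structure: the memory \<open>st\<close>
  represents the maintained triple \<open>U, S, V\<close>, in whatever form. The matrix being modified
  is \<open>U * S * V\<^sup>T\<close>, with \<open>dim_row U\<close> rows and \<open>dim_row V\<close> columns.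
\<close>

type_synonym rep = "state \<Rightarrow> real mat \<Rightarrow> real mat \<Rightarrow> real mat \<Rightarrow> bool"

definition implements_start :: "svd_routine \<Rightarrow> nat \<Rightarrow> rep \<Rightarrow> com \<Rightarrow> bool" where
  "implements_start svd k Rep c \<longleftrightarrow>
     (\<forall>m n U S V. svd_triple k m n U S V \<longrightarrow>
        (\<exists>t st. exec svd c (start_state k m n U S V) t st \<and> Rep st U S V))"

definition implements_add_rows :: "svd_routine \<Rightarrow> nat \<Rightarrow> nat \<Rightarrow> rep \<Rightarrow> com \<Rightarrow> bool" where
  "implements_add_rows svd C k Rep c \<longleftrightarrow>
     (\<forall>st U S V s E es.
        Rep st U S V \<and> E \<in> carrier_mat s (dim_row V) \<and> is_sparse_form es E \<longrightarrow>
        (\<exists>t st' U' S' V'.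
           exec svd c (set_nvar ''s'' s (load_sparse ''E'' es st)) t st' \<and>
           t \<le> C * (nnz E * (s + k)^2 + (s + k)^3) \<and>
           is_truncated_svd k ((U * S * V\<^sup>T) @\<^sub>r E) U' S' V' \<and>
           Rep st' U' S' V'))"

definition implements_add_cols :: "svd_routine \<Rightarrow> nat \<Rightarrow> nat \<Rightarrow> rep \<Rightarrow> com \<Rightarrow> bool" where
  "implements_add_cols svd C k Rep c \<longleftrightarrow>
     (\<forall>st U S V s E es.
        Rep st U S V \<and> E \<in> carrier_mat (dim_row U) s \<and> is_sparse_form es E \<longrightarrow>
        (\<exists>t st' U' S' V'.
           exec svd c (set_nvar ''s'' s (load_sparse ''E'' es st)) t st' \<and>
           t \<le> C * (nnz E * (s + k)^2 + (s + k)^3) \<and>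
           is_truncated_svd k (append_cols (U * S * V\<^sup>T) E) U' S' V' \<and>
           Rep st' U' S' V'))"

definition implements_update_weights :: "svd_routine \<Rightarrow> nat \<Rightarrow> nat \<Rightarrow> rep \<Rightarrow> com \<Rightarrow> bool" where
  "implements_update_weights svd C k Rep c \<longleftrightarrow>
     (\<forall>st U S V s D ds E es.
        Rep st U S V \<and>
        D \<in> carrier_mat (dim_row U) s \<and> is_sparse_form ds D \<and>
        E \<in> carrier_mat (dim_row V) s \<and> is_sparse_form es E \<longrightarrow>
        (\<exists>t st' U' S' V'.
           exec svd c (set_nvar ''s'' s (load_sparse ''D'' ds (load_sparse ''E'' es st))) t st' \<and>
           t \<le> C * ((nnz D + nnz E) * (s + k)^2 + (s + k)^3) \<and>
           is_truncated_svd k (U * S * V\<^sup>T + D * E\<^sup>T) U' S' V' \<and>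
           Rep st' U' S' V'))"

definition implements_query_U :: "svd_routine \<Rightarrow> nat \<Rightarrow> nat \<Rightarrow> rep \<Rightarrow> com \<Rightarrow> bool" where
  "implements_query_U svd C k Rep c \<longleftrightarrow>
     (\<forall>st U S V i. Rep st U S V \<and> i < dim_row U \<longrightarrow>
        (\<exists>t st'. exec svd c (set_nvar ''i'' i st) t st' \<and> t \<le> C * k^2 \<and>
           query_answer k st' = (row U i, S) \<and> Rep st' U S V))"

definition implements_query_V :: "svd_routine \<Rightarrow> nat \<Rightarrow> nat \<Rightarrow> rep \<Rightarrow> com \<Rightarrow> bool" where
  "implements_query_V svd C k Rep c \<longleftrightarrow>
     (\<forall>st U S V i. Rep st U S V \<and> i < dim_row V \<longrightarrow>
        (\<exists>t st'. exec svd c (set_nvar ''i'' i st) t st' \<and> t \<le> C * k^2 \<and>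
           query_answer k st' = (row V i, S) \<and> Rep st' U S V))"

end

theory Submission
  imports Defs "Jordan_Normal_Form.Determinant"
begin

text \<open>
  Adding \<open>s\<close> rows to \<open>A = U S V\<^sup>T\<close> means padding \<open>U\<close> with zero rows and adding
  \<open>D E\<^sup>T\<close> with \<open>D\<close> an embedding of unit vectors; adding columns is symmetric. So everything reduces to
  \<open>A + D E\<^sup>T = [U D] K [V E]\<^sup>T\<close> with \<open>K = diag(S, 1)\<close> of size \<open>p = k + s\<close>.

  The Gram matrix of \<open>[U D]\<close> costs \<open>O(nnz(D) p\<^sup>2)\<close>, as only rows touched by \<open>D\<close> are needed, and its SVD gives
  \<open>[U D] = Q R\<close> where the nonzero columns of \<open>Q\<close> are orthonormal. The SVD of the \<open>p \<times> p\<close> matrix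
  \<open>R K R'\<^sup>T\<close> yields the new singular vectors as \<open>[U D] Y\<close>. If its rank is below \<open>k\<close>, the missing
  ones are singular vectors of a projection inside the range of \<open>Q\<close>. Hence every row of \<open>U\<close> is multiplied by the upper
  \<open>k \<times> k\<close> block \<open>F\<close> of \<open>Y\<close>, and only the rows touched by \<open>D\<close> get another summand.

  Multiplying all rows at once is done lazily, by updating a matrix \<open>W\<close> with \<open>U = x W\<close>. Later rows can only be
  assigned if \<open>W\<close> stays invertible, but \<open>F\<close> may be singular, and its corank may be large. Therefore every linear
  dependence between rows of \<open>W F\<close> is recorded as an event that eliminates the youngest coordinate involved, to whose row in
  \<open>W\<close> a new direction is added. As only older coordinates are changed, a row of \<open>x\<close> is affected, for every coordinate,
  only by the first event on it after its assignment. These at most \<open>k\<close> events are found by following pointers, so a row is read in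
  time \<open>O(k\<^sup>2)\<close>, however many events there were.
\<close>

section \<open>Matrices\<close>

text \<open>The time bounds contain neither m nor n, so no operation may visit a row that its sparse
  input does not name; this is what forces the implicit form of U and V. Why the repair of W is
  invisible: an event with coefficients y, where y W = 0 and y(c) = 1, replaces x by x - x(c) y.
  This leaves x W unchanged and makes coordinate c vanish, so row c of W may then be altered freely.
  Right singular vectors belonging to the null directions are added there until W is invertible.
  Taking the youngest coordinate as c makes the vanishing permanent: a coordinate that has vanished
  for some row can only be refilled from one that is at least as young, and that one has vanished
  for this row as well. An update creates at most k events of cost O(k^2) each. The unit embeddings
  for added rows and columns have s nonzero entries, and s (s + k)^2 is absorbed by (s + k)^3.
  Division by zero yields zero, so pseudo-inverses and indicators of nonzero singular values are
  plain quotients.\<close>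

declare index_mult_mat(1) [simp del]

text \<open>The side conditions are equations between dimensions instead of carrier memberships, so
  that the simplifier can discharge them while it normalises long products to right-nested
  form.\<close>

lemma mat_assoc: "dim_col A = dim_row B \<Longrightarrow> dim_col B = dim_row C \<Longrightarrow>
    (A * B) * C = A * (B * (C :: real mat))"
  by (rule assoc_mult_mat[of _ "dim_row A" "dim_row B" _ "dim_row C" _ "dim_col C"]) auto

lemma mat_transpose_mult: "dim_col A = dim_row B \<Longrightarrow> (A * B)\<^sup>T = B\<^sup>T * (A :: real mat)\<^sup>T"
  by (rule transpose_mult[of _ "dim_row A" "dim_row B" _ "dim_col B"]) auto

lemma mat_one_left: "dim_row A = n \<Longrightarrow> 1\<^sub>m n * A = (A :: real mat)"
  by (rule left_mult_one_mat[of _ n "dim_col A"]) auto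

lemma mat_one_right: "dim_col A = n \<Longrightarrow> A * 1\<^sub>m n = (A :: real mat)"
  by (rule right_mult_one_mat[of _ "dim_row A" n]) auto

lemmas mat_simps = mat_assoc mat_transpose_mult mat_one_left mat_one_right

lemma orthogonal_inverse:
  assumes "A \<in> carrier_mat p p" "A\<^sup>T * A = (1\<^sub>m p :: real mat)"
  shows "A * A\<^sup>T = 1\<^sub>m p"
  by (rule mat_mult_left_right_inverse[OF _ _ assms(2)]) (use assms in auto)

text \<open>In right-nested products an inverse pair does not stand as a subterm
  \<open>A * B\<close>, so it is cancelled in front of the remaining factor
  \<open>X\<close>.\<close>

lemma mat_cancel:
  assumes "A * B = (1\<^sub>m p :: real mat)" "dim_col A = dim_row B" "dim_col B = dim_row X"
    "dim_row X = p"
  shows "A * (B * X) = X"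
  using mat_assoc[of A B X] assms mat_one_left[of X p] by simp

lemma mult_mat_index: "i < dim_row A \<Longrightarrow> j < dim_col B \<Longrightarrow> dim_col A = dim_row B \<Longrightarrow>
    (A * B) $$ (i,j) = (\<Sum>l<dim_row B. A $$ (i,l) * (B $$ (l,j) :: real))"
  by (simp add: index_mult_mat scalar_prod_def atLeast0LessThan)

text \<open>The diagonal entries of the Gram matrix are the sums of squares of the columns of
  \<open>Z\<close>.\<close>

lemma gram_eq_zero:
  assumes "Z\<^sup>T * Z = (0\<^sub>m (dim_col Z) (dim_col Z) :: real mat)"
  shows "Z = 0\<^sub>m (dim_row Z) (dim_col Z)"
proof (rule eq_matI)
  fix i j assume ij: "i < dim_row (0\<^sub>m (dim_row Z) (dim_col Z) :: real mat)"
    "j < dim_col (0\<^sub>m (dim_row Z) (dim_col Z) :: real mat)"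
  have "(Z\<^sup>T * Z) $$ (j,j) = (\<Sum>l<dim_row Z. Z $$ (l,j) * Z $$ (l,j))"
    using ij by (simp add: mult_mat_index)
  hence "(\<Sum>l<dim_row Z. Z $$ (l,j) * Z $$ (l,j)) = 0"
    using assms ij by simp
  hence "Z $$ (i,j) * Z $$ (i,j) = 0"
    using ij by (subst (asm) sum_nonneg_eq_0_iff) auto
  thus "Z $$ (i,j) = (0\<^sub>m (dim_row Z) (dim_col Z) :: real mat) $$ (i,j)" using ij by simp
qed auto

section \<open>Diagonal matrices\<close>

definition dg :: "nat \<Rightarrow> (nat \<Rightarrow> real) \<Rightarrow> real mat" where
  "dg p f = mat p p (\<lambda>(i,j). if i = j then f i else 0)"

lemma dg_dim [simp]: "dim_row (dg p f) = p" "dim_col (dg p f) = p"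
  by (auto simp: dg_def)

lemma dg_index: "i < p \<Longrightarrow> j < p \<Longrightarrow> dg p f $$ (i,j) = (if i = j then f i else 0)"
  by (simp add: dg_def)

lemma dg_transpose [simp]: "(dg p f)\<^sup>T = dg p f"
  by (rule eq_matI) (auto simp: dg_def)

lemma mult_dg_index: "i < dim_row A \<Longrightarrow> j < p \<Longrightarrow> dim_col A = p \<Longrightarrow>
    (A * dg p f) $$ (i,j) = A $$ (i,j) * f j"
  by (subst mult_mat_index) (auto simp: dg_index if_distrib cong: if_cong)

lemma dg_mult_index: "i < p \<Longrightarrow> j < dim_col A \<Longrightarrow> dim_row A = p \<Longrightarrow>
    (dg p f * A) $$ (i,j) = f i * A $$ (i,j)"
proof -
  assume a: "i < p" "j < dim_col A" "dim_row A = p"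
  have "(dg p f * A) $$ (i,j) = (\<Sum>l<p. if i = l then f i * A $$ (l,j) else 0)"
  proof -
    have "(dg p f * A) $$ (i,j) = (\<Sum>l<p. dg p f $$ (i,l) * A $$ (l,j))"
      using a by (simp add: mult_mat_index)
    also have "\<dots> = (\<Sum>l<p. if i = l then f i * A $$ (l,j) else 0)"
      using a by (intro sum.cong) (auto simp: dg_index)
    finally show ?thesis .
  qed
  also have "\<dots> = f i * A $$ (i,j)" using a by simp
  finally show ?thesis .
qed

lemma dg_mult: "dg p f * dg p g = dg p (\<lambda>i. f i * g i)"
  by (rule eq_matI) (auto simp: mult_dg_index dg_index)

lemma dg_mult_left: "dim_row X = p \<Longrightarrow> dg p f * (dg p g * X) = dg p (\<lambda>i. f i * g i) * X"
  by (subst mat_assoc[symmetric]) (auto simp: dg_mult)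

lemma dg_cong: "(\<And>i. i < p \<Longrightarrow> f i = g i) \<Longrightarrow> dg p f = dg p g"
  by (rule eq_matI) (auto simp: dg_index)

lemma dg_zero: "dg p (\<lambda>_. 0) = 0\<^sub>m p p"
  by (rule eq_matI) (auto simp: dg_index)

lemma diagonal_mat_dg: "S \<in> carrier_mat p p \<Longrightarrow> diagonal_mat S \<Longrightarrow> S = dg p (\<lambda>i. S $$ (i,i))"
  by (rule eq_matI) (auto simp: dg_index diagonal_mat_def)

section \<open>Singular values, rank and orthonormal columns\<close>

lemma is_svd_square:
  assumes "is_svd X A S B" "X \<in> carrier_mat p p"
  shows "A \<in> carrier_mat p p" "A\<^sup>T * A = 1\<^sub>m p" "A * A\<^sup>T = 1\<^sub>m p"
    "B \<in> carrier_mat p p" "B\<^sup>T * B = 1\<^sub>m p" "B * B\<^sup>T = 1\<^sub>m p"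
    "S = dg p (\<lambda>i. S $$ (i,i))" "X = A * (S * B\<^sup>T)"
    "\<And>i. i < p \<Longrightarrow> 0 \<le> S $$ (i,i)"
    "\<And>i j. i \<le> j \<Longrightarrow> j < p \<Longrightarrow> S $$ (j,j) \<le> S $$ (i,i)"
proof -
  have p: "dim_row X = p" "dim_col X = p" using assms by auto
  note d = assms(1)[unfolded is_svd_def Let_def p]
  show A: "A \<in> carrier_mat p p" "A\<^sup>T * A = 1\<^sub>m p" and B: "B \<in> carrier_mat p p" "B\<^sup>T * B = 1\<^sub>m p"
    and "\<And>i. i < p \<Longrightarrow> 0 \<le> S $$ (i,i)"
    and "\<And>i j. i \<le> j \<Longrightarrow> j < p \<Longrightarrow> S $$ (j,j) \<le> S $$ (i,i)" using d by auto
  show "A * A\<^sup>T = 1\<^sub>m p" "B * B\<^sup>T = 1\<^sub>m p" by (rule orthogonal_inverse; fact)+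
  have S: "S \<in> carrier_mat p p" "diagonal_mat S" using d by auto
  show "S = dg p (\<lambda>i. S $$ (i,i))" using S by (rule diagonal_mat_dg)
  have "X = A * S * B\<^sup>T" using d by auto
  thus "X = A * (S * B\<^sup>T)" using A B S by (simp add: mat_assoc)
qed

text \<open>Padded with zeros to square matrices, the two factors would have determinants with
  product 1, although the left one has a zero column if there are fewer than \<open>k\<close>
  indices. The index type is arbitrary because the bound is also applied to a disjoint union of two
  index sets.\<close>

lemma rank_bound:
  fixes y :: "nat \<Rightarrow> 'a \<Rightarrow> real"
  assumes fin: "finite L"
    and id: "\<And>i j. i < k \<Longrightarrow> j < k \<Longrightarrow> (\<Sum>l\<in>L. y i l * z l j) = (if i = j then 1 else 0)"
  shows "k \<le> card L"
proof (rule ccontr)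
  assume "\<not> ?thesis"
  define d where "d = card L"
  hence d: "d < k" using \<open>\<not> _\<close> by simp
  obtain h where h: "bij_betw h {..<d} L"
    using ex_bij_betw_nat_finite[OF fin] unfolding d_def atLeast0LessThan by blast
  define Y where "Y = mat k k (\<lambda>(i,l). if l < d then y i (h l) else 0)"
  define Z where "Z = mat k k (\<lambda>(l,j). if l < d then z (h l) j else 0)"
  have "Y * Z = 1\<^sub>m k"
  proof (rule eq_matI)
    fix i j assume "i < dim_row (1\<^sub>m k :: real mat)" "j < dim_col (1\<^sub>m k :: real mat)"
    hence ij: "i < k" "j < k" by auto
    have "(Y * Z) $$ (i,j) = (\<Sum>l<k. if l < d then y i (h l) * z (h l) j else 0)"
      using ij by (subst mult_mat_index) (auto simp: Y_def Z_def intro!: sum.cong)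
    also have "\<dots> = (\<Sum>l<d. y i (h l) * z (h l) j)"
      using d by (intro sum.mono_neutral_cong_right) auto
    also have "\<dots> = (\<Sum>l\<in>L. y i l * z l j)"
      by (rule sum.reindex_bij_betw[OF h])
    finally show "(Y * Z) $$ (i,j) = 1\<^sub>m k $$ (i,j)" using ij id by simp
  qed (auto simp: Y_def Z_def)
  hence "det Y * det Z = 1"
    using det_mult[of Y k Z] by (simp add: Y_def Z_def)
  moreover have "det Y = 0"
  proof -
    have "Y *\<^sub>v unit_vec k d = 0\<^sub>v k"
      using d by (intro eq_vecI) (auto simp: Y_def scalar_prod_right_unit)
    moreover have "unit_vec k d \<noteq> (0\<^sub>v k :: real vec)" using d by auto
    moreover have "Y \<in> carrier_mat k k" by (simp add: Y_def)
    ultimately show ?thesis using det_0_iff_vec_prod_zero[of Y k] unit_vec_carrier by blast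
  qed
  ultimately show False by simp
qed

text \<open>The identity \<open>U\<^sup>T * U\<close> factors through the row indices.\<close>

lemma orthonormal_cols_le:
  assumes "U \<in> carrier_mat m q" "U\<^sup>T * U = (1\<^sub>m q :: real mat)"
  shows "q \<le> m"
proof -
  have "q \<le> card {..<m}"
  proof (rule rank_bound[where y = "\<lambda>i l. U $$ (l,i)" and z = "\<lambda>l j. U $$ (l,j)"])
    fix i j assume ij: "i < q" "j < q"
    have "(U\<^sup>T * U) $$ (i,j) = (\<Sum>l<m. U $$ (l,i) * U $$ (l,j))"
      using ij assms(1) by (subst mult_mat_index) auto
    thus "(\<Sum>l<m. U $$ (l,i) * U $$ (l,j)) = (if i = j then 1 else 0)"
      using assms(2) ij by simp
  qed auto
  thus ?thesis by simp
qed

lemma orthonormal_iff: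
  "U \<in> carrier_mat m q \<Longrightarrow> (U\<^sup>T * U = (1\<^sub>m q :: real mat)) \<longleftrightarrow>
    (\<forall>i<q. \<forall>j<q. (\<Sum>l<m. U $$ (l,i) * U $$ (l,j)) = (if i = j then 1 else 0))"
proof -
  assume U: "U \<in> carrier_mat m q"
  have "(U\<^sup>T * U) $$ (i,j) = (\<Sum>l<m. U $$ (l,i) * U $$ (l,j))" if "i < q" "j < q" for i j
    using that U by (subst mult_mat_index) auto
  moreover have "(U\<^sup>T * U = 1\<^sub>m q) \<longleftrightarrow> (\<forall>i<q. \<forall>j<q. (U\<^sup>T * U) $$ (i,j) = 1\<^sub>m q $$ (i,j))"
    using U by (auto intro!: eq_matI)
  ultimately show ?thesis by simp
qed

text \<open>The columns of \<open>U\<close>, laid down as rows and filled up with zero rows, form a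
  singular square matrix. A vector in its kernel is orthogonal to all columns of \<open>U\<close>
  and, once normalised, becomes the next column.\<close>

lemma orthonormal_extend1:
  assumes U: "U \<in> carrier_mat m q" "U\<^sup>T * U = (1\<^sub>m q :: real mat)" and q: "q < m"
  shows "\<exists>U'. U' \<in> carrier_mat m (Suc q) \<and> U'\<^sup>T * U' = (1\<^sub>m (Suc q) :: real mat) \<and> first_cols q U' = U"
proof -
  define H where "H = mat m m (\<lambda>(i,j). if i < q then U $$ (j,i) else 0)"
  have H: "H \<in> carrier_mat m m" by (simp add: H_def)
  have "H\<^sup>T *\<^sub>v unit_vec m q = 0\<^sub>v m"
    using q by (intro eq_vecI) (auto simp: H_def scalar_prod_right_unit)
  moreover have "unit_vec m q \<noteq> (0\<^sub>v m :: real vec)" using q by auto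
  ultimately have "det (H\<^sup>T) = 0"
    using det_0_iff_vec_prod_zero[of "H\<^sup>T" m] H unit_vec_carrier by (metis transpose_carrier_mat)
  hence "det H = 0" using det_transpose[OF H] by simp
  then obtain v where v: "v \<in> carrier_vec m" "v \<noteq> 0\<^sub>v m" "H *\<^sub>v v = 0\<^sub>v m"
    using det_0_iff_vec_prod_zero[OF H] by blast
  have orth: "(\<Sum>l<m. U $$ (l,i) * v $ l) = 0" if "i < q" for i
  proof -
    have "(H *\<^sub>v v) $ i = (\<Sum>l<m. U $$ (l,i) * v $ l)"
      using that q v(1) by (auto simp: H_def scalar_prod_def atLeast0LessThan)
    thus ?thesis using v(3) that q by simp
  qed
  define c where "c = (\<Sum>l<m. v $ l * v $ l)"
  have "c \<noteq> 0"
  proof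
    assume "c = 0"
    hence "v $ l = 0" if "l < m" for l
      using that unfolding c_def by (subst (asm) sum_nonneg_eq_0_iff) auto
    thus False using v(1,2) by auto
  qed
  moreover have "c \<ge> 0" unfolding c_def by (intro sum_nonneg) auto
  ultimately have c: "c > 0" by simp
  define U' where "U' = mat m (Suc q) (\<lambda>(i,j). if j < q then U $$ (i,j) else v $ i / sqrt c)"
  have U': "U' \<in> carrier_mat m (Suc q)" by (simp add: U'_def)
  have "(\<Sum>l<m. U' $$ (l,i) * U' $$ (l,j)) = (if i = j then 1 else 0)"
    if ij: "i < Suc q" "j < Suc q" for i j
  proof -
    have eq: "(\<Sum>l<m. U' $$ (l,i) * U' $$ (l,j)) =
        (\<Sum>l<m. (if i < q then U $$ (l,i) else v $ l / sqrt c) * (if j < q then U $$ (l,j) else v $ l / sqrt c))"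
      using ij by (intro sum.cong) (auto simp: U'_def)
    consider "i < q" "j < q" | "i < q" "j = q" | "i = q" "j < q" | "i = q" "j = q"
      using ij by linarith
    thus ?thesis
    proof cases
      case 1 thus ?thesis unfolding eq using orthonormal_iff[OF U(1)] U(2) by simp
    next
      case 2 thus ?thesis unfolding eq using orth[of i] by (simp add: sum_divide_distrib[symmetric])
    next
      case 3 thus ?thesis unfolding eq using orth[of j] by (simp add: sum_divide_distrib[symmetric] mult.commute)
    next
      case 4
      have "sqrt c * sqrt c = c" using c by simp
      thus ?thesis unfolding eq using 4 c by (simp add: sum_divide_distrib[symmetric] c_def[symmetric])
    qed
  qed
  hence "U'\<^sup>T * U' = 1\<^sub>m (Suc q)" using orthonormal_iff[OF U'] by blast
  moreover have "first_cols q U' = U"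
    using U(1) by (intro eq_matI) (auto simp: first_cols_def U'_def)
  ultimately show ?thesis using U' by blast
qed

lemma first_cols_first_cols: "i \<le> j \<Longrightarrow> first_cols i (first_cols j U) = first_cols i U"
  by (rule eq_matI) (auto simp: first_cols_def)

lemma orthonormal_extend:
  assumes "U \<in> carrier_mat m q" "U\<^sup>T * U = (1\<^sub>m q :: real mat)"
  shows "\<exists>U'. U' \<in> carrier_mat m m \<and> U'\<^sup>T * U' = (1\<^sub>m m :: real mat) \<and> first_cols q U' = U"
  using assms
proof (induction "m - q" arbitrary: q U)
  case 0
  hence "q = m" using orthonormal_cols_le[OF 0(2,3)] by simp
  thus ?case using 0 by (intro exI[of _ U]) (auto simp: first_cols_def intro!: eq_matI)
next
  case (Suc d)
  obtain U1 where U1: "U1 \<in> carrier_mat m (Suc q)" "U1\<^sup>T * U1 = (1\<^sub>m (Suc q) :: real mat)"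
    "first_cols q U1 = U"
    using orthonormal_extend1[OF Suc(3,4)] Suc(2) by (metis zero_less_Suc zero_less_diff)
  obtain U' where U': "U' \<in> carrier_mat m m" "U'\<^sup>T * U' = (1\<^sub>m m :: real mat)" "first_cols (Suc q) U' = U1"
    using Suc(1)[OF _ U1(1,2)] Suc(2) by fastforce
  have "first_cols q U' = U"
    using first_cols_first_cols[of q "Suc q" U'] U'(3) U1(3) by simp
  thus ?case using U' by blast
qed

text \<open>The definition of a truncated SVD refers to a full one, whereas the algorithm yields
  \<open>q\<close> orthonormal columns on either side. Both are completed to orthogonal matrices and
  the diagonal is padded with zeros. The width \<open>q\<close> may exceed \<open>k\<close>, because
  \<open>X\<close> may have rank above \<open>k\<close> although only \<open>k\<close> columns are
  kept.\<close>

lemma truncated_svd_from_thin: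
  assumes U: "U \<in> carrier_mat m q" "U\<^sup>T * U = (1\<^sub>m q :: real mat)"
    and V: "V \<in> carrier_mat n q" "V\<^sup>T * V = (1\<^sub>m q :: real mat)"
    and s: "\<And>i. i < q \<Longrightarrow> 0 \<le> s i" "\<And>i j. i \<le> j \<Longrightarrow> j < q \<Longrightarrow> s j \<le> s i"
    and X: "X = U * (dg q s * V\<^sup>T)" and k: "k \<le> q"
  shows "is_truncated_svd k X (first_cols k U) (dg k s) (first_cols k V)"
proof -
  have q: "q \<le> m" "q \<le> n" using orthonormal_cols_le U V by blast+
  obtain U' where U': "U' \<in> carrier_mat m m" "U'\<^sup>T * U' = (1\<^sub>m m :: real mat)" "first_cols q U' = U"
    using orthonormal_extend[OF U] by blast
  obtain V' where V': "V' \<in> carrier_mat n n" "V'\<^sup>T * V' = (1\<^sub>m n :: real mat)" "first_cols q V' = V"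
    using orthonormal_extend[OF V] by blast
  have Ui: "U $$ (i,j) = U' $$ (i,j)" if "i < m" "j < q" for i j
    using that U'(1,3) by (auto simp: first_cols_def)
  have Vi: "V $$ (i,j) = V' $$ (i,j)" if "i < n" "j < q" for i j
    using that V'(1,3) by (auto simp: first_cols_def)
  define S where "S = mat m n (\<lambda>(i,j). if i = j \<and> i < q then s i else 0)"
  have dX: "dim_row X = m" "dim_col X = n" using U V by (auto simp: X)
  have Xi: "X $$ (i,j) = (\<Sum>l<q. U $$ (i,l) * (s l * V $$ (j,l)))" if "i < m" "j < n" for i j
    unfolding X using that U V by (subst mult_mat_index) (auto simp: dg_mult_index intro!: sum.cong)
  have SV: "(S * V'\<^sup>T) $$ (l,j) = (if l < q then s l * V' $$ (j,l) else 0)" if "l < m" "j < n" for l j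
  proof -
    have "(S * V'\<^sup>T) $$ (l,j) = (\<Sum>h<n. S $$ (l,h) * V' $$ (j,h))"
      using that V' by (simp add: mult_mat_index S_def)
    also have "\<dots> = (\<Sum>h<n. if h = l then (if l < q then s l * V' $$ (j,l) else 0) else 0)"
      using that by (intro sum.cong) (auto simp: S_def)
    finally have "(S * V'\<^sup>T) $$ (l,j) = (\<Sum>h<n. if h = l then (if l < q then s l * V' $$ (j,l) else 0) else 0)" .
    thus ?thesis using q by (auto simp: if_distrib)
  qed
  have "X = U' * S * V'\<^sup>T"
  proof (rule eq_matI)
    fix i j assume "i < dim_row (U' * S * V'\<^sup>T)" "j < dim_col (U' * S * V'\<^sup>T)"
    hence ij: "i < m" "j < n" using U' V' by auto
    have "(U' * S * V'\<^sup>T) $$ (i,j) = (U' * (S * V'\<^sup>T)) $$ (i,j)"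
      using U' V' by (simp add: mat_assoc S_def)
    also have "\<dots> = (\<Sum>l<m. U' $$ (i,l) * (S * V'\<^sup>T) $$ (l,j))"
      using U' V' ij by (subst mult_mat_index) (auto simp: S_def)
    also have "\<dots> = (\<Sum>l<m. U' $$ (i,l) * (if l < q then s l * V' $$ (j,l) else 0))"
      using ij by (intro sum.cong) (auto simp: SV)
    also have "\<dots> = (\<Sum>l<q. U' $$ (i,l) * (s l * V' $$ (j,l)))"
      using q by (intro sum.mono_neutral_cong_right) auto
    also have "\<dots> = X $$ (i,j)" using ij by (auto simp: Xi Ui Vi intro!: sum.cong)
    finally show "X $$ (i,j) = (U' * S * V'\<^sup>T) $$ (i,j)" by simp
  qed (use U' V' dX in auto)
  hence "is_svd X U' S V'"
    unfolding is_svd_def Let_def dX using U' V' s q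
    by (auto simp: S_def diagonal_mat_def)
  moreover have "dg k s = mat k k (\<lambda>(i,j). S $$ (i,j))"
    using k q by (intro eq_matI) (auto simp: dg_index S_def)
  moreover have "first_cols k U = first_cols k U'" "first_cols k V = first_cols k V'"
    using first_cols_first_cols[OF k] U'(3) V'(3) by metis+
  ultimately show ?thesis
    unfolding is_truncated_svd_def dX using k q by auto
qed

text \<open>A Gram matrix is positive semidefinite, so left and right singular vectors agree.\<close>

lemma gram_svd:
  assumes svd: "is_svd (Z\<^sup>T * Z) A S B" and p: "dim_col Z = p"
  shows "Z\<^sup>T * (Z * A) = A * S"
proof -
  define G where "G = Z\<^sup>T * Z"
  have G: "G \<in> carrier_mat p p" "G\<^sup>T = G" using p by (auto simp: G_def mat_transpose_mult)
  note f = is_svd_square[OF svd[folded G_def] G(1)]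
  have dims: "dim_row A = p" "dim_col A = p" "dim_row B = p" "dim_col B = p" "dim_row S = p" "dim_col S = p"
    using f(1,4) arg_cong[OF f(7), of dim_row] arg_cong[OF f(7), of dim_col] by auto
  have ST: "S\<^sup>T = S" using f(7) dg_transpose by metis
  \<comment> \<open>In \<open>G\<close> itself the right factor \<open>B\<close> is not known to be
    related to \<open>A\<close>; the square, written as \<open>G * G\<^sup>T\<close>, no longer
    contains \<open>B\<close>.\<close>
  have "G * G = G * G\<^sup>T" using G by simp
  also have "\<dots> = A * (S * (B\<^sup>T * (B * (S * A\<^sup>T))))"
    unfolding f(8) by (simp add: mat_simps dims ST)
  also have "B\<^sup>T * (B * (S * A\<^sup>T)) = S * A\<^sup>T" by (rule mat_cancel[OF f(5)]) (auto simp: dims)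
  finally have "G * (G * A) = A * (S * (S * (A\<^sup>T * A)))"
    using G by (simp add: mat_assoc[symmetric] dims)
  hence GG: "G * (G * A) = A * (S * S)" using f(2) by (simp add: mat_simps dims)
  \<comment> \<open>The defect of the claim. It solves \<open>G * W + W * S = 0\<close>, where both
    coefficients are positive semidefinite; after multiplication by \<open>W\<^sup>T\<close> each
    diagonal entry is a sum of two nonnegative terms, which must both vanish.\<close>
  define W where "W = G * A - A * S"
  have W: "W \<in> carrier_mat p p" "G * A \<in> carrier_mat p p" "A * S \<in> carrier_mat p p"
    using G dims by (auto simp: W_def)
  have "G * W + W * S = (G * (G * A) - G * (A * S)) + ((G * A) * S - (A * S) * S)"
  proof -
    have S: "S \<in> carrier_mat p p" using dims by auto
    show ?thesis unfolding W_def mult_minus_distrib_mat[OF G(1) W(2,3)] minus_mult_distrib_mat[OF W(2,3) S] ..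
  qed
  also have "\<dots> = 0\<^sub>m p p"
    unfolding GG using G dims by (intro eq_matI) (auto simp: mat_assoc)
  finally have sum0: "G * W + W * S = 0\<^sub>m p p" .
  have "W = 0\<^sub>m p p"
  proof (rule eq_matI)
    fix i j assume "i < dim_row (0\<^sub>m p p :: real mat)" "j < dim_col (0\<^sub>m p p :: real mat)"
    hence ij: "i < p" "j < p" by auto
    have s: "0 \<le> S $$ (j,j)" using f(9) ij by auto
    have "W\<^sup>T * (G * W + W * S) = (Z * W)\<^sup>T * (Z * W) + W\<^sup>T * (W * S)"
      using W(1) dims G p by (subst mult_add_distrib_mat[of _ p p _ p]) (auto simp: mat_simps G_def)
    moreover have "W\<^sup>T * 0\<^sub>m p p = 0\<^sub>m p p" using W by (intro right_mult_zero_mat) auto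
    ultimately have "(Z * W)\<^sup>T * (Z * W) + W\<^sup>T * (W * S) = 0\<^sub>m p p" unfolding sum0 by simp
    hence "((Z * W)\<^sup>T * (Z * W)) $$ (j,j) + (W\<^sup>T * W * S) $$ (j,j) = 0"
    proof -
      have a: "((Z * W)\<^sup>T * (Z * W) + W\<^sup>T * (W * S)) $$ (j,j) = 0"
        unfolding \<open>(Z * W)\<^sup>T * (Z * W) + W\<^sup>T * (W * S) = 0\<^sub>m p p\<close> using ij by simp
      have "W\<^sup>T * W * S = W\<^sup>T * (W * S)" using W dims by (simp add: mat_assoc)
      thus ?thesis using a ij W dims by simp
    qed
    moreover have "(W\<^sup>T * W * S) $$ (j,j) = (\<Sum>l<p. W $$ (l,j) * W $$ (l,j)) * S $$ (j,j)"
    proof -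
      have "(W\<^sup>T * W * S) $$ (j,j) = (W\<^sup>T * W) $$ (j,j) * S $$ (j,j)"
        using ij W by (subst f(7)) (simp add: mult_dg_index)
      thus ?thesis using ij W by (simp add: mult_mat_index)
    qed
    moreover have "((Z * W)\<^sup>T * (Z * W)) $$ (j,j) = (\<Sum>l<dim_row Z. (Z * W) $$ (l,j) * (Z * W) $$ (l,j))"
      using ij W by (simp add: mult_mat_index)
    ultimately have z: "(\<Sum>l<dim_row Z. (Z * W) $$ (l,j) * (Z * W) $$ (l,j)) = 0"
      "(\<Sum>l<p. W $$ (l,j) * W $$ (l,j)) * S $$ (j,j) = 0"
      using s by (smt (verit) mult_nonneg_nonneg sum_nonneg zero_le_square)+
    have "(\<Sum>l<p. W $$ (l,j) * W $$ (l,j)) = 0"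
    proof (cases "S $$ (j,j) = 0")
      case True
      \<comment> \<open>For singular value 0 the second of the two terms says nothing. But then
        column \<open>j\<close> of \<open>W\<close> is a column of \<open>G * A\<close>, and in its
        product with itself one factor \<open>Z\<close> of \<open>G\<close> can be moved over to
        \<open>W\<close>, where the first term gives zero.\<close>
      have Wj: "W $$ (l,j) = (G * A) $$ (l,j)" if "l < p" for l
      proof -
        have "(A * S) $$ (l,j) = A $$ (l,j) * S $$ (j,j)"
          using that ij dims by (subst f(7)) (simp add: mult_dg_index)
        thus ?thesis using that ij True W dims by (simp add: W_def)
      qed
      have ZWj: "(Z * W) $$ (l,j) = 0" if "l < dim_row Z" for l
        using z(1) that by (subst (asm) sum_nonneg_eq_0_iff) auto
      have "(\<Sum>l<p. W $$ (l,j) * W $$ (l,j)) = (\<Sum>l<p. (G * A) $$ (l,j) * W $$ (l,j))"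
        using Wj by (intro sum.cong) auto
      also have "\<dots> = ((G * A)\<^sup>T * W) $$ (j,j)"
        using ij W dims G by (simp add: mult_mat_index)
      also have "(G * A)\<^sup>T * W = (Z * A)\<^sup>T * (Z * W)"
        using dims W p by (simp add: mat_simps G_def)
      also have "\<dots> $$ (j,j) = (\<Sum>l<dim_row Z. (Z * A) $$ (l,j) * (Z * W) $$ (l,j))"
        using ij W dims by (simp add: mult_mat_index)
      also have "\<dots> = 0" using ZWj by simp
      finally show ?thesis .
    next
      case False thus ?thesis using z by simp
    qed
    hence "W $$ (i,j) * W $$ (i,j) = 0"
      using ij by (subst (asm) sum_nonneg_eq_0_iff) auto
    thus "W $$ (i,j) = 0\<^sub>m p p $$ (i,j)" using ij by simp
  qed (use W in auto)
  hence "G * A = A * S"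
    using W(2,3) unfolding W_def
    by (metis (no_types, lifting) W_def \<open>W = 0\<^sub>m p p\<close> minus_add_minus_mat add_uminus_minus_mat eq_matI index_minus_mat(1) index_zero_mat(1) carrier_matD right_minus_eq)
  thus ?thesis using dims p by (simp add: G_def mat_assoc)
qed

text \<open>A factorisation \<open>Z = Q * R\<close> with \<open>Q = Z * T\<close> that needs only
  the small Gram matrix. As \<open>1 / sqrt 0 = 0\<close>, \<open>T\<close> inverts only the nonzero
  singular values; \<open>P\<close> is their indicator, and the other columns of \<open>Q\<close>
  are zero.\<close>

lemma orthonormal_factor:
  assumes svd: "is_svd (Z\<^sup>T * Z) A S B" and p: "dim_col Z = p"
  defines "T \<equiv> A * dg p (\<lambda>i. 1 / sqrt (S $$ (i,i)))"
    and "R \<equiv> dg p (\<lambda>i. sqrt (S $$ (i,i))) * A\<^sup>T"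
    and "P \<equiv> dg p (\<lambda>i. S $$ (i,i) / S $$ (i,i))"
  shows "(Z * T)\<^sup>T * (Z * T) = P" "(Z * T) * R = Z" "P * R = R"
proof -
  have G: "Z\<^sup>T * Z \<in> carrier_mat p p" using p by auto
  note f = is_svd_square[OF svd G]
  define s where "s = (\<lambda>i. S $$ (i,i))"
  have S: "S = dg p s" unfolding s_def by (rule f(7))
  have dims: "dim_row A = p" "dim_col A = p" using f(1) by auto
  have GA: "Z\<^sup>T * (Z * A) = A * dg p s" using gram_svd[OF svd p] S by simp
  have AGA: "A\<^sup>T * (Z\<^sup>T * (Z * (A * dg p g))) = dg p (\<lambda>i. s i * g i)" for g
  proof -
    have "A\<^sup>T * (Z\<^sup>T * (Z * (A * dg p g))) = A\<^sup>T * ((Z\<^sup>T * (Z * A)) * dg p g)"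
      using dims p by (simp add: mat_assoc)
    also have "\<dots> = A\<^sup>T * (A * dg p (\<lambda>i. s i * g i))" unfolding GA using dims by (simp add: mat_assoc dg_mult)
    also have "\<dots> = dg p (\<lambda>i. s i * g i)" by (rule mat_cancel[OF f(2)]) (auto simp: dims)
    finally show ?thesis .
  qed
  have s0: "0 \<le> s i" if "i < p" for i using f(9)[OF that] by (simp add: s_def)
  have "(Z * T)\<^sup>T * (Z * T) = dg p (\<lambda>i. 1 / sqrt (s i)) * dg p (\<lambda>i. s i * (1 / sqrt (s i)))"
    unfolding T_def using dims p AGA by (simp add: mat_simps s_def)
  also have "\<dots> = P" unfolding dg_mult P_def
    by (rule dg_cong) (use s0 in \<open>auto simp: s_def field_simps\<close>)
  finally show "(Z * T)\<^sup>T * (Z * T) = P" .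
  show "P * R = R"
    unfolding P_def R_def using dims by (subst dg_mult_left) (auto intro!: arg_cong[of _ _ "\<lambda>x. x * _"] dg_cong)
  \<comment> \<open>The part of \<open>Z\<close> along the singular vectors with value 0. Its Gram
    matrix is zero, so it vanishes and nothing is lost by dropping these directions.\<close>
  define N where "N = Z * (A * dg p (\<lambda>i. 1 - s i / s i))"
  have "N\<^sup>T * N = dg p (\<lambda>i. (1 - s i / s i) * (s i * (1 - s i / s i)))"
    unfolding N_def using dims p by (simp add: mat_simps AGA dg_mult)
  also have "\<dots> = dg p (\<lambda>_. 0)" by (rule dg_cong) auto
  finally have "N = 0\<^sub>m (dim_row Z) p"
    using gram_eq_zero[of N] dims by (simp add: N_def dg_zero)
  hence N0: "N * A\<^sup>T = 0\<^sub>m (dim_row Z) p"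
    using dims by simp
  have one: "dg p (\<lambda>i. s i / s i) + dg p (\<lambda>i. 1 - s i / s i) = 1\<^sub>m p"
    by (intro eq_matI) (auto simp: dg_index)
  have one_split: "Z * (A * (1\<^sub>m p * A\<^sup>T)) = Z"
    using dims p by (simp add: mat_one_left mat_one_right f(3))
  let ?D1 = "dg p (\<lambda>i. s i / s i)" and ?D2 = "dg p (\<lambda>i. 1 - s i / s i)"
  have c: "dg p g \<in> carrier_mat p p" "A\<^sup>T \<in> carrier_mat p p" "Z \<in> carrier_mat (dim_row Z) p" for g
    using dims p by (auto intro: carrier_matI)
  have c2: "dg p g * A\<^sup>T \<in> carrier_mat p p" "A * (dg p g * A\<^sup>T) \<in> carrier_mat p p" for g
    using dims by (auto intro: carrier_matI)
  have split: "Z * (A * ((?D1 + ?D2) * A\<^sup>T)) = Z * (A * (?D1 * A\<^sup>T)) + Z * (A * (?D2 * A\<^sup>T))"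
    unfolding add_mult_distrib_mat[OF c(1,1,2)] mult_add_distrib_mat[OF f(1) c2(1,1)]
      mult_add_distrib_mat[OF c(3) c2(2,2)] ..
  have N_eq: "Z * (A * (?D2 * A\<^sup>T)) = 0\<^sub>m (dim_row Z) p"
    unfolding N0[symmetric] N_def using dims p by (simp add: mat_assoc)
  have D1: "?D1 = dg p (\<lambda>i. 1 / sqrt (s i)) * dg p (\<lambda>i. sqrt (s i))"
    unfolding dg_mult by (rule dg_cong) auto
  have "(Z * T) * R = Z * (A * (?D1 * A\<^sup>T))"
    unfolding T_def R_def D1 using dims p by (simp add: mat_assoc s_def)
  also have "\<dots> = Z * (A * ((?D1 + ?D2) * A\<^sup>T))"
    unfolding split N_eq using dims by (intro eq_matI) auto
  also have "\<dots> = Z" unfolding one by (rule one_split)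
  finally show "(Z * T) * R = Z" .
qed

text \<open>The columns of \<open>A\<close> with nonzero weight, completed by singular vectors of the
  projection onto their orthogonal complement inside the range of the projection \<open>dg p \<pi>\<close>.\<close>

lemma orthonormal_completion:
  fixes A A' R1 :: "real mat" and w \<pi> :: "nat \<Rightarrow> real"
  assumes R1: "R1 \<in> carrier_mat p k" "R1\<^sup>T * (dg p \<pi> * R1) = 1\<^sub>m k"
    and A: "A \<in> carrier_mat p p" "A\<^sup>T * A = 1\<^sub>m p"
    and \<pi>: "\<And>i. \<pi> i = 0 \<or> \<pi> i = 1" and w: "\<And>i. w i = 0 \<or> w i = 1"
    and mono: "\<And>i j. i \<le> j \<Longrightarrow> j < p \<Longrightarrow> w i = 0 \<Longrightarrow> w j = 0"
    and \<pi>A: "\<And>i l. i < p \<Longrightarrow> l < p \<Longrightarrow> w l \<noteq> 0 \<Longrightarrow> \<pi> i * A $$ (i,l) = A $$ (i,l)"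
    and svd: "is_svd (dg p \<pi> - A * (dg p w * A\<^sup>T)) A' S' B'"
    and q: "q \<le> p" "\<And>j. j < q \<Longrightarrow> w j = 0 \<Longrightarrow> j < k"
  defines "C \<equiv> mat p q (\<lambda>(i,j). if w j \<noteq> 0 then A $$ (i,j) else A' $$ (i, card {l. l < j \<and> w l = 0}))"
  shows "C\<^sup>T * C = 1\<^sub>m q" "dg p \<pi> * C = C"
proof -
  define P where "P = dg p \<pi>"
  define W where "W = dg p w"
  define N where "N = P - A * (W * A\<^sup>T)"
  have P: "P \<in> carrier_mat p p" "P\<^sup>T = P" "P * P = P"
    using \<pi> by (auto simp: P_def dg_mult intro!: dg_cong)
  have W: "W \<in> carrier_mat p p" "W\<^sup>T = W" "W * W = W"
    using w by (auto simp: W_def dg_mult intro!: dg_cong)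
  have dims: "dim_row P = p" "dim_col P = p" "dim_row W = p" "dim_col W = p"
    "dim_row A = p" "dim_col A = p" using P W A by auto
  have N: "N \<in> carrier_mat p p" using dims by (auto simp: N_def)
  have AT: "A\<^sup>T * (A * X) = X" if "dim_row X = p" for X
    by (rule mat_cancel[OF A(2)]) (auto simp: that dims)
  have PAW: "P * (A * W) = A * W"
  proof (rule eq_matI)
    fix i l assume "i < dim_row (A * W)" "l < dim_col (A * W)"
    hence il: "i < p" "l < p" using dims by auto
    have "(P * (A * W)) $$ (i,l) = \<pi> i * (A $$ (i,l) * w l)"
      using il dims by (simp add: P_def W_def dg_mult_index mult_dg_index)
    also have "\<dots> = A $$ (i,l) * w l"
      using \<pi>A[OF il] by (cases "w l = 0") (simp_all flip: mult.assoc)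
    finally show "(P * (A * W)) $$ (i,l) = (A * W) $$ (i,l)"
      using il dims by (simp add: W_def mult_dg_index)
  qed (auto simp: dims)
  have PAWX: "P * (A * (W * X)) = A * (W * X)" if "dim_row X = p" for X
  proof -
    have "P * (A * (W * X)) = (P * (A * W)) * X" using that dims by (simp add: mat_assoc)
    thus ?thesis unfolding PAW using that dims by (simp add: mat_assoc)
  qed
  have WAP: "W * (A\<^sup>T * P) = W * A\<^sup>T"
    using arg_cong[OF PAW, of transpose_mat] P(2) W(2) dims by (simp add: mat_simps)
  have WWX: "W * (W * X) = W * X" if "dim_row X = p" for X
    using that dims W(3) by (simp flip: mat_assoc)
  define H where "H = A * (W * A\<^sup>T)"
  have H: "H \<in> carrier_mat p p" "H\<^sup>T = H" "P * H = H" "H * P = H" "H * H = H" "A\<^sup>T * H = W * A\<^sup>T"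
    "W * (A\<^sup>T * H) = W * A\<^sup>T"
    unfolding H_def using dims W(2) by (auto simp: mat_simps PAWX WAP AT WWX)
  have NH: "N = P - H" by (simp add: N_def H_def)
  have NT: "N\<^sup>T = N" unfolding NH using P H
    by (simp add: transpose_minus[of _ p p])
  have PN: "P * N = N" unfolding NH using P H by (simp add: mult_minus_distrib_mat[of _ p p _ p])
  have HN: "H * N = 0\<^sub>m p p" unfolding NH using P H by (simp add: mult_minus_distrib_mat[of _ p p _ p])
  have "N * N = P * N - H * N" 
    using minus_mult_distrib_mat[OF P(1) H(1) N] by (simp add: NH)
  hence NN: "N * N = N" unfolding PN HN using N by (intro eq_matI) auto
  have svd1: "is_svd N A' S' B'" using svd by (simp add: N_def P_def W_def)
  note f = is_svd_square[OF svd1 N]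
  \<comment> \<open>\<open>N\<close> is symmetric and idempotent, hence its own Gram matrix, so
    \<open>gram_svd\<close> turns its singular vectors into eigenvectors.\<close>
  have svd2: "is_svd (N\<^sup>T * N) A' S' B'" using svd1 NT NN by simp
  have A'd: "dim_row A' = p" "dim_col A' = p" using f(1) by auto
  have S'd: "dim_row S' = p" "dim_col S' = p" by (subst f(7), simp)+
  have NA': "N * A' = A' * S'"
    using gram_svd[OF svd2] N NT NN A'd by (simp flip: mat_assoc)
  define s where "s = (\<lambda>i. S' $$ (i,i))"
  have S': "S' = dg p s" unfolding s_def by (rule f(7))
  \<comment> \<open>Columns of \<open>A'\<close> with nonzero singular value lie in the range of
    \<open>N\<close>, which \<open>W * A\<^sup>T\<close> annihilates.\<close>
  have orth': "(A\<^sup>T * A') $$ (l,r) = 0" if "l < p" "r < p" "w l \<noteq> 0" "s r \<noteq> 0" for l r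
  proof -
    have "W * (A\<^sup>T * N) = W * (A\<^sup>T * P) - W * (A\<^sup>T * H)"
    proof -
      have c: "A\<^sup>T \<in> carrier_mat p p" "A\<^sup>T * P \<in> carrier_mat p p" "A\<^sup>T * H \<in> carrier_mat p p"
        using A P(1) H(1) by auto
      show ?thesis
        unfolding NH mult_minus_distrib_mat[OF c(1) P(1) H(1)] mult_minus_distrib_mat[OF W(1) c(2,3)] ..
    qed
    also have "\<dots> = 0\<^sub>m p p" unfolding WAP H(7) using dims by (intro eq_matI) auto
    finally have z: "W * (A\<^sup>T * N) = 0\<^sub>m p p" .
    have "(W * (A\<^sup>T * N)) * A' = 0\<^sub>m p p" unfolding z using A'd by (intro left_mult_zero_mat) auto
    hence "W * ((A\<^sup>T * A') * S') = 0\<^sub>m p p" using dims N A'd S'd NA' by (simp add: mat_assoc)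
    hence "(W * ((A\<^sup>T * A') * S')) $$ (l,r) = 0" using that by simp
    hence "w l * ((A\<^sup>T * A') $$ (l,r) * s r) = 0"
      using that dims A'd S'd by (simp add: W_def S' dg_mult_index mult_dg_index)
    thus ?thesis using that by simp
  qed
  have \<pi>A': "\<pi> i * A' $$ (i,r) = A' $$ (i,r)" if "i < p" "r < p" "s r \<noteq> 0" for i r
  proof -
    have "P * (A' * S') = A' * S'" using PN dims N A'd by (simp flip: NA' mat_assoc)
    hence "(P * (A' * S')) $$ (i,r) = (A' * S') $$ (i,r)" by simp
    hence "\<pi> i * (A' $$ (i,r) * s r) = A' $$ (i,r) * s r"
      using that dims A'd by (simp add: P_def S' dg_mult_index mult_dg_index)
    thus ?thesis using that(3) by (simp flip: mult.assoc)
  qed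
  \<comment> \<open>\<open>r j\<close> columns of \<open>A'\<close> have been consumed before
    position \<open>j\<close>; the gaps thus receive the leading columns, those with the largest
    singular values.\<close>
  define r where "r = (\<lambda>j. card {l. l < j \<and> w l = 0})"
  have r_le: "r j \<le> j" for j
    unfolding r_def using card_mono[of "{..<j}" "{l. l < j \<and> w l = 0}"] by auto
  have r_less: "r i < r j" if "i < j" "w i = 0" for i j
    unfolding r_def using that by (intro psubset_card_mono) auto
  \<comment> \<open>If the supply of \<open>A'\<close> ran out at a gap \<open>j < k\<close>, then
    \<open>P = H + N\<close> would have at most \<open>j\<close> nonzero directions: the weighted
    columns of \<open>A\<close> before \<open>j\<close> and fewer than or exactly \<open>r j\<close>
    columns of \<open>A'\<close>. But \<open>R1\<^sup>T * (P * R1)\<close> is the identity of size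
    \<open>k\<close> and factors through these directions, contradicting
    \<open>rank_bound\<close>.\<close>
  have nz: "s (r j) \<noteq> 0" if j: "j < q" "w j = 0" for j
  proof
    assume z: "s (r j) = 0"
    have jk: "j < k" "j < p" using q j by auto
    define L1 where "L1 = {l. l < p \<and> w l \<noteq> 0}"
    define L2 where "L2 = {l. l < p \<and> s l \<noteq> 0}"
    have L1: "L1 \<subseteq> {l. l < j \<and> w l \<noteq> 0}"
      using mono[of j] j(2) by (auto simp: L1_def) (meson not_less)
    have L2: "L2 \<subseteq> {..<r j}"
    proof
      fix l assume l: "l \<in> L2"
      have "s l = 0" if "r j \<le> l"
        using f(10)[OF that] f(9)[of l] l z by (auto simp: L2_def s_def)
      thus "l \<in> {..<r j}" using l by (auto simp: L2_def not_less[symmetric])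
    qed
    have fin: "finite L1" "finite L2" by (auto simp: L1_def L2_def)
    define y where "y = (\<lambda>i l. case l of Inl l \<Rightarrow> (R1\<^sup>T * A) $$ (i,l) | Inr l \<Rightarrow> (R1\<^sup>T * A') $$ (i,l))"
    define x where "x = (\<lambda>l i. case l of Inl l \<Rightarrow> w l * (R1\<^sup>T * A) $$ (i,l) | Inr l \<Rightarrow> s l * (R1\<^sup>T * A') $$ (i,l))"
    have "k \<le> card (L1 <+> L2)"
    proof (rule rank_bound[where y = y and z = x])
      show "finite (L1 <+> L2)" using fin by simp
      fix a b assume ab: "a < k" "b < k"
      have Nf: "N = A' * (S' * A'\<^sup>T)"
      proof -
        have "N = N * (A' * A'\<^sup>T)" using N f(3) by (simp add: mat_one_right)
        also have "\<dots> = A' * (S' * A'\<^sup>T)" using N A'd S'd NA' by (simp flip: mat_assoc)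
        finally show ?thesis .
      qed
      have "P = H + N" unfolding NH using P(1) H(1) by (intro eq_matI) auto
      hence "1\<^sub>m k = R1\<^sup>T * ((H + N) * R1)" using R1(2) by (simp add: P_def)
      also have "\<dots> = R1\<^sup>T * (H * R1) + R1\<^sup>T * (N * R1)"
        using H(1) N R1(1) by (simp add: add_mult_distrib_mat[of _ p p] mult_add_distrib_mat[of _ k p _ k])
      also have "R1\<^sup>T * (H * R1) = ((R1\<^sup>T * A) * W) * (R1\<^sup>T * A)\<^sup>T"
        unfolding H_def using dims R1(1) by (simp add: mat_simps)
      also have "R1\<^sup>T * (N * R1) = ((R1\<^sup>T * A') * S') * (R1\<^sup>T * A')\<^sup>T"
        unfolding Nf using A'd S'd R1(1) by (simp add: mat_simps)
      finally have e: "1\<^sub>m k $$ (a,b) = (((R1\<^sup>T * A) * W) * (R1\<^sup>T * A)\<^sup>T) $$ (a,b)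
          + (((R1\<^sup>T * A') * S') * (R1\<^sup>T * A')\<^sup>T) $$ (a,b)"
        using ab R1(1) by simp
      have "(((R1\<^sup>T * A) * W) * (R1\<^sup>T * A)\<^sup>T) $$ (a,b)
          = (\<Sum>l<p. (R1\<^sup>T * A) $$ (a,l) * w l * (R1\<^sup>T * A) $$ (b,l))"
        using ab R1(1) dims by (subst mult_mat_index) (auto simp: W_def mult_dg_index intro!: sum.cong)
      also have "\<dots> = (\<Sum>l\<in>L1. y a (Inl l) * x (Inl l) b)"
        by (intro sum.mono_neutral_cong_right) (auto simp: L1_def x_def y_def)
      finally have e1: "(((R1\<^sup>T * A) * W) * (R1\<^sup>T * A)\<^sup>T) $$ (a,b) = (\<Sum>l\<in>L1. y a (Inl l) * x (Inl l) b)" .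
      have "(((R1\<^sup>T * A') * S') * (R1\<^sup>T * A')\<^sup>T) $$ (a,b)
          = (\<Sum>l<p. (R1\<^sup>T * A') $$ (a,l) * s l * (R1\<^sup>T * A') $$ (b,l))"
        using ab R1(1) A'd by (subst mult_mat_index) (auto simp: S' mult_dg_index intro!: sum.cong)
      also have "\<dots> = (\<Sum>l\<in>L2. y a (Inr l) * x (Inr l) b)"
        by (intro sum.mono_neutral_cong_right) (auto simp: L2_def x_def y_def)
      finally have e2: "(((R1\<^sup>T * A') * S') * (R1\<^sup>T * A')\<^sup>T) $$ (a,b) = (\<Sum>l\<in>L2. y a (Inr l) * x (Inr l) b)" .
      show "(\<Sum>l\<in>L1 <+> L2. y a l * x l b) = (if a = b then 1 else 0)"
        using e ab fin unfolding e1 e2 by (simp add: sum.Plus)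
    qed
    also have "\<dots> = card L1 + card L2" using fin by (simp add: card_Plus)
    also have "\<dots> \<le> card {l. l < j \<and> w l \<noteq> 0} + r j"
      using card_mono[OF _ L1] card_mono[OF _ L2] by simp
    also have "\<dots> = card ({l. l < j \<and> w l \<noteq> 0} \<union> {l. l < j \<and> w l = 0})"
      unfolding r_def by (subst card_Un_disjoint) auto
    also have "{l. l < j \<and> w l \<noteq> 0} \<union> {l. l < j \<and> w l = 0} = {..<j}" by auto
    finally show False using jk by simp
  qed
  have C: "C \<in> carrier_mat p q" by (simp add: C_def)
  have Ci: "C $$ (i,j) = (if w j \<noteq> 0 then A $$ (i,j) else A' $$ (i, r j))" if "i < p" "j < q" for i j
    using that by (simp add: C_def r_def)
  have rp: "r j < p" if "j < q" for j using r_le[of j] q(1) that by simp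
  have cross: "(\<Sum>l<p. A $$ (l,i) * A' $$ (l, r j)) = 0" if "i < q" "j < q" "w i \<noteq> 0" "w j = 0" for i j
    using orth'[of i "r j"] that nz[of j] rp[of j] q(1) dims A'd by (simp add: mult_mat_index)
  show "C\<^sup>T * C = 1\<^sub>m q"
    unfolding orthonormal_iff[OF C]
  proof (intro allI impI)
    fix i j assume ij: "i < q" "j < q"
    have "(\<Sum>l<p. C $$ (l,i) * C $$ (l,j)) = (\<Sum>l<p. (if w i \<noteq> 0 then A $$ (l,i) else A' $$ (l, r i)) *
        (if w j \<noteq> 0 then A $$ (l,j) else A' $$ (l, r j)))"
      using ij by (intro sum.cong) (auto simp: Ci)
    also have "\<dots> = (if i = j then 1 else 0)"
    proof -
      have rij: "r i = r j \<longleftrightarrow> i = j" if "w i = 0" "w j = 0"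
        using r_less[of i j] r_less[of j i] that by (metis less_irrefl linorder_neqE_nat)
      note oA = orthonormal_iff[THEN iffD1, OF A, rule_format]
      note oA' = orthonormal_iff[THEN iffD1, OF f(1,2), rule_format]
      show ?thesis
        by (cases "w i = 0"; cases "w j = 0")
          (use ij q(1) oA[of i j] oA'[of "r i" "r j"] cross[of i j] cross[of j i] rp[of i] rp[of j] rij
            in \<open>auto simp: mult.commute\<close>)
    qed
    finally show "(\<Sum>l<p. C $$ (l,i) * C $$ (l,j)) = (if i = j then 1 else 0)" .
  qed
  show "dg p \<pi> * C = C"
  proof (rule eq_matI)
    fix i j assume "i < dim_row C" "j < dim_col C"
    hence ij: "i < p" "j < q" using C by auto
    show "(dg p \<pi> * C) $$ (i,j) = C $$ (i,j)"
      using ij C \<pi>A[of i j] \<pi>A'[of i "r j"] nz[of j] rp[of j] q(1) by (simp add: dg_mult_index Ci)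
  qed (use C in auto)
qed

section \<open>The low-rank update in terms of small matrices\<close>

lemma append_cols_index:
  assumes "A \<in> carrier_mat m k" "B \<in> carrier_mat m s"
  shows "append_cols A B \<in> carrier_mat m (k + s)"
    "i < m \<Longrightarrow> j < k + s \<Longrightarrow> append_cols A B $$ (i,j) = (if j < k then A $$ (i,j) else B $$ (i, j - k))"
  using assms by (auto simp: append_cols_def)

lemma first_cols_append_cols:
  assumes "A \<in> carrier_mat m k" "B \<in> carrier_mat m s"
  shows "first_cols k (append_cols A B) = A"
  using append_cols_index[OF assms] assms(1) by (intro eq_matI) (auto simp: first_cols_def)

lemma first_cols_mult: "k \<le> dim_col B \<Longrightarrow> dim_col A = dim_row B \<Longrightarrow>
    first_cols k (A * B) = A * first_cols k B"
  by (rule eq_matI) (auto simp: first_cols_def mult_mat_index intro!: sum.cong)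

lemma first_cols_mat: "k \<le> q \<Longrightarrow> first_cols k (mat p q f) = mat p k f"
  by (rule eq_matI) (auto simp: first_cols_def)

lemma sum_lessThan_add: "(\<Sum>l<k + (s::nat). g l) = (\<Sum>l<k. g l) + (\<Sum>l<s. g (k + l) :: 'a :: comm_monoid_add)"
  by (induction s) (auto simp: add.assoc)

lemma append_cols_low_rank:
  assumes "U \<in> carrier_mat m k" "V \<in> carrier_mat n k" "D \<in> carrier_mat m s" "E \<in> carrier_mat n s"
    "S \<in> carrier_mat k k" "diagonal_mat S"
  shows "U * S * V\<^sup>T + D * E\<^sup>T
    = append_cols U D * (dg (k + s) (\<lambda>i. if i < k then S $$ (i,i) else 1) * (append_cols V E)\<^sup>T)"
proof (rule eq_matI)
  let ?K = "dg (k + s) (\<lambda>i. if i < k then S $$ (i,i) else 1)"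
  note cU = append_cols_index[OF assms(1,3)] and cV = append_cols_index[OF assms(2,4)]
  fix i j assume "i < dim_row (append_cols U D * (?K * (append_cols V E)\<^sup>T))"
    "j < dim_col (append_cols U D * (?K * (append_cols V E)\<^sup>T))"
  hence ij: "i < m" "j < n" using cU(1) cV(1) by auto
  have "(append_cols U D * (?K * (append_cols V E)\<^sup>T)) $$ (i,j)
      = (\<Sum>l<k+s. append_cols U D $$ (i,l) * ((if l < k then S $$ (l,l) else 1) * append_cols V E $$ (j,l)))"
    using ij cU(1) cV(1) by (subst mult_mat_index) (auto simp: dg_mult_index intro!: sum.cong)
  also have "\<dots> = (\<Sum>l<k. U $$ (i,l) * (S $$ (l,l) * V $$ (j,l))) + (\<Sum>l<s. D $$ (i,l) * E $$ (j,l))"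
    unfolding sum_lessThan_add using ij
    by (intro arg_cong2[of _ _ _ _ "(+)"] sum.cong) (auto simp: cU(2) cV(2))
  also have "\<dots> = (U * S * V\<^sup>T + D * E\<^sup>T) $$ (i,j)"
  proof -
    have "U * S * V\<^sup>T = U * (dg k (\<lambda>i. S $$ (i,i)) * V\<^sup>T)"
      using assms diagonal_mat_dg[OF assms(5,6)] by (simp add: mat_assoc)
    moreover have "(U * (dg k (\<lambda>i. S $$ (i,i)) * V\<^sup>T)) $$ (i,j) = (\<Sum>l<k. U $$ (i,l) * (S $$ (l,l) * V $$ (j,l)))"
      using ij assms by (subst mult_mat_index) (auto simp: dg_mult_index intro!: sum.cong)
    moreover have "(D * E\<^sup>T) $$ (i,j) = (\<Sum>l<s. D $$ (i,l) * E $$ (j,l))"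
      using ij assms by (subst mult_mat_index) auto
    ultimately show ?thesis using ij assms by simp
  qed
  finally show "(U * S * V\<^sup>T + D * E\<^sup>T) $$ (i,j) = (append_cols U D * (?K * (append_cols V E)\<^sup>T)) $$ (i,j)" by simp
qed (use assms append_cols_index(1)[OF assms(1,3)] append_cols_index(1)[OF assms(2,4)] in auto)

text \<open>The cardinality counts the columns borrowed from \<open>A'\<close> so far. No entry
  depends on \<open>q\<close>, so restricting to fewer columns merely lowers \<open>q\<close>;
  correctness is shown for a matrix that may be wider than the computed one.\<close>

definition mixed_cols :: "nat \<Rightarrow> nat \<Rightarrow> (nat \<Rightarrow> real) \<Rightarrow> real mat \<Rightarrow> real mat \<Rightarrow> real mat" where
  "mixed_cols p q \<sigma> A A' = mat p q (\<lambda>(i,j).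
     if \<sigma> j \<noteq> 0 then A $$ (i,j) else A' $$ (i, card {l. l < j \<and> \<sigma> l = 0}))"

text \<open>If \<open>Z = Q * R\<close> on both sides and \<open>M = RU * (K * RV\<^sup>T)\<close>
  has singular vectors \<open>A\<close> and \<open>B\<close>, then \<open>Q * A\<close> and
  \<open>Q * B\<close> would be the new singular vectors, were the columns of \<open>Q\<close> all
  nonzero. Where \<open>\<sigma>\<close> is nonzero, the columns of \<open>A\<close> and
  \<open>B\<close> avoid the zero columns of \<open>Q\<close>; elsewhere they need not, and
  \<open>mixed_cols\<close> replaces them.\<close>

lemma low_rank_update_svd:
  fixes U S V D E :: "real mat"
  assumes triple: "svd_triple k m n U S V"
    and D: "D \<in> carrier_mat m s" and E: "E \<in> carrier_mat n s"
    and p: "p = k + s"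
    and svdU: "is_svd ((append_cols U D)\<^sup>T * append_cols U D) AU (dg p su) BU"
    and svdV: "is_svd ((append_cols V E)\<^sup>T * append_cols V E) AV (dg p sv) BV"
    and svdM: "is_svd ((dg p (\<lambda>i. sqrt (su i)) * AU\<^sup>T) *
        (dg p (\<lambda>i. if i < k then S $$ (i,i) else 1) * (dg p (\<lambda>i. sqrt (sv i)) * AV\<^sup>T)\<^sup>T)) A (dg p \<sigma>) B"
    and svdNU: "is_svd (dg p (\<lambda>i. su i / su i) - A * (dg p (\<lambda>i. \<sigma> i / \<sigma> i) * A\<^sup>T)) AU' SU' BU'"
    and svdNV: "is_svd (dg p (\<lambda>i. sv i / sv i) - B * (dg p (\<lambda>i. \<sigma> i / \<sigma> i) * B\<^sup>T)) AV' SV' BV'"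
  shows "is_truncated_svd k (U * S * V\<^sup>T + D * E\<^sup>T)
     (append_cols U D * (AU * dg p (\<lambda>i. 1 / sqrt (su i)) * mixed_cols p k \<sigma> A AU'))
     (dg k \<sigma>)
     (append_cols V E * (AV * dg p (\<lambda>i. 1 / sqrt (sv i)) * mixed_cols p k \<sigma> B AV'))"
proof -
  note tr = triple[unfolded svd_triple_def]
  define ZU where "ZU = append_cols U D"
  define ZV where "ZV = append_cols V E"
  define TU where "TU = AU * dg p (\<lambda>i. 1 / sqrt (su i))"
  define TV where "TV = AV * dg p (\<lambda>i. 1 / sqrt (sv i))"
  define RU where "RU = dg p (\<lambda>i. sqrt (su i)) * AU\<^sup>T"
  define RV where "RV = dg p (\<lambda>i. sqrt (sv i)) * AV\<^sup>T"
  define PU where "PU = dg p (\<lambda>i. su i / su i)"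
  define PV where "PV = dg p (\<lambda>i. sv i / sv i)"
  define K where "K = dg p (\<lambda>i. if i < k then S $$ (i,i) else 1)"
  define w where "w = (\<lambda>i. \<sigma> i / \<sigma> i)"
  have w01: "w i = 0 \<or> w i = 1" "w i = 0 \<longleftrightarrow> \<sigma> i = 0" for i by (auto simp: w_def)
  have ZU: "ZU \<in> carrier_mat m p" and ZV: "ZV \<in> carrier_mat n p"
    using tr D E append_cols_index(1) by (auto simp: ZU_def ZV_def p)
  have dg_diag: "dg p (\<lambda>i. dg p f $$ (i,i)) = dg p f" for f by (rule dg_cong) (simp add: dg_index)
  have dgf: "dg p (\<lambda>i. h (dg p f $$ (i,i))) = dg p (\<lambda>i. h (f i))" for f h
    by (rule dg_cong) (simp add: dg_index)
  have dgf2: "dg p (\<lambda>i. h (dg p f $$ (i,i)) (dg p f $$ (i,i))) = dg p (\<lambda>i. h (f i) (f i))" for f h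
    by (rule dg_cong) (simp add: dg_index)
  have oU: "(ZU * TU)\<^sup>T * (ZU * TU) = PU" "(ZU * TU) * RU = ZU" "PU * RU = RU"
    using orthonormal_factor[OF svdU[folded ZU_def], of p,
        unfolded dgf2[of "(/)"] dgf[of "\<lambda>x. 1 / sqrt x"] dgf[of sqrt]] ZU
    unfolding TU_def RU_def PU_def by auto
  have oV: "(ZV * TV)\<^sup>T * (ZV * TV) = PV" "(ZV * TV) * RV = ZV" "PV * RV = RV"
    using orthonormal_factor[OF svdV[folded ZV_def], of p,
        unfolded dgf2[of "(/)"] dgf[of "\<lambda>x. 1 / sqrt x"] dgf[of sqrt]] ZV
    unfolding TV_def RV_def PV_def by auto
  have AU: "AU \<in> carrier_mat p p" using is_svd_square(1)[OF svdU[folded ZU_def]] ZU by auto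
  have AV: "AV \<in> carrier_mat p p" using is_svd_square(1)[OF svdV[folded ZV_def]] ZV by auto
  have dims: "dim_row TU = p" "dim_col TU = p" "dim_row RU = p" "dim_col RU = p"
    "dim_row TV = p" "dim_col TV = p" "dim_row RV = p" "dim_col RV = p"
    "dim_row PU = p" "dim_col PU = p" "dim_row PV = p" "dim_col PV = p" "dim_row K = p" "dim_col K = p"
    using AU AV by (auto simp: TU_def RU_def TV_def RV_def PU_def PV_def K_def)
  define M where "M = RU * (K * RV\<^sup>T)"
  have M: "M \<in> carrier_mat p p" using dims by (auto simp: M_def)
  have svdM': "is_svd M A (dg p \<sigma>) B" using svdM by (simp add: M_def RU_def RV_def K_def)
  note f = is_svd_square[OF svdM' M]
  have ABd: "dim_row A = p" "dim_col A = p" "dim_row B = p" "dim_col B = p" using f(1,4) by auto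
  have s0: "0 \<le> \<sigma> i" if "i < p" for i using f(9)[OF that] that by (simp add: dg_index)
  have smono: "\<sigma> j \<le> \<sigma> i" if "i \<le> j" "j < p" for i j using f(10)[OF that] that by (simp add: dg_index)
  have wmono: "w j = 0" if "i \<le> j" "j < p" "w i = 0" for i j
    using smono[OF that(1,2)] s0[of j] that w01 by auto
  have range: "\<pi> i * A' $$ (i,l) = A' $$ (i,l)"
    if "dg p \<pi> * X = X" "X * B' = A' * dg p \<sigma>" "dim_col X = p" "dim_row X = p"
      "dim_row A' = p" "dim_col A' = p" "dim_row B' = p"
      "i < p" "l < p" "w l \<noteq> 0" for \<pi> X A' B' i l
  proof -
    have "dg p \<pi> * (X * B') = (dg p \<pi> * X) * B'" using that(3,4,7) by (simp add: mat_assoc)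
    hence "dg p \<pi> * (A' * dg p \<sigma>) = A' * dg p \<sigma>" unfolding that(1,2) .
    from arg_cong[OF this, of "\<lambda>M. M $$ (i,l)"]
    have "\<pi> i * (A' $$ (i,l) * \<sigma> l) = A' $$ (i,l) * \<sigma> l"
      using that by (simp add: dg_mult_index mult_dg_index)
    thus ?thesis using that w01 by (simp flip: mult.assoc)
  qed
  have MB: "M * B = A * dg p \<sigma>"
    unfolding f(8) using ABd f(5) by (simp add: mat_simps)
  have MA: "M\<^sup>T * A = B * dg p \<sigma>"
    unfolding f(8) using ABd f(2) by (simp add: mat_simps)
  have PM: "PU * M = M" "PV * M\<^sup>T = M\<^sup>T"
  proof -
    have "PU * M = (PU * RU) * (K * RV\<^sup>T)" unfolding M_def using dims by (simp add: mat_simps)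
    thus "PU * M = M" unfolding oU(3) M_def .
    have "PV * M\<^sup>T = (PV * RV) * (K * RU\<^sup>T)" unfolding M_def using dims by (simp add: mat_simps K_def)
    thus "PV * M\<^sup>T = M\<^sup>T" unfolding oV(3) M_def using dims by (simp add: mat_simps K_def)
  qed
  \<comment> \<open>The first \<open>k\<close> columns of \<open>Z\<close> are orthonormal. Through
    \<open>Z = (Z * T) * R\<close> this makes the first \<open>k\<close> columns of \<open>R\<close>
    witness that \<open>P\<close> has rank at least \<open>k\<close>, so there is room for
    \<open>k\<close> singular vectors.\<close>
  have rank: "(first_cols k R)\<^sup>T * (P * first_cols k R) = 1\<^sub>m k" "first_cols k R \<in> carrier_mat p k"
    if "(Z * T)\<^sup>T * (Z * T) = P" "(Z * T) * R = Z" "U1\<^sup>T * U1 = 1\<^sub>m k" "first_cols k Z = U1"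
      "dim_row R = p" "dim_col R = p" "dim_col T = p" "dim_row T = p" "dim_col Z = p" for Z T R P U1
  proof -
    have kp: "k \<le> p" using p by simp
    have "U1 = (Z * T) * first_cols k R"
      using first_cols_mult[of k R "Z * T"] that kp by simp
    moreover have fd: "dim_row (first_cols k R) = p" using that by (simp add: first_cols_def)
    ultimately have "1\<^sub>m k = (first_cols k R)\<^sup>T * (((Z * T)\<^sup>T * (Z * T)) * first_cols k R)"
      using that(3) that(5-) by (simp add: mat_simps)
    thus "(first_cols k R)\<^sup>T * (P * first_cols k R) = 1\<^sub>m k" unfolding that(1) by (rule sym)
    show "first_cols k R \<in> carrier_mat p k" using that(5) by (simp add: first_cols_def)
  qed
  have fU: "first_cols k ZU = U"
    using tr D first_cols_append_cols by (auto simp: ZU_def)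
  have fV: "first_cols k ZV = V"
    using tr E first_cols_append_cols by (auto simp: ZV_def)
  \<comment> \<open>A compromise: all nonzero singular values have to lie below \<open>q\<close> for
    the thin factorisation to reproduce the whole matrix, but gaps can only be filled below
    \<open>k\<close>. Leastness ensures that every gap below \<open>q\<close> is also below
    \<open>k\<close>.\<close>
  define q where "q = (LEAST q. k \<le> q \<and> (\<forall>j. q \<le> j \<longrightarrow> j < p \<longrightarrow> w j = 0))"
  have ex: "k \<le> p \<and> (\<forall>j. p \<le> j \<longrightarrow> j < p \<longrightarrow> w j = 0)" using p by simp
  have q: "k \<le> q" "\<And>j. q \<le> j \<Longrightarrow> j < p \<Longrightarrow> w j = 0" "q \<le> p"
    using LeastI[of "\<lambda>q. k \<le> q \<and> (\<forall>j. q \<le> j \<longrightarrow> j < p \<longrightarrow> w j = 0)", OF ex]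
      Least_le[of "\<lambda>q. k \<le> q \<and> (\<forall>j. q \<le> j \<longrightarrow> j < p \<longrightarrow> w j = 0)", OF ex]
    unfolding q_def[symmetric] by auto
  have qk: "j < k" if j: "j < q" "w j = 0" for j
  proof (rule ccontr)
    assume "\<not> j < k"
    hence "k \<le> j \<and> (\<forall>j'. j \<le> j' \<longrightarrow> j' < p \<longrightarrow> w j' = 0)" using wmono j(2) by simp
    hence "q \<le> j" unfolding q_def by (rule Least_le)
    thus False using j by simp
  qed
  have compl: "(mixed_cols p q \<sigma> A0 A')\<^sup>T * mixed_cols p q \<sigma> A0 A' = 1\<^sub>m q"
      "dg p \<pi> * mixed_cols p q \<sigma> A0 A' = mixed_cols p q \<sigma> A0 A'"
    if a: "(first_cols k R)\<^sup>T * (dg p \<pi> * first_cols k R) = 1\<^sub>m k" "first_cols k R \<in> carrier_mat p k"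
      and X: "dg p \<pi> * X = X" "X * B0 = A0 * dg p \<sigma>" "dim_col X = p" "dim_row X = p"
      and A0: "A0 \<in> carrier_mat p p" "A0\<^sup>T * A0 = 1\<^sub>m p" and B0: "dim_row B0 = p"
      and \<pi>: "\<And>i. \<pi> i = 0 \<or> \<pi> i = 1"
      and svd: "is_svd (dg p \<pi> - A0 * (dg p w * A0\<^sup>T)) A' S' B'"
    for R \<pi> X A0 B0 A' S' B'
  proof -
    have "\<pi> i * A0 $$ (i,l) = A0 $$ (i,l)" if "i < p" "l < p" "w l \<noteq> 0" for i l
      by (rule range[OF X]) (use A0 B0 that in auto)
    note oc = orthonormal_completion[OF a(2,1) A0 \<pi> w01(1) wmono this svd q(3) qk,
        folded w01(2), unfolded w01(2), folded mixed_cols_def]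
    show "(mixed_cols p q \<sigma> A0 A')\<^sup>T * mixed_cols p q \<sigma> A0 A' = 1\<^sub>m q" by (rule oc(1))
    show "dg p \<pi> * mixed_cols p q \<sigma> A0 A' = mixed_cols p q \<sigma> A0 A'" by (rule oc(2))
  qed
  define CU where "CU = mixed_cols p q \<sigma> A AU'"
  define CV where "CV = mixed_cols p q \<sigma> B AV'"
  have UV1: "U\<^sup>T * U = 1\<^sub>m k" "V\<^sup>T * V = 1\<^sub>m k" using tr by auto
  have Zd: "dim_col ZU = p" "dim_col ZV = p" using ZU ZV by auto
  note rU = rank[OF oU(1,2) UV1(1) fU dims(3,4,2,1) Zd(1)]
  note rV = rank[OF oV(1,2) UV1(2) fV dims(7,8,6,5) Zd(2)]
  have CU: "CU\<^sup>T * CU = 1\<^sub>m q" "PU * CU = CU"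
    unfolding CU_def PU_def
    by (rule compl[OF rU[unfolded PU_def] PM(1)[unfolded PU_def] MB _ _ f(1,2) ABd(3) _ svdNU[folded w_def]];
        use M in auto)+
  have CV: "CV\<^sup>T * CV = 1\<^sub>m q" "PV * CV = CV"
    unfolding CV_def PV_def
    by (rule compl[OF rV[unfolded PV_def] PM(2)[unfolded PV_def] MA _ _ f(4,5) ABd(1) _ svdNV[folded w_def]];
        use M in auto)+
  have Cd: "dim_row CU = p" "dim_col CU = q" "dim_row CV = p" "dim_col CV = q"
    by (auto simp: CU_def CV_def mixed_cols_def)
  have on: "(Z * T * C)\<^sup>T * (Z * T * C) = 1\<^sub>m q"
    if "(Z * T)\<^sup>T * (Z * T) = P" "P * C = C" "C\<^sup>T * C = 1\<^sub>m q" "dim_row C = p" "dim_col T = p"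
      "dim_row T = p" "dim_col Z = p" for Z T C P :: "real mat"
  proof -
    have "(Z * T * C)\<^sup>T * (Z * T * C) = C\<^sup>T * (((Z * T)\<^sup>T * (Z * T)) * C)"
      using that(4-) by (simp add: mat_simps)
    thus ?thesis using that(1-3) by simp
  qed
  \<comment> \<open>The replaced columns carry singular value 0 on both sides and contribute nothing
    to the product.\<close>
  have mid: "A * (dg p \<sigma> * B\<^sup>T) = CU * (dg q \<sigma> * CV\<^sup>T)"
  proof (rule eq_matI)
    fix i j assume "i < dim_row (CU * (dg q \<sigma> * CV\<^sup>T))" "j < dim_col (CU * (dg q \<sigma> * CV\<^sup>T))"
    hence ij: "i < p" "j < p" using Cd by auto
    have "(A * (dg p \<sigma> * B\<^sup>T)) $$ (i,j) = (\<Sum>l<p. A $$ (i,l) * (\<sigma> l * B $$ (j,l)))"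
      using ij ABd by (subst mult_mat_index) (auto simp: dg_mult_index intro!: sum.cong)
    also have "\<dots> = (\<Sum>l<q. CU $$ (i,l) * (\<sigma> l * CV $$ (j,l)))"
    proof (rule sum.mono_neutral_cong_right)
      show "\<forall>l\<in>{..<p} - {..<q}. A $$ (i,l) * (\<sigma> l * B $$ (j,l)) = 0" using q(2) w01 by auto
      show "A $$ (i,l) * (\<sigma> l * B $$ (j,l)) = CU $$ (i,l) * (\<sigma> l * CV $$ (j,l))" if "l \<in> {..<q}" for l
        using that ij by (cases "\<sigma> l = 0") (auto simp: CU_def CV_def mixed_cols_def)
    qed (use q in auto)
    also have "\<dots> = (CU * (dg q \<sigma> * CV\<^sup>T)) $$ (i,j)"
      using ij Cd by (subst mult_mat_index) (auto simp: dg_mult_index intro!: sum.cong)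
    finally show "(A * (dg p \<sigma> * B\<^sup>T)) $$ (i,j) = (CU * (dg q \<sigma> * CV\<^sup>T)) $$ (i,j)" .
  qed (use Cd ABd in auto)
  have "U * S * V\<^sup>T + D * E\<^sup>T = ZU * (K * ZV\<^sup>T)"
    unfolding ZU_def ZV_def K_def p by (rule append_cols_low_rank) (use tr D E in auto)
  also have "\<dots> = ((ZU * TU) * RU) * (K * ((ZV * TV) * RV)\<^sup>T)" unfolding oU oV ..
  also have "\<dots> = (ZU * TU) * (M * (ZV * TV)\<^sup>T)"
    unfolding M_def using dims ZU ZV by (simp add: mat_simps)
  also have "\<dots> = (ZU * TU) * ((CU * (dg q \<sigma> * CV\<^sup>T)) * (ZV * TV)\<^sup>T)"
    unfolding f(8) mid ..
  also have "\<dots> = (ZU * TU * CU) * (dg q \<sigma> * (ZV * TV * CV)\<^sup>T)"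
    using dims ZU ZV Cd by (simp add: mat_simps)
  finally have X: "U * S * V\<^sup>T + D * E\<^sup>T = (ZU * TU * CU) * (dg q \<sigma> * (ZV * TV * CV)\<^sup>T)" .
  have "is_truncated_svd k (U * S * V\<^sup>T + D * E\<^sup>T)
     (first_cols k (ZU * TU * CU)) (dg k \<sigma>) (first_cols k (ZV * TV * CV))"
  proof (rule truncated_svd_from_thin[OF _ _ _ _ _ _ X q(1)])
    show "ZU * TU * CU \<in> carrier_mat m q" "ZV * TV * CV \<in> carrier_mat n q"
      using ZU ZV Cd by auto
    show "(ZU * TU * CU)\<^sup>T * (ZU * TU * CU) = 1\<^sub>m q"
      by (rule on[OF oU(1) CU(2,1)]) (use Cd dims ZU in auto)
    show "(ZV * TV * CV)\<^sup>T * (ZV * TV * CV) = 1\<^sub>m q"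
      by (rule on[OF oV(1) CV(2,1)]) (use Cd dims ZV in auto)
  qed (use s0 smono q in auto)
  moreover have "first_cols k (ZU * TU * CU) = ZU * (TU * mixed_cols p k \<sigma> A AU')"
    using q dims Cd ZU by (simp add: mat_assoc first_cols_mult)
      (simp add: CU_def mixed_cols_def first_cols_mat)
  moreover have "first_cols k (ZV * TV * CV) = ZV * (TV * mixed_cols p k \<sigma> B AV')"
    using q dims Cd ZV by (simp add: mat_assoc first_cols_mult)
      (simp add: CV_def mixed_cols_def first_cols_mat)
  ultimately show ?thesis unfolding ZU_def ZV_def TU_def TV_def by simp
qed

section \<open>Total correctness with running times\<close>

text \<open>Registers and arrays of either kind share one name space here.\<close>

fun mods :: "com \<Rightarrow> string set" where
  "mods Skip = {}"
| "mods (NAssign x e) = {x}"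
| "mods (RAssign x e) = {x}"
| "mods (NWrite a i j e) = {a}"
| "mods (RWrite a i j e) = {a}"
| "mods (Seq c d) = mods c \<union> mods d"
| "mods (If b c d) = mods c \<union> mods d"
| "mods (While b c) = mods c"
| "mods (SVD e a u s v) = {u, s, v}"

definition agree :: "string set \<Rightarrow> state \<Rightarrow> state \<Rightarrow> bool" where
  "agree X st st' \<longleftrightarrow> (\<forall>x. x \<notin> X \<longrightarrow> nvar st' x = nvar st x \<and> rvar st' x = rvar st x \<and>
     narr st' x = narr st x \<and> rarr st' x = rarr st x)"

lemma agreeD:
  assumes "agree X st st'" "x \<notin> X"
  shows "nvar st' x = nvar st x" "rvar st' x = rvar st x" "narr st' x = narr st x" "rarr st' x = rarr st x"
  using assms by (auto simp: agree_def)

lemma agree_refl [simp]: "agree X st st"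
  by (simp add: agree_def)

lemma agree_trans:
  assumes "agree X st st'" "agree Y st' st''" "X \<union> Y \<subseteq> Z"
  shows "agree Z st st''"
  unfolding agree_def
proof (intro allI impI)
  fix x assume "x \<notin> Z"
  hence "x \<notin> X" "x \<notin> Y" using assms(3) by auto
  thus "nvar st'' x = nvar st x \<and> rvar st'' x = rvar st x \<and> narr st'' x = narr st x \<and> rarr st'' x = rarr st x"
    using agreeD[OF assms(1)] agreeD[OF assms(2)] by simp
qed

lemma agree_mono: "agree X st st' \<Longrightarrow> X \<subseteq> Z \<Longrightarrow> agree Z st st'"
  by (auto simp: agree_def)

lemma exec_agree: "exec svd c st t st' \<Longrightarrow> agree (mods c) st st'"
proof (induction rule: exec.induct)
  case (SVD e st a u s v)
  show ?case
    by (auto simp: agree_def apply_svd_def write_block_def split: prod.splits)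
qed (auto simp: agree_def set_cell_def)

text \<open>Total correctness with a time bound. As execution is deterministic
  (\<open>exec_deterministic\<close>), one terminating run describes the behaviour
  completely.\<close>

definition runs :: "svd_routine \<Rightarrow> com \<Rightarrow> state \<Rightarrow> nat \<Rightarrow> (state \<Rightarrow> bool) \<Rightarrow> bool" where
  "runs svd c st B Q \<longleftrightarrow> (\<exists>t st'. exec svd c st t st' \<and> t \<le> B \<and> Q st')"

text \<open>The frame \<open>agree (mods c) st s\<close> comes for free, so a postcondition need
  only mention what the program computes.\<close>

lemma runs_weaken:
  assumes "runs svd c st B Q" "B \<le> B'" "\<And>s. Q s \<Longrightarrow> agree (mods c) st s \<Longrightarrow> Q' s"
  shows "runs svd c st B' Q'"
  using assms exec_agree unfolding runs_def by (meson order_trans)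

lemma runs_mono: "runs svd c st B Q \<Longrightarrow> B \<le> B' \<Longrightarrow> runs svd c st B' Q"
  by (rule runs_weaken)

lemma runs_Seq:
  assumes "runs svd c st B1 R" "\<And>s. R s \<Longrightarrow> agree (mods c) st s \<Longrightarrow> runs svd d s B2 Q"
  shows "runs svd (Seq c d) st (B1 + B2) Q"
proof -
  obtain t1 s1 where 1: "exec svd c st t1 s1" "t1 \<le> B1" "R s1" using assms(1) by (auto simp: runs_def)
  obtain t2 s2 where 2: "exec svd d s1 t2 s2" "t2 \<le> B2" "Q s2"
    using assms(2)[OF 1(3) exec_agree[OF 1(1)]] by (auto simp: runs_def)
  show ?thesis unfolding runs_def using exec.Seq[OF 1(1) 2(1)] 1 2
    by (intro exI[of _ "t1 + t2"] exI[of _ s2]) auto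
qed

lemma runs_If:
  assumes "beval b st \<Longrightarrow> runs svd c st B Q" "\<not> beval b st \<Longrightarrow> runs svd d st B Q"
  shows "runs svd (If b c d) st (1 + bcost b + B) Q"
  using assms exec.IfTrue exec.IfFalse unfolding runs_def
  by (cases "beval b st") (meson add_left_mono)+

lemma read_write_block:
  "M \<in> carrier_mat p q \<Longrightarrow> read_block a p q (write_block a M st) = M"
  "a \<noteq> b \<Longrightarrow> read_block a p q (write_block b M st) = read_block a p q st"
  by (auto simp: read_block_def write_block_def intro!: eq_matI)

lemma runs_SVD:
  assumes "valid_svd_routine svd" "neval e st = p" "u \<noteq> s" "u \<noteq> v" "s \<noteq> v"
  shows "runs svd (SVD e a u s v) st (1 + ncost e + p ^ 3)
    (\<lambda>s'. is_svd (read_block a p p st) (read_block u p p s') (read_block s p p s') (read_block v p p s'))"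
proof -
  have car: "read_block a p p st \<in> carrier_mat p p" by (simp add: read_block_def)
  obtain U S V where f: "svd (read_block a p p st) = (U, S, V)" by (cases "svd (read_block a p p st)") auto
  have svd: "is_svd (read_block a p p st) U S V"
    using assms(1) car f unfolding valid_svd_routine_def by fastforce
  have dims: "U \<in> carrier_mat p p" "V \<in> carrier_mat p p" "S \<in> carrier_mat p p"
    using svd car unfolding is_svd_def Let_def by auto
  let ?s' = "apply_svd svd p a u s v st"
  have "read_block u p p ?s' = U" "read_block s p p ?s' = S" "read_block v p p ?s' = V"
    using assms(3-5) dims by (simp_all add: apply_svd_def f read_write_block)
  thus ?thesis unfolding runs_def using svd exec.SVD[of svd e a u s v st] assms(2) by auto
qed

section \<open>Loop-free code\<close>

fun straight :: "com \<Rightarrow> bool" where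
  "straight (Seq c d) \<longleftrightarrow> straight c \<and> straight d"
| "straight (If b c d) \<longleftrightarrow> straight c \<and> straight d"
| "straight (While b c) \<longleftrightarrow> False"
| "straight (SVD e a u s v) \<longleftrightarrow> False"
| "straight _ \<longleftrightarrow> True"

fun effect :: "com \<Rightarrow> state \<Rightarrow> state" where
  "effect (NAssign x e) st = st\<lparr>nvar := (nvar st)(x := neval e st)\<rparr>"
| "effect (RAssign x e) st = st\<lparr>rvar := (rvar st)(x := reval e st)\<rparr>"
| "effect (NWrite a i j e) st = st\<lparr>narr := set_cell a (neval i st) (neval j st) (neval e st) (narr st)\<rparr>"
| "effect (RWrite a i j e) st = st\<lparr>rarr := set_cell a (neval i st) (neval j st) (reval e st) (rarr st)\<rparr>"
| "effect (Seq c d) st = effect d (effect c st)"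
| "effect (If b c d) st = (if beval b st then effect c st else effect d st)"
| "effect _ st = st"

text \<open>Meaningful only for loop-free programs.\<close>

fun max_cost :: "com \<Rightarrow> nat" where
  "max_cost Skip = 1"
| "max_cost (NAssign x e) = 1 + ncost e"
| "max_cost (RAssign x e) = 1 + rcost e"
| "max_cost (NWrite a i j e) = 1 + ncost i + ncost j + ncost e"
| "max_cost (RWrite a i j e) = 1 + ncost i + ncost j + rcost e"
| "max_cost (Seq c d) = max_cost c + max_cost d"
| "max_cost (If b c d) = 1 + bcost b + max (max_cost c) (max_cost d)"
| "max_cost _ = 0"

text \<open>The final state is exact, while the time is only bounded, by the more expensive branch
  of every conditional. This leaves loop bodies to the simplifier.\<close>

lemma runs_straight_exact: "straight c \<Longrightarrow> runs svd c st (max_cost c) (\<lambda>s. s = effect c st)"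
proof (induction c arbitrary: st)
  case (Seq c d)
  show ?case
    using Seq by (auto intro!: runs_Seq[where R = "\<lambda>s. s = effect c st"])
next
  case (If b c d)
  have c: "runs svd c st (max (max_cost c) (max_cost d)) (\<lambda>s. s = effect (If b c d) st)" if "beval b st"
    by (rule runs_weaken[OF If.IH(1)]) (use If.prems that in auto)
  have d: "runs svd d st (max (max_cost c) (max_cost d)) (\<lambda>s. s = effect (If b c d) st)" if "\<not> beval b st"
    by (rule runs_weaken[OF If.IH(2)]) (use If.prems that in auto)
  show ?case unfolding max_cost.simps by (rule runs_If[OF c d])
qed (auto simp: runs_def intro: exec.intros)

lemma runs_straight:
  assumes "straight c" "max_cost c \<le> B" "Q (effect c st)"
  shows "runs svd c st B Q"
  by (rule runs_weaken[OF runs_straight_exact[OF assms(1)]]) (use assms in auto)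

section \<open>Counting loops and dense matrix arithmetic\<close>

fun seq :: "com list \<Rightarrow> com" where
  "seq [] = Skip"
| "seq [c] = c"
| "seq (c # cs) = Seq c (seq cs)"

definition For :: "string \<Rightarrow> string \<Rightarrow> com \<Rightarrow> com" where
  "For x N c = Seq (NAssign x (NLit 0))
     (While (NLess (NVar x) (NVar N)) (Seq c (NAssign x (NAdd (NVar x) (NLit 1)))))"

lemma mods_For [simp]: "mods (For x N c) = insert x (mods c)"
  by (auto simp: For_def)

lemma straight_For [simp]: "\<not> straight (For x N c)"
  by (simp add: For_def)

lemma set_nvar_simps [simp]:
  "nvar (set_nvar x v st) y = (if y = x then v else nvar st y)" "rvar (set_nvar x v st) = rvar st"
  "narr (set_nvar x v st) = narr st" "rarr (set_nvar x v st) = rarr st"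
  by (auto simp: set_nvar_def)

text \<open>The invariant is always evaluated in states whose counter has already been set, and each
  step may use the frame since the start of the loop. A round adds 8 for the test and the increment
  (4 each); the final 6 pays for the initialisation (2) and the last test (4).\<close>

lemma runs_For:
  assumes n: "nvar st N = n" "x \<noteq> N" "x \<notin> mods c" "N \<notin> mods c"
    and init: "I 0 (set_nvar x 0 st)"
    and step: "\<And>i s. i < n \<Longrightarrow> I i s \<Longrightarrow> agree (insert x (mods c)) st s \<Longrightarrow> nvar s x = i \<Longrightarrow> nvar s N = n \<Longrightarrow>
       runs svd c s B (\<lambda>s'. I (Suc i) (set_nvar x (Suc i) s'))"
  shows "runs svd (For x N c) st (n * (B + 8) + 6) (I n)"
proof -
  let ?body = "Seq c (NAssign x (NAdd (NVar x) (NLit 1)))"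
  let ?W = "While (NLess (NVar x) (NVar N)) ?body"
  have loop: "\<exists>t s'. exec svd ?W s t s' \<and> t \<le> (n - i) * (B + 8) + 4 \<and> I n s'"
    if "i \<le> n" "I i s" "agree (insert x (mods c)) st s" "nvar s x = i" for i s
    using that
  proof (induction "n - i" arbitrary: i s)
    case 0
    hence i: "i = n" by simp
    have N: "nvar s N = n" using agreeD(1)[OF 0(4), of N] n by simp
    have "exec svd ?W s (1 + bcost (NLess (NVar x) (NVar N))) s"
      by (rule exec.WhileFalse) (use N i 0 in simp)
    thus ?case using i 0(3) by (intro exI conjI) auto
  next
    case (Suc d)
    have N: "nvar s N = n" using agreeD(1)[OF Suc(5), of N] n by simp
    have i: "i < n" using Suc(2) by simp
    obtain t s' where s': "exec svd c s t s'" "t \<le> B" "I (Suc i) (set_nvar x (Suc i) s')"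
      using step[OF i Suc(4,5,6) N] by (auto simp: runs_def)
    have fr: "agree (mods c) s s'" by (rule exec_agree[OF s'(1)])
    have x: "nvar s' x = i" using agreeD(1)[OF fr n(3)] Suc(6) by simp
    have e: "exec svd ?body s (t + (1 + ncost (NAdd (NVar x) (NLit 1)))) (set_nvar x (Suc i) s')"
      using exec.Seq[OF s'(1) exec.NAssign[of svd x "NAdd (NVar x) (NLit 1)" s']] x by (simp add: set_nvar_def)
    have fr': "agree (insert x (mods c)) st (set_nvar x (Suc i) s')"
      using Suc(5) fr by (auto simp: agree_def)
    obtain t' s2 where s2: "exec svd ?W (set_nvar x (Suc i) s') t' s2" "t' \<le> (n - Suc i) * (B + 8) + 4" "I n s2"
    proof -
      have "d = n - Suc i" "Suc i \<le> n" "nvar (set_nvar x (Suc i) s') x = Suc i" using Suc(2) i by auto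
      from Suc(1)[OF this(1,2) s'(3) fr' this(3)] that show ?thesis by blast
    qed
    have "exec svd ?W s (1 + bcost (NLess (NVar x) (NVar N)) + (t + (1 + ncost (NAdd (NVar x) (NLit 1)))) + t') s2"
      by (rule exec.WhileTrue[OF _ e s2(1)]) (use N i Suc(6) in simp)
    moreover have "1 + bcost (NLess (NVar x) (NVar N)) + (t + (1 + ncost (NAdd (NVar x) (NLit 1)))) + t'
       \<le> (n - i) * (B + 8) + 4"
    proof -
      have "(n - i) * (B + 8) = (B + 8) + (n - Suc i) * (B + 8)"
        using i by (metis Suc_diff_Suc mult_Suc)
      thus ?thesis using s'(2) s2(2) by simp
    qed
    ultimately show ?case using s2(3) by blast
  qed
  have st0: "agree (insert x (mods c)) st (set_nvar x 0 st)" by (auto simp: agree_def)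
  obtain t s' where s': "exec svd ?W (set_nvar x 0 st) t s'" "t \<le> n * (B + 8) + 4" "I n s'"
    using loop[OF _ init st0] by auto
  have "exec svd (NAssign x (NLit 0)) st (Suc (Suc 0)) (set_nvar x 0 st)"
    using exec.NAssign[of svd x "NLit 0" st] by (simp add: set_nvar_def)
  from exec.Seq[OF this s'(1)] show ?thesis
    unfolding runs_def For_def using s' by (intro exI conjI) auto
qed

text \<open>Names with a leading underscore are scratch space throughout; stores, arguments and
  answers never use them, so frame conditions reduce to comparing characters. The program
  \<open>pre\<close> prepares values that a single expression cannot express, such as case
  distinctions and sums.\<close>

definition Fill :: "string \<Rightarrow> string \<Rightarrow> string \<Rightarrow> com \<Rightarrow> rexp \<Rightarrow> com" where
  "Fill c N1 N2 pre e = For ''_i'' N1 (For ''_j'' N2 (Seq pre (RWrite c (NVar ''_i'') (NVar ''_j'') e)))"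

lemma mods_Fill [simp]: "mods (Fill c N1 N2 pre e) = insert ''_i'' (insert ''_j'' (insert c (mods pre)))"
  by (auto simp: Fill_def)

lemma runs_Fill:
  assumes n: "nvar st N1 = n1" "nvar st N2 = n2"
    and N: "N1 \<notin> {''_i'', ''_j'', ''_l'', ''_a'', c}" "N2 \<notin> {''_i'', ''_j'', ''_l'', ''_a'', c}"
    and c: "c \<notin> {''_i'', ''_j'', ''_l'', ''_a''}" and pre: "mods pre \<subseteq> {''_l'', ''_a''}"
    and val: "\<And>i j s. i < n1 \<Longrightarrow> j < n2 \<Longrightarrow> agree {''_i'', ''_j'', ''_l'', ''_a'', c} st s \<Longrightarrow>
       nvar s ''_i'' = i \<Longrightarrow> nvar s ''_j'' = j \<Longrightarrow> runs svd pre s B (\<lambda>s'. reval e s' = f i j)"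
  shows "runs svd (Fill c N1 N2 pre e) st (n1 * (n2 * (B + rcost e + 11) + 14) + 6)
    (\<lambda>s'. \<forall>i j. rarr s' c i j = (if i < n1 \<and> j < n2 then f i j else rarr st c i j))"
proof -
  let ?X = "{''_i'', ''_j'', ''_l'', ''_a'', c}"
  have np: "''_i'' \<notin> mods pre" "''_j'' \<notin> mods pre" "c \<notin> mods pre" "N2 \<notin> mods pre" "N1 \<notin> mods pre"
    "c \<noteq> ''_i''" "c \<noteq> ''_j''" "N1 \<noteq> ''_i''" "N1 \<noteq> ''_j''" "N2 \<noteq> ''_i''" "N2 \<noteq> ''_j''" "N1 \<noteq> c" "N2 \<noteq> c"
    using pre c N by auto
  note np' = np(6-)[symmetric]
  have sub: "insert ''_i'' (mods (For ''_j'' N2 (Seq pre (RWrite c (NVar ''_i'') (NVar ''_j'') e)))) \<subseteq> ?X"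
    using pre by auto
  have "runs svd (Fill c N1 N2 pre e) st (n1 * (n2 * ((B + (rcost e + 3)) + 8) + 6 + 8) + 6)
    (\<lambda>s'. \<forall>i j. rarr s' c i j = (if i < n1 \<and> j < n2 then f i j else rarr st c i j))"
    unfolding Fill_def
  proof (rule runs_For[where I = "\<lambda>r s'. \<forall>i j. rarr s' c i j = (if i < r \<and> j < n2 then f i j else rarr st c i j)"], goal_cases)
    case (6 r s)
    have fr: "agree ?X st s" by (rule agree_mono[OF 6(3) sub])
    show ?case
    proof (rule runs_weaken[OF runs_For[where n = n2 and B = "B + (rcost e + 3)" and I = "\<lambda>q s'. \<forall>i j. rarr s' c i j =
        (if i < r \<and> j < n2 \<or> i = r \<and> j < q then f i j else rarr st c i j)"]], goal_cases)
      case 1 show ?case using agreeD(1)[OF fr N(2)] n by simp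
    next
      case (6 q s2)
      have fr2: "agree ?X st s2" by (rule agree_trans[OF fr 6(3)]) (use pre in auto)
      have r: "nvar s2 ''_i'' = r" using agreeD(1)[OF 6(3), of "''_i''"] \<open>nvar s ''_i'' = r\<close> np np' by simp
      show ?case
      proof (rule runs_Seq[OF val[OF \<open>r < n1\<close> 6(1) fr2 r 6(4)]], rule runs_straight)
        fix s3 assume s3: "reval e s3 = f r q" "agree (mods pre) s2 s3"
        have "nvar s3 ''_i'' = r" "nvar s3 ''_j'' = q" "rarr s3 c = rarr s2 c"
          using agreeD[OF s3(2), of "''_i''"] agreeD[OF s3(2), of "''_j''"] agreeD[OF s3(2), of c]
            np np' r 6(4) by auto
        thus "\<forall>i j. rarr (set_nvar ''_j'' (Suc q) (effect (RWrite c (NVar ''_i'') (NVar ''_j'') e) s3)) c i j =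
             (if i < r \<and> j < n2 \<or> i = r \<and> j < Suc q then f i j else rarr st c i j)"
          using s3(1) 6(2) by (auto simp: set_cell_def)
      qed auto
    qed (use np np' 6 in auto)
  qed (use n np np' in auto)
  thus ?thesis by (rule runs_weaken) (auto simp: algebra_simps)
qed

definition Sum_Fill :: "string \<Rightarrow> string \<Rightarrow> string \<Rightarrow> string \<Rightarrow> rexp \<Rightarrow> com" where
  "Sum_Fill c N1 N2 N3 e = Fill c N1 N2
     (Seq (RAssign ''_a'' (RLit 0)) (For ''_l'' N3 (RAssign ''_a'' (RAdd (RVar ''_a'') e)))) (RVar ''_a'')"

lemma mods_Sum_Fill [simp]: "mods (Sum_Fill c N1 N2 N3 e) = {''_i'', ''_j'', ''_l'', ''_a'', c}"
  by (auto simp: Sum_Fill_def)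

text \<open>Dense matrix products are instances. The number \<open>a\<close> of rows is kept apart
  from the bound \<open>p\<close> on the other two ranges, because single rows have to be computed
  in quadratic time. The cap 25 on the cost of a summand allows one constant for all uses.\<close>

lemma runs_Sum_Fill:
  assumes n: "nvar st N1 = n1" "nvar st N2 = n2" "nvar st N3 = n3"
    and le: "n1 \<le> a" "n2 \<le> p" "n3 \<le> p" "0 < p" "rcost e \<le> 25"
    and N: "N1 \<notin> {''_i'', ''_j'', ''_l'', ''_a'', c}" "N2 \<notin> {''_i'', ''_j'', ''_l'', ''_a'', c}"
      "N3 \<notin> {''_i'', ''_j'', ''_l'', ''_a'', c}"
    and c: "c \<notin> {''_i'', ''_j'', ''_l'', ''_a''}"
    and val: "\<And>i j l s. i < n1 \<Longrightarrow> j < n2 \<Longrightarrow> l < n3 \<Longrightarrow> agree {''_i'', ''_j'', ''_l'', ''_a'', c} st s \<Longrightarrow>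
       nvar s ''_i'' = i \<Longrightarrow> nvar s ''_j'' = j \<Longrightarrow> nvar s ''_l'' = l \<Longrightarrow> reval e s = f i j l"
  shows "runs svd (Sum_Fill c N1 N2 N3 e) st (a * p ^ 2 * 80 + 6)
    (\<lambda>s'. \<forall>i j. rarr s' c i j = (if i < n1 \<and> j < n2 then \<Sum>l<n3. f i j l else rarr st c i j))"
proof -
  let ?X = "{''_i'', ''_j'', ''_l'', ''_a'', c}"
  have "runs svd (Sum_Fill c N1 N2 N3 e) st (n1 * (n2 * ((2 + (n3 * ((rcost e + 3) + 8) + 6)) + rcost (RVar ''_a'') + 11) + 14) + 6)
    (\<lambda>s'. \<forall>i j. rarr s' c i j = (if i < n1 \<and> j < n2 then \<Sum>l<n3. f i j l else rarr st c i j))"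
    unfolding Sum_Fill_def
  proof (rule runs_Fill, goal_cases)
    case (7 i j s)
    show ?case
    proof (rule runs_Seq[OF runs_straight[where Q = "\<lambda>s'. s' = s\<lparr>rvar := (rvar s)(''_a'' := 0)\<rparr>"]], goal_cases)
      case (4 s1)
      show ?case
      proof (rule runs_weaken[OF runs_For[where n = n3 and B = "rcost e + 3" and I = "\<lambda>q s'. rvar s' ''_a'' = (\<Sum>l<q. f i j l)"]], goal_cases)
        case 1 show ?case using 4 agreeD(1)[OF 7(3) N(3)] n by simp
      next
        case (6 q s2)
        have fr: "agree ?X st s2"
          by (rule agree_trans[OF 7(3) agree_trans[OF 4(2) 6(3) subset_refl]]) auto
        have ij: "nvar s2 ''_i'' = i" "nvar s2 ''_j'' = j"
          using agreeD(1)[OF 6(3), of "''_i''"] agreeD(1)[OF 6(3), of "''_j''"] 4 7 by auto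
        show ?case
          by (rule runs_straight) (use val[OF 7(1,2) 6(1) fr ij 6(4)] 6(2) in auto)
      qed (use 4 7 N in auto)
    qed auto
  qed (use n N c in auto)
  moreover have "n1 * (n2 * ((2 + (n3 * ((rcost e + 3) + 8) + 6)) + rcost (RVar ''_a'') + 11) + 14) + 6 \<le> a * p ^ 2 * 80 + 6"
  proof -
    have "n3 * ((rcost e + 3) + 8) \<le> p * 36" using le by (intro mult_le_mono) auto
    hence "(2 + (n3 * ((rcost e + 3) + 8) + 6)) + rcost (RVar ''_a'') + 11 \<le> p * 56" using le(4) by simp
    hence "n2 * ((2 + (n3 * ((rcost e + 3) + 8) + 6)) + rcost (RVar ''_a'') + 11) \<le> p * (p * 56)"
      using le by (intro mult_le_mono) auto
    moreover have "0 < p * p" using le(4) by simp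
    ultimately have "n2 * ((2 + (n3 * ((rcost e + 3) + 8) + 6)) + rcost (RVar ''_a'') + 11) + 14 \<le> p ^ 2 * 80"
      unfolding power2_eq_square by linarith
    hence "n1 * (n2 * ((2 + (n3 * ((rcost e + 3) + 8) + 6)) + rcost (RVar ''_a'') + 11) + 14) \<le> a * (p ^ 2 * 80)"
      using le by (intro mult_le_mono) auto
    thus ?thesis by simp
  qed
  ultimately show ?thesis by (rule runs_weaken) auto
qed

lemma runs_Fill_straight:
  assumes n: "nvar st N1 = n1" "nvar st N2 = n2"
    and le: "n1 \<le> a" "n2 \<le> p" "0 < p" "rcost e \<le> 20" "max_cost pre \<le> 40"
    and N: "N1 \<notin> {''_i'', ''_j'', ''_l'', ''_a'', c}" "N2 \<notin> {''_i'', ''_j'', ''_l'', ''_a'', c}"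
    and c: "c \<notin> {''_i'', ''_j'', ''_l'', ''_a''}"
    and pre: "straight pre" "mods pre \<subseteq> {''_l'', ''_a''}"
    and val: "\<And>i j s. i < n1 \<Longrightarrow> j < n2 \<Longrightarrow> agree {''_i'', ''_j'', ''_l'', ''_a'', c} st s \<Longrightarrow>
       nvar s ''_i'' = i \<Longrightarrow> nvar s ''_j'' = j \<Longrightarrow> reval e (effect pre s) = f i j"
  shows "runs svd (Fill c N1 N2 pre e) st (a * p * 85 + 6)
    (\<lambda>s'. \<forall>i j. rarr s' c i j = (if i < n1 \<and> j < n2 then f i j else rarr st c i j))"
proof -
  have "runs svd (Fill c N1 N2 pre e) st (n1 * (n2 * (40 + rcost e + 11) + 14) + 6)
    (\<lambda>s'. \<forall>i j. rarr s' c i j = (if i < n1 \<and> j < n2 then f i j else rarr st c i j))"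
    by (rule runs_Fill[OF n N c pre(2)], rule runs_straight[OF pre(1) le(5)], rule val)
  moreover have "n1 * (n2 * (40 + rcost e + 11) + 14) + 6 \<le> a * p * 85 + 6"
  proof -
    have "n2 * (40 + rcost e + 11) \<le> p * 71" using le by (intro mult_le_mono) auto
    hence "n2 * (40 + rcost e + 11) + 14 \<le> p * 85" using le(3) by simp
    hence "n1 * (n2 * (40 + rcost e + 11) + 14) \<le> a * (p * 85)" using le by (intro mult_le_mono) auto
    thus ?thesis by simp
  qed
  ultimately show ?thesis by (rule runs_weaken) auto
qed

text \<open>Unlike \<open>runs\<close>, this names the final state. Proofs about long programs can
  thus run forward through named states, collecting facts about each, and add up the times only at
  the end.\<close>

definition run :: "svd_routine \<Rightarrow> com \<Rightarrow> state \<Rightarrow> nat \<Rightarrow> state \<Rightarrow> bool" where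
  "run svd c st B s \<longleftrightarrow> (\<exists>t\<le>B. exec svd c st t s)"

lemma runsE:
  assumes "runs svd c st B Q"
  obtains s where "run svd c st B s" "agree (mods c) st s" "Q s"
  using assms exec_agree unfolding runs_def run_def by blast

lemma runsI: "run svd c st B s \<Longrightarrow> B \<le> B' \<Longrightarrow> Q s \<Longrightarrow> runs svd c st B' Q"
  unfolding runs_def run_def by (meson order_trans)

lemma run_Seq: "run svd c st B s \<Longrightarrow> run svd d s B' s' \<Longrightarrow> run svd (Seq c d) st (B + B') s'"
  unfolding run_def using exec.Seq by (meson add_mono)

lemma run_straight: "straight c \<Longrightarrow> max_cost c \<le> B \<Longrightarrow> run svd c st B (effect c st)"
  using runs_straight_exact[of c svd st] unfolding runs_def run_def by (meson order_trans)

lemma run_runs_Seq: "run svd c st B s \<Longrightarrow> runs svd d s B' Q \<Longrightarrow> runs svd (Seq c d) st (B + B') Q"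
  unfolding run_def runs_def using exec.Seq by (meson add_mono)

section \<open>Event histories\<close>

text \<open>An event \<open>e\<close> removes coordinate \<open>c e\<close> of a row vector by folding it into the others. Applied to
  a vector whose coordinate \<open>c e\<close> vanishes it does nothing.\<close>

definition event_step :: "(nat \<Rightarrow> nat) \<Rightarrow> (nat \<Rightarrow> nat \<Rightarrow> real) \<Rightarrow> nat \<Rightarrow> (nat \<Rightarrow> real) \<Rightarrow> nat \<Rightarrow> real" where
  "event_step c y e x = (\<lambda>l. x l - x (c e) * y e l)"

definition replay :: "(nat \<Rightarrow> nat) \<Rightarrow> (nat \<Rightarrow> nat \<Rightarrow> real) \<Rightarrow> nat \<Rightarrow> nat \<Rightarrow> (nat \<Rightarrow> real) \<Rightarrow> nat \<Rightarrow> real" where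
  "replay c y t t' = fold (event_step c y) [t..<t']"

lemma replay_same [simp]: "t' \<le> t \<Longrightarrow> replay c y t t' x = x"
  by (simp add: replay_def)

lemma replay_Suc: "t \<le> t' \<Longrightarrow> replay c y t (Suc t') x = event_step c y t' (replay c y t t' x)"
  by (simp add: replay_def)

lemma replay_replay: "t \<le> t' \<Longrightarrow> t' \<le> t'' \<Longrightarrow> replay c y t' t'' (replay c y t t' x) = replay c y t t'' x"
  unfolding replay_def by (metis comp_apply fold_append le_Suc_ex upt_add_eq_append)

lemma replay_cong:
  assumes "\<And>e. t \<le> e \<Longrightarrow> e < t' \<Longrightarrow> c e = c' e \<and> y e = y' e"
  shows "replay c y t t' x = replay c' y' t t' x"
  unfolding replay_def
  by (rule List.fold_cong) (use assms in \<open>auto simp: event_step_def\<close>)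

text \<open>The value is shifted by one: \<open>Suc e\<close> for the last event \<open>e\<close>,
  and 0 if there is none. Larger values mean younger coordinates; compared with the time stamp
  \<open>t0\<close> of a row, a value above \<open>t0\<close> says that the coordinate has been
  eliminated since the row was assigned.\<close>

fun last_event :: "(nat \<Rightarrow> nat) \<Rightarrow> nat \<Rightarrow> nat \<Rightarrow> nat" where
  "last_event c 0 j = 0"
| "last_event c (Suc t) j = (if c t = j then Suc t else last_event c t j)"

lemma last_event_le: "last_event c t j \<le> t"
  by (induction t) (auto simp: le_SucI)

lemma last_event_ge: "e < t \<Longrightarrow> c e = j \<Longrightarrow> Suc e \<le> last_event c t j"
proof (induction t)
  case (Suc t)
  thus ?case by (cases "e = t") auto
qed simp

lemma last_event_cong: "(\<And>e. e < t \<Longrightarrow> c e = c' e) \<Longrightarrow> last_event c t j = last_event c' t j"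
  by (induction t) auto

text \<open>An event folds its coordinate only into coordinates that are at least as old. Hence
  whenever it concerns a row, so do all the coordinates that it changes.\<close>

definition history :: "nat \<Rightarrow> (nat \<Rightarrow> nat) \<Rightarrow> (nat \<Rightarrow> nat \<Rightarrow> real) \<Rightarrow> nat \<Rightarrow> bool" where
  "history k c y T \<longleftrightarrow> (\<forall>e<T. c e < k \<and> y e (c e) = 1 \<and>
     (\<forall>l<k. y e l \<noteq> 0 \<longrightarrow> last_event c e l \<le> last_event c e (c e)))"

text \<open>An event on \<open>l\<close> itself clears it, since its coefficient there is 1. Any
  other event that would change \<open>l\<close> folds a coordinate at least as young as
  \<open>l\<close>; that one has been eliminated since \<open>t0\<close> too, so by induction the
  amount folded is zero.\<close>

lemma replay_dead:
  assumes "history k c y T" "t0 \<le> t" "t \<le> T" "l < k" "t0 < last_event c t l"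
  shows "replay c y t0 t x l = 0"
  using assms(2-)
proof (induction t arbitrary: l)
  case 0
  thus ?case by simp
next
  case (Suc t)
  show ?case
  proof (cases "t0 = Suc t")
    case True
    thus ?thesis using Suc last_event_le[of c "Suc t" l] by simp
  next
    case False
    hence t: "t0 \<le> t" "t < T" using Suc by auto
    have h: "c t < k" "y t (c t) = 1" "\<And>l. l < k \<Longrightarrow> y t l \<noteq> 0 \<Longrightarrow> last_event c t l \<le> last_event c t (c t)"
      using assms(1) t unfolding history_def by auto
    show ?thesis
    proof (cases "c t = l")
      case True
      thus ?thesis using t h by (simp add: replay_Suc event_step_def)
    next
      case False
      hence dead: "t0 < last_event c t l" using Suc.prems by simp
      hence "replay c y t0 t x l = 0" using Suc t by simp
      moreover have "replay c y t0 t x (c t) * y t l = 0"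
        using Suc.IH[of "c t"] h(1) h(3)[OF Suc.prems(3)] dead t by (cases "y t l = 0") auto
      ultimately show ?thesis using t by (simp add: replay_Suc event_step_def)
    qed
  qed
qed

text \<open>An event has no effect on a row if its coordinate had an earlier event since the row was
  assigned, because the coordinate is zero by then.\<close>

lemma replay_skip:
  assumes "history k c y T" "t0 \<le> t" "t \<le> t'" "t' \<le> T"
    and dead: "\<And>e. t \<le> e \<Longrightarrow> e < t' \<Longrightarrow> \<exists>e0. t0 \<le> e0 \<and> e0 < e \<and> c e0 = c e"
  shows "replay c y t0 t' x = replay c y t0 t x"
  using assms(3,4) dead
proof (induction t' rule: dec_induct)
  case (step e)
  obtain e0 where e0: "t0 \<le> e0" "e0 < e" "c e0 = c e" using step by auto
  have "replay c y t0 e x (c e) = 0"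
    by (rule replay_dead[OF assms(1)])
      (use step assms e0 last_event_ge[of e0 e c "c e"] in \<open>auto simp: history_def\<close>)
  thus ?case using step assms by (simp add: replay_Suc event_step_def)
qed simp

text \<open>\<open>h (last_event c t j) j\<close> points to the first event after time \<open>t\<close> on coordinate \<open>j\<close>,
  shifted by one so that \<open>0\<close> means that there is none.\<close>

definition next_pointers :: "nat \<Rightarrow> (nat \<Rightarrow> nat) \<Rightarrow> (nat \<Rightarrow> nat \<Rightarrow> nat) \<Rightarrow> nat \<Rightarrow> bool" where
  "next_pointers k c h T \<longleftrightarrow> (\<forall>t\<le>T. \<forall>j<k. case h (last_event c t j) j of
     0 \<Rightarrow> \<forall>e. t \<le> e \<longrightarrow> e < T \<longrightarrow> c e \<noteq> j
   | Suc e \<Rightarrow> t \<le> e \<and> e < T \<and> c e = j \<and> (\<forall>e'. t \<le> e' \<longrightarrow> e' < e \<longrightarrow> c e' \<noteq> j))"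

lemma next_pointers_0:
  assumes "next_pointers k c h T" "t \<le> T" "j < k" "h (last_event c t j) j = 0" "t \<le> e" "e < T"
  shows "c e \<noteq> j"
  using assms(1)[unfolded next_pointers_def, rule_format, OF assms(2,3)] assms(4-) by simp

lemma next_pointers_Suc:
  assumes "next_pointers k c h T" "t \<le> T" "j < k" "h (last_event c t j) j = Suc e"
  shows "t \<le> e" "e < T" "c e = j" "\<And>e'. t \<le> e' \<Longrightarrow> e' < e \<Longrightarrow> c e' \<noteq> j"
  using assms(1)[unfolded next_pointers_def, rule_format, OF assms(2,3)] assms(4) by simp_all

text \<open>Every event in the skipped interval repeats a coordinate whose first event since
  \<open>t0\<close> has already been replayed. The \<open>max\<close> covers the situation before
  the first jump, where \<open>u = 0\<close> may lie before the time stamp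
  \<open>t0\<close>.\<close>

lemma replay_jump:
  assumes hist: "history k c y T" and np: "next_pointers k c h T" and t0: "t0 \<le> T" and u: "u \<le> T"
    and t: "max t0 u \<le> t'" "t' \<le> T"
    and none: "\<And>j. j < k \<Longrightarrow> u < h (last_event c t0 j) j \<Longrightarrow> t' < h (last_event c t0 j) j"
  shows "replay c y t0 t' x = replay c y t0 (max t0 u) x"
proof (rule replay_skip[OF hist _ t])
  fix e assume e: "max t0 u \<le> e" "e < t'"
  hence eT: "e < T" "t0 \<le> e" using t by auto
  hence ck: "c e < k" using hist by (auto simp: history_def)
  have "h (last_event c t0 (c e)) (c e) \<noteq> 0"
    using next_pointers_0[OF np t0 ck _ eT(2,1)] by auto
  then obtain e0 where e0: "h (last_event c t0 (c e)) (c e) = Suc e0" by (cases "h (last_event c t0 (c e)) (c e)") auto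
  note e0' = next_pointers_Suc[OF np t0 ck e0]
  have "e0 \<le> e" using e0'(4)[OF eT(2)] by force
  moreover have "e0 \<noteq> e" using none[OF ck] e e0 by auto
  ultimately show "\<exists>e0. t0 \<le> e0 \<and> e0 < e \<and> c e0 = c e" using e0' by (intro exI[of _ e0]) auto
qed auto

lemma history_extend:
  assumes "history k c y T" and j: "c' T = j" "j < k"
    and c': "\<And>e. e < T \<Longrightarrow> c' e = c e" and y': "\<And>e. e < T \<Longrightarrow> y' e = y e"
    and y: "y' T j = 1" "\<And>l. l < k \<Longrightarrow> y' T l \<noteq> 0 \<Longrightarrow> last_event c T l \<le> last_event c T j"
  shows "history k c' y' (Suc T)"
proof -
  have le: "last_event c' e l = last_event c e l" if "e \<le> T" for e l
    using that c' by (intro last_event_cong) auto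
  show ?thesis unfolding history_def
  proof (intro allI impI)
    fix e assume e: "e < Suc T"
    show "c' e < k \<and> y' e (c' e) = 1 \<and> (\<forall>l<k. y' e l \<noteq> 0 \<longrightarrow> last_event c' e l \<le> last_event c' e (c' e))"
    proof (cases "e = T")
      case True thus ?thesis using j y le by auto
    next
      case False
      hence "e < T" using e by simp
      thus ?thesis using assms(1) c' y' le unfolding history_def by auto
    qed
  qed
qed

text \<open>All times with the same last event on \<open>j\<close> share one pointer cell. A new
  event therefore answers the question of all those times with a single write, and opens one fresh,
  empty cell for the times after it.\<close>

lemma next_pointers_extend:
  assumes np: "next_pointers k c h T" and j: "c' T = j" "j < k"
    and c': "\<And>e. e < T \<Longrightarrow> c' e = c e"
    and h': "\<And>t l. h' t l = (if t = Suc T \<and> l = j then 0 else if t = last_event c T j \<and> l = j then Suc T else h t l)"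
  shows "next_pointers k c' h' (Suc T)"
proof -
  have le: "last_event c' e l = last_event c e l" if "e \<le> T" for e l
    using that c' by (intro last_event_cong) auto
  \<comment> \<open>At the current time nothing lies ahead, so the cells in use now are still
    empty.\<close>
  have none: "h (last_event c T l) l = 0" if "l < k" for l
    using next_pointers_Suc(1,2)[OF np order_refl that] by (cases "h (last_event c T l) l") force+
  show ?thesis unfolding next_pointers_def
  proof (intro allI impI)
    fix t l assume tl: "t \<le> Suc T" "l < k"
    show "case h' (last_event c' t l) l of
         0 \<Rightarrow> \<forall>e. t \<le> e \<longrightarrow> e < Suc T \<longrightarrow> c' e \<noteq> l
       | Suc e \<Rightarrow> t \<le> e \<and> e < Suc T \<and> c' e = l \<and> (\<forall>e'. t \<le> e' \<longrightarrow> e' < e \<longrightarrow> c' e' \<noteq> l)"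
    proof (cases "t = Suc T")
      case True
      have "h' (last_event c' t l) l = 0"
      proof (cases "l = j")
        case False
        hence "last_event c' t l = last_event c T l" using True j le by simp
        thus ?thesis using none[OF tl(2)] False h' by simp
      qed (use True j h' in simp)
      thus ?thesis using True by simp
    next
      case False
      hence t: "t \<le> T" using tl by simp
      have L: "last_event c' t l = last_event c t l" "last_event c t l \<noteq> Suc T"
        using le[OF t] last_event_le[of c t l] t by auto
      show ?thesis
      proof (cases "l = j \<and> last_event c t l = last_event c T j")
        case True
        hence "h (last_event c t l) l = 0" using none[OF tl(2)] by metis
        hence "\<forall>e. t \<le> e \<longrightarrow> e < T \<longrightarrow> c e \<noteq> l" using next_pointers_0[OF np t tl(2)] by blast
        moreover have "h' (last_event c' t l) l = Suc T" unfolding h' using True L by auto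
        ultimately show ?thesis using t True j c' by auto
      next
        case F: False
        have hl: "h' (last_event c' t l) l = h (last_event c t l) l" using F L h' by auto
        show ?thesis
        proof (cases "h (last_event c t l) l")
          case 0
          \<comment> \<open>An empty cell means that no event on \<open>l\<close> has happened since
            \<open>t\<close>. If the new event were on \<open>l\<close>, the cell of time
            \<open>t\<close> would be the very cell being written, which is excluded in this
            branch.\<close>
          have "c' T \<noteq> l"
          proof
            assume "c' T = l"
            hence l: "l = j" using j by simp
            have "last_event c t' l = last_event c t l" if "t \<le> t'" "t' \<le> T" for t'
              using that
            proof (induction t' rule: dec_induct)
              case (step n)
              thus ?case using next_pointers_0[OF np t tl(2) 0, of n] by simp
            qed simp
            from this[OF t order_refl] F l show False by simp
          qed
          thus ?thesis unfolding hl 0 using next_pointers_0[OF np t tl(2) 0] c' by (auto simp: less_Suc_eq)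
        next
          case (Suc e)
          thus ?thesis unfolding hl using next_pointers_Suc[OF np t tl(2) Suc] c' by auto
        qed
      qed
    qed
  qed
qed

section \<open>The row store\<close>

text \<open>Row \<open>t\<close> of the table \<open>b\<close> keeps the last events as seen at time
  \<open>t\<close>. A row that knows only its time stamp thus finds each of its pointer cells in
  \<open>h\<close> by one further lookup.\<close>

definition store_history :: "nat \<Rightarrow> string \<Rightarrow> state \<Rightarrow> bool" where
  "store_history k X st \<longleftrightarrow>
     (let T = nvar st (CHR ''T'' # X); c = (\<lambda>e. narr st (CHR ''c'' # X) e 0) in
       history k c (rarr st (CHR ''y'' # X)) T \<and>
       (\<forall>t\<le>T. \<forall>j<k. narr st (CHR ''b'' # X) t j = last_event c t j) \<and>
       next_pointers k c (narr st (CHR ''h'' # X)) T)"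

text \<open>Row \<open>i\<close> is kept as a coordinate vector \<open>x i\<close> together with the time \<open>t i\<close> of its last assignment. Its
  current value is obtained by replaying the later events and multiplying by the matrix \<open>W\<close>, whose
  inverse is \<open>w\<close>. The string \<open>X\<close> distinguishes several stores.\<close>

definition store :: "nat \<Rightarrow> nat \<Rightarrow> string \<Rightarrow> state \<Rightarrow> (nat \<Rightarrow> nat \<Rightarrow> real) \<Rightarrow> bool" where
  "store k r X st R \<longleftrightarrow> store_history k X st \<and>
     (\<forall>i<k. \<forall>j<k. (\<Sum>l<k. rarr st (CHR ''w'' # X) i l * rarr st (CHR ''W'' # X) l j) = (if i = j then 1 else 0)) \<and>
     (\<forall>i<r. narr st (CHR ''t'' # X) i 0 \<le> nvar st (CHR ''T'' # X) \<and>
       (\<forall>l<k. R i l = (\<Sum>j<k. replay (\<lambda>e. narr st (CHR ''c'' # X) e 0) (rarr st (CHR ''y'' # X))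
          (narr st (CHR ''t'' # X) i 0) (nvar st (CHR ''T'' # X)) (rarr st (CHR ''x'' # X) i) j
          * rarr st (CHR ''W'' # X) j l)))"

definition store_names :: "string \<Rightarrow> string set" where
  "store_names X = {CHR ''T'' # X, CHR ''c'' # X, CHR ''y'' # X, CHR ''b'' # X, CHR ''h'' # X,
     CHR ''w'' # X, CHR ''W'' # X, CHR ''t'' # X, CHR ''x'' # X}"

lemma store_agree:
  assumes "agree Y st st'" "store_names X \<inter> Y = {}"
  shows "store k r X st' R \<longleftrightarrow> store k r X st R"
proof -
  have n: "n \<notin> Y" if "n \<in> store_names X" for n using assms(2) that by auto
  note e = agreeD[OF assms(1) n, unfolded store_names_def]
  show ?thesis unfolding store_def store_history_def
    by (simp add: e(1)[of "CHR ''T'' # X"] e(3)[of "CHR ''c'' # X"] e(4)[of "CHR ''y'' # X"]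
      e(3)[of "CHR ''b'' # X"] e(3)[of "CHR ''h'' # X"] e(4)[of "CHR ''w'' # X"] e(4)[of "CHR ''W'' # X"]
      e(3)[of "CHR ''t'' # X"] e(4)[of "CHR ''x'' # X"])
qed

section \<open>Reading a row\<close>

definition get :: "string \<Rightarrow> com" where
  "get X = seq [
     Seq (NAssign ''_1'' (NLit 1)) (Seq (NAssign ''_u'' (NLit 0))
       (NAssign ''_t'' (NRead (CHR ''t'' # X) (NVar ''_r'') (NLit 0)))),
     For ''_j'' ''k'' (RWrite ''_q'' (NLit 0) (NVar ''_j'') (RRead (CHR ''x'' # X) (NVar ''_r'') (NVar ''_j''))),
     For ''_o'' ''k'' (seq [
       NAssign ''_v'' (NLit 0),
       For ''_j'' ''k'' (Seq
         (NAssign ''_w'' (NRead (CHR ''h'' # X) (NRead (CHR ''b'' # X) (NVar ''_t'') (NVar ''_j'')) (NVar ''_j'')))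
         (If (BAnd (NLess (NVar ''_u'') (NVar ''_w''))
                (BNot (BAnd (NLess (NLit 0) (NVar ''_v'')) (BNot (NLess (NVar ''_w'') (NVar ''_v''))))))
            (NAssign ''_v'' (NVar ''_w'')) Skip)),
       If (NLess (NLit 0) (NVar ''_v''))
         (seq [
           Seq (NAssign ''_u'' (NVar ''_v'')) (Seq (NAssign ''_w'' (NSub (NVar ''_v'') (NLit 1)))
             (RAssign ''_a'' (RRead ''_q'' (NLit 0) (NRead (CHR ''c'' # X) (NVar ''_w'') (NLit 0))))),
           For ''_j'' ''k'' (RWrite ''_q'' (NLit 0) (NVar ''_j'') (RSub (RRead ''_q'' (NLit 0) (NVar ''_j''))
             (RMul (RVar ''_a'') (RRead (CHR ''y'' # X) (NVar ''_w'') (NVar ''_j'')))))])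
         Skip]),
     Sum_Fill ''row'' ''_1'' ''k'' ''k''
       (RMul (RRead ''_q'' (NLit 0) (NVar ''_l'')) (RRead (CHR ''W'' # X) (NVar ''_l'') (NVar ''_j'')))]"

lemma mods_get: "mods (get X) = {''_1'', ''_t'', ''_u'', ''_j'', ''_q'', ''_o'', ''_v'', ''_w'', ''_a'', ''_i'', ''_l'', ''row''}"
  by (auto simp: get_def)

text \<open>The least pointer above \<open>u\<close>. Pointers to events are positive by their
  shift, so 0 is free to mean that none has been found.\<close>

lemma runs_min_pointer:
  fixes X :: string
  assumes k: "nvar st ''k'' = k" and v: "nvar st ''_v'' = 0"
  defines "d \<equiv> \<lambda>j. narr st (CHR ''h'' # X) (narr st (CHR ''b'' # X) (nvar st ''_t'') j) j"
    and "u \<equiv> nvar st ''_u''"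
  shows "runs svd (For ''_j'' ''k'' (Seq
         (NAssign ''_w'' (NRead (CHR ''h'' # X) (NRead (CHR ''b'' # X) (NVar ''_t'') (NVar ''_j'')) (NVar ''_j'')))
         (If (BAnd (NLess (NVar ''_u'') (NVar ''_w''))
                (BNot (BAnd (NLess (NLit 0) (NVar ''_v'')) (BNot (NLess (NVar ''_w'') (NVar ''_v''))))))
            (NAssign ''_v'' (NVar ''_w'')) Skip))) st (k * 40 + 6)
     (\<lambda>s. let v = nvar s ''_v'' in if v = 0 then \<forall>j<k. d j \<le> u
       else (\<exists>j<k. v = d j) \<and> u < v \<and> (\<forall>j<k. u < d j \<longrightarrow> v \<le> d j))"
proof -
  define I where "I = (\<lambda>q (s :: state). let v = nvar s ''_v'' in if v = 0 then \<forall>j<q. d j \<le> u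
       else (\<exists>j<q. v = d j) \<and> u < v \<and> (\<forall>j<q. u < d j \<longrightarrow> v \<le> d j))"
  show ?thesis
  proof (rule runs_weaken[OF runs_For[where n = k and B = 28 and I = I]], goal_cases)
    case (6 q s)
    have e: "narr s (CHR ''h'' # X) = narr st (CHR ''h'' # X)" "narr s (CHR ''b'' # X) = narr st (CHR ''b'' # X)"
      "nvar s ''_t'' = nvar st ''_t''" "nvar s ''_u'' = u"
      using agreeD[OF 6(3)] by (auto simp: u_def)
    show ?case
    proof (rule runs_straight)
      have dq: "narr s (CHR ''h'' # X) (narr s (CHR ''b'' # X) (nvar s ''_t'') q) q = d q"
        by (simp add: e d_def)
      show "I (Suc q) (set_nvar ''_j'' (Suc q) (effect (Seq
           (NAssign ''_w'' (NRead (CHR ''h'' # X) (NRead (CHR ''b'' # X) (NVar ''_t'') (NVar ''_j'')) (NVar ''_j'')))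
           (If (BAnd (NLess (NVar ''_u'') (NVar ''_w''))
                  (BNot (BAnd (NLess (NLit 0) (NVar ''_v'')) (BNot (NLess (NVar ''_w'') (NVar ''_v''))))))
              (NAssign ''_v'' (NVar ''_w'')) Skip)) s))"
        using 6(2) unfolding I_def Let_def
        by (auto simp: dq e(4) 6(4) less_Suc_eq not_less) (meson leD linear order_trans)+
    qed auto
  qed (use k v in \<open>auto simp: I_def Let_def\<close>)
qed

text \<open>Each of the \<open>k\<close> rounds finds the least pointer above \<open>_u\<close> by
  scanning the coordinates, replays that event on \<open>_q\<close> and moves \<open>_u\<close> to
  it. The pointers depend only on the time stamp of the row and are not followed any further: later
  events on the same coordinate have no effect. Hence the time does not depend on the length of the
  history.\<close>

lemma runs_get:
  assumes store: "store k r X st R" and k: "nvar st ''k'' = k" "0 < k" and i: "nvar st ''_r'' = i" "i < r"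
  shows "runs svd (get X) st (k ^ 2 * 1000) (\<lambda>s. \<forall>l<k. rarr s ''row'' 0 l = R i l)"
proof -
  define T where "T = nvar st (CHR ''T'' # X)"
  define c where "c = (\<lambda>e. narr st (CHR ''c'' # X) e 0)"
  define y where "y = rarr st (CHR ''y'' # X)"
  define h where "h = narr st (CHR ''h'' # X)"
  define x where "x = rarr st (CHR ''x'' # X) i"
  define W where "W = rarr st (CHR ''W'' # X)"
  define t0 where "t0 = narr st (CHR ''t'' # X) i 0"
  define d where "d = (\<lambda>j. h (last_event c t0 j) j)"
  have hist: "history k c y T" and np: "next_pointers k c h T"
    and b: "\<And>t j. t \<le> T \<Longrightarrow> j < k \<Longrightarrow> narr st (CHR ''b'' # X) t j = last_event c t j"
    and t0: "t0 \<le> T" and R: "\<And>l. l < k \<Longrightarrow> R i l = (\<Sum>j<k. replay c y t0 T x j * W j l)"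
    using store i unfolding store_def store_history_def Let_def T_def c_def y_def h_def x_def W_def t0_def
    by auto
  define s1 where "s1 = effect (Seq (NAssign ''_1'' (NLit 1)) (Seq (NAssign ''_u'' (NLit 0))
       (NAssign ''_t'' (NRead (CHR ''t'' # X) (NVar ''_r'') (NLit 0))))) st"
  have s1: "nvar s1 ''_1'' = 1" "nvar s1 ''_t'' = t0" "nvar s1 ''_u'' = 0" "nvar s1 ''_r'' = i" "nvar s1 ''k'' = k"
    "rarr s1 = rarr st" "narr s1 = narr st"
    using k i by (auto simp: s1_def t0_def)
  have "runs svd (For ''_j'' ''k'' (RWrite ''_q'' (NLit 0) (NVar ''_j'') (RRead (CHR ''x'' # X) (NVar ''_r'') (NVar ''_j'')))) s1 (k * (6 + 8) + 6)
    (\<lambda>s. \<forall>l<k. rarr s ''_q'' 0 l = x l)"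
  proof (rule runs_For[where n = k and I = "\<lambda>q s. \<forall>l<q. rarr s ''_q'' 0 l = x l" and B = 6], goal_cases)
    case (6 q s)
    have "rarr s (CHR ''x'' # X) = rarr st (CHR ''x'' # X)" "nvar s ''_r'' = i"
      using agreeD[OF 6(3)] s1 by auto
    thus ?case by (intro runs_straight) (use 6 in \<open>auto simp: set_cell_def x_def less_Suc_eq\<close>)
  qed (use s1 in auto)
  then obtain s2 where s2: "run svd (For ''_j'' ''k'' (RWrite ''_q'' (NLit 0) (NVar ''_j'') (RRead (CHR ''x'' # X) (NVar ''_r'') (NVar ''_j'')))) s1 (k * (6 + 8) + 6) s2"
    "agree {''_j'', ''_q''} s1 s2" "\<forall>l<k. rarr s2 ''_q'' 0 l = x l"
    by (rule runsE) simp
  note a2 = agreeD[OF s2(2)]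
  let ?min = "For ''_j'' ''k'' (Seq
         (NAssign ''_w'' (NRead (CHR ''h'' # X) (NRead (CHR ''b'' # X) (NVar ''_t'') (NVar ''_j'')) (NVar ''_j'')))
         (If (BAnd (NLess (NVar ''_u'') (NVar ''_w''))
                (BNot (BAnd (NLess (NLit 0) (NVar ''_v'')) (BNot (NLess (NVar ''_w'') (NVar ''_v''))))))
            (NAssign ''_v'' (NVar ''_w'')) Skip))"
  let ?pre = "Seq (NAssign ''_u'' (NVar ''_v'')) (Seq (NAssign ''_w'' (NSub (NVar ''_v'') (NLit 1)))
             (RAssign ''_a'' (RRead ''_q'' (NLit 0) (NRead (CHR ''c'' # X) (NVar ''_w'') (NLit 0)))))"
  let ?upd = "For ''_j'' ''k'' (RWrite ''_q'' (NLit 0) (NVar ''_j'') (RSub (RRead ''_q'' (NLit 0) (NVar ''_j''))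
             (RMul (RVar ''_a'') (RRead (CHR ''y'' # X) (NVar ''_w'') (NVar ''_j'')))))"
  let ?round = "Seq (NAssign ''_v'' (NLit 0)) (Seq ?min (If (NLess (NLit 0) (NVar ''_v'')) (Seq ?pre ?upd) Skip))"
  \<comment> \<open>Either no pointer is left, or each round so far has used up at least one. After
    \<open>k\<close> rounds the second alternative means that all \<open>k\<close> pointers are used
    up, which is the first one again.\<close>
  define I where "I = (\<lambda>q (s :: state). let u = nvar s ''_u'' in u \<le> T \<and>
      (\<forall>l<k. rarr s ''_q'' 0 l = replay c y t0 (max t0 u) x l) \<and>
      ((\<forall>j<k. d j \<le> u) \<or> q \<le> card {j. j < k \<and> 0 < d j \<and> d j \<le> u}))"
  have "runs svd (For ''_o'' ''k'' ?round) s2 (k * (k * 110 + 8) + 6) (I k)"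
  proof (rule runs_For[where n = k and I = I and B = "k * 110"], goal_cases)
    case 1 show ?case using a2 s1 by simp
  next
    case 5 show ?case using a2 s1 s2(3) by (simp add: I_def)
  next
    case (6 q s)
    define u where "u = nvar s ''_u''"
    note a7 = agreeD[OF 6(3)]
    have m: "narr s (CHR ''h'' # X) = h" "narr s (CHR ''b'' # X) = narr st (CHR ''b'' # X)" "nvar s ''_t'' = t0"
      "narr s (CHR ''c'' # X) = narr st (CHR ''c'' # X)" "rarr s (CHR ''y'' # X) = y"
      by (simp_all add: a7 a2 s1 h_def y_def)
    define sa where "sa = effect (NAssign ''_v'' (NLit 0)) s"
    have sa: "nvar sa ''_v'' = 0" "nvar sa ''k'' = k" "nvar sa ''_t'' = t0" "nvar sa ''_u'' = u"
      "narr sa = narr s" "rarr sa = rarr s" using 6(5) m by (auto simp: sa_def u_def)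
    have dj: "narr sa (CHR ''h'' # X) (narr sa (CHR ''b'' # X) (nvar sa ''_t'') j) j = d j" if "j < k" for j
      using that sa m b t0 by (simp add: d_def)
    have "runs svd ?min sa (k * 40 + 6) (\<lambda>sb. let v = nvar sb ''_v'' in if v = 0 then \<forall>j<k. d j \<le> u
       else (\<exists>j<k. v = d j) \<and> u < v \<and> (\<forall>j<k. u < d j \<longrightarrow> v \<le> d j))"
    proof (rule runs_weaken[OF runs_min_pointer[where X = X and svd = svd, OF sa(2,1)]])
      fix sb
      assume "let v = nvar sb ''_v'' in
         if v = 0 then \<forall>j<k. narr sa (CHR ''h'' # X) (narr sa (CHR ''b'' # X) (nvar sa ''_t'') j) j \<le> nvar sa ''_u''
         else (\<exists>j<k. v = narr sa (CHR ''h'' # X) (narr sa (CHR ''b'' # X) (nvar sa ''_t'') j) j) \<and>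
           nvar sa ''_u'' < v \<and>
           (\<forall>j<k. nvar sa ''_u'' < narr sa (CHR ''h'' # X) (narr sa (CHR ''b'' # X) (nvar sa ''_t'') j) j \<longrightarrow>
              v \<le> narr sa (CHR ''h'' # X) (narr sa (CHR ''b'' # X) (nvar sa ''_t'') j) j)"
      thus "let v = nvar sb ''_v'' in if v = 0 then \<forall>j<k. d j \<le> u
       else (\<exists>j<k. v = d j) \<and> u < v \<and> (\<forall>j<k. u < d j \<longrightarrow> v \<le> d j)"
        using dj unfolding sa(4) Let_def by (simp cong: conj_cong split: if_splits)
    qed simp
    then obtain sb where sb: "run svd ?min sa (k * 40 + 6) sb" "agree (mods ?min) sa sb"
      "let v = nvar sb ''_v'' in if v = 0 then \<forall>j<k. d j \<le> u
       else (\<exists>j<k. v = d j) \<and> u < v \<and> (\<forall>j<k. u < d j \<longrightarrow> v \<le> d j)"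
      by (rule runsE)
    note ab = agreeD[OF sb(2)]
    have mb: "narr sb (CHR ''c'' # X) = narr st (CHR ''c'' # X)" "rarr sb (CHR ''y'' # X) = y"
      "nvar sb ''_u'' = u" "rarr sb ''_q'' = rarr s ''_q''" "nvar sb ''k'' = k"
      by (simp_all add: ab sa m)
    define v where "v = nvar sb ''_v''"
    have Iq: "u \<le> T" "\<forall>l<k. rarr s ''_q'' 0 l = replay c y t0 (max t0 u) x l"
      "(\<forall>j<k. d j \<le> u) \<or> q \<le> card {j. j < k \<and> 0 < d j \<and> d j \<le> u}"
      using 6(2) by (auto simp: I_def Let_def u_def)
    let ?Q = "\<lambda>s'. I (Suc q) (set_nvar ''_o'' (Suc q) s')"
    have "runs svd (If (NLess (NLit 0) (NVar ''_v'')) (Seq ?pre ?upd) Skip) sb (1 + bcost (NLess (NLit 0) (NVar ''_v'')) + (16 + (k * (15 + 8) + 6))) ?Q"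
    proof (rule runs_If)
      assume "\<not> beval (NLess (NLit 0) (NVar ''_v'')) sb"
      hence "\<forall>j<k. d j \<le> u" using sb(3) by (simp add: Let_def)
      hence "?Q sb" using mb Iq by (simp add: I_def Let_def)
      thus "runs svd Skip sb (16 + (k * (15 + 8) + 6)) ?Q" by (intro runs_straight) auto
    next
      assume "beval (NLess (NLit 0) (NVar ''_v'')) sb"
      hence v0: "0 < v" by (simp add: v_def)
      have vv: "u < v" "\<And>j. j < k \<Longrightarrow> u < d j \<Longrightarrow> v \<le> d j" "\<exists>j<k. v = d j"
        using sb(3) v0 by (auto simp: Let_def v_def)
      then obtain j0 where j0: "j0 < k" "v = d j0" by auto
      obtain e where e: "v = Suc e" using v0 by (cases v) auto
      have he: "h (last_event c t0 j0) j0 = Suc e" using j0 e by (simp add: d_def)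
      note ne = next_pointers_Suc[OF np t0 j0(1) he]
      \<comment> \<open>Nothing effective happens between the last replayed event and
        \<open>e\<close>, since \<open>Suc e\<close> is the least remaining pointer.\<close>
      have rep: "replay c y t0 e x = replay c y t0 (max t0 u) x"
      proof (rule replay_jump[OF hist np t0 Iq(1)])
        fix j assume "j < k" "u < h (last_event c t0 j) j"
        thus "e < h (last_event c t0 j) j" using vv(2)[of j] e by (simp add: d_def)
      qed (use ne(1,2) vv(1) e in auto)
      have rep': "replay c y t0 (max t0 v) x = event_step c y e (replay c y t0 (max t0 u) x)"
        using ne(1) e rep by (simp add: replay_Suc max_def)
      define sc where "sc = effect ?pre sb"
      have ce: "narr sb (CHR ''c'' # X) e 0 = j0" using mb ne(3) by (simp add: c_def)
      have sc: "nvar sc ''_u'' = v" "nvar sc ''_w'' = e" "rvar sc ''_a'' = rarr s ''_q'' 0 j0"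
        "rarr sc = rarr sb" "nvar sc ''k'' = k"
        using mb e ce by (auto simp: sc_def v_def[symmetric])
      have card: "Suc q \<le> card {j. j < k \<and> 0 < d j \<and> d j \<le> v}"
      proof -
        have "\<not> (\<forall>j<k. d j \<le> u)" using vv j0 by auto
        hence "q \<le> card {j. j < k \<and> 0 < d j \<and> d j \<le> u}" using Iq(3) by blast
        also have "\<dots> < card {j. j < k \<and> 0 < d j \<and> d j \<le> v}"
        proof (rule psubset_card_mono)
          have "j0 \<in> {j. j < k \<and> 0 < d j \<and> d j \<le> v} - {j. j < k \<and> 0 < d j \<and> d j \<le> u}"
            using vv(1) j0 v0 by simp
          moreover have "{j. j < k \<and> 0 < d j \<and> d j \<le> u} \<subseteq> {j. j < k \<and> 0 < d j \<and> d j \<le> v}"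
            using vv(1) by auto
          ultimately show "{j. j < k \<and> 0 < d j \<and> d j \<le> u} \<subset> {j. j < k \<and> 0 < d j \<and> d j \<le> v}" by blast
        qed simp
        finally show ?thesis by simp
      qed
      have upd: "runs svd ?upd sc (k * (15 + 8) + 6) ?Q"
      proof (rule runs_weaken[OF runs_For[where n = k and B = 15 and I = "\<lambda>p s'. \<forall>l<k. rarr s' ''_q'' 0 l =
          (if l < p then event_step c y e (replay c y t0 (max t0 u) x) l else rarr s ''_q'' 0 l)"]], goal_cases)
        case (6 p s')
        have "rarr s' (CHR ''y'' # X) = y" "nvar s' ''_w'' = e" "rvar s' ''_a'' = rarr s ''_q'' 0 j0"
          using agreeD[OF 6(3)] sc mb by auto
        thus ?case
          by (intro runs_straight) (use 6 Iq(2) j0 ne(3) in \<open>auto simp: set_cell_def less_Suc_eq event_step_def\<close>)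
      next
        case (8 s')
        have "nvar s' ''_u'' = v" using agreeD[OF 8(2)] sc by simp
        moreover have "v \<le> T" using e ne by simp
        ultimately show ?case using 8(1) card rep' by (simp add: I_def)
      qed (use sc mb in auto)
      have "run svd ?pre sb 16 sc"
        unfolding sc_def by (rule run_straight) auto
      from run_runs_Seq[OF this upd] show "runs svd (Seq ?pre ?upd) sb (16 + (k * (15 + 8) + 6)) ?Q" .
    qed
    from run_runs_Seq[OF sb(1) this] have rest: "runs svd (Seq ?min (If (NLess (NLit 0) (NVar ''_v'')) (Seq ?pre ?upd) Skip)) sa
      (k * 40 + 6 + (1 + bcost (NLess (NLit 0) (NVar ''_v'')) + (16 + (k * (15 + 8) + 6)))) ?Q" .
    have r0: "run svd (NAssign ''_v'' (NLit 0)) s 2 sa"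
      unfolding sa_def by (rule run_straight) auto
    show ?case
      by (rule runs_weaken[OF run_runs_Seq[OF r0 rest]]) (use k in auto)
  qed (use a2 s1 in auto)
  then obtain s3 where s3: "run svd (For ''_o'' ''k'' ?round) s2 (k * (k * 110 + 8) + 6) s3"
    "agree (insert ''_o'' (mods ?round)) s2 s3" "I k s3"
    by (rule runsE) simp
  define u where "u = nvar s3 ''_u''"
  have I3: "u \<le> T" "\<forall>l<k. rarr s3 ''_q'' 0 l = replay c y t0 (max t0 u) x l"
    "(\<forall>j<k. d j \<le> u) \<or> k \<le> card {j. j < k \<and> 0 < d j \<and> d j \<le> u}"
    using s3(3) by (auto simp: I_def Let_def u_def)
  have du: "\<forall>j<k. d j \<le> u"
    using I3(3)
  proof
    assume "k \<le> card {j. j < k \<and> 0 < d j \<and> d j \<le> u}"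
    hence "{j. j < k \<and> 0 < d j \<and> d j \<le> u} = {..<k}"
      by (intro card_seteq) auto
    thus ?thesis by auto
  qed
  have rep: "replay c y t0 T x = replay c y t0 (max t0 u) x"
    by (rule replay_jump[OF hist np t0 I3(1)]) (use du t0 I3(1) in \<open>auto simp: d_def\<close>)
  note a3 = agreeD[OF s3(2)]
  have m3: "rarr s3 (CHR ''W'' # X) = W" "nvar s3 ''_1'' = 1" "nvar s3 ''k'' = k"
    by (simp_all add: a3 a2 s1 W_def)
  have fin: "runs svd (Sum_Fill ''row'' ''_1'' ''k'' ''k''
       (RMul (RRead ''_q'' (NLit 0) (NVar ''_l'')) (RRead (CHR ''W'' # X) (NVar ''_l'') (NVar ''_j''))))
     s3 (1 * k ^ 2 * 80 + 6) (\<lambda>s. \<forall>l<k. rarr s ''row'' 0 l = R i l)"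
  proof (rule runs_weaken[OF runs_Sum_Fill[where ?n1.0 = 1 and ?n2.0 = k and ?n3.0 = k and a = 1 and p = k and
        f = "\<lambda>i j l. rarr s3 ''_q'' i l * W l j"]], goal_cases)
    case (13 i j l s)
    thus ?case using agreeD[OF 13(4)] m3 by simp
  next
    case (15 s)
    thus ?case using R I3(2) rep by simp
  qed (use m3 k in auto)
  have r1: "run svd (Seq (NAssign ''_1'' (NLit 1)) (Seq (NAssign ''_u'' (NLit 0))
       (NAssign ''_t'' (NRead (CHR ''t'' # X) (NVar ''_r'') (NLit 0))))) st 8 s1"
    unfolding s1_def by (rule run_straight) auto
  have kk: "k \<le> k ^ 2" "1 \<le> k ^ 2" using k by (auto simp: power2_eq_square)
  have rounds: "k * (k * 110 + 8) = 110 * k ^ 2 + 8 * k" by (simp add: power2_eq_square algebra_simps)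
  show ?thesis unfolding get_def seq.simps
  proof (rule runs_mono[OF run_runs_Seq[OF r1 run_runs_Seq[OF s2(1) run_runs_Seq[OF s3(1) fin]]]])
    show "8 + (k * (6 + 8) + 6 + (k * (k * 110 + 8) + 6 + (1 * k\<^sup>2 * 80 + 6))) \<le> k\<^sup>2 * 1000"
      unfolding rounds using kk by simp
  qed
qed

section \<open>Assigning a row\<close>

lemma inverse_solve:
  fixes k :: nat
  assumes "\<And>i j. i < k \<Longrightarrow> j < k \<Longrightarrow> (\<Sum>l<k. w i l * W l j) = (if i = j then 1 else (0 :: real))" and l: "l < k"
  shows "(\<Sum>j<k. (\<Sum>i<k. p i * w i j) * W j l) = p l"
proof -
  have "(\<Sum>j<k. (\<Sum>i<k. p i * w i j) * W j l) = (\<Sum>j<k. \<Sum>i<k. p i * (w i j * W j l))"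
    by (simp add: sum_distrib_right mult.assoc)
  also have "\<dots> = (\<Sum>i<k. \<Sum>j<k. p i * (w i j * W j l))" by (rule sum.swap)
  also have "\<dots> = (\<Sum>i<k. p i * (if i = l then 1 else 0))"
    using assms by (intro sum.cong) (auto simp flip: sum_distrib_left)
  also have "\<dots> = (\<Sum>i<k. if i = l then p i else 0)" by (intro sum.cong) auto
  finally show ?thesis using l by simp
qed

definition put :: "string \<Rightarrow> com" where
  "put X = seq [
     NAssign ''_1'' (NLit 1),
     Sum_Fill ''_q'' ''_1'' ''k'' ''k''
       (RMul (RRead ''_p'' (NLit 0) (NVar ''_l'')) (RRead (CHR ''w'' # X) (NVar ''_l'') (NVar ''_j''))),
     For ''_j'' ''k'' (RWrite (CHR ''x'' # X) (NVar ''_r'') (NVar ''_j'') (RRead ''_q'' (NLit 0) (NVar ''_j''))),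
     NWrite (CHR ''t'' # X) (NVar ''_r'') (NLit 0) (NVar (CHR ''T'' # X))]"

lemma mods_put: "mods (put X) = {''_1'', ''_i'', ''_j'', ''_l'', ''_a'', ''_q'', CHR ''x'' # X, CHR ''t'' # X}"
  by (auto simp: put_def)

text \<open>The coordinates are obtained by multiplying the new value by the inverse
  \<open>w\<close>; with the current time as stamp there is nothing to replay. The bound
  \<open>max r (Suc i)\<close> covers both overwriting a row and appending one at index
  \<open>r\<close>.\<close>

lemma runs_put:
  assumes store: "store k r X st R" and k: "nvar st ''k'' = k" "0 < k" and i: "nvar st ''_r'' = i" "i \<le> r"
  shows "runs svd (put X) st (k ^ 2 * 200) (\<lambda>s. store k (max r (Suc i)) X s (R(i := rarr st ''_p'' 0)))"
proof -
  define p where "p = rarr st ''_p'' 0"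
  define w where "w = rarr st (CHR ''w'' # X)"
  define s1 where "s1 = effect (NAssign ''_1'' (NLit 1)) st"
  have s1: "nvar s1 ''_1'' = 1" "nvar s1 ''k'' = k" "nvar s1 ''_r'' = i" "rarr s1 = rarr st"
    using k i by (auto simp: s1_def)
  have r1: "run svd (NAssign ''_1'' (NLit 1)) st 2 s1" unfolding s1_def by (rule run_straight) auto
  have a1: "agree {''_1''} st s1" by (auto simp: s1_def agree_def)
  let ?sf = "Sum_Fill ''_q'' ''_1'' ''k'' ''k''
       (RMul (RRead ''_p'' (NLit 0) (NVar ''_l'')) (RRead (CHR ''w'' # X) (NVar ''_l'') (NVar ''_j'')))"
  have "runs svd ?sf s1 (1 * k ^ 2 * 80 + 6) (\<lambda>s. \<forall>i j. rarr s ''_q'' i j =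
     (if i < 1 \<and> j < k then \<Sum>l<k. rarr s1 ''_p'' i l * w l j else rarr s1 ''_q'' i j))"
  proof (rule runs_Sum_Fill, goal_cases)
    case (13 i j l s)
    thus ?case using agreeD[OF 13(4)] s1 by (simp add: w_def)
  qed (use s1 k in auto)
  then obtain s2 where s2: "run svd ?sf s1 (1 * k ^ 2 * 80 + 6) s2" "agree (mods ?sf) s1 s2"
    "\<forall>i j. rarr s2 ''_q'' i j = (if i < 1 \<and> j < k then \<Sum>l<k. rarr s1 ''_p'' i l * w l j else rarr s1 ''_q'' i j)"
    by (rule runsE)
  note a2 = agreeD[OF s2(2)]
  let ?cp = "For ''_j'' ''k'' (RWrite (CHR ''x'' # X) (NVar ''_r'') (NVar ''_j'') (RRead ''_q'' (NLit 0) (NVar ''_j'')))"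
  have "runs svd ?cp s2 (k * (10 + 8) + 6) (\<lambda>s. \<forall>a b. rarr s (CHR ''x'' # X) a b =
     (if a = i \<and> b < k then rarr s2 ''_q'' 0 b else rarr s2 (CHR ''x'' # X) a b))"
  proof (rule runs_For[where n = k and B = 10 and I = "\<lambda>n s. \<forall>a b. rarr s (CHR ''x'' # X) a b =
     (if a = i \<and> b < n then rarr s2 ''_q'' 0 b else rarr s2 (CHR ''x'' # X) a b)"], goal_cases)
    case (6 n s)
    have "nvar s ''_r'' = i" "rarr s ''_q'' = rarr s2 ''_q''" using agreeD[OF 6(3)] a2 s1 by auto
    thus ?case by (intro runs_straight) (use 6 in \<open>auto simp: set_cell_def less_Suc_eq\<close>)
  qed (use s1 a2 in auto)
  then obtain s3 where s3: "run svd ?cp s2 (k * (10 + 8) + 6) s3" "agree (mods ?cp) s2 s3"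
    "\<forall>a b. rarr s3 (CHR ''x'' # X) a b =
     (if a = i \<and> b < k then rarr s2 ''_q'' 0 b else rarr s2 (CHR ''x'' # X) a b)"
    by (rule runsE)
  note a3 = agreeD[OF s3(2)]
  define T where "T = nvar st (CHR ''T'' # X)"
  define c where "c = (\<lambda>e. narr st (CHR ''c'' # X) e 0)"
  define y where "y = rarr st (CHR ''y'' # X)"
  define W where "W = rarr st (CHR ''W'' # X)"
  define x where "x = rarr st (CHR ''x'' # X)"
  define s4 where "s4 = effect (NWrite (CHR ''t'' # X) (NVar ''_r'') (NLit 0) (NVar (CHR ''T'' # X))) s3"
  have f: "rarr s3 (CHR ''W'' # X) = W" "rarr s3 (CHR ''w'' # X) = w" "rarr s3 (CHR ''y'' # X) = y"
    "nvar s3 (CHR ''T'' # X) = T" "narr s3 (CHR ''c'' # X) = narr st (CHR ''c'' # X)"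
    "narr s3 (CHR ''b'' # X) = narr st (CHR ''b'' # X)" "narr s3 (CHR ''h'' # X) = narr st (CHR ''h'' # X)"
    "narr s3 (CHR ''t'' # X) = narr st (CHR ''t'' # X)" "nvar s3 ''_r'' = i"
    "rarr s2 (CHR ''x'' # X) = x"
    by (simp_all add: a3 a2 s1 agreeD[OF a1] W_def w_def y_def T_def x_def)
  have g: "rarr s4 = rarr s3" "nvar s4 = nvar s3" "narr s4 (CHR ''c'' # X) = narr st (CHR ''c'' # X)"
    "narr s4 (CHR ''b'' # X) = narr st (CHR ''b'' # X)" "narr s4 (CHR ''h'' # X) = narr st (CHR ''h'' # X)"
    "\<And>a. narr s4 (CHR ''t'' # X) a 0 = (if a = i then T else narr st (CHR ''t'' # X) a 0)"
    using f by (auto simp: s4_def set_cell_def)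
  have x': "rarr s3 (CHR ''x'' # X) a = x a" if "a \<noteq> i" for a
    using s3(3) f(10) that by auto
  have xi: "rarr s3 (CHR ''x'' # X) i b = (\<Sum>l<k. p l * w l b)" if "b < k" for b
    using s3(3) s2(3) s1 that by (simp add: p_def)
  have inv: "\<And>i j. i < k \<Longrightarrow> j < k \<Longrightarrow> (\<Sum>l<k. w i l * W l j) = (if i = j then 1 else 0)"
    using store by (simp add: store_def w_def W_def)
  have "store k (max r (Suc i)) X s4 (R(i := p))"
    unfolding store_def
  proof (intro conjI allI impI)
    show "store_history k X s4"
      using store unfolding store_def store_history_def Let_def by (simp add: g f T_def y_def)
    fix a b assume "a < k" "b < k"
    thus "(\<Sum>l<k. rarr s4 (CHR ''w'' # X) a l * rarr s4 (CHR ''W'' # X) l b) = (if a = b then 1 else 0)"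
      using inv by (simp add: g f)
  next
    fix a assume a: "a < max r (Suc i)"
    show "narr s4 (CHR ''t'' # X) a 0 \<le> nvar s4 (CHR ''T'' # X)"
      using store a i unfolding store_def by (auto simp: g f T_def)
    fix l assume l: "l < k"
    show "(R(i := p)) a l = (\<Sum>j<k. replay (\<lambda>e. narr s4 (CHR ''c'' # X) e 0) (rarr s4 (CHR ''y'' # X))
          (narr s4 (CHR ''t'' # X) a 0) (nvar s4 (CHR ''T'' # X)) (rarr s4 (CHR ''x'' # X) a) j
          * rarr s4 (CHR ''W'' # X) j l)"
    proof (cases "a = i")
      case True
      thus ?thesis using inverse_solve[OF inv l, of p] xi by (simp add: g f)
    next
      case False
      hence "a < r" using a i by simp
      thus ?thesis using store l False x'[OF False] unfolding store_def by (simp add: g f T_def c_def y_def W_def x_def)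
    qed
  qed
  moreover have r4: "run svd (NWrite (CHR ''t'' # X) (NVar ''_r'') (NLit 0) (NVar (CHR ''T'' # X))) s3 4 s4"
    unfolding s4_def by (rule run_straight) auto
  have kk: "k \<le> k ^ 2" "1 \<le> k ^ 2" using k by (auto simp: power2_eq_square)
  ultimately show ?thesis unfolding put_def seq.simps p_def
    by (intro runsI[OF run_Seq[OF r1 run_Seq[OF s2(1) run_Seq[OF s3(1) r4]]]]) (use kk in auto)
qed

section \<open>Eliminating a coordinate\<close>

definition event :: "string \<Rightarrow> com" where
  "event X = seq [
     Seq (NAssign ''_v'' (NLit 0)) (NAssign ''_u'' (NLit 0)),
     For ''_j'' ''k'' (If (BAnd (RLess (RLit 0) (RMul (RRead ''_A'' (NVar ''_j'') (NVar ''_o'')) (RRead ''_A'' (NVar ''_j'') (NVar ''_o''))))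
         (BNot (BAnd (NLess (NLit 0) (NVar ''_u''))
           (BNot (NLess (NRead (CHR ''b'' # X) (NVar (CHR ''T'' # X)) (NVar ''_v''))
                        (NRead (CHR ''b'' # X) (NVar (CHR ''T'' # X)) (NVar ''_j'')))))))
       (Seq (NAssign ''_v'' (NVar ''_j'')) (NAssign ''_u'' (NLit 1))) Skip),
     Seq (NWrite (CHR ''c'' # X) (NVar (CHR ''T'' # X)) (NLit 0) (NVar ''_v''))
       (RAssign ''_g'' (RRead ''_A'' (NVar ''_v'') (NVar ''_o''))),
     For ''_j'' ''k'' (RWrite (CHR ''y'' # X) (NVar (CHR ''T'' # X)) (NVar ''_j'')
       (RDiv (RRead ''_A'' (NVar ''_j'') (NVar ''_o'')) (RVar ''_g''))),
     For ''_j'' ''k'' (Seq (RAssign ''_g'' (RRead ''_A'' (NVar ''_v'') (NVar ''_j'')))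
       (For ''_l'' ''k'' (RWrite ''_A'' (NVar ''_l'') (NVar ''_j'') (RSub (RRead ''_A'' (NVar ''_l'') (NVar ''_j''))
         (RMul (RVar ''_g'') (RRead (CHR ''y'' # X) (NVar (CHR ''T'' # X)) (NVar ''_l''))))))),
     For ''_j'' ''k'' (RWrite (CHR ''W'' # X) (NVar ''_v'') (NVar ''_j'')
       (RAdd (RRead (CHR ''W'' # X) (NVar ''_v'') (NVar ''_j'')) (RRead ''_B'' (NVar ''_j'') (NVar ''_o'')))),
     For ''_j'' ''k'' (NWrite (CHR ''b'' # X) (NAdd (NVar (CHR ''T'' # X)) (NLit 1)) (NVar ''_j'')
       (NRead (CHR ''b'' # X) (NVar (CHR ''T'' # X)) (NVar ''_j''))),
     Seq (NWrite (CHR ''h'' # X) (NRead (CHR ''b'' # X) (NVar (CHR ''T'' # X)) (NVar ''_v'')) (NVar ''_v'')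
           (NAdd (NVar (CHR ''T'' # X)) (NLit 1)))
       (Seq (NWrite (CHR ''b'' # X) (NAdd (NVar (CHR ''T'' # X)) (NLit 1)) (NVar ''_v'') (NAdd (NVar (CHR ''T'' # X)) (NLit 1)))
         (Seq (NWrite (CHR ''h'' # X) (NAdd (NVar (CHR ''T'' # X)) (NLit 1)) (NVar ''_v'') (NLit 0))
           (NAssign (CHR ''T'' # X) (NAdd (NVar (CHR ''T'' # X)) (NLit 1)))))]"

lemma mods_event: "mods (event X) = {''_v'', ''_u'', ''_j'', ''_g'', ''_l'', ''_A'', CHR ''c'' # X, CHR ''y'' # X, CHR ''W'' # X,
    CHR ''b'' # X, CHR ''h'' # X, CHR ''T'' # X}"
  by (auto simp: event_def)

text \<open>Column \<open>i\<close> of \<open>A\<close> is the dependence to be recorded and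
  \<open>v\<close> the youngest coordinate occurring in it, recognised by the largest entry in row
  \<open>T\<close> of \<open>b\<close>. Normalised at \<open>v\<close> it becomes the coefficients
  of the event; a Gaussian elimination step then clears the entries at \<open>v\<close> in all
  columns.\<close>

lemma runs_event:
  assumes k: "nvar st ''k'' = k" "0 < k" and o: "nvar st ''_o'' = i" and T: "nvar st (CHR ''T'' # X) = T"
    and A: "rarr st ''_A'' = A" and B: "rarr st ''_B'' = B" and W: "rarr st (CHR ''W'' # X) = W"
    and b: "narr st (CHR ''b'' # X) = b" and h: "narr st (CHR ''h'' # X) = h"
    and ex: "\<exists>j<k. A j i \<noteq> 0"
  shows "runs svd (event X) st (k ^ 2 * 800) (\<lambda>s. \<exists>v<k. A v i \<noteq> 0 \<and> (\<forall>j<k. A j i \<noteq> 0 \<longrightarrow> b T j \<le> b T v) \<and>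
     nvar s (CHR ''T'' # X) = Suc T \<and>
     narr s (CHR ''c'' # X) = (narr st (CHR ''c'' # X))(T := (narr st (CHR ''c'' # X) T)(0 := v)) \<and>
     (\<forall>e. e \<noteq> T \<longrightarrow> rarr s (CHR ''y'' # X) e = rarr st (CHR ''y'' # X) e) \<and>
     (\<forall>l<k. rarr s (CHR ''y'' # X) T l = A l i / A v i) \<and>
     (\<forall>l<k. \<forall>j<k. rarr s ''_A'' l j = A l j - A v j * (A l i / A v i)) \<and>
     (\<forall>j<k. \<forall>l<k. rarr s (CHR ''W'' # X) j l = W j l + (if j = v then B l i else 0)) \<and>
     (\<forall>t j. j < k \<longrightarrow> narr s (CHR ''b'' # X) t j = (if t = Suc T then if j = v then Suc T else b T j else b t j)) \<and>
     (\<forall>t j. narr s (CHR ''h'' # X) t j = (if t = Suc T \<and> j = v then 0 else if t = b T v \<and> j = v then Suc T else h t j)))"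
proof -
  let ?T = "CHR ''T'' # X" and ?b = "CHR ''b'' # X" and ?y = "CHR ''y'' # X" and ?c = "CHR ''c'' # X"
    and ?W = "CHR ''W'' # X" and ?h = "CHR ''h'' # X"
  let ?c1 = "Seq (NAssign ''_v'' (NLit 0)) (NAssign ''_u'' (NLit 0))"
  define s1 where "s1 = effect ?c1 st"
  have r1: "run svd ?c1 st 4 s1" unfolding s1_def by (rule run_straight) auto
  have a1: "agree {''_v'', ''_u''} st s1" by (auto simp: s1_def agree_def)
  have s1: "nvar s1 ''_v'' = 0" "nvar s1 ''_u'' = 0" by (auto simp: s1_def)
  let ?body2 = "If (BAnd (RLess (RLit 0) (RMul (RRead ''_A'' (NVar ''_j'') (NVar ''_o'')) (RRead ''_A'' (NVar ''_j'') (NVar ''_o''))))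
         (BNot (BAnd (NLess (NLit 0) (NVar ''_u''))
           (BNot (NLess (NRead ?b (NVar ?T) (NVar ''_v''))
                        (NRead ?b (NVar ?T) (NVar ''_j'')))))))
       (Seq (NAssign ''_v'' (NVar ''_j'')) (NAssign ''_u'' (NLit 1))) Skip"
  let ?c2 = "For ''_j'' ''k'' ?body2"
  define I where "I = (\<lambda>q (s :: state). if nvar s ''_u'' = 0 then \<forall>j<q. A j i = 0
     else nvar s ''_v'' < q \<and> A (nvar s ''_v'') i \<noteq> 0 \<and> (\<forall>j<q. A j i \<noteq> 0 \<longrightarrow> b T j \<le> b T (nvar s ''_v'')))"
  have "runs svd ?c2 s1 (k * (40 + 8) + 6) (I k)"
  proof (rule runs_For[where n = k and B = 40 and I = I], goal_cases)
    case (6 q s)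
    have e: "nvar s ''_o'' = i" "nvar s ?T = T" "rarr s ''_A'' = A" "narr s ?b = b"
      using agreeD[OF 6(3)] agreeD[OF a1] o T A b by auto
    \<comment> \<open>Reals are compared by \<open><\<close> only; the sign of the square serves as
      the test for nonzero.\<close>
    have sq: "0 < x * x \<longleftrightarrow> x \<noteq> 0" for x :: real by (metis not_real_square_gt_zero)
    show ?case
    proof (rule runs_straight)
      show "I (Suc q) (set_nvar ''_j'' (Suc q) (effect ?body2 s))"
      proof (cases "A q i \<noteq> 0 \<and> (nvar s ''_u'' = 0 \<or> b T (nvar s ''_v'') < b T q)")
        case True
        hence ef: "effect ?body2 s = s\<lparr>nvar := (nvar s)(''_v'' := q, ''_u'' := 1)\<rparr>"
          by (simp add: e 6(4) sq)
        have "b T j \<le> b T q" if "j < q" "A j i \<noteq> 0" for j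
        proof (cases "nvar s ''_u'' = 0")
          case True thus ?thesis using 6(2) that by (simp add: I_def)
        next
          case False
          hence "b T j \<le> b T (nvar s ''_v'')" using 6(2) that by (simp add: I_def)
          thus ?thesis using True False by simp
        qed
        thus ?thesis using True unfolding ef by (auto simp: I_def less_Suc_eq)
      next
        case False
        hence ef: "effect ?body2 s = s"
          by (auto simp: e 6(4) sq)
        show ?thesis unfolding ef using 6(2) False by (auto simp: I_def less_Suc_eq split: if_splits)
      qed
    qed auto
  qed (use agreeD[OF a1] k s1 in \<open>auto simp: I_def\<close>)
  then obtain s2 where s2: "run svd ?c2 s1 (k * (40 + 8) + 6) s2" "agree (mods ?c2) s1 s2" "I k s2" by (rule runsE)
  define v where "v = nvar s2 ''_v''"
  have v: "v < k" "A v i \<noteq> 0" "\<And>j. j < k \<Longrightarrow> A j i \<noteq> 0 \<Longrightarrow> b T j \<le> b T v"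
    using s2(3) ex by (auto simp: I_def v_def split: if_splits)
  have a2: "agree {''_v'', ''_u'', ''_j''} st s2" by (rule agree_trans[OF a1 s2(2)]) auto
  let ?c3 = "Seq (NWrite ?c (NVar ?T) (NLit 0) (NVar ''_v'')) (RAssign ''_g'' (RRead ''_A'' (NVar ''_v'') (NVar ''_o'')))"
  define s3 where "s3 = effect ?c3 s2"
  have r3: "run svd ?c3 s2 20 s3" unfolding s3_def by (rule run_straight) auto
  have a3: "agree {''_v'', ''_u'', ''_j'', ?c, ''_g''} st s3"
  proof (rule agree_trans[OF a2])
    show "agree {?c, ''_g''} s2 s3" by (auto simp: s3_def agree_def set_cell_def)
  qed auto
  have s3: "narr s3 ?c = (narr st ?c)(T := (narr st ?c T)(0 := v))" "rvar s3 ''_g'' = A v i" "nvar s3 ''_v'' = v"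
    using agreeD[OF a2] o T A by (auto simp: s3_def set_cell_def v_def)
  let ?c4 = "For ''_j'' ''k'' (RWrite ?y (NVar ?T) (NVar ''_j'') (RDiv (RRead ''_A'' (NVar ''_j'') (NVar ''_o'')) (RVar ''_g'')))"
  have "runs svd ?c4 s3 (k * (20 + 8) + 6) (\<lambda>s. \<forall>e l. rarr s ?y e l = (if e = T \<and> l < k then A l i / A v i else rarr st ?y e l))"
  proof (rule runs_For[where n = k and B = 20 and I = "\<lambda>q s. \<forall>e l. rarr s ?y e l = (if e = T \<and> l < q then A l i / A v i else rarr st ?y e l)"], goal_cases)
    case (6 q s)
    have e: "nvar s ''_o'' = i" "nvar s ?T = T" "rarr s ''_A'' = A" "rvar s ''_g'' = A v i"
      using agreeD[OF 6(3)] agreeD[OF a3] s3 o T A by auto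
    show ?case by (rule runs_straight) (use 6(2,4) e in \<open>auto simp: set_cell_def less_Suc_eq\<close>)
  qed (use agreeD[OF a3] k in auto)
  then obtain s4 where s4: "run svd ?c4 s3 (k * (20 + 8) + 6) s4" "agree (mods ?c4) s3 s4"
    "\<forall>e l. rarr s4 ?y e l = (if e = T \<and> l < k then A l i / A v i else rarr st ?y e l)" by (rule runsE)
  have a4: "agree {''_v'', ''_u'', ''_j'', ?c, ''_g'', ?y} st s4" by (rule agree_trans[OF a3 s4(2)]) auto
  have f4: "narr s4 ?c = narr s3 ?c" "nvar s4 ''_v'' = v" using agreeD[OF s4(2)] s3 by auto
  let ?in5 = "For ''_l'' ''k'' (RWrite ''_A'' (NVar ''_l'') (NVar ''_j'') (RSub (RRead ''_A'' (NVar ''_l'') (NVar ''_j''))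
         (RMul (RVar ''_g'') (RRead ?y (NVar ?T) (NVar ''_l'')))))"
  let ?c5 = "For ''_j'' ''k'' (Seq (RAssign ''_g'' (RRead ''_A'' (NVar ''_v'') (NVar ''_j''))) ?in5)"
  have "runs svd ?c5 s4 (k * ((6 + (k * (20 + 8) + 6)) + 8) + 6) (\<lambda>s. \<forall>l<k. \<forall>j. rarr s ''_A'' l j = (if j < k then A l j - A v j * (A l i / A v i) else A l j))"
  proof (rule runs_For[where n = k and B = "6 + (k * (20 + 8) + 6)" and
        I = "\<lambda>q s. \<forall>l<k. \<forall>j. rarr s ''_A'' l j = (if j < q then A l j - A v j * (A l i / A v i) else A l j)"], goal_cases)
    case (6 q s)
    have e: "nvar s ?T = T" "nvar s ''_v'' = v" "rarr s ?y = rarr s4 ?y" "nvar s ''k'' = k"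
      using agreeD[OF 6(3)] agreeD[OF a4] f4 T k by auto
    define s' where "s' = effect (RAssign ''_g'' (RRead ''_A'' (NVar ''_v'') (NVar ''_j''))) s"
    have r': "run svd (RAssign ''_g'' (RRead ''_A'' (NVar ''_v'') (NVar ''_j''))) s 6 s'"
      unfolding s'_def by (rule run_straight) auto
    have s': "rvar s' ''_g'' = A v q" "rarr s' = rarr s" "nvar s' = nvar s"
      using 6(2,4) v(1) e by (auto simp: s'_def)
    have "runs svd ?in5 s' (k * (20 + 8) + 6) (\<lambda>s2. \<forall>l<k. \<forall>j. rarr (set_nvar ''_j'' (Suc q) s2) ''_A'' l j
        = (if j < Suc q then A l j - A v j * (A l i / A v i) else A l j))"
    proof (rule runs_weaken[OF runs_For[where n = k and B = 20 and I = "\<lambda>p s2. \<forall>l<k. \<forall>j. rarr s2 ''_A'' l j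
        = (if j < q \<or> j = q \<and> l < p then A l j - A v j * (A l i / A v i) else A l j)"]], goal_cases)
      case (6 p s2)
      have e2: "nvar s2 ?T = T" "nvar s2 ''_j'' = q" "rarr s2 ?y = rarr s4 ?y" "rvar s2 ''_g'' = A v q"
        using agreeD[OF 6(3)] e s' \<open>nvar s ''_j'' = q\<close> by auto
      show ?case by (rule runs_straight) (use 6(1,2,4) e2 s4(3) in \<open>auto simp: set_cell_def less_Suc_eq\<close>)
    qed (use 6 e s' in \<open>auto simp: less_Suc_eq\<close>)
    from run_runs_Seq[OF r' this] show ?case .
  qed (use agreeD[OF a4] k A in auto)
  then obtain s5 where s5: "run svd ?c5 s4 (k * ((6 + (k * (20 + 8) + 6)) + 8) + 6) s5" "agree (mods ?c5) s4 s5"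
    "\<forall>l<k. \<forall>j. rarr s5 ''_A'' l j = (if j < k then A l j - A v j * (A l i / A v i) else A l j)" by (rule runsE)
  have a5: "agree {''_v'', ''_u'', ''_j'', ?c, ''_g'', ?y, ''_l'', ''_A''} st s5" by (rule agree_trans[OF a4 s5(2)]) auto
  have f5: "narr s5 ?c = narr s3 ?c" "nvar s5 ''_v'' = v" "rarr s5 ?y = rarr s4 ?y" using agreeD[OF s5(2)] f4 by auto
  let ?c6 = "For ''_j'' ''k'' (RWrite ?W (NVar ''_v'') (NVar ''_j'')
       (RAdd (RRead ?W (NVar ''_v'') (NVar ''_j'')) (RRead ''_B'' (NVar ''_j'') (NVar ''_o''))))"
  have "runs svd ?c6 s5 (k * (20 + 8) + 6) (\<lambda>s. \<forall>j l. rarr s ?W j l = W j l + (if j = v \<and> l < k then B l i else 0))"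
  proof (rule runs_For[where n = k and B = 20 and I = "\<lambda>q s. \<forall>j l. rarr s ?W j l = W j l + (if j = v \<and> l < q then B l i else 0)"], goal_cases)
    case (6 q s)
    have e: "nvar s ''_o'' = i" "nvar s ''_v'' = v" "rarr s ''_B'' = B"
      using agreeD[OF 6(3)] agreeD[OF a5] f5 o B by auto
    show ?case by (rule runs_straight) (use 6(2,4) e in \<open>auto simp: set_cell_def less_Suc_eq\<close>)
  qed (use agreeD[OF a5] k W in auto)
  then obtain s6 where s6: "run svd ?c6 s5 (k * (20 + 8) + 6) s6" "agree (mods ?c6) s5 s6"
    "\<forall>j l. rarr s6 ?W j l = W j l + (if j = v \<and> l < k then B l i else 0)" by (rule runsE)
  have a6: "agree {''_v'', ''_u'', ''_j'', ?c, ''_g'', ?y, ''_l'', ''_A'', ?W} st s6" by (rule agree_trans[OF a5 s6(2)]) auto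
  have f6: "narr s6 ?c = narr s3 ?c" "nvar s6 ''_v'' = v" "rarr s6 ?y = rarr s4 ?y" "rarr s6 ''_A'' = rarr s5 ''_A''"
    using agreeD[OF s6(2)] f5 by auto
  let ?c7 = "For ''_j'' ''k'' (NWrite ?b (NAdd (NVar ?T) (NLit 1)) (NVar ''_j'') (NRead ?b (NVar ?T) (NVar ''_j'')))"
  have "runs svd ?c7 s6 (k * (20 + 8) + 6) (\<lambda>s. \<forall>t j. narr s ?b t j = (if t = Suc T \<and> j < k then b T j else b t j))"
  proof (rule runs_For[where n = k and B = 20 and I = "\<lambda>q s. \<forall>t j. narr s ?b t j = (if t = Suc T \<and> j < q then b T j else b t j)"], goal_cases)
    case (6 q s)
    have e: "nvar s ?T = T" using agreeD[OF 6(3)] agreeD[OF a6] T by auto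
    show ?case by (rule runs_straight) (use 6(2,4) e in \<open>auto simp: set_cell_def less_Suc_eq\<close>)
  qed (use agreeD[OF a6] k b in auto)
  then obtain s7 where s7: "run svd ?c7 s6 (k * (20 + 8) + 6) s7" "agree (mods ?c7) s6 s7"
    "\<forall>t j. narr s7 ?b t j = (if t = Suc T \<and> j < k then b T j else b t j)" by (rule runsE)
  have a7: "agree {''_v'', ''_u'', ''_j'', ?c, ''_g'', ?y, ''_l'', ''_A'', ?W, ?b} st s7" by (rule agree_trans[OF a6 s7(2)]) auto
  have f7: "narr s7 ?c = narr s3 ?c" "nvar s7 ''_v'' = v" "rarr s7 ?y = rarr s4 ?y" "rarr s7 ''_A'' = rarr s5 ''_A''"
    "rarr s7 ?W = rarr s6 ?W" "nvar s7 ?T = T" "narr s7 ?h = h"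
    using agreeD[OF s7(2)] f6 agreeD[OF a7] T h by auto
  let ?c8 = "Seq (NWrite ?h (NRead ?b (NVar ?T) (NVar ''_v'')) (NVar ''_v'') (NAdd (NVar ?T) (NLit 1)))
       (Seq (NWrite ?b (NAdd (NVar ?T) (NLit 1)) (NVar ''_v'') (NAdd (NVar ?T) (NLit 1)))
         (Seq (NWrite ?h (NAdd (NVar ?T) (NLit 1)) (NVar ''_v'') (NLit 0)) (NAssign ?T (NAdd (NVar ?T) (NLit 1)))))"
  define s8 where "s8 = effect ?c8 s7"
  have r8: "run svd ?c8 s7 50 s8" unfolding s8_def by (rule run_straight) auto
  have s8: "nvar s8 ?T = Suc T" "rarr s8 = rarr s7" "narr s8 ?c = narr s7 ?c"
    "\<forall>t j. j < k \<longrightarrow> narr s8 ?b t j = (if t = Suc T then if j = v then Suc T else b T j else b t j)"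
    "\<forall>t j. narr s8 ?h t j = (if t = Suc T \<and> j = v then 0 else if t = b T v \<and> j = v then Suc T else h t j)"
    using f7 s7(3) v(1) by (auto simp: s8_def set_cell_def)
  have kk: "k \<le> k ^ 2" "1 \<le> k ^ 2" using k by (auto simp: power2_eq_square)
  have inner: "k * ((6 + (k * (20 + 8) + 6)) + 8) = 28 * k ^ 2 + 20 * k" by (simp add: power2_eq_square algebra_simps)
  show ?thesis unfolding event_def seq.simps
  proof (rule runsI[OF run_Seq[OF r1 run_Seq[OF s2(1) run_Seq[OF r3 run_Seq[OF s4(1) run_Seq[OF s5(1) run_Seq[OF s6(1) run_Seq[OF s7(1) r8]]]]]]]], goal_cases)
    case 1 show ?case unfolding inner using kk by simp
  next
    case 2
    have y: "rarr s8 ?y = rarr s4 ?y" using s8 f7 by simp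
    have "rarr s4 ?y e = rarr st ?y e" if "e \<noteq> T" for e using s4(3) that by auto
    thus ?case using v s8 f7 s4(3) s5(3) s6(3) s3(1)
      by (intro exI[of _ v]) (simp add: y)
  qed
qed

section \<open>Restoring invertibility after a singular transformation\<close>

lemma read_block_index [simp]: "i < p \<Longrightarrow> j < q \<Longrightarrow> read_block a p q st $$ (i,j) = rarr st a i j"
  "dim_row (read_block a p q st) = p" "dim_col (read_block a p q st) = q"
  by (auto simp: read_block_def)

text \<open>Memory arrays are functions of two indices, so the consequences of an SVD are restated
  for entries: \<open>A\<^sup>T * M = S * B\<^sup>T\<close>, \<open>M * B = A * S\<close>, and
  orthogonality.\<close>

definition svd_entries :: "nat \<Rightarrow> (nat \<Rightarrow> nat \<Rightarrow> real) \<Rightarrow> (nat \<Rightarrow> nat \<Rightarrow> real) \<Rightarrow> (nat \<Rightarrow> nat \<Rightarrow> real) \<Rightarrow> (nat \<Rightarrow> nat \<Rightarrow> real) \<Rightarrow> bool" where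
  "svd_entries k M A S B \<longleftrightarrow>
     (\<forall>i<k. \<forall>l<k. (\<Sum>j<k. A j i * M j l) = S i i * B l i) \<and>
     (\<forall>j<k. \<forall>i<k. (\<Sum>l<k. M j l * B l i) = A j i * S i i) \<and>
     (\<forall>i<k. \<forall>i'<k. (\<Sum>l<k. A l i * A l i') = (if i = i' then 1 else 0)) \<and>
     (\<forall>i<k. \<forall>i'<k. (\<Sum>l<k. B l i * B l i') = (if i = i' then 1 else 0)) \<and>
     (\<forall>l<k. \<forall>l'<k. (\<Sum>i<k. B l i * B l' i) = (if l = l' then 1 else 0)) \<and>
     (\<forall>i<k. 0 \<le> S i i)"

lemma is_svd_entries:
  assumes "is_svd (read_block m k k st) (read_block a k k s) (read_block \<sigma> k k s) (read_block b k k s)"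
  shows "svd_entries k (rarr st m) (rarr s a) (rarr s \<sigma>) (rarr s b)"
proof -
  let ?M = "read_block m k k st" and ?A = "read_block a k k s" and ?S = "read_block \<sigma> k k s" and ?B = "read_block b k k s"
  have "?M \<in> carrier_mat k k" by (simp add: read_block_def)
  note f = is_svd_square[OF assms this]
  define D where "D = dg k (\<lambda>i. ?S $$ (i,i))"
  have S: "?S = D" unfolding D_def by (rule f(7))
  have D: "dim_row D = k" "dim_col D = k" by (auto simp: D_def)
  have AM: "?A\<^sup>T * ?M = D * ?B\<^sup>T" unfolding f(8) S by (rule mat_cancel[OF f(2)]) (auto simp: D)
  have MB: "?M * ?B = ?A * D" unfolding f(8) S using f(5) D by (simp add: mat_simps)
  have "(\<Sum>j<k. rarr s a j i * rarr st m j l) = rarr s \<sigma> i i * rarr s b l i" if "i < k" "l < k" for i l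
    using arg_cong[OF AM, of "\<lambda>M. M $$ (i,l)"] that by (simp add: mult_mat_index[of _ "?A\<^sup>T"] D_def dg_mult_index)
  moreover have "(\<Sum>l<k. rarr st m j l * rarr s b l i) = rarr s a j i * rarr s \<sigma> i i" if "i < k" "j < k" for i j
    using arg_cong[OF MB, of "\<lambda>M. M $$ (j,i)"] that by (simp add: mult_mat_index[of _ ?M] D_def mult_dg_index)
  moreover have "(\<Sum>l<k. rarr s a l i * rarr s a l i') = (if i = i' then 1 else 0)" if "i < k" "i' < k" for i i'
    using arg_cong[OF f(2), of "\<lambda>M. M $$ (i,i')"] that by (simp add: mult_mat_index)
  moreover have "(\<Sum>l<k. rarr s b l i * rarr s b l i') = (if i = i' then 1 else 0)" if "i < k" "i' < k" for i i'
    using arg_cong[OF f(5), of "\<lambda>M. M $$ (i,i')"] that by (simp add: mult_mat_index)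
  moreover have "(\<Sum>i<k. rarr s b l i * rarr s b l' i) = (if l = l' then 1 else 0)" if "l < k" "l' < k" for l l'
    using arg_cong[OF f(6), of "\<lambda>M. M $$ (l,l')"] that by (simp add: mult_mat_index)
  moreover have "0 \<le> rarr s \<sigma> i i" if "i < k" for i using f(9)[OF that] that by simp
  ultimately show ?thesis unfolding svd_entries_def by blast
qed

text \<open>The state after the columns \<open>< i\<close> of the left singular vectors of \<open>M\<close> have been treated. Each one with
  singular value \<open>0\<close> is a linear dependence between the rows of \<open>M\<close>; it becomes an event on the row
  \<open>f i\<close>, which gets the corresponding right singular vector added, restoring the rank.\<close>

definition elim_inv :: "nat \<Rightarrow> string \<Rightarrow> nat \<Rightarrow> (nat \<Rightarrow> nat) \<Rightarrow> (nat \<Rightarrow> nat \<Rightarrow> real) \<Rightarrow> (nat \<Rightarrow> nat \<Rightarrow> real) \<Rightarrow>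
    (nat \<Rightarrow> nat \<Rightarrow> real) \<Rightarrow> (nat \<Rightarrow> nat \<Rightarrow> real) \<Rightarrow> (nat \<Rightarrow> nat \<Rightarrow> real) \<Rightarrow> nat \<Rightarrow> state \<Rightarrow> bool" where
  "elim_inv k X T0 c0 y0 M A0 S0 B i s \<longleftrightarrow>
     (let T = nvar s (CHR ''T'' # X); c = (\<lambda>e. narr s (CHR ''c'' # X) e 0); y = rarr s (CHR ''y'' # X);
          W = rarr s (CHR ''W'' # X); A = rarr s ''_A'' in
       store_history k X s \<and> T0 \<le> T \<and> (\<forall>e<T0. c e = c0 e \<and> y e = y0 e) \<and>
       (\<forall>x. \<forall>l<k. (\<Sum>j<k. replay c y T0 T x j * W j l) = (\<Sum>j<k. x j * M j l)) \<and>
       (\<exists>f. inj_on f {i'. i' < i \<and> S0 i' i' = 0} \<and>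
          (\<forall>i'<i. S0 i' i' = 0 \<longrightarrow> f i' < k \<and> (\<forall>j<k. i \<le> j \<longrightarrow> A (f i') j = 0)) \<and>
          (\<forall>j<k. \<forall>l<k. W j l = M j l + (\<Sum>i' | i' < i \<and> S0 i' i' = 0. if f i' = j then B l i' else 0))) \<and>
       (\<forall>i'<k. i \<le> i' \<longrightarrow> S0 i' i' = 0 \<longrightarrow> (\<forall>l<k. (\<Sum>j<k. A j i' * M j l) = 0)) \<and>
       (\<forall>i'<k. \<forall>i''<k. i \<le> i' \<longrightarrow> i \<le> i'' \<longrightarrow> (\<Sum>l<k. A0 l i'' * A l i') = (if i'' = i' then 1 else 0)))"

lemma elim_inv_set_nvar [simp]:
  "elim_inv k X T0 c0 y0 M A0 S0 B i (set_nvar (CHR ''_'' # x) v s) = elim_inv k X T0 c0 y0 M A0 S0 B i s"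
  by (simp add: elim_inv_def store_history_def)

lemma elim_inv_start:
  assumes "store_history k X s" "svd_entries k M (rarr s ''_A'') S B"
    and W: "\<And>j l. j < k \<Longrightarrow> l < k \<Longrightarrow> rarr s (CHR ''W'' # X) j l = M j l"
  shows "elim_inv k X (nvar s (CHR ''T'' # X)) (\<lambda>e. narr s (CHR ''c'' # X) e 0) (rarr s (CHR ''y'' # X)) M (rarr s ''_A'') S B 0 s"
  using assms unfolding elim_inv_def Let_def svd_entries_def by simp

lemma elim_inv_skip:
  assumes inv: "elim_inv k X T0 c0 y0 M A0 S0 B i s" and nz: "S0 i i \<noteq> 0"
  shows "elim_inv k X T0 c0 y0 M A0 S0 B (Suc i) s"
proof -
  have Z: "{i'. i' < Suc i \<and> S0 i' i' = 0} = {i'. i' < i \<and> S0 i' i' = 0}"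
    using nz less_Suc_eq by auto

  note d = inv[unfolded elim_inv_def Let_def]
  obtain f where f: "inj_on f {i'. i' < i \<and> S0 i' i' = 0}"
    "\<And>i'. i' < i \<Longrightarrow> S0 i' i' = 0 \<Longrightarrow> f i' < k"
    "\<And>i' j. i' < i \<Longrightarrow> S0 i' i' = 0 \<Longrightarrow> j < k \<Longrightarrow> i \<le> j \<Longrightarrow> rarr s ''_A'' (f i') j = 0"
    "\<forall>j<k. \<forall>l<k. rarr s (CHR ''W'' # X) j l = M j l + (\<Sum>i' | i' < i \<and> S0 i' i' = 0. if f i' = j then B l i' else 0)"
    using d by auto
  have f': "\<forall>i'<Suc i. S0 i' i' = 0 \<longrightarrow> f i' < k \<and> (\<forall>j<k. Suc i \<le> j \<longrightarrow> rarr s ''_A'' (f i') j = 0)"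
  proof (intro allI impI)
    fix i' assume "i' < Suc i" and S: "S0 i' i' = 0"
    hence "i' < i" using nz less_Suc_eq by auto
    thus "f i' < k \<and> (\<forall>j<k. Suc i \<le> j \<longrightarrow> rarr s ''_A'' (f i') j = 0)" using f(2,3) S by simp
  qed
  have "\<forall>i'<k. Suc i \<le> i' \<longrightarrow> S0 i' i' = 0 \<longrightarrow> (\<forall>l<k. (\<Sum>j<k. rarr s ''_A'' j i' * M j l) = 0)"
    "\<forall>i'<k. \<forall>i''<k. Suc i \<le> i' \<longrightarrow> Suc i \<le> i'' \<longrightarrow> (\<Sum>l<k. A0 l i'' * rarr s ''_A'' l i') = (if i'' = i' then 1 else 0)"
    using d by simp_all
  thus ?thesis unfolding elim_inv_def Let_def Z
    using d by (elim conjE, intro conjI exI[of _ f] f(1) f' f(4)) assumption+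
qed

text \<open>The columns of \<open>A\<close> change during elimination, but the remaining ones stay
  dual to the original orthonormal columns \<open>A0\<close>; a zero column could not pair to
  1.\<close>

lemma elim_inv_nonzero:
  assumes inv: "elim_inv k X T0 c0 y0 M A0 S0 B i s" and i: "i < k"
  shows "\<exists>j<k. rarr s ''_A'' j i \<noteq> 0"
proof (rule ccontr)
  assume "\<not> ?thesis"
  hence "(\<Sum>l<k. A0 l i * rarr s ''_A'' l i) = 0" by simp
  moreover have "(\<Sum>l<k. A0 l i * rarr s ''_A'' l i) = 1" using inv i by (simp add: elim_inv_def Let_def)
  ultimately show False by simp
qed

text \<open>The normalised dependence \<open>z\<close> annihilates both \<open>M\<close> and the
  current \<open>W\<close>, so replaying the event changes no value. As \<open>z v = 1\<close>,
  coordinate \<open>v\<close> is zero afterwards and the direction added to row \<open>v\<close> of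
  \<open>W\<close> remains unseen. Clearing the entries at \<open>v\<close> keeps \<open>v\<close>
  out of the remaining dependences, so each row of \<open>W\<close> is altered at most once.\<close>

lemma elim_inv_event:
  assumes inv: "elim_inv k X T0 c0 y0 M A0 S0 B i s" and i: "i < k" "S0 i i = 0"
  defines "T \<equiv> nvar s (CHR ''T'' # X)" and "A \<equiv> rarr s ''_A''" and "W \<equiv> rarr s (CHR ''W'' # X)"
    and "b \<equiv> narr s (CHR ''b'' # X)" and "h \<equiv> narr s (CHR ''h'' # X)"
  assumes v: "v < k" "A v i \<noteq> 0" "\<forall>j<k. A j i \<noteq> 0 \<longrightarrow> b T j \<le> b T v"
    and T': "nvar s' (CHR ''T'' # X) = Suc T"
    and c': "narr s' (CHR ''c'' # X) = (narr s (CHR ''c'' # X))(T := (narr s (CHR ''c'' # X) T)(0 := v))"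
    and y': "\<forall>e. e \<noteq> T \<longrightarrow> rarr s' (CHR ''y'' # X) e = rarr s (CHR ''y'' # X) e"
      "\<forall>l<k. rarr s' (CHR ''y'' # X) T l = A l i / A v i"
    and A': "\<forall>l<k. \<forall>j<k. rarr s' ''_A'' l j = A l j - A v j * (A l i / A v i)"
    and W': "\<forall>j<k. \<forall>l<k. rarr s' (CHR ''W'' # X) j l = W j l + (if j = v then B l i else 0)"
    and b': "\<forall>t j. j < k \<longrightarrow> narr s' (CHR ''b'' # X) t j = (if t = Suc T then if j = v then Suc T else b T j else b t j)"
    and h': "\<forall>t j. narr s' (CHR ''h'' # X) t j = (if t = Suc T \<and> j = v then 0 else if t = b T v \<and> j = v then Suc T else h t j)"
  shows "elim_inv k X T0 c0 y0 M A0 S0 B (Suc i) s'"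
proof -
  define c where "c = (\<lambda>e. narr s (CHR ''c'' # X) e 0)"
  define y where "y = rarr s (CHR ''y'' # X)"
  define cn where "cn = (\<lambda>e. narr s' (CHR ''c'' # X) e 0)"
  define yn where "yn = rarr s' (CHR ''y'' # X)"
  define z where "z = yn T"
  define Wn where "Wn = rarr s' (CHR ''W'' # X)"
  define An where "An = rarr s' ''_A''"
  let ?Z = "{i'. i' < i \<and> S0 i' i' = 0}"
  note d = inv[unfolded elim_inv_def Let_def, folded c_def y_def T_def A_def W_def]
  note d1 = d[THEN conjunct1] and d2 = d[THEN conjunct2, THEN conjunct1] and d3 = d[THEN conjunct2, THEN conjunct2]
  note d4 = d3[THEN conjunct1] and d5 = d3[THEN conjunct2, THEN conjunct1] and d6 = d3[THEN conjunct2, THEN conjunct2]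
  note d7 = d6[THEN conjunct1] and d8 = d6[THEN conjunct2, THEN conjunct1] and d9 = d6[THEN conjunct2, THEN conjunct2]
  have sh: "store_history k X s" and T0: "T0 \<le> T" by (fact d1 d2)+
  have fr: "\<forall>e<T0. c e = c0 e \<and> y e = y0 e" using d4 by (simp add: c_def)
  have rep: "\<And>x l. l < k \<Longrightarrow> (\<Sum>j<k. replay c y T0 T x j * W j l) = (\<Sum>j<k. x j * M j l)"
    and null: "\<And>i' l. i' < k \<Longrightarrow> i \<le> i' \<Longrightarrow> S0 i' i' = 0 \<Longrightarrow> l < k \<Longrightarrow> (\<Sum>j<k. A j i' * M j l) = 0"
    and dual: "\<And>i' i''. i' < k \<Longrightarrow> i'' < k \<Longrightarrow> i \<le> i' \<Longrightarrow> i \<le> i'' \<Longrightarrow> (\<Sum>l<k. A0 l i'' * A l i') = (if i'' = i' then 1 else 0)"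
    using d5 d8 d9 by auto
  obtain f where f: "inj_on f ?Z" "\<And>i'. i' < i \<Longrightarrow> S0 i' i' = 0 \<Longrightarrow> f i' < k"
    "\<And>i' j. i' < i \<Longrightarrow> S0 i' i' = 0 \<Longrightarrow> j < k \<Longrightarrow> i \<le> j \<Longrightarrow> A (f i') j = 0"
    "\<And>j l. j < k \<Longrightarrow> l < k \<Longrightarrow> W j l = M j l + (\<Sum>i'\<in>?Z. if f i' = j then B l i' else 0)"
    using d7 by auto
  have cn: "cn = c(T := v)" by (rule ext) (simp add: cn_def c_def c')
  have yn: "\<And>e. e \<noteq> T \<Longrightarrow> yn e = y e" using y'(1) by (simp add: yn_def y_def)
  have z: "\<And>l. l < k \<Longrightarrow> z l = A l i / A v i" using y'(2) by (simp add: yn_def z_def)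
  have zv: "z v = 1" using z v by simp
  have An: "\<And>l j. l < k \<Longrightarrow> j < k \<Longrightarrow> An l j = A l j - A v j * z l" using A' z by (simp add: An_def)
  have Wn: "\<And>j l. j < k \<Longrightarrow> l < k \<Longrightarrow> Wn j l = W j l + (if j = v then B l i else 0)" using W' by (simp add: Wn_def)
  have zM: "(\<Sum>j<k. z j * M j l) = 0" if "l < k" for l
  proof -
    have "(\<Sum>j<k. z j * M j l) = (\<Sum>j<k. A j i * M j l) / A v i"
      by (simp add: sum_divide_distrib z)
    thus ?thesis using null[OF i(1) order_refl i(2) that] by simp
  qed
  \<comment> \<open>Where \<open>W\<close> already differs from \<open>M\<close>, the current column
    of \<open>A\<close> has been cleared, so \<open>z\<close> does not see the difference.\<close>
  have zW: "(\<Sum>j<k. z j * W j l) = 0" if l: "l < k" for l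
  proof -
    have "z j * (\<Sum>i'\<in>?Z. if f i' = j then B l i' else 0) = 0" if j: "j < k" for j
    proof -
      have "z j * (if f i' = j then B l i' else 0) = 0" if "i' \<in> ?Z" for i'
        using that f(3)[of i' i] i z[OF j] by auto
      thus ?thesis unfolding sum_distrib_left by (intro sum.neutral ballI)
    qed
    hence "(\<Sum>j<k. z j * W j l) = (\<Sum>j<k. z j * M j l)"
      using l by (intro sum.cong) (auto simp: f(4) distrib_left)
    thus ?thesis using zM l by simp
  qed
  have bT: "b t j = last_event c t j" if "t \<le> T" "j < k" for t j
    using sh that unfolding store_history_def Let_def by (simp add: T_def b_def c_def)
  have hist: "history k c y T" and np: "next_pointers k c h T"
    using sh unfolding store_history_def Let_def by (simp_all add: T_def h_def c_def y_def)
  have hist': "history k cn yn (Suc T)"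
  proof (rule history_extend[OF hist])
    fix l assume l: "l < k" "yn T l \<noteq> 0"
    hence "A l i \<noteq> 0" using z by (auto simp: z_def)
    thus "last_event c T l \<le> last_event c T v" using v l bT by auto
  qed (use v zv yn in \<open>auto simp: cn z_def\<close>)
  have np': "next_pointers k cn (narr s' (CHR ''h'' # X)) (Suc T)"
    by (rule next_pointers_extend[OF np, of _ v]) (use v h' bT in \<open>auto simp: cn\<close>)
  have lc: "last_event cn t j = last_event c t j" if "t \<le> T" for t j
    using that by (intro last_event_cong) (auto simp: cn)
  have b'': "narr s' (CHR ''b'' # X) t j = last_event cn t j" if "t \<le> Suc T" "j < k" for t j
    using that b' bT lc v by (cases "t = Suc T") (auto simp: cn)
  have sh': "store_history k X s'"
    unfolding store_history_def Let_def T' cn_def[symmetric] yn_def[symmetric] using hist' np' b'' by auto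
  \<comment> \<open>The change of row \<open>v\<close> enters with the coefficient
    \<open>x1 v - x1 v * z v\<close>, which is zero.\<close>
  have rep': "(\<Sum>j<k. replay cn yn T0 (Suc T) x j * Wn j l) = (\<Sum>j<k. x j * M j l)" if l: "l < k" for x l
  proof -
    define x1 where "x1 = replay c y T0 T x"
    have "replay cn yn T0 T x = x1" unfolding x1_def by (rule replay_cong) (use yn in \<open>auto simp: cn\<close>)
    hence r: "replay cn yn T0 (Suc T) x = (\<lambda>j. x1 j - x1 v * z j)"
      using T0 by (simp add: replay_Suc event_step_def cn z_def)
    have "(\<Sum>j<k. (x1 j - x1 v * z j) * Wn j l)
        = (\<Sum>j<k. x1 j * W j l - x1 v * (z j * W j l) + (if j = v then (x1 v - x1 v * z v) * B l i else 0))"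
      using l by (intro sum.cong) (auto simp: Wn algebra_simps)
    also have "\<dots> = (\<Sum>j<k. x1 j * W j l) - x1 v * (\<Sum>j<k. z j * W j l)"
      using v zv by (simp add: sum.distrib sum_subtractf sum_distrib_left)
    finally show ?thesis unfolding r using rep[OF l, of x] zW[OF l] by (simp add: x1_def)
  qed
  have Z': "{i'. i' < Suc i \<and> S0 i' i' = 0} = insert i ?Z" using i by (auto simp: less_Suc_eq)
  define fn where "fn = f(i := v)"
  have fz: "fn i' = f i'" if "i' \<in> ?Z" for i' using that by (auto simp: fn_def)
  \<comment> \<open>The rows altered before have a zero in column \<open>i\<close>, whereas
    \<open>v\<close> was chosen with a nonzero entry there.\<close>
  have "v \<notin> f ` ?Z" using f(3)[of _ i] i v(2) by auto
  moreover have "fn ` ?Z = f ` ?Z" using fz by (intro image_cong) auto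
  moreover have "inj_on fn ?Z" using f(1) fz by (metis (no_types, lifting) inj_on_cong)
  ultimately have inj: "inj_on fn (insert i ?Z)" by (auto simp: fn_def)
  have P: "(\<Sum>i'\<in>insert i ?Z. if fn i' = j then B l i' else 0)
      = (if v = j then B l i else 0) + (\<Sum>i'\<in>?Z. if f i' = j then B l i' else 0)" for j l
  proof -
    have "(\<Sum>i'\<in>?Z. if fn i' = j then B l i' else 0) = (\<Sum>i'\<in>?Z. if f i' = j then B l i' else 0)"
      by (intro sum.cong) (auto simp: fz)
    thus ?thesis by (simp add: fn_def)
  qed
  have f': "inj_on fn {i'. i' < Suc i \<and> S0 i' i' = 0} \<and>
      (\<forall>i'<Suc i. S0 i' i' = 0 \<longrightarrow> fn i' < k \<and> (\<forall>j<k. Suc i \<le> j \<longrightarrow> An (fn i') j = 0)) \<and>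
      (\<forall>j<k. \<forall>l<k. Wn j l = M j l + (\<Sum>i' | i' < Suc i \<and> S0 i' i' = 0. if fn i' = j then B l i' else 0))"
  proof (intro conjI allI impI)
    show "inj_on fn {i'. i' < Suc i \<and> S0 i' i' = 0}" unfolding Z' by (rule inj)
  next
    fix j l assume jl: "j < k" "l < k"
    show "Wn j l = M j l + (\<Sum>i' | i' < Suc i \<and> S0 i' i' = 0. if fn i' = j then B l i' else 0)"
      unfolding Z' P Wn[OF jl] f(4)[OF jl] by simp
  next
    fix i' assume i': "i' < Suc i" "S0 i' i' = 0"
    show "fn i' < k" using f(2)[of i'] i' v by (cases "i' = i") (auto simp: fn_def)
    fix j assume j: "j < k" "Suc i \<le> j"
    show "An (fn i') j = 0"
    proof (cases "i' = i")
      case True thus ?thesis using An v j zv by (simp add: fn_def)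
    next
      case False
      hence "i' < i" using i' by simp
      thus ?thesis using An[of "f i'" j] f(2)[of i'] f(3)[of i' j] f(3)[of i' i] z[of "f i'"] i i' j by (simp add: fn_def)
    qed
  qed
  have null': "(\<Sum>j<k. An j i' * M j l) = 0" if "i' < k" "Suc i \<le> i'" "S0 i' i' = 0" "l < k" for i' l
  proof -
    have "(\<Sum>j<k. An j i' * M j l) = (\<Sum>j<k. A j i' * M j l - A v i' * (z j * M j l))"
      using that by (intro sum.cong) (auto simp: An algebra_simps)
    also have "\<dots> = (\<Sum>j<k. A j i' * M j l) - A v i' * (\<Sum>j<k. z j * M j l)"
      by (simp add: sum_subtractf sum_distrib_left)
    also have "\<dots> = 0" using that zM null[of i' l] by simp
    finally show ?thesis .
  qed
  \<comment> \<open>The later columns change by multiples of column \<open>i\<close>, which pairs to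
    zero with every column of \<open>A0\<close> beyond \<open>i\<close>.\<close>
  have dual': "(\<Sum>l<k. A0 l i'' * An l i') = (if i'' = i' then 1 else 0)"
    if "i' < k" "i'' < k" "Suc i \<le> i'" "Suc i \<le> i''" for i' i''
  proof -
    have "(\<Sum>l<k. A0 l i'' * An l i') = (\<Sum>l<k. A0 l i'' * A l i' - (A v i' / A v i) * (A0 l i'' * A l i))"
      using that by (intro sum.cong) (auto simp: An z algebra_simps)
    also have "\<dots> = (\<Sum>l<k. A0 l i'' * A l i') - (A v i' / A v i) * (\<Sum>l<k. A0 l i'' * A l i)"
      by (simp add: sum_subtractf sum_distrib_left)
    also have "\<dots> = (if i'' = i' then 1 else 0)" using that dual[of i i''] dual[of i' i''] i by simp
    finally show ?thesis .
  qed
  have fr': "\<forall>e<T0. cn e = c0 e \<and> yn e = y0 e" using fr yn T0 by (auto simp: cn)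
  show ?thesis unfolding elim_inv_def Let_def T' cn_def[symmetric] yn_def[symmetric] Wn_def[symmetric] An_def[symmetric]
    using sh' T0 fr' rep' f' null' dual' by (intro conjI exI[of _ fn]) auto
qed

text \<open>A vector killed by \<open>W\<close> is killed by \<open>M\<close>, whose rows are
  combinations of rows of \<open>W\<close>. It is then orthogonal to all right singular vectors of
  \<open>M\<close>: to those with nonzero singular value because \<open>M\<close> kills it, to the
  others because each of them is the difference of a row of \<open>W\<close> and a row of
  \<open>M\<close>.\<close>

lemma elim_inv_injective:
  assumes inv: "elim_inv k X T0 c0 y0 M A0 S0 B k s" and svd: "svd_entries k M A0 S0 B"
    and W0: "\<And>j. j < k \<Longrightarrow> (\<Sum>l<k. rarr s (CHR ''W'' # X) j l * v l) = 0" and l: "l < k"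
  shows "v l = 0"
proof -
  define W where "W = rarr s (CHR ''W'' # X)"
  let ?Z = "{i'. i' < k \<and> S0 i' i' = 0}"
  obtain f where f: "inj_on f ?Z" "\<And>i'. i' < k \<Longrightarrow> S0 i' i' = 0 \<Longrightarrow> f i' < k"
    "\<And>j l. j < k \<Longrightarrow> l < k \<Longrightarrow> W j l = M j l + (\<Sum>i'\<in>?Z. if f i' = j then B l i' else 0)"
    using inv unfolding elim_inv_def Let_def W_def by auto
  have Wv: "(\<Sum>l<k. W j l * v l) = 0" if "j < k" for j using W0[OF that] by (simp add: W_def)
  have Mv: "(\<Sum>l<k. M j l * v l) = 0" if j: "j < k" for j
  proof -
    \<comment> \<open>Replaying the events on the \<open>j\<close>-th unit vector yields the
      coefficients of row \<open>j\<close> of \<open>M\<close> in the rows of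
      \<open>W\<close>.\<close>
    obtain x where x: "\<And>l. l < k \<Longrightarrow> (\<Sum>j'<k. x j' * W j' l) = (\<Sum>j'<k. (if j' = j then 1 else 0) * M j' l)"
    proof
      show "l < k \<Longrightarrow> (\<Sum>j'<k. replay (\<lambda>e. narr s (CHR ''c'' # X) e 0) (rarr s (CHR ''y'' # X)) T0 (nvar s (CHR ''T'' # X))
          (\<lambda>j'. if j' = j then 1 else 0) j' * W j' l) = (\<Sum>j'<k. (if j' = j then 1 else 0) * M j' l)" for l
        using inv[unfolded elim_inv_def Let_def, THEN conjunct2, THEN conjunct2, THEN conjunct2, THEN conjunct1,
          THEN spec, of "\<lambda>j'. if j' = j then 1 else 0", THEN spec, of l] by (simp add: W_def)
    qed
    have Mx: "M j l = (\<Sum>j'<k. x j' * W j' l)" if "l < k" for l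
      using x[OF that] j by (simp add: if_distrib[of "\<lambda>a. a * _"] cong: if_cong)
    have "(\<Sum>l<k. M j l * v l) = (\<Sum>l<k. \<Sum>j'<k. x j' * (W j' l * v l))"
      by (intro sum.cong) (auto simp: Mx sum_distrib_right mult.assoc)
    also have "\<dots> = (\<Sum>j'<k. \<Sum>l<k. x j' * (W j' l * v l))" by (rule sum.swap)
    also have "\<dots> = 0" by (simp add: sum_distrib_left[symmetric] Wv)
    finally show ?thesis .
  qed
  have Bv: "(\<Sum>l<k. B l i * v l) = 0" if i: "i < k" for i
  proof (cases "S0 i i = 0")
    case True
    hence iZ: "i \<in> ?Z" using i by simp
    have fi: "f i < k" using f(2) i True by simp
    have d: "(\<Sum>i'\<in>?Z. if f i' = f i then B l i' else 0) = B l i" for l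
    proof -
      have "(\<Sum>i'\<in>?Z. if f i' = f i then B l i' else 0) = (\<Sum>i'\<in>?Z. if i' = i then B l i' else 0)"
        using inj_onD[OF f(1) _ _ iZ] by (intro sum.cong) auto
      thus ?thesis using iZ by simp
    qed
    have "(\<Sum>l<k. B l i * v l) = (\<Sum>l<k. W (f i) l * v l - M (f i) l * v l)"
      using fi by (intro sum.cong) (auto simp: f(3) d algebra_simps)
    also have "\<dots> = 0" using Wv[OF fi] Mv[OF fi] by (simp add: sum_subtractf)
    finally show ?thesis .
  next
    case False
    have "S0 i i * (\<Sum>l<k. B l i * v l) = (\<Sum>l<k. (\<Sum>j<k. A0 j i * M j l) * v l)"
      using svd i by (simp add: svd_entries_def sum_distrib_left mult.assoc)
    also have "\<dots> = (\<Sum>l<k. \<Sum>j<k. A0 j i * (M j l * v l))" by (simp add: sum_distrib_right mult.assoc)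
    also have "\<dots> = (\<Sum>j<k. \<Sum>l<k. A0 j i * (M j l * v l))" by (rule sum.swap)
    also have "\<dots> = 0" by (simp add: sum_distrib_left[symmetric] Mv)
    finally show ?thesis using False by simp
  qed
  have "v l = (\<Sum>l'<k. (\<Sum>i<k. B l i * B l' i) * v l')"
  proof -
    have "(\<Sum>l'<k. (\<Sum>i<k. B l i * B l' i) * v l') = (\<Sum>l'<k. if l' = l then v l' else 0)"
      using svd l by (intro sum.cong) (auto simp: svd_entries_def)
    thus ?thesis using l by simp
  qed
  also have "\<dots> = (\<Sum>l'<k. \<Sum>i<k. B l i * (B l' i * v l'))" by (simp add: sum_distrib_right mult.assoc)
  also have "\<dots> = (\<Sum>i<k. \<Sum>l'<k. B l i * (B l' i * v l'))" by (rule sum.swap)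
  also have "\<dots> = 0" by (simp add: sum_distrib_left[symmetric] Bv)
  finally show ?thesis .
qed

text \<open>An injective matrix has no singular value 0, so
  \<open>B * S\<^sup>-\<^sup>1 * A\<^sup>T\<close> is its inverse.\<close>

lemma svd_inverse:
  assumes svd: "svd_entries k W A S B" and inj: "\<And>v. (\<And>j. j < k \<Longrightarrow> (\<Sum>l<k. W j l * v l) = 0) \<Longrightarrow> \<forall>l<k. v l = (0::real)"
    and il: "i < k" "l < k"
  shows "(\<Sum>j<k. (\<Sum>r<k. B i r * A j r / S r r) * W j l) = (if i = l then 1 else 0)"
proof -
  have nz: "S r r \<noteq> 0" if r: "r < k" for r
  proof
    assume "S r r = 0"
    hence "\<forall>l<k. B l r = 0" using svd r by (intro inj) (simp add: svd_entries_def)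
    hence "(\<Sum>l<k. B l r * B l r) = 0" by simp
    moreover have "(\<Sum>l<k. B l r * B l r) = 1" using svd r by (simp add: svd_entries_def)
    ultimately show False by simp
  qed
  have "(\<Sum>j<k. (\<Sum>r<k. B i r * A j r / S r r) * W j l) = (\<Sum>j<k. \<Sum>r<k. B i r / S r r * (A j r * W j l))"
    by (simp add: sum_distrib_right mult.assoc)
  also have "\<dots> = (\<Sum>r<k. \<Sum>j<k. B i r / S r r * (A j r * W j l))" by (rule sum.swap)
  also have "\<dots> = (\<Sum>r<k. B i r / S r r * (S r r * B l r))"
  proof (intro sum.cong refl)
    fix r assume "r \<in> {..<k}"
    hence "(\<Sum>j<k. A j r * W j l) = S r r * B l r" using svd il by (simp add: svd_entries_def)
    thus "(\<Sum>j<k. B i r / S r r * (A j r * W j l)) = B i r / S r r * (S r r * B l r)"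
      unfolding sum_distrib_left[symmetric] by simp
  qed
  also have "\<dots> = (\<Sum>r<k. B i r * B l r)" using nz by (intro sum.cong) auto
  also have "\<dots> = (if i = l then 1 else 0)" using svd il by (simp add: svd_entries_def)
  finally show ?thesis .
qed

text \<open>One SVD exposes the dependences of the new \<open>W\<close>, and a second one, taken
  after the repair, supplies its inverse \<open>w\<close>. Computing \<open>w\<close> afresh fits
  into the cubic budget and spares an analysis of how each event changes it. Singular values are
  nonnegative, so failing to be positive means being 0.\<close>

definition transform :: "string \<Rightarrow> com" where
  "transform X = seq [
     Sum_Fill ''_M'' ''k'' ''k'' ''k'' (RMul (RRead (CHR ''W'' # X) (NVar ''_i'') (NVar ''_l'')) (RRead ''_F'' (NVar ''_l'') (NVar ''_j''))),
     Fill (CHR ''W'' # X) ''k'' ''k'' Skip (RRead ''_M'' (NVar ''_i'') (NVar ''_j'')),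
     SVD (NVar ''k'') ''_M'' ''_A'' ''_S'' ''_B'',
     For ''_o'' ''k'' (If (BNot (RLess (RLit 0) (RRead ''_S'' (NVar ''_o'') (NVar ''_o'')))) (event X) Skip),
     SVD (NVar ''k'') (CHR ''W'' # X) ''_A'' ''_S'' ''_B'',
     Sum_Fill (CHR ''w'' # X) ''k'' ''k'' ''k'' (RDiv (RMul (RRead ''_B'' (NVar ''_i'') (NVar ''_l'')) (RRead ''_A'' (NVar ''_j'') (NVar ''_l'')))
       (RRead ''_S'' (NVar ''_l'') (NVar ''_l'')))]"

lemma mods_transform: "mods (transform X) = {''_i'', ''_j'', ''_l'', ''_a'', ''_M'', ''_A'', ''_S'', ''_B'', ''_o'', ''_v'', ''_u'', ''_g'',
    CHR ''c'' # X, CHR ''y'' # X, CHR ''W'' # X, CHR ''w'' # X, CHR ''b'' # X, CHR ''h'' # X, CHR ''T'' # X}"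
  by (auto simp: transform_def mods_event)

lemma store_history_agree:
  assumes "agree Y st st'" "{CHR ''T'' # X, CHR ''c'' # X, CHR ''y'' # X, CHR ''b'' # X, CHR ''h'' # X} \<inter> Y = {}"
  shows "store_history k X st' \<longleftrightarrow> store_history k X st"
proof -
  have n: "n \<notin> Y" if "n \<in> {CHR ''T'' # X, CHR ''c'' # X, CHR ''y'' # X, CHR ''b'' # X, CHR ''h'' # X}" for n
    using assms(2) that by auto
  note e = agreeD[OF assms(1) n]
  show ?thesis unfolding store_history_def
    by (simp add: e(1)[of "CHR ''T'' # X"] e(3)[of "CHR ''c'' # X"] e(4)[of "CHR ''y'' # X"]
      e(3)[of "CHR ''b'' # X"] e(3)[of "CHR ''h'' # X"])
qed

text \<open>The time does not depend on the number \<open>r\<close> of rows, although all of them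
  are multiplied by \<open>F\<close>: stored coordinates and time stamps stay untouched, and only
  \<open>W\<close>, \<open>w\<close> and the event tables change.\<close>

lemma runs_transform:
  assumes svd: "valid_svd_routine svd" and store: "store k r X st R" and k: "nvar st ''k'' = k" "0 < k"
  shows "runs svd (transform X) st (k ^ 3 * 2000) (\<lambda>s. store k r X s (\<lambda>i l. \<Sum>j<k. R i j * rarr st ''_F'' j l))"
proof -
  let ?T = "CHR ''T'' # X" and ?b = "CHR ''b'' # X" and ?y = "CHR ''y'' # X" and ?c = "CHR ''c'' # X"
    and ?W = "CHR ''W'' # X" and ?w = "CHR ''w'' # X" and ?h = "CHR ''h'' # X" and ?t = "CHR ''t'' # X" and ?x = "CHR ''x'' # X"
  define F where "F = rarr st ''_F''"
  define T0 where "T0 = nvar st ?T"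
  define c0 where "c0 = (\<lambda>e. narr st ?c e 0)"
  define y0 where "y0 = rarr st ?y"
  define W0 where "W0 = rarr st ?W"
  define M where "M = (\<lambda>i j. \<Sum>l<k. W0 i l * F l j)"
  let ?c1 = "Sum_Fill ''_M'' ''k'' ''k'' ''k'' (RMul (RRead ?W (NVar ''_i'') (NVar ''_l'')) (RRead ''_F'' (NVar ''_l'') (NVar ''_j'')))"
  have "runs svd ?c1 st (k * k ^ 2 * 80 + 6) (\<lambda>s. \<forall>i j. rarr s ''_M'' i j =
     (if i < k \<and> j < k then \<Sum>l<k. W0 i l * F l j else rarr st ''_M'' i j))"
  proof (rule runs_Sum_Fill, goal_cases)
    case (13 i j l s)
    thus ?case using agreeD[OF 13(4)] by (simp add: W0_def F_def)
  qed (use k in auto)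
  then obtain s1 where s1: "run svd ?c1 st (k * k ^ 2 * 80 + 6) s1" "agree (mods ?c1) st s1"
    "\<forall>i j. rarr s1 ''_M'' i j = (if i < k \<and> j < k then \<Sum>l<k. W0 i l * F l j else rarr st ''_M'' i j)" by (rule runsE)
  note a1 = agreeD[OF s1(2)]
  let ?c2 = "Fill ?W ''k'' ''k'' Skip (RRead ''_M'' (NVar ''_i'') (NVar ''_j''))"
  have "runs svd ?c2 s1 (k * k * 85 + 6) (\<lambda>s. \<forall>i j. rarr s ?W i j =
     (if i < k \<and> j < k then rarr s1 ''_M'' i j else rarr s1 ?W i j))"
  proof (rule runs_Fill_straight, goal_cases)
    case (13 i j s)
    thus ?case using agreeD[OF 13(3)] by simp
  qed (use k a1 in auto)
  then obtain s2 where s2: "run svd ?c2 s1 (k * k * 85 + 6) s2" "agree (mods ?c2) s1 s2"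
    "\<forall>i j. rarr s2 ?W i j = (if i < k \<and> j < k then rarr s1 ''_M'' i j else rarr s1 ?W i j)" by (rule runsE)
  have a2: "agree {''_i'', ''_j'', ''_l'', ''_a'', ''_M'', ?W} st s2" by (rule agree_trans[OF s1(2) s2(2)]) auto
  have W2: "rarr s2 ?W i j = M i j" if "i < k" "j < k" for i j using s1(3) s2(3) that by (simp add: M_def)
  have M2: "rarr s2 ''_M'' i j = M i j" if "i < k" "j < k" for i j
    using agreeD[OF s2(2), of "''_M''"] s1(3) that by (simp add: M_def)
  let ?c3 = "SVD (NVar ''k'') ''_M'' ''_A'' ''_S'' ''_B''"
  have "runs svd ?c3 s2 (1 + ncost (NVar ''k'') + k ^ 3) (\<lambda>s. is_svd (read_block ''_M'' k k s2) (read_block ''_A'' k k s)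
       (read_block ''_S'' k k s) (read_block ''_B'' k k s))"
    by (rule runs_SVD[OF svd]) (use agreeD[OF a2] k in auto)
  then obtain s3 where s3: "run svd ?c3 s2 (1 + ncost (NVar ''k'') + k ^ 3) s3" "agree (mods ?c3) s2 s3"
    "is_svd (read_block ''_M'' k k s2) (read_block ''_A'' k k s3) (read_block ''_S'' k k s3) (read_block ''_B'' k k s3)"
    by (rule runsE)
  have a3: "agree {''_i'', ''_j'', ''_l'', ''_a'', ''_M'', ?W, ''_A'', ''_S'', ''_B''} st s3"
    by (rule agree_trans[OF a2 s3(2)]) auto
  define A0 where "A0 = rarr s3 ''_A''"
  define S0 where "S0 = rarr s3 ''_S''"
  define B0 where "B0 = rarr s3 ''_B''"
  have se: "svd_entries k M A0 S0 B0"
  proof -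
    have "svd_entries k (rarr s2 ''_M'') A0 S0 B0" using is_svd_entries[OF s3(3)] by (simp add: A0_def S0_def B0_def)
    thus ?thesis using M2 by (simp add: svd_entries_def)
  qed
  let ?inv = "elim_inv k X T0 c0 y0 M A0 S0 B0"
  have start: "?inv 0 s3"
  proof -
    have sh: "store_history k X s3" using store store_history_agree[OF a3] unfolding store_def by auto
    have e: "nvar s3 ?T = T0" "(\<lambda>e. narr s3 ?c e 0) = c0" "rarr s3 ?y = y0"
      using agreeD[OF a3] by (simp_all add: T0_def c0_def y0_def)
    have W3: "rarr s3 ?W j l = M j l" if "j < k" "l < k" for j l
      using W2[OF that] agreeD[OF s3(2), of ?W] by simp
    from elim_inv_start[OF sh _ W3] se show ?thesis unfolding e A0_def by blast
  qed
  let ?body = "If (BNot (RLess (RLit 0) (RRead ''_S'' (NVar ''_o'') (NVar ''_o'')))) (event X) Skip"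
  let ?c4 = "For ''_o'' ''k'' ?body"
  have "runs svd ?c4 s3 (k * ((1 + bcost (BNot (RLess (RLit 0) (RRead ''_S'' (NVar ''_o'') (NVar ''_o'')))) + k ^ 2 * 800) + 8) + 6) (?inv k)"
  proof (rule runs_For[where n = k and I = ?inv], goal_cases)
    case (6 i s)
    have e: "rarr s ''_S'' = S0" "rarr s ''_B'' = B0" "nvar s ''k'' = k"
      using agreeD[OF 6(3)] agreeD[OF a3] k by (auto simp: mods_event S0_def B0_def)
    have b: "beval (BNot (RLess (RLit 0) (RRead ''_S'' (NVar ''_o'') (NVar ''_o'')))) s \<longleftrightarrow> S0 i i = 0"
      using se 6(1,4) e by (auto simp: svd_entries_def)
    show ?case
    proof (rule runs_If)
      assume "beval (BNot (RLess (RLit 0) (RRead ''_S'' (NVar ''_o'') (NVar ''_o'')))) s"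
      hence S: "S0 i i = 0" using b by simp
      show "runs svd (event X) s (k ^ 2 * 800) (\<lambda>s'. ?inv (Suc i) (set_nvar ''_o'' (Suc i) s'))"
      proof (rule runs_weaken[OF runs_event[OF e(3) k(2) 6(4) refl refl e(2) refl refl refl elim_inv_nonzero[OF 6(2,1)]]], simp, goal_cases)
        case (1 s')
        show ?case using 1(1)
          by (elim exE conjE) (unfold elim_inv_set_nvar, rule elim_inv_event[OF 6(2,1) S]; assumption)
      qed
    next
      assume "\<not> beval (BNot (RLess (RLit 0) (RRead ''_S'' (NVar ''_o'') (NVar ''_o'')))) s"
      hence "S0 i i \<noteq> 0" using b by simp
      thus "runs svd Skip s (k ^ 2 * 800) (\<lambda>s'. ?inv (Suc i) (set_nvar ''_o'' (Suc i) s'))"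
        using elim_inv_skip[OF 6(2)] k by (intro runs_straight) auto
    qed
  qed (use agreeD[OF a3] k start in \<open>auto simp: mods_event\<close>)
  then obtain s4 where s4: "run svd ?c4 s3 (k * ((1 + bcost (BNot (RLess (RLit 0) (RRead ''_S'' (NVar ''_o'') (NVar ''_o'')))) + k ^ 2 * 800) + 8) + 6) s4"
    "agree (mods ?c4) s3 s4" "?inv k s4" by (rule runsE)
  have a4: "agree {''_i'', ''_j'', ''_l'', ''_a'', ''_M'', ''_A'', ''_S'', ''_B'', ''_o'', ''_v'', ''_u'', ''_g'',
      ?c, ?y, ?W, ?b, ?h, ?T} st s4"
    by (rule agree_trans[OF a3 s4(2)]) (auto simp: mods_event)
  define W where "W = rarr s4 ?W"
  let ?c5 = "SVD (NVar ''k'') ?W ''_A'' ''_S'' ''_B''"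
  have "runs svd ?c5 s4 (1 + ncost (NVar ''k'') + k ^ 3) (\<lambda>s. is_svd (read_block ?W k k s4) (read_block ''_A'' k k s)
       (read_block ''_S'' k k s) (read_block ''_B'' k k s))"
    by (rule runs_SVD[OF svd]) (use agreeD[OF a4] k in auto)
  then obtain s5 where s5: "run svd ?c5 s4 (1 + ncost (NVar ''k'') + k ^ 3) s5" "agree (mods ?c5) s4 s5"
    "is_svd (read_block ?W k k s4) (read_block ''_A'' k k s5) (read_block ''_S'' k k s5) (read_block ''_B'' k k s5)"
    by (rule runsE)
  have a45: "agree {''_A'', ''_S'', ''_B''} s4 s5" using s5(2) by simp
  note se5 = is_svd_entries[OF s5(3), folded W_def]
  let ?c6 = "Sum_Fill ?w ''k'' ''k'' ''k'' (RDiv (RMul (RRead ''_B'' (NVar ''_i'') (NVar ''_l'')) (RRead ''_A'' (NVar ''_j'') (NVar ''_l'')))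
       (RRead ''_S'' (NVar ''_l'') (NVar ''_l'')))"
  have "runs svd ?c6 s5 (k * k ^ 2 * 80 + 6) (\<lambda>s. \<forall>i j. rarr s ?w i j =
     (if i < k \<and> j < k then \<Sum>l<k. rarr s5 ''_B'' i l * rarr s5 ''_A'' j l / rarr s5 ''_S'' l l else rarr s5 ?w i j))"
  proof (rule runs_Sum_Fill, goal_cases)
    case (13 i j l s)
    thus ?case using agreeD[OF 13(4)] by simp
  qed (use k agreeD[OF a45] agreeD[OF a4] in auto)
  then obtain s6 where s6: "run svd ?c6 s5 (k * k ^ 2 * 80 + 6) s6" "agree (mods ?c6) s5 s6"
    "\<forall>i j. rarr s6 ?w i j = (if i < k \<and> j < k then \<Sum>l<k. rarr s5 ''_B'' i l * rarr s5 ''_A'' j l / rarr s5 ''_S'' l l else rarr s5 ?w i j)"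
    by (rule runsE)
  have a46: "agree {''_A'', ''_S'', ''_B'', ''_i'', ''_j'', ''_l'', ''_a'', ?w} s4 s6"
    by (rule agree_trans[OF a45 s6(2)]) auto
  have inverse: "(\<Sum>l<k. rarr s6 ?w i l * rarr s6 ?W l j) = (if i = j then 1 else 0)" if ij: "i < k" "j < k" for i j
  proof -
    have "rarr s6 ?W = W" using agreeD[OF a46] by (simp add: W_def)
    moreover have "\<forall>l<k. v l = 0" if "\<And>j. j < k \<Longrightarrow> (\<Sum>l<k. W j l * v l) = 0" for v
      using elim_inv_injective[OF s4(3) se, of v] that by (simp add: W_def)
    ultimately show ?thesis using svd_inverse[OF se5 _ ij] ij s6(3) by simp
  qed
  note inv4 = s4(3)[unfolded elim_inv_def Let_def]
  define T where "T = nvar s4 ?T"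
  define c where "c = (\<lambda>e. narr s4 ?c e 0)"
  define y where "y = rarr s4 ?y"
  have sh4: "store_history k X s4" and TT: "T0 \<le> T" by (use inv4 in \<open>auto simp: T_def\<close>)
  have fr: "\<forall>e<T0. c e = c0 e \<and> y e = y0 e" using inv4[THEN conjunct2, THEN conjunct2, THEN conjunct1] by (simp add: c_def y_def)
  have rep: "(\<Sum>j<k. replay c y T0 T x j * W j l) = (\<Sum>j<k. x j * M j l)" if "l < k" for x l
    using inv4[THEN conjunct2, THEN conjunct2, THEN conjunct2, THEN conjunct1, THEN spec, of x, THEN spec, of l] that
    by (simp add: c_def y_def T_def W_def)
  have e6: "nvar s6 ?T = T" "narr s6 ?c = narr s4 ?c" "rarr s6 ?y = y" "rarr s6 ?W = W"
    "narr s6 ?t = narr st ?t" "rarr s6 ?x = rarr st ?x"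
    using agreeD[OF a46] agreeD[OF a4] by (simp_all add: T_def y_def W_def)
  have "store k r X s6 (\<lambda>i l. \<Sum>j<k. R i j * F j l)"
    unfolding store_def
  proof (intro conjI allI impI)
    show "store_history k X s6" using sh4 store_history_agree[OF a46] by simp
    show "(\<Sum>l<k. rarr s6 ?w i l * rarr s6 ?W l j) = (if i = j then 1 else 0)" if "i < k" "j < k" for i j
      by (rule inverse[OF that])
    fix i assume i: "i < r"
    define t where "t = narr st ?t i 0"
    define x where "x = rarr st ?x i"
    have t: "t \<le> T0" and Ri: "\<And>l. l < k \<Longrightarrow> R i l = (\<Sum>j<k. replay c0 y0 t T0 x j * W0 j l)"
      using store i unfolding store_def by (simp_all add: t_def x_def T0_def c0_def y0_def W0_def)
    show "narr s6 ?t i 0 \<le> nvar s6 ?T" using t TT by (simp add: e6 t_def)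
    fix l assume l: "l < k"
    define x1 where "x1 = replay c0 y0 t T0 x"
    have "replay c y t T0 x = x1" unfolding x1_def by (rule replay_cong) (use fr in auto)
    \<comment> \<open>The replay of a row splits at \<open>T0\<close>: the old events give its old
      coordinates, and the appended ones carry these from \<open>M\<close> over to the repaired
      \<open>W\<close>.\<close>
    hence rp: "replay c y t T x = replay c y T0 T x1" using replay_replay[OF t TT, of c y x] by simp
    have "(\<Sum>j<k. R i j * F j l) = (\<Sum>j<k. \<Sum>j'<k. x1 j' * (W0 j' j * F j l))"
      by (intro sum.cong) (auto simp: Ri x1_def sum_distrib_right mult.assoc)
    also have "\<dots> = (\<Sum>j'<k. \<Sum>j<k. x1 j' * (W0 j' j * F j l))" by (rule sum.swap)
    also have "\<dots> = (\<Sum>j'<k. x1 j' * M j' l)" by (simp add: M_def sum_distrib_left)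
    also have "\<dots> = (\<Sum>j<k. replay c y t T x j * W j l)" unfolding rp by (rule rep[OF l, symmetric])
    finally show "(\<Sum>j<k. R i j * F j l) = (\<Sum>j<k. replay (\<lambda>e. narr s6 ?c e 0) (rarr s6 ?y) (narr s6 ?t i 0) (nvar s6 ?T) (rarr s6 ?x i) j
          * rarr s6 ?W j l)"
      by (simp add: e6 c_def t_def x_def)
  qed
  moreover have "k * k ^ 2 * 80 + 6 + (k * k * 85 + 6 + ((1 + ncost (NVar ''k'') + k ^ 3) +
    ((k * ((1 + bcost (BNot (RLess (RLit 0) (RRead ''_S'' (NVar ''_o'') (NVar ''_o'')))) + k ^ 2 * 800) + 8) + 6) +
     ((1 + ncost (NVar ''k'') + k ^ 3) + (k * k ^ 2 * 80 + 6))))) \<le> k ^ 3 * 2000"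
  proof -
    have kk: "k \<le> k ^ 3" "1 \<le> k ^ 3" "k * k \<le> k ^ 3" using k by (auto simp: power3_eq_cube)
    have "k * ((1 + bcost (BNot (RLess (RLit 0) (RRead ''_S'' (NVar ''_o'') (NVar ''_o'')))) + k ^ 2 * 800) + 8) = 15 * k + 800 * k ^ 3"
      "k * k ^ 2 = k ^ 3"
      by (simp_all add: power2_eq_square power3_eq_cube algebra_simps)
    thus ?thesis using kk by simp
  qed
  ultimately show ?thesis unfolding transform_def seq.simps F_def
    by (intro runsI[OF run_Seq[OF s1(1) run_Seq[OF s2(1) run_Seq[OF s3(1) run_Seq[OF s4(1) run_Seq[OF s5(1) s6(1)]]]]]]) auto
qed

section \<open>Sparse matrices\<close>

definition holds_sparse :: "string \<Rightarrow> sparse \<Rightarrow> state \<Rightarrow> bool" where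
  "holds_sparse x es st \<longleftrightarrow> nvar st x = length es \<and>
     (\<forall>l<length es. narr st x l 0 = fst (es ! l) \<and> narr st x l 1 = fst (snd (es ! l)) \<and>
        rarr st x l 0 = snd (snd (es ! l)))"

lemma holds_sparse_agree: "agree Y st st' \<Longrightarrow> x \<notin> Y \<Longrightarrow> holds_sparse x es st' = holds_sparse x es st"
  unfolding holds_sparse_def by (simp add: agreeD)

lemma sparse_entry:
  assumes "is_sparse_form es X" "l < length es"
  shows "fst (es ! l) < dim_row X" "fst (snd (es ! l)) < dim_col X"
    "snd (snd (es ! l)) = X $$ (fst (es ! l), fst (snd (es ! l)))"
    "X $$ (fst (es ! l), fst (snd (es ! l))) \<noteq> 0"
proof -
  have "es ! l \<in> set es" using assms(2) by simp
  then obtain i j where "es ! l = (i, j, X $$ (i,j))" "i < dim_row X" "j < dim_col X" "X $$ (i,j) \<noteq> 0"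
    using assms(1) by (auto simp: is_sparse_form_def)
  thus "fst (es ! l) < dim_row X" "fst (snd (es ! l)) < dim_col X"
    "snd (snd (es ! l)) = X $$ (fst (es ! l), fst (snd (es ! l)))"
    "X $$ (fst (es ! l), fst (snd (es ! l))) \<noteq> 0" by auto
qed

lemma sparse_nth:
  assumes "is_sparse_form es X" "i < dim_row X" "j < dim_col X" "X $$ (i,j) \<noteq> 0"
  obtains l where "l < length es" "es ! l = (i, j, X $$ (i,j))"
proof -
  have "(i, j, X $$ (i,j)) \<in> set es" using assms by (auto simp: is_sparse_form_def)
  thus ?thesis using that by (metis in_set_conv_nth)
qed

text \<open>The value in a list entry is determined by its position, so distinct triples have
  distinct positions.\<close>

lemma sparse_bij:
  assumes "is_sparse_form es X"
  shows "bij_betw (\<lambda>l. (fst (es ! l), fst (snd (es ! l)))) {..<length es}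
    {(i,j). i < dim_row X \<and> j < dim_col X \<and> X $$ (i,j) \<noteq> 0}"
proof (rule bij_betwI')
  fix l l' assume l: "l \<in> {..<length es}" "l' \<in> {..<length es}"
  have eq: "es ! l = (fst (es ! l), fst (snd (es ! l)), X $$ (fst (es ! l), fst (snd (es ! l))))" if "l < length es" for l
    using sparse_entry(3)[OF assms that] by (metis prod.collapse)
  have "distinct es" using assms by (simp add: is_sparse_form_def)
  thus "((fst (es ! l), fst (snd (es ! l))) = (fst (es ! l'), fst (snd (es ! l')))) = (l = l')"
    using l eq[of l] eq[of l'] by (auto simp: nth_eq_iff_index_eq)
next
  fix l assume "l \<in> {..<length es}"
  thus "(fst (es ! l), fst (snd (es ! l))) \<in> {(i,j). i < dim_row X \<and> j < dim_col X \<and> X $$ (i,j) \<noteq> 0}"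
    using sparse_entry[OF assms] by auto
next
  fix ij assume "ij \<in> {(i,j). i < dim_row X \<and> j < dim_col X \<and> X $$ (i,j) \<noteq> 0}"
  then obtain i j where ij: "ij = (i,j)" "i < dim_row X" "j < dim_col X" "X $$ (i,j) \<noteq> 0" by auto
  obtain l where "l < length es" "es ! l = (i, j, X $$ (i,j))" by (rule sparse_nth[OF assms ij(2-4)])
  thus "\<exists>l\<in>{..<length es}. ij = (fst (es ! l), fst (snd (es ! l)))" using ij(1) by (intro bexI[of _ l]) auto
qed

lemma sparse_length: "is_sparse_form es X \<Longrightarrow> length es = nnz X"
  using bij_betw_same_card[OF sparse_bij] by (simp add: nnz_def)

text \<open>A column of the matrix is paired with \<open>g\<close> by going through the whole list;
  this is how \<open>D\<^sup>T\<close> is applied without ever forming it.\<close>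

lemma sparse_sum:
  fixes g :: "nat \<Rightarrow> real"
  assumes es: "is_sparse_form es X" and c: "c < dim_col X"
  shows "(\<Sum>l<length es. if fst (snd (es ! l)) = c then snd (snd (es ! l)) * g (fst (es ! l)) else 0)
    = (\<Sum>i<dim_row X. X $$ (i,c) * g i)"
proof -
  let ?N = "{(i,j). i < dim_row X \<and> j < dim_col X \<and> X $$ (i,j) \<noteq> 0}"
  have fin: "finite ?N" by (rule finite_subset[of _ "{..<dim_row X} \<times> {..<dim_col X}"]) auto
  have "(\<Sum>l<length es. if fst (snd (es ! l)) = c then snd (snd (es ! l)) * g (fst (es ! l)) else 0)
    = (\<Sum>l<length es. (\<lambda>(i,j). if j = c then X $$ (i,j) * g i else 0) (fst (es ! l), fst (snd (es ! l))))"
    using sparse_entry(3)[OF es] by (intro sum.cong) auto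
  also have "\<dots> = (\<Sum>(i,j)\<in>?N. if j = c then X $$ (i,j) * g i else 0)"
    by (rule sum.reindex_bij_betw[OF sparse_bij[OF es]])
  also have "\<dots> = (\<Sum>(i,j)\<in>(\<lambda>i. (i,c)) ` {i. i < dim_row X \<and> X $$ (i,c) \<noteq> 0}. X $$ (i,j) * g i)"
    using fin c by (intro sum.mono_neutral_cong_right) auto
  also have "\<dots> = (\<Sum>i | i < dim_row X \<and> X $$ (i,c) \<noteq> 0. X $$ (i,c) * g i)"
    by (subst sum.reindex) (auto simp: inj_on_def)
  also have "\<dots> = (\<Sum>i<dim_row X. X $$ (i,c) * g i)"
    by (intro sum.mono_neutral_left) auto
  finally show ?thesis .
qed

section \<open>The update algorithm\<close>

text \<open>Rows of the dense copy \<open>_D\<close> that do not occur in the list keep stale values, since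
  clearing all of them would take time proportional to the size of the matrix.\<close>

definition sparse_rows :: "string \<Rightarrow> string \<Rightarrow> com" where
  "sparse_rows X L = seq [
     For ''_o'' L (For ''_j'' ''s'' (RWrite ''_D'' (NRead L (NVar ''_o'') (NLit 0)) (NVar ''_j'') (RLit 0))),
     For ''_o'' L (RWrite ''_D'' (NRead L (NVar ''_o'') (NLit 0)) (NRead L (NVar ''_o'') (NLit 1)) (RRead L (NVar ''_o'') (NLit 0))),
     For ''_e'' L (seq [
       NAssign ''_r'' (NRead L (NVar ''_e'') (NLit 0)),
       get X,
       For ''_j'' ''k'' (RWrite (CHR ''z'' # X) (NVar ''_e'') (NVar ''_j'') (RRead ''row'' (NLit 0) (NVar ''_j''))),
       For ''_j'' ''s'' (RWrite (CHR ''z'' # X) (NVar ''_e'') (NAdd (NVar ''k'') (NVar ''_j'')) (RRead ''_D'' (NVar ''_r'') (NVar ''_j'')))])]"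

lemma mods_sparse_rows: "mods (sparse_rows X L) = {''_o'', ''_j'', ''_D'', ''_e'', ''_r'', CHR ''z'' # X,
    ''_1'', ''_t'', ''_u'', ''_q'', ''_v'', ''_w'', ''_a'', ''_i'', ''_l'', ''row''}"
  by (auto simp: sparse_rows_def mods_get)

text \<open>All work is charged to list entries: a row hit by several entries is cleared and fetched
  once for each of them. This keeps the bound without any need to detect repetitions, and
  \<open>z\<close> is indexed by list position rather than by row.\<close>

lemma runs_sparse_rows:
  assumes L: "L \<in> {''D'', ''E''}" and store: "store k r X st (\<lambda>i l. U $$ (i,l))" and k: "nvar st ''k'' = k" "0 < k" and s: "nvar st ''s'' = s"
    and es: "is_sparse_form es D" "holds_sparse L es st" and D: "D \<in> carrier_mat r s" and U: "U \<in> carrier_mat r k"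
  shows "runs svd (sparse_rows X L) st (length es * (k + s) ^ 2 * 1500 + 20)
    (\<lambda>s'. \<forall>l<length es. \<forall>j<k+s. rarr s' (CHR ''z'' # X) l j = append_cols U D $$ (fst (es ! l), j))"
proof -
  define N where "N = length es"
  have Lx: "L \<noteq> CHR ''_'' # x" "L \<noteq> CHR ''z'' # x" "L \<noteq> ''row''" "L \<noteq> ''k''" "L \<noteq> ''s''" for x using L by auto
  have Lx': "CHR ''_'' # x \<noteq> L" "CHR ''z'' # x \<noteq> L" "''row'' \<noteq> L" "''k'' \<noteq> L" "''s'' \<noteq> L" for x using L by auto
  have e: "fst (es ! l) < r" "fst (snd (es ! l)) < s" "snd (snd (es ! l)) = D $$ (fst (es ! l), fst (snd (es ! l)))" if "l < N" for l
    using sparse_entry[OF es(1)] that D by (auto simp: N_def)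
  have h: "nvar st L = N" "\<And>l. l < N \<Longrightarrow> narr st L l 0 = fst (es ! l)" "\<And>l. l < N \<Longrightarrow> narr st L l 1 = fst (snd (es ! l))"
    "\<And>l. l < N \<Longrightarrow> rarr st L l 0 = D $$ (fst (es ! l), fst (snd (es ! l)))"
    using es(2) e by (auto simp: holds_sparse_def N_def)
  let ?c1 = "For ''_o'' L (For ''_j'' ''s'' (RWrite ''_D'' (NRead L (NVar ''_o'') (NLit 0)) (NVar ''_j'') (RLit 0)))"
  have "runs svd ?c1 st (N * ((s * (10 + 8) + 6) + 8) + 6) (\<lambda>s1. \<forall>l<N. \<forall>j<s. rarr s1 ''_D'' (fst (es ! l)) j = 0)"
  proof (rule runs_For[where n = N and I = "\<lambda>n s1. \<forall>l<n. \<forall>j<s. rarr s1 ''_D'' (fst (es ! l)) j = 0"], goal_cases)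
    case (6 n s1)
    have f: "narr s1 L n 0 = fst (es ! n)" "nvar s1 ''s'' = s" using agreeD[OF 6(3)] Lx h(2)[OF 6(1)] s by auto
    show ?case
    proof (rule runs_weaken[OF runs_For[where n = s and B = 10 and I = "\<lambda>q s2. \<forall>l j. (l < n \<and> j < s \<or> l = n \<and> j < q) \<longrightarrow> rarr s2 ''_D'' (fst (es ! l)) j = 0"]], goal_cases)
      case (6 q s2)
      have "narr s2 L n 0 = fst (es ! n)" "nvar s2 ''_o'' = n"
        using agreeD[OF 6(3)] Lx f(1) \<open>nvar s1 ''_o'' = n\<close> by auto
      thus ?case by (intro runs_straight) (use 6(2,4) in \<open>auto simp: set_cell_def less_Suc_eq\<close>, metis)
    qed (use 6(2) f in \<open>auto simp: less_Suc_eq\<close>)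
  qed (use h s Lx Lx' in auto)
  then obtain s1 where s1: "run svd ?c1 st (N * ((s * (10 + 8) + 6) + 8) + 6) s1" "agree (mods ?c1) st s1"
    "\<forall>l<N. \<forall>j<s. rarr s1 ''_D'' (fst (es ! l)) j = 0" by (rule runsE)
  note a1 = agreeD[OF s1(2)]
  let ?c2 = "For ''_o'' L (RWrite ''_D'' (NRead L (NVar ''_o'') (NLit 0)) (NRead L (NVar ''_o'') (NLit 1)) (RRead L (NVar ''_o'') (NLit 0)))"
  have "runs svd ?c2 s1 (N * (20 + 8) + 6) (\<lambda>s2. \<forall>l<N. \<forall>j<s. rarr s2 ''_D'' (fst (es ! l)) j =
     (if \<exists>l'<N. fst (es ! l') = fst (es ! l) \<and> fst (snd (es ! l')) = j then D $$ (fst (es ! l), j) else 0))"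
  proof (rule runs_For[where n = N and I = "\<lambda>n s2. \<forall>l<N. \<forall>j<s. rarr s2 ''_D'' (fst (es ! l)) j =
     (if \<exists>l'<n. fst (es ! l') = fst (es ! l) \<and> fst (snd (es ! l')) = j then D $$ (fst (es ! l), j) else 0)"], goal_cases)
    case (6 n s2)
    have f: "narr s2 L = narr st L" "rarr s2 L = rarr st L" using agreeD[OF 6(3)] a1 Lx by auto
    show ?case
    proof (rule runs_straight)
      show "\<forall>l<N. \<forall>j<s. rarr (set_nvar ''_o'' (Suc n) (effect (RWrite ''_D'' (NRead L (NVar ''_o'') (NLit 0)) (NRead L (NVar ''_o'') (NLit 1)) (RRead L (NVar ''_o'') (NLit 0))) s2)) ''_D'' (fst (es ! l)) j =
         (if \<exists>l'<Suc n. fst (es ! l') = fst (es ! l) \<and> fst (snd (es ! l')) = j then D $$ (fst (es ! l), j) else 0)"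
      proof (intro allI impI)
        fix l j assume lj: "l < N" "j < s"
        have "rarr (set_nvar ''_o'' (Suc n) (effect (RWrite ''_D'' (NRead L (NVar ''_o'') (NLit 0)) (NRead L (NVar ''_o'') (NLit 1)) (RRead L (NVar ''_o'') (NLit 0))) s2)) ''_D'' (fst (es ! l)) j
          = (if fst (es ! n) = fst (es ! l) \<and> fst (snd (es ! n)) = j then D $$ (fst (es ! n), fst (snd (es ! n))) else rarr s2 ''_D'' (fst (es ! l)) j)"
          using h(2,3,4)[OF 6(1)] by (auto simp: set_cell_def f 6(4))
        thus "rarr (set_nvar ''_o'' (Suc n) (effect (RWrite ''_D'' (NRead L (NVar ''_o'') (NLit 0)) (NRead L (NVar ''_o'') (NLit 1)) (RRead L (NVar ''_o'') (NLit 0))) s2)) ''_D'' (fst (es ! l)) j =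
         (if \<exists>l'<Suc n. fst (es ! l') = fst (es ! l) \<and> fst (snd (es ! l')) = j then D $$ (fst (es ! l), j) else 0)"
          using 6(2) lj less_Suc_eq by auto
      qed
    qed auto
  qed (use a1 h s s1(3) Lx Lx' in auto)
  then obtain s2 where s2: "run svd ?c2 s1 (N * (20 + 8) + 6) s2" "agree (mods ?c2) s1 s2"
    "\<forall>l<N. \<forall>j<s. rarr s2 ''_D'' (fst (es ! l)) j =
     (if \<exists>l'<N. fst (es ! l') = fst (es ! l) \<and> fst (snd (es ! l')) = j then D $$ (fst (es ! l), j) else 0)" by (rule runsE)
  \<comment> \<open>On listed rows the cells that were cleared and not written again belong to zero
    entries of \<open>D\<close>, as every nonzero entry occurs in the list.\<close>
  have D2: "rarr s2 ''_D'' (fst (es ! l)) j = D $$ (fst (es ! l), j)" if lj: "l < N" "j < s" for l j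
  proof (cases "D $$ (fst (es ! l), j) = 0")
    case True thus ?thesis using s2(3) lj by simp
  next
    case False
    obtain l' where "l' < length es" "es ! l' = (fst (es ! l), j, D $$ (fst (es ! l), j))"
      by (rule sparse_nth[OF es(1) _ _ False]) (use e(1)[OF lj(1)] lj D in auto)
    hence "\<exists>l'<N. fst (es ! l') = fst (es ! l) \<and> fst (snd (es ! l')) = j" by (intro exI[of _ l']) (simp add: N_def)
    thus ?thesis using s2(3) lj by simp
  qed
  have a2: "agree {''_o'', ''_j'', ''_D''} st s2" by (rule agree_trans[OF s1(2) s2(2)]) auto
  let ?n1 = "NAssign ''_r'' (NRead L (NVar ''_e'') (NLit 0))"
  let ?f1 = "For ''_j'' ''k'' (RWrite (CHR ''z'' # X) (NVar ''_e'') (NVar ''_j'') (RRead ''row'' (NLit 0) (NVar ''_j'')))"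
  let ?f2 = "For ''_j'' ''s'' (RWrite (CHR ''z'' # X) (NVar ''_e'') (NAdd (NVar ''k'') (NVar ''_j'')) (RRead ''_D'' (NVar ''_r'') (NVar ''_j'')))"
  let ?body = "Seq ?n1 (Seq (get X) (Seq ?f1 ?f2))"
  let ?Z = "append_cols U D"
  have "runs svd (For ''_e'' L ?body) s2 (N * ((4 + (k ^ 2 * 1000 + ((k * (10 + 8) + 6) + (s * (10 + 8) + 6)))) + 8) + 6)
    (\<lambda>s'. \<forall>l<N. \<forall>j<k+s. rarr s' (CHR ''z'' # X) l j = ?Z $$ (fst (es ! l), j))"
  proof (rule runs_For[where n = N and I = "\<lambda>n s'. \<forall>l<n. \<forall>j<k+s. rarr s' (CHR ''z'' # X) l j = ?Z $$ (fst (es ! l), j)"], goal_cases)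
    case (6 n s3)
    have a3: "agree (insert ''_e'' (mods ?body) \<union> {''_D''}) st s3"
      by (rule agree_trans[OF a2 6(3)]) (auto simp: mods_get)
    define s4 where "s4 = effect ?n1 s3"
    have r4: "run svd ?n1 s3 4 s4" unfolding s4_def by (rule run_straight) auto
    have f3: "narr s3 L n 0 = fst (es ! n)" using agreeD[OF a3] Lx h(2)[OF 6(1)] by (simp add: mods_get)
    have s4: "nvar s4 ''_r'' = fst (es ! n)" "nvar s4 ''_e'' = n" "nvar s4 ''k'' = k" "rarr s4 = rarr s3" "nvar s4 ''s'' = s"
      using f3 6(4) agreeD[OF a3] k s by (simp_all add: s4_def mods_get)
    have a4: "agree (insert ''_e'' (mods ?body) \<union> {''_D''}) st s4"
    proof (rule agree_trans[OF a3])
      show "agree {''_r''} s3 s4" by (simp add: s4_def agree_def)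
    qed auto
    have st4: "store k r X s4 (\<lambda>i l. U $$ (i,l))"
      using store store_agree[OF a4] by (simp add: mods_get store_names_def)
    obtain s5 where s5: "run svd (get X) s4 (k ^ 2 * 1000) s5" "agree (mods (get X)) s4 s5"
      "\<forall>l<k. rarr s5 ''row'' 0 l = U $$ (fst (es ! n), l)"
      by (rule runsE[OF runs_get[OF st4 s4(3) k(2) s4(1) e(1)[OF 6(1)]]])
    note a5 = agreeD[OF s5(2), unfolded mods_get]
    have "rarr s2 ''_D'' = rarr s3 ''_D''" using agreeD(4)[OF 6(3), of "''_D''"] by (simp add: mods_get)
    hence D5: "rarr s5 ''_D'' (fst (es ! n)) j = D $$ (fst (es ! n), j)" if "j < s" for j
      using D2[OF 6(1) that] a5 s4 by simp
    have z5: "rarr s5 (CHR ''z'' # X) = rarr s3 (CHR ''z'' # X)" using a5 s4 by simp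
    have "runs svd ?f1 s5 (k * (10 + 8) + 6) (\<lambda>s'. \<forall>l j. rarr s' (CHR ''z'' # X) l j =
       (if l = n \<and> j < k then U $$ (fst (es ! n), j) else rarr s5 (CHR ''z'' # X) l j))"
    proof (rule runs_For[where n = k and I = "\<lambda>q s'. \<forall>l j. rarr s' (CHR ''z'' # X) l j =
       (if l = n \<and> j < q then U $$ (fst (es ! n), j) else rarr s5 (CHR ''z'' # X) l j)"], goal_cases)
      case (6 q s')
      have "nvar s' ''_e'' = n" "rarr s' ''row'' = rarr s5 ''row''" using agreeD[OF 6(3)] a5 s4 by auto
      thus ?case by (intro runs_straight) (use 6 s5(3) in \<open>auto simp: set_cell_def less_Suc_eq\<close>)
    qed (use a5 s4 in auto)
    then obtain s6 where s6: "run svd ?f1 s5 (k * (10 + 8) + 6) s6" "agree (mods ?f1) s5 s6"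
      "\<forall>l j. rarr s6 (CHR ''z'' # X) l j = (if l = n \<and> j < k then U $$ (fst (es ! n), j) else rarr s5 (CHR ''z'' # X) l j)" by (rule runsE)
    note a6 = agreeD[OF s6(2)]
    have "runs svd ?f2 s6 (s * (10 + 8) + 6) (\<lambda>s'. \<forall>l j. rarr s' (CHR ''z'' # X) l j =
       (if l = n \<and> k \<le> j \<and> j < k + s then D $$ (fst (es ! n), j - k) else rarr s6 (CHR ''z'' # X) l j))"
    proof (rule runs_For[where n = s and I = "\<lambda>q s'. \<forall>l j. rarr s' (CHR ''z'' # X) l j =
       (if l = n \<and> k \<le> j \<and> j < k + q then D $$ (fst (es ! n), j - k) else rarr s6 (CHR ''z'' # X) l j)"], goal_cases)
      case (6 q s')
      have "nvar s' ''_e'' = n" "nvar s' ''_r'' = fst (es ! n)" "rarr s' ''_D'' = rarr s5 ''_D''" "nvar s' ''k'' = k"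
        using agreeD[OF 6(3)] a6 a5 s4 by auto
      thus ?case by (intro runs_straight) (use 6 D5 in \<open>auto simp: set_cell_def less_Suc_eq\<close>)
    qed (use a6 a5 s4 in auto)
    hence f2: "runs svd ?f2 s6 (s * (10 + 8) + 6) (\<lambda>s'. \<forall>l<Suc n. \<forall>j<k+s. rarr (set_nvar ''_e'' (Suc n) s') (CHR ''z'' # X) l j = ?Z $$ (fst (es ! l), j))"
    proof (rule runs_weaken)
      fix s' :: state assume s': "\<forall>l j. rarr s' (CHR ''z'' # X) l j = (if l = n \<and> k \<le> j \<and> j < k + s then D $$ (fst (es ! n), j - k) else rarr s6 (CHR ''z'' # X) l j)"
      show "\<forall>l<Suc n. \<forall>j<k+s. rarr (set_nvar ''_e'' (Suc n) s') (CHR ''z'' # X) l j = ?Z $$ (fst (es ! l), j)"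
      proof (intro allI impI)
        fix l j assume lj: "l < Suc n" "j < k + s"
        show "rarr (set_nvar ''_e'' (Suc n) s') (CHR ''z'' # X) l j = ?Z $$ (fst (es ! l), j)"
        proof (cases "l = n")
          case True
          thus ?thesis using s' s6(3) lj append_cols_index(2)[OF U D e(1)[OF 6(1)] lj(2)] by simp
        next
          case False
          thus ?thesis using s' s6(3) z5 lj 6(2) by simp
        qed
      qed
    qed simp
    show ?case by (rule run_runs_Seq[OF r4 run_runs_Seq[OF s5(1) run_runs_Seq[OF s6(1) f2]]])
  qed (use agreeD[OF a2] h Lx Lx' in \<open>auto simp: mods_get\<close>)
  note r3 = this
  have bound: "(N * ((s * (10 + 8) + 6) + 8) + 6) + ((N * (20 + 8) + 6) + (N * ((4 + (k ^ 2 * 1000 + ((k * (10 + 8) + 6) + (s * (10 + 8) + 6)))) + 8) + 6))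
     \<le> length es * (k + s) ^ 2 * 1500 + 20"
  proof -
    have 1: "k ^ 2 \<le> (k + s) ^ 2" by (intro power_mono) auto
    have 2: "k + s \<le> (k + s) ^ 2" "1 \<le> (k + s) ^ 2" using k by (auto simp: power2_eq_square)
    have "((s * (10 + 8) + 6) + 8) + (20 + 8) + ((4 + (k ^ 2 * 1000 + ((k * (10 + 8) + 6) + (s * (10 + 8) + 6)))) + 8) \<le> (k + s) ^ 2 * 1500"
    proof -
      have "\<And>P Q :: nat. Q \<le> P \<Longrightarrow> k + s \<le> P \<Longrightarrow> 1 \<le> P \<Longrightarrow>
        ((s * (10 + 8) + 6) + 8) + (20 + 8) + ((4 + (Q * 1000 + ((k * (10 + 8) + 6) + (s * (10 + 8) + 6)))) + 8) \<le> P * 1500"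
        by simp
      from this[OF 1 2] show ?thesis .
    qed
    hence "N * (((s * (10 + 8) + 6) + 8) + (20 + 8) + ((4 + (k ^ 2 * 1000 + ((k * (10 + 8) + 6) + (s * (10 + 8) + 6)))) + 8)) \<le> N * ((k + s) ^ 2 * 1500)"
      by (rule mult_le_mono2)
    thus ?thesis by (simp add: N_def algebra_simps)
  qed
  show ?thesis unfolding sparse_rows_def seq.simps
    by (rule runs_mono[OF run_runs_Seq[OF s1(1) run_runs_Seq[OF s2(1) r3[unfolded N_def]]]]) (use bound in \<open>simp add: N_def\<close>)
qed

lemma read_block_eqI:
  "M \<in> carrier_mat p q \<Longrightarrow> (\<And>i j. i < p \<Longrightarrow> j < q \<Longrightarrow> rarr st a i j = M $$ (i,j)) \<Longrightarrow> read_block a p q st = M"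
  by (rule eq_matI) auto

lemma read_block_agree: "agree Y st st' \<Longrightarrow> a \<notin> Y \<Longrightarrow> read_block a p q st' = read_block a p q st"
  by (simp add: read_block_def agreeD)

text \<open>The Gram matrix of \<open>[U D]\<close> is computed from its blocks; all but the identity
  \<open>U\<^sup>T U\<close> are obtained from \<open>D\<^sup>T [U D]\<close>, which needs only the rows of \<open>U\<close> where \<open>D\<close> is nonzero.\<close>

definition gram :: "string \<Rightarrow> string \<Rightarrow> com" where
  "gram X L = seq [
     sparse_rows X L,
     Fill ''_H'' ''s'' ''_n'' Skip (RLit 0),
     For ''_o'' L (For ''_j'' ''_n'' (RWrite ''_H'' (NRead L (NVar ''_o'') (NLit 1)) (NVar ''_j'')
       (RAdd (RRead ''_H'' (NRead L (NVar ''_o'') (NLit 1)) (NVar ''_j''))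
         (RMul (RRead L (NVar ''_o'') (NLit 0)) (RRead (CHR ''z'' # X) (NVar ''_o'') (NVar ''_j'')))))),
     Fill ''_G'' ''_n'' ''_n''
       (If (NLess (NVar ''_i'') (NVar ''k''))
         (If (NLess (NVar ''_j'') (NVar ''k''))
           (If (BAnd (BNot (NLess (NVar ''_i'') (NVar ''_j''))) (BNot (NLess (NVar ''_j'') (NVar ''_i''))))
             (RAssign ''_a'' (RLit 1)) (RAssign ''_a'' (RLit 0)))
           (RAssign ''_a'' (RRead ''_H'' (NSub (NVar ''_j'') (NVar ''k'')) (NVar ''_i''))))
         (RAssign ''_a'' (RRead ''_H'' (NSub (NVar ''_i'') (NVar ''k'')) (NVar ''_j''))))
       (RVar ''_a''),
     SVD (NVar ''_n'') ''_G'' (CHR ''P'' # X) (CHR ''G'' # X) ''_B2'']"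

lemma mods_gram: "mods (gram X L) = {''_o'', ''_j'', ''_D'', ''_e'', ''_r'', CHR ''z'' # X,
    ''_1'', ''_t'', ''_u'', ''_q'', ''_v'', ''_w'', ''_a'', ''_i'', ''_l'', ''row'', ''_H'', ''_G'', CHR ''P'' # X, CHR ''G'' # X, ''_B2''}"
  by (auto simp: gram_def mods_sparse_rows)

text \<open>Besides the decomposition, the fetched rows \<open>z\<close> are part of the result:
  they are needed again once the row store has been transformed and the old rows can no longer be
  read.\<close>

lemma runs_gram:
  assumes svd: "valid_svd_routine svd" and L: "L \<in> {''D'', ''E''}" and store: "store k r X st (\<lambda>i l. U $$ (i,l))"
    and k: "nvar st ''k'' = k" "0 < k" and s: "nvar st ''s'' = s" and n: "nvar st ''_n'' = k + s"
    and es: "is_sparse_form es D" "holds_sparse L es st" and D: "D \<in> carrier_mat r s"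
    and U: "U \<in> carrier_mat r k" "U\<^sup>T * U = 1\<^sub>m k"
  shows "runs svd (gram X L) st (length es * (k + s) ^ 2 * 1600 + (k + s) ^ 3 * 300)
    (\<lambda>s'. (\<exists>B. is_svd ((append_cols U D)\<^sup>T * append_cols U D) (read_block (CHR ''P'' # X) (k + s) (k + s) s')
         (read_block (CHR ''G'' # X) (k + s) (k + s) s') B) \<and>
       (\<forall>l<length es. \<forall>j<k+s. rarr s' (CHR ''z'' # X) l j = append_cols U D $$ (fst (es ! l), j)))"
proof -
  define N where "N = length es"
  define p where "p = k + s"
  define Z where "Z = append_cols U D"
  have p: "0 < p" "k \<le> p" "s \<le> p" using k by (auto simp: p_def)
  have Z: "Z \<in> carrier_mat r p" using append_cols_index(1)[OF U(1) D] by (simp add: Z_def p_def)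
  have Lx: "L \<noteq> CHR ''_'' # x" "L \<noteq> CHR ''z'' # x" "L \<noteq> ''row''" "L \<noteq> ''k''" "L \<noteq> ''s''" for x using L by auto
  have Lx': "CHR ''_'' # x \<noteq> L" "CHR ''z'' # x \<noteq> L" "''row'' \<noteq> L" "''k'' \<noteq> L" "''s'' \<noteq> L" for x using L by auto
  have e: "fst (es ! l) < r" "fst (snd (es ! l)) < s" if "l < N" for l
    using sparse_entry[OF es(1)] that D by (auto simp: N_def)
  obtain s1 where s1: "run svd (sparse_rows X L) st (N * p ^ 2 * 1500 + 20) s1" "agree (mods (sparse_rows X L)) st s1"
    "\<forall>l<N. \<forall>j<p. rarr s1 (CHR ''z'' # X) l j = Z $$ (fst (es ! l), j)"
    by (rule runsE[OF runs_sparse_rows[OF L store k s es D U(1)], folded N_def p_def Z_def])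
  note a1 = agreeD[OF s1(2), unfolded mods_sparse_rows]
  have h1: "holds_sparse L es s1"
    using es(2) holds_sparse_agree[OF s1(2), of L es] Lx by (simp add: mods_sparse_rows)
  have r1: "nvar s1 ''k'' = k" "nvar s1 ''s'' = s" "nvar s1 ''_n'' = p" using a1 k s n by (simp_all add: p_def)
  let ?c2 = "Fill ''_H'' ''s'' ''_n'' Skip (RLit 0)"
  have "runs svd ?c2 s1 (p * p * 85 + 6) (\<lambda>s'. \<forall>i j. rarr s' ''_H'' i j = (if i < s \<and> j < p then 0 else rarr s1 ''_H'' i j))"
    by (rule runs_Fill_straight) (use r1 p in auto)
  then obtain s2 where s2: "run svd ?c2 s1 (p * p * 85 + 6) s2" "agree (mods ?c2) s1 s2"
    "\<forall>i j. rarr s2 ''_H'' i j = (if i < s \<and> j < p then 0 else rarr s1 ''_H'' i j)" by (rule runsE)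
  have h2: "holds_sparse L es s2" using h1 holds_sparse_agree[OF s2(2), of L es] Lx by simp
  note a2 = agreeD[OF s2(2)]
  have z2: "rarr s2 (CHR ''z'' # X) = rarr s1 (CHR ''z'' # X)" by (simp add: a2)
  define v where "v = (\<lambda>l. snd (snd (es ! l)))"
  \<comment> \<open>The partial sums of \<open>D\<^sup>T * Z\<close> after the first
    \<open>n\<close> list entries.\<close>
  define H where "H = (\<lambda>n c j. \<Sum>l<n. if fst (snd (es ! l)) = c then v l * Z $$ (fst (es ! l), j) else 0)"
  let ?w = "RWrite ''_H'' (NRead L (NVar ''_o'') (NLit 1)) (NVar ''_j'')
       (RAdd (RRead ''_H'' (NRead L (NVar ''_o'') (NLit 1)) (NVar ''_j''))
         (RMul (RRead L (NVar ''_o'') (NLit 0)) (RRead (CHR ''z'' # X) (NVar ''_o'') (NVar ''_j''))))"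
  let ?c3 = "For ''_o'' L (For ''_j'' ''_n'' ?w)"
  have "runs svd ?c3 s2 (N * ((p * (20 + 8) + 6) + 8) + 6) (\<lambda>s'. \<forall>c<s. \<forall>j<p. rarr s' ''_H'' c j = H N c j)"
  proof (rule runs_For[where n = N and I = "\<lambda>n s'. \<forall>c<s. \<forall>j<p. rarr s' ''_H'' c j = H n c j"], goal_cases)
    case (6 m s3)
    have f3: "narr s3 L m 1 = fst (snd (es ! m))" "rarr s3 L m 0 = v m" "rarr s3 (CHR ''z'' # X) = rarr s1 (CHR ''z'' # X)" "nvar s3 ''_n'' = p"
      using agreeD[OF 6(3)] a2 r1 Lx h2 6(1) by (auto simp: holds_sparse_def N_def v_def)
    show ?case
    proof (rule runs_weaken[OF runs_For[where n = p and B = 20 and I = "\<lambda>q s'. \<forall>c<s. \<forall>j<p. rarr s' ''_H'' c j =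
        (if j < q then H (Suc m) c j else H m c j)"]], goal_cases)
      case (6 q s4)
      have f4: "narr s4 L m 1 = fst (snd (es ! m))" "rarr s4 L m 0 = v m" "rarr s4 (CHR ''z'' # X) = rarr s1 (CHR ''z'' # X)" "nvar s4 ''_o'' = m"
        using agreeD[OF 6(3)] f3 Lx \<open>nvar s3 ''_o'' = m\<close> by auto
      have "rarr s4 (CHR ''z'' # X) m q = Z $$ (fst (es ! m), q)" using f4(3) s1(3) 6(1) \<open>m < N\<close> by simp
      thus ?case
        by (intro runs_straight) (use f4 6(1,2,4) e(2)[OF \<open>m < N\<close>] in \<open>auto simp: set_cell_def less_Suc_eq H_def\<close>)
    qed (use 6(2) f3 in auto)
  qed (use h2 s2(3) a2 r1 Lx Lx' in \<open>auto simp: holds_sparse_def N_def H_def\<close>)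
  then obtain s3 where s3: "run svd ?c3 s2 (N * ((p * (20 + 8) + 6) + 8) + 6) s3" "agree (mods ?c3) s2 s3"
    "\<forall>c<s. \<forall>j<p. rarr s3 ''_H'' c j = H N c j" by (rule runsE)
  note a3 = agreeD[OF s3(2)]
  have r3: "nvar s3 ''k'' = k" "nvar s3 ''_n'' = p" using a3 a2 r1 by auto
  have H: "rarr s3 ''_H'' c j = (\<Sum>i<r. D $$ (i,c) * Z $$ (i,j))" if "c < s" "j < p" for c j
    using s3(3) that sparse_sum[OF es(1), of c "\<lambda>i. Z $$ (i,j)"] D by (simp add: H_def N_def v_def cong: if_cong)
  let ?pre = "If (NLess (NVar ''_i'') (NVar ''k''))
         (If (NLess (NVar ''_j'') (NVar ''k''))
           (If (BAnd (BNot (NLess (NVar ''_i'') (NVar ''_j''))) (BNot (NLess (NVar ''_j'') (NVar ''_i''))))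
             (RAssign ''_a'' (RLit 1)) (RAssign ''_a'' (RLit 0)))
           (RAssign ''_a'' (RRead ''_H'' (NSub (NVar ''_j'') (NVar ''k'')) (NVar ''_i''))))
         (RAssign ''_a'' (RRead ''_H'' (NSub (NVar ''_i'') (NVar ''k'')) (NVar ''_j'')))"
  let ?c4 = "Fill ''_G'' ''_n'' ''_n'' ?pre (RVar ''_a'')"
  have Zi: "Z $$ (i,j) = (if j < k then U $$ (i,j) else D $$ (i, j - k))" if "i < r" "j < p" for i j
    using append_cols_index(2)[OF U(1) D that(1)] that(2) by (simp add: Z_def p_def)
  have G: "(Z\<^sup>T * Z) $$ (i,j) = (if i < k then if j < k then if i = j then 1 else 0 else rarr s3 ''_H'' (j - k) i else rarr s3 ''_H'' (i - k) j)"
    if ij: "i < p" "j < p" for i j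
  proof -
    have e: "(Z\<^sup>T * Z) $$ (i,j) = (\<Sum>l<r. Z $$ (l,i) * Z $$ (l,j))"
      using Z ij by (simp add: mult_mat_index)
    show ?thesis
    proof (cases "i < k")
      case True
      show ?thesis
      proof (cases "j < k")
        case True
        have "(\<Sum>l<r. Z $$ (l,i) * Z $$ (l,j)) = (\<Sum>l<r. U $$ (l,i) * U $$ (l,j))"
          using \<open>i < k\<close> True ij by (intro sum.cong) (auto simp: Zi)
        thus ?thesis using e \<open>i < k\<close> True orthonormal_iff[THEN iffD1, OF U, rule_format, of i j] by simp
      next
        case False
        have "(\<Sum>l<r. Z $$ (l,i) * Z $$ (l,j)) = (\<Sum>l<r. D $$ (l,j - k) * Z $$ (l,i))"
          using False ij by (intro sum.cong) (auto simp: Zi)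
        thus ?thesis using e \<open>i < k\<close> False H[of "j - k" i] ij by (simp add: p_def)
      qed
    next
      case False
      have "(\<Sum>l<r. Z $$ (l,i) * Z $$ (l,j)) = (\<Sum>l<r. D $$ (l,i - k) * Z $$ (l,j))"
        using False ij by (intro sum.cong) (auto simp: Zi[of _ i])
      thus ?thesis using e False H[of "i - k" j] ij by (simp add: p_def)
    qed
  qed
  have "runs svd ?c4 s3 (p * p * 85 + 6) (\<lambda>s'. \<forall>i j. rarr s' ''_G'' i j = (if i < p \<and> j < p then (Z\<^sup>T * Z) $$ (i,j) else rarr s3 ''_G'' i j))"
  proof (rule runs_Fill_straight, goal_cases)
    case (13 i j s')
    have "nvar s' ''k'' = k" "rarr s' ''_H'' = rarr s3 ''_H''" using agreeD[OF 13(3)] r3 by auto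
    thus ?case using 13 by (auto simp: G)
  qed (use r3 p in auto)
  then obtain s4 where s4: "run svd ?c4 s3 (p * p * 85 + 6) s4" "agree (mods ?c4) s3 s4"
    "\<forall>i j. rarr s4 ''_G'' i j = (if i < p \<and> j < p then (Z\<^sup>T * Z) $$ (i,j) else rarr s3 ''_G'' i j)" by (rule runsE)
  note a4 = agreeD[OF s4(2)]
  have G4: "read_block ''_G'' p p s4 = Z\<^sup>T * Z" by (rule read_block_eqI) (use Z s4(3) in auto)
  have z4: "rarr s4 (CHR ''z'' # X) = rarr s1 (CHR ''z'' # X)" by (simp add: a4 a3 z2)
  let ?c5 = "SVD (NVar ''_n'') ''_G'' (CHR ''P'' # X) (CHR ''G'' # X) ''_B2''"
  have "runs svd ?c5 s4 (1 + ncost (NVar ''_n'') + p ^ 3) (\<lambda>s'. is_svd (read_block ''_G'' p p s4)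
      (read_block (CHR ''P'' # X) p p s') (read_block (CHR ''G'' # X) p p s') (read_block ''_B2'' p p s'))"
    by (rule runs_SVD[OF svd]) (use a4 r3 in auto)
  hence r5: "runs svd ?c5 s4 (1 + ncost (NVar ''_n'') + p ^ 3) (\<lambda>s'. (\<exists>B. is_svd (Z\<^sup>T * Z)
      (read_block (CHR ''P'' # X) p p s') (read_block (CHR ''G'' # X) p p s') B) \<and>
      (\<forall>l<N. \<forall>j<p. rarr s' (CHR ''z'' # X) l j = Z $$ (fst (es ! l), j)))"
  proof (rule runs_weaken)
    fix s' assume "agree (mods ?c5) s4 s'"
    from agreeD(4)[OF this, of "CHR ''z'' # X"] have z: "rarr s' (CHR ''z'' # X) = rarr s1 (CHR ''z'' # X)" using z4 by simp
    assume "is_svd (read_block ''_G'' p p s4)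
      (read_block (CHR ''P'' # X) p p s') (read_block (CHR ''G'' # X) p p s') (read_block ''_B2'' p p s')"
    thus "(\<exists>B. is_svd (Z\<^sup>T * Z)
      (read_block (CHR ''P'' # X) p p s') (read_block (CHR ''G'' # X) p p s') B) \<and>
      (\<forall>l<N. \<forall>j<p. rarr s' (CHR ''z'' # X) l j = Z $$ (fst (es ! l), j))"
      using G4 z s1(3) by auto
  qed simp
  have bound: "N * p ^ 2 * 1500 + 20 + ((p * p * 85 + 6) + ((N * ((p * (20 + 8) + 6) + 8) + 6) + ((p * p * 85 + 6) + (1 + ncost (NVar ''_n'') + p ^ 3))))
    \<le> N * p ^ 2 * 1600 + p ^ 3 * 300"
  proof -
    have 1: "p * p \<le> p ^ 3" "1 \<le> p ^ 3" using p by (auto simp: power3_eq_cube)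
    have "p * (20 + 8) + 6 + 8 \<le> p ^ 2 * 100"
    proof -
      have "p \<le> p ^ 2" "1 \<le> p ^ 2" using p by (auto simp: power2_eq_square)
      moreover have "\<And>P. p \<le> P \<Longrightarrow> 1 \<le> P \<Longrightarrow> p * (20 + 8) + 6 + 8 \<le> P * 100" by simp
      ultimately show ?thesis by blast
    qed
    hence 2: "N * ((p * (20 + 8) + 6) + 8) \<le> N * (p ^ 2 * 100)" by (rule mult_le_mono2)
    have "\<And>P Q R T :: nat. Q \<le> P \<Longrightarrow> 1 \<le> P \<Longrightarrow> T \<le> R * 100 \<Longrightarrow> R * 1500 + 20 + ((Q * 85 + 6) + ((T + 6) + ((Q * 85 + 6) + (2 + P)))) \<le> R * 1600 + P * 300"
      by simp
    from this[OF 1 2[folded mult.assoc]] show ?thesis by simp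
  qed
  show ?thesis unfolding gram_def seq.simps N_def[symmetric] p_def[symmetric] Z_def[symmetric]
    by (rule runs_mono[OF run_runs_Seq[OF s1(1) run_runs_Seq[OF s2(1) run_runs_Seq[OF s3(1) run_runs_Seq[OF s4(1) r5]]]] bound])
qed

text \<open>The quotients \<open>S/S\<close> are indicators of the nonzero singular values, because \<open>0/0 = 0\<close>.\<close>

definition transfer_factor :: "string \<Rightarrow> string \<Rightarrow> com" where
  "transfer_factor X A = seq [
     Sum_Fill ''_N'' ''_n'' ''_n'' ''_n'' (RMul (RMul (RRead A (NVar ''_i'') (NVar ''_l'')) (RRead A (NVar ''_j'') (NVar ''_l'')))
       (RDiv (RRead ''_S1'' (NVar ''_l'') (NVar ''_l'')) (RRead ''_S1'' (NVar ''_l'') (NVar ''_l'')))),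
     Fill ''_N2'' ''_n'' ''_n'' Skip (RSub (RDiv (RRead (CHR ''G'' # X) (NVar ''_i'') (NVar ''_j'')) (RRead (CHR ''G'' # X) (NVar ''_i'') (NVar ''_j'')))
       (RRead ''_N'' (NVar ''_i'') (NVar ''_j''))),
     SVD (NVar ''_n'') ''_N2'' ''_C'' ''_S2'' ''_B2'',
     NAssign ''_v'' (NLit 0),
     For ''_o'' ''_n'' (Seq (NWrite ''_q1'' (NVar ''_o'') (NLit 0) (NVar ''_v''))
       (If (RLess (RLit 0) (RRead ''_S1'' (NVar ''_o'') (NVar ''_o''))) Skip (NAssign ''_v'' (NAdd (NVar ''_v'') (NLit 1))))),
     Fill ''_C1'' ''_n'' ''k'' (If (RLess (RLit 0) (RRead ''_S1'' (NVar ''_j'') (NVar ''_j'')))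
         (RAssign ''_a'' (RRead A (NVar ''_i'') (NVar ''_j'')))
         (RAssign ''_a'' (RRead ''_C'' (NVar ''_i'') (NRead ''_q1'' (NVar ''_j'') (NLit 0))))) (RVar ''_a''),
     Sum_Fill (CHR ''Y'' # X) ''_n'' ''k'' ''_n'' (RMul (RDiv (RRead (CHR ''P'' # X) (NVar ''_i'') (NVar ''_l''))
         (RSqrt (RRead (CHR ''G'' # X) (NVar ''_l'') (NVar ''_l'')))) (RRead ''_C1'' (NVar ''_l'') (NVar ''_j'')))]"

lemma mods_transfer_factor: "mods (transfer_factor X A) = {''_i'', ''_j'', ''_l'', ''_a'', ''_N'', ''_N2'', ''_C'', ''_S2'', ''_B2'', ''_v'', ''_o'', ''_q1'', ''_C1'', CHR ''Y'' # X}"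
  by (auto simp: transfer_factor_def)

text \<open>The array \<open>_q1\<close> holds the counts that \<open>mixed_cols\<close> uses to
  choose columns of the completion. Both sides share the singular values in \<open>_S1\<close>, but
  each completes within its own range, so the projection is formed with the \<open>G\<close> of the
  same store.\<close>

lemma runs_transfer_factor:
  assumes svd: "valid_svd_routine svd" and A: "A \<in> {''_A1'', ''_B1''}" and k: "nvar st ''k'' = k" "0 < k" "k \<le> p" and n: "nvar st ''_n'' = p"
    and G: "read_block (CHR ''G'' # X) p p st = dg p su" and \<sigma>: "\<And>i. i < p \<Longrightarrow> \<sigma> i = rarr st ''_S1'' i i" "\<And>i. i < p \<Longrightarrow> 0 \<le> \<sigma> i"
  shows "runs svd (transfer_factor X A) st (p ^ 3 * 700)
    (\<lambda>s'. \<exists>A' S' B'. is_svd (dg p (\<lambda>i. su i / su i) - read_block A p p st * (dg p (\<lambda>i. \<sigma> i / \<sigma> i) * (read_block A p p st)\<^sup>T)) A' S' B' \<and>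
       read_block (CHR ''Y'' # X) p k s' = read_block (CHR ''P'' # X) p p st * dg p (\<lambda>i. 1 / sqrt (su i)) * mixed_cols p k \<sigma> (read_block A p p st) A')"
proof -
  have p: "0 < p" using k by simp
  have Ax: "A \<noteq> CHR ''Y'' # X" "A \<noteq> ''_i''" "A \<noteq> ''_j''" "A \<noteq> ''_l''" "A \<noteq> ''_a''" "A \<noteq> ''_N''" "A \<noteq> ''_N2''"
    "A \<noteq> ''_C''" "A \<noteq> ''_S2''" "A \<noteq> ''_B2''" "A \<noteq> ''_v''" "A \<noteq> ''_o''" "A \<noteq> ''_q1''" "A \<noteq> ''_C1''" using A by auto
  define Am where "Am = rarr st A"
  define N where "N = dg p (\<lambda>i. su i / su i) - read_block A p p st * (dg p (\<lambda>i. \<sigma> i / \<sigma> i) * (read_block A p p st)\<^sup>T)"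
  have Gij: "rarr st (CHR ''G'' # X) i j = (if i = j then su i else 0)" if "i < p" "j < p" for i j
    using arg_cong[OF G, of "\<lambda>M. M $$ (i,j)"] that by (simp add: dg_index)
  let ?c1 = "Sum_Fill ''_N'' ''_n'' ''_n'' ''_n'' (RMul (RMul (RRead A (NVar ''_i'') (NVar ''_l'')) (RRead A (NVar ''_j'') (NVar ''_l'')))
       (RDiv (RRead ''_S1'' (NVar ''_l'') (NVar ''_l'')) (RRead ''_S1'' (NVar ''_l'') (NVar ''_l''))))"
  have "runs svd ?c1 st (p * p ^ 2 * 80 + 6) (\<lambda>s'. \<forall>i j. rarr s' ''_N'' i j = (if i < p \<and> j < p then \<Sum>l<p. Am i l * Am j l * (\<sigma> l / \<sigma> l) else rarr st ''_N'' i j))"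
  proof (rule runs_Sum_Fill, goal_cases)
    case (13 i j l s)
    thus ?case using agreeD[OF 13(4)] Ax \<sigma>(1) by (simp add: Am_def)
  qed (use n p in auto)
  then obtain s1 where s1: "run svd ?c1 st (p * p ^ 2 * 80 + 6) s1" "agree (mods ?c1) st s1"
    "\<forall>i j. rarr s1 ''_N'' i j = (if i < p \<and> j < p then \<Sum>l<p. Am i l * Am j l * (\<sigma> l / \<sigma> l) else rarr st ''_N'' i j)" by (rule runsE)
  note a1 = agreeD[OF s1(2)]
  let ?c2 = "Fill ''_N2'' ''_n'' ''_n'' Skip (RSub (RDiv (RRead (CHR ''G'' # X) (NVar ''_i'') (NVar ''_j'')) (RRead (CHR ''G'' # X) (NVar ''_i'') (NVar ''_j'')))
       (RRead ''_N'' (NVar ''_i'') (NVar ''_j'')))"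
  have "runs svd ?c2 s1 (p * p * 85 + 6) (\<lambda>s'. \<forall>i j. rarr s' ''_N2'' i j = (if i < p \<and> j < p then
      rarr st (CHR ''G'' # X) i j / rarr st (CHR ''G'' # X) i j - rarr s1 ''_N'' i j else rarr s1 ''_N2'' i j))"
  proof (rule runs_Fill_straight, goal_cases)
    case (13 i j s)
    thus ?case using agreeD[OF 13(3)] a1 by simp
  qed (use n p a1 in auto)
  then obtain s2 where s2: "run svd ?c2 s1 (p * p * 85 + 6) s2" "agree (mods ?c2) s1 s2"
    "\<forall>i j. rarr s2 ''_N2'' i j = (if i < p \<and> j < p then
      rarr st (CHR ''G'' # X) i j / rarr st (CHR ''G'' # X) i j - rarr s1 ''_N'' i j else rarr s1 ''_N2'' i j)" by (rule runsE)
  have a2: "agree {''_i'', ''_j'', ''_l'', ''_a'', ''_N'', ''_N2''} st s2" by (rule agree_trans[OF s1(2) s2(2)]) auto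
  have N2: "read_block ''_N2'' p p s2 = N"
  proof (rule read_block_eqI)
    fix i j assume ij: "i < p" "j < p"
    have "(read_block A p p st * (dg p (\<lambda>i. \<sigma> i / \<sigma> i) * (read_block A p p st)\<^sup>T)) $$ (i,j) = (\<Sum>l<p. Am i l * Am j l * (\<sigma> l / \<sigma> l))"
    proof -
      have "(read_block A p p st * (dg p (\<lambda>i. \<sigma> i / \<sigma> i) * (read_block A p p st)\<^sup>T)) $$ (i,j)
         = (\<Sum>l<p. Am i l * ((\<sigma> l / \<sigma> l) * Am j l))"
        using ij by (subst mult_mat_index) (auto simp: dg_mult_index Am_def intro!: sum.cong)
      thus ?thesis by (simp only: ac_simps)
    qed
    thus "rarr s2 ''_N2'' i j = N $$ (i,j)" using s2(3) s1(3) ij by (simp add: N_def dg_index Gij)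
  qed (auto simp: N_def intro!: carrier_matI)
  let ?c3 = "SVD (NVar ''_n'') ''_N2'' ''_C'' ''_S2'' ''_B2''"
  have "runs svd ?c3 s2 (1 + ncost (NVar ''_n'') + p ^ 3) (\<lambda>s'. is_svd (read_block ''_N2'' p p s2) (read_block ''_C'' p p s') (read_block ''_S2'' p p s') (read_block ''_B2'' p p s'))"
    by (rule runs_SVD[OF svd]) (use agreeD[OF a2] n in auto)
  then obtain s3 where s3: "run svd ?c3 s2 (1 + ncost (NVar ''_n'') + p ^ 3) s3" "agree (mods ?c3) s2 s3"
    "is_svd (read_block ''_N2'' p p s2) (read_block ''_C'' p p s3) (read_block ''_S2'' p p s3) (read_block ''_B2'' p p s3)" by (rule runsE)
  have a3: "agree {''_i'', ''_j'', ''_l'', ''_a'', ''_N'', ''_N2'', ''_C'', ''_S2'', ''_B2''} st s3" by (rule agree_trans[OF a2 s3(2)]) auto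
  define s4 where "s4 = effect (NAssign ''_v'' (NLit 0)) s3"
  have r4: "run svd (NAssign ''_v'' (NLit 0)) s3 2 s4" unfolding s4_def by (rule run_straight) auto
  have a34: "agree {''_v''} s3 s4" by (simp add: s4_def agree_def)
  have v4: "nvar s4 ''_v'' = 0" by (simp add: s4_def)
  have a4: "agree {''_i'', ''_j'', ''_l'', ''_a'', ''_N'', ''_N2'', ''_C'', ''_S2'', ''_B2'', ''_v''} st s4" by (rule agree_trans[OF a3 a34]) auto
  let ?c5 = "For ''_o'' ''_n'' (Seq (NWrite ''_q1'' (NVar ''_o'') (NLit 0) (NVar ''_v''))
       (If (RLess (RLit 0) (RRead ''_S1'' (NVar ''_o'') (NVar ''_o''))) Skip (NAssign ''_v'' (NAdd (NVar ''_v'') (NLit 1)))))"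
  define q where "q = (\<lambda>j. card {l. l < j \<and> \<sigma> l = 0})"
  have qSuc: "q (Suc j) = (if \<sigma> j = 0 then Suc (q j) else q j)" for j
  proof -
    have "{l. l < Suc j \<and> \<sigma> l = 0} = (if \<sigma> j = 0 then insert j {l. l < j \<and> \<sigma> l = 0} else {l. l < j \<and> \<sigma> l = 0})"
      by (auto simp: less_Suc_eq)
    thus ?thesis by (simp add: q_def)
  qed
  have "runs svd ?c5 s4 (p * (30 + 8) + 6) (\<lambda>s'. nvar s' ''_v'' = q p \<and> (\<forall>j<p. narr s' ''_q1'' j 0 = q j))"
  proof (rule runs_For[where n = p and B = 30 and I = "\<lambda>m s'. nvar s' ''_v'' = q m \<and> (\<forall>j<m. narr s' ''_q1'' j 0 = q j)"], goal_cases)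
    case (6 m s')
    have "rarr s' ''_S1'' = rarr st ''_S1''" using agreeD[OF 6(3)] agreeD[OF a4] by simp
    hence "rarr s' ''_S1'' m m = \<sigma> m" "0 \<le> \<sigma> m" using \<sigma> 6(1) by auto
    thus ?case by (intro runs_straight) (use 6(2,4) in \<open>auto simp: set_cell_def less_Suc_eq qSuc\<close>)
  qed (use v4 n agreeD[OF a4] in \<open>auto simp: q_def\<close>)
  then obtain s5 where s5: "run svd ?c5 s4 (p * (30 + 8) + 6) s5" "agree (mods ?c5) s4 s5"
    "\<forall>j<p. narr s5 ''_q1'' j 0 = q j" by (rule runsE) auto
  have a5: "agree {''_i'', ''_j'', ''_l'', ''_a'', ''_N'', ''_N2'', ''_C'', ''_S2'', ''_B2'', ''_v'', ''_o'', ''_q1''} st s5" by (rule agree_trans[OF a4 s5(2)]) auto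
  have C5: "rarr s5 ''_C'' = rarr s3 ''_C''" using agreeD[OF s5(2)] agreeD[OF a34] by simp
  define Cm where "Cm = mixed_cols p k \<sigma> (read_block A p p st) (read_block ''_C'' p p s3)"
  have qle: "q j \<le> j" for j unfolding q_def using card_mono[of "{..<j}" "{l. l < j \<and> \<sigma> l = 0}"] by auto
  have Cm: "Cm $$ (i,j) = (if 0 < \<sigma> j then Am i j else rarr s3 ''_C'' i (q j))" if "i < p" "j < k" for i j
  proof -
    have "0 < \<sigma> j \<longleftrightarrow> \<sigma> j \<noteq> 0" using \<sigma>(2)[of j] that k by (auto simp: less_le)
    moreover have "q j < p" using qle[of j] that k by simp
    ultimately show ?thesis using that k
      by (simp add: Cm_def mixed_cols_def Am_def fun_cong[OF q_def, of j, symmetric])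
  qed
  let ?pre = "If (RLess (RLit 0) (RRead ''_S1'' (NVar ''_j'') (NVar ''_j'')))
         (RAssign ''_a'' (RRead A (NVar ''_i'') (NVar ''_j'')))
         (RAssign ''_a'' (RRead ''_C'' (NVar ''_i'') (NRead ''_q1'' (NVar ''_j'') (NLit 0))))"
  let ?c6 = "Fill ''_C1'' ''_n'' ''k'' ?pre (RVar ''_a'')"
  have "runs svd ?c6 s5 (p * p * 85 + 6) (\<lambda>s'. \<forall>i j. rarr s' ''_C1'' i j = (if i < p \<and> j < k then Cm $$ (i,j) else rarr s5 ''_C1'' i j))"
  proof (rule runs_Fill_straight, goal_cases)
    case (13 i j s)
    have "rarr s ''_S1'' = rarr st ''_S1''" "rarr s A = Am" "rarr s ''_C'' = rarr s3 ''_C''" "narr s ''_q1'' j 0 = q j"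
      using agreeD[OF 13(3)] agreeD[OF a5] Ax C5 s5(3) 13(2) k by (auto simp: Am_def)
    thus ?case using 13 Cm[OF 13(1,2)] \<sigma>(1)[of j] k by simp
  qed (use n k p agreeD[OF a5] in auto)
  then obtain s6 where s6: "run svd ?c6 s5 (p * p * 85 + 6) s6" "agree (mods ?c6) s5 s6"
    "\<forall>i j. rarr s6 ''_C1'' i j = (if i < p \<and> j < k then Cm $$ (i,j) else rarr s5 ''_C1'' i j)" by (rule runsE)
  have a6: "agree {''_i'', ''_j'', ''_l'', ''_a'', ''_N'', ''_N2'', ''_C'', ''_S2'', ''_B2'', ''_v'', ''_o'', ''_q1'', ''_C1''} st s6" by (rule agree_trans[OF a5 s6(2)]) auto
  let ?c7 = "Sum_Fill (CHR ''Y'' # X) ''_n'' ''k'' ''_n'' (RMul (RDiv (RRead (CHR ''P'' # X) (NVar ''_i'') (NVar ''_l''))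
         (RSqrt (RRead (CHR ''G'' # X) (NVar ''_l'') (NVar ''_l'')))) (RRead ''_C1'' (NVar ''_l'') (NVar ''_j'')))"
  have "runs svd ?c7 s6 (p * p ^ 2 * 80 + 6) (\<lambda>s'. \<forall>i j. rarr s' (CHR ''Y'' # X) i j = (if i < p \<and> j < k then
      \<Sum>l<p. rarr st (CHR ''P'' # X) i l / sqrt (su l) * Cm $$ (l,j) else rarr s6 (CHR ''Y'' # X) i j))"
  proof (rule runs_Sum_Fill, goal_cases)
    case (13 i j l s)
    have "rarr s (CHR ''P'' # X) = rarr st (CHR ''P'' # X)" "rarr s (CHR ''G'' # X) = rarr st (CHR ''G'' # X)" "rarr s ''_C1'' = rarr s6 ''_C1''"
      using agreeD[OF 13(4)] agreeD[OF a6] by auto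
    thus ?case using 13 s6(3) by (simp add: Gij)
  qed (use n k p agreeD[OF a6] in auto)
  hence r7: "runs svd ?c7 s6 (p * p ^ 2 * 80 + 6) (\<lambda>s'. \<exists>A' S' B'. is_svd N A' S' B' \<and>
       read_block (CHR ''Y'' # X) p k s' = read_block (CHR ''P'' # X) p p st * dg p (\<lambda>i. 1 / sqrt (su i)) * mixed_cols p k \<sigma> (read_block A p p st) A')"
  proof (rule runs_weaken)
    fix s' :: state assume Y: "\<forall>i j. rarr s' (CHR ''Y'' # X) i j = (if i < p \<and> j < k then
      \<Sum>l<p. rarr st (CHR ''P'' # X) i l / sqrt (su l) * Cm $$ (l,j) else rarr s6 (CHR ''Y'' # X) i j)"
    have Cd: "dim_row Cm = p" "dim_col Cm = k" by (simp_all add: Cm_def mixed_cols_def)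
    have "read_block (CHR ''Y'' # X) p k s' = read_block (CHR ''P'' # X) p p st * dg p (\<lambda>i. 1 / sqrt (su i)) * Cm"
    proof (rule read_block_eqI)
      fix i j assume ij: "i < p" "j < k"
      show "rarr s' (CHR ''Y'' # X) i j = (read_block (CHR ''P'' # X) p p st * dg p (\<lambda>i. 1 / sqrt (su i)) * Cm) $$ (i,j)"
        using Y ij Cd by (subst mult_mat_index) (auto simp: mult_dg_index intro!: sum.cong)
    qed (use Cd in auto)
    thus "\<exists>A' S' B'. is_svd N A' S' B' \<and>
       read_block (CHR ''Y'' # X) p k s' = read_block (CHR ''P'' # X) p p st * dg p (\<lambda>i. 1 / sqrt (su i)) * mixed_cols p k \<sigma> (read_block A p p st) A'"
      using s3(3) unfolding N2 Cm_def by blast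
  qed simp
  have bound: "p * p ^ 2 * 80 + 6 + ((p * p * 85 + 6) + ((1 + ncost (NVar ''_n'') + p ^ 3) + (2 + ((p * (30 + 8) + 6) + ((p * p * 85 + 6) + (p * p ^ 2 * 80 + 6)))))) \<le> p ^ 3 * 700"
  proof -
    have 1: "p * p \<le> p ^ 3" "1 \<le> p ^ 3" "p \<le> p ^ 3" using p by (auto simp: power3_eq_cube)
    have 2: "p * p ^ 2 = p ^ 3" by (simp add: power2_eq_square power3_eq_cube)
    have "\<And>P Q. Q \<le> P \<Longrightarrow> 1 \<le> P \<Longrightarrow> p \<le> P \<Longrightarrow> P * 80 + 6 + ((Q * 85 + 6) + ((1 + ncost (NVar ''_n'') + P) + (2 + ((p * (30 + 8) + 6) + ((Q * 85 + 6) + (P * 80 + 6)))))) \<le> P * 700"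
      by simp
    from this[OF 1] show ?thesis unfolding 2 .
  qed
  show ?thesis unfolding transfer_factor_def seq.simps N_def[symmetric]
    by (rule runs_mono[OF run_runs_Seq[OF s1(1) run_runs_Seq[OF s2(1) run_runs_Seq[OF s3(1) run_runs_Seq[OF r4 run_runs_Seq[OF s5(1) run_runs_Seq[OF s6(1) r7]]]]]] bound])
qed

lemma store_cong:
  assumes "store k r X st R" "\<And>i l. i < r \<Longrightarrow> l < k \<Longrightarrow> R' i l = R i l"
  shows "store k r X st R'"
  using assms unfolding store_def by simp

text \<open>Multiplying by the upper block \<open>F\<close> already gives the final value of every
  row in which \<open>D\<close> is zero; the listed rows are then recomputed from the saved
  \<open>z\<close> and assigned anew.\<close>

definition update_rows :: "string \<Rightarrow> string \<Rightarrow> com" where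
  "update_rows X L = seq [
     Fill ''_F'' ''k'' ''k'' Skip (RRead (CHR ''Y'' # X) (NVar ''_i'') (NVar ''_j'')),
     transform X,
     For ''_e'' L (seq [
       NAssign ''_r'' (NRead L (NVar ''_e'') (NLit 0)),
       Sum_Fill ''_p'' ''_c1'' ''k'' ''_n'' (RMul (RRead (CHR ''z'' # X) (NVar ''_e'') (NVar ''_l'')) (RRead (CHR ''Y'' # X) (NVar ''_l'') (NVar ''_j''))),
       put X])]"

lemma mods_update_rows: "mods (update_rows X L) = {''_i'', ''_j'', ''_l'', ''_a'', ''_M'', ''_A'', ''_S'', ''_B'', ''_o'', ''_v'', ''_u'', ''_g'',
    ''_F'', ''_e'', ''_r'', ''_p'', ''_1'', ''_q''} \<union> store_names X"
  by (auto simp: update_rows_def mods_transform mods_put store_names_def)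

lemma runs_update_rows:
  assumes svd: "valid_svd_routine svd" and L: "L \<in> {''D'', ''E''}" and store: "store k r X st (\<lambda>i l. U $$ (i,l))"
    and k: "nvar st ''k'' = k" "0 < k" and n: "nvar st ''_n'' = k + s" "nvar st ''_c1'' = 1"
    and es: "is_sparse_form es D" "holds_sparse L es st" and D: "D \<in> carrier_mat r s" and U: "U \<in> carrier_mat r k"
    and z: "\<And>l j. l < length es \<Longrightarrow> j < k + s \<Longrightarrow> rarr st (CHR ''z'' # X) l j = append_cols U D $$ (fst (es ! l), j)"
  shows "runs svd (update_rows X L) st (length es * (k + s) ^ 2 * 500 + (k + s) ^ 3 * 2200)
    (\<lambda>s'. store k r X s' (\<lambda>i l. (append_cols U D * read_block (CHR ''Y'' # X) (k + s) k st) $$ (i,l)))"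
proof -
  define N where "N = length es"
  define p where "p = k + s"
  define Z where "Z = append_cols U D"
  define Y where "Y = read_block (CHR ''Y'' # X) p k st"
  have p: "0 < p" "k \<le> p" using k by (auto simp: p_def)
  have Z: "Z \<in> carrier_mat r p" using append_cols_index(1)[OF U D] by (simp add: Z_def p_def)
  have Y: "Y \<in> carrier_mat p k" by (simp add: Y_def read_block_def)
  have Lx: "L \<noteq> CHR ''_'' # x" "L \<notin> store_names X" "CHR ''_'' # x \<noteq> L" for x using L by (auto simp: store_names_def)
  have ei: "fst (es ! l) < r" if "l < N" for l using sparse_entry[OF es(1)] that D by (auto simp: N_def)
  have ZY: "(Z * Y) $$ (i,j) = (\<Sum>l<p. Z $$ (i,l) * rarr st (CHR ''Y'' # X) l j)" if "i < r" "j < k" for i j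
    using that Z Y by (subst mult_mat_index) (auto simp: Y_def intro!: sum.cong)
  let ?c1 = "Fill ''_F'' ''k'' ''k'' Skip (RRead (CHR ''Y'' # X) (NVar ''_i'') (NVar ''_j''))"
  have "runs svd ?c1 st (p * p * 85 + 6) (\<lambda>s'. \<forall>i j. rarr s' ''_F'' i j = (if i < k \<and> j < k then rarr st (CHR ''Y'' # X) i j else rarr st ''_F'' i j))"
  proof (rule runs_Fill_straight, goal_cases)
    case (13 i j s')
    thus ?case using agreeD[OF 13(3)] by simp
  qed (use k p in auto)
  then obtain s1 where s1: "run svd ?c1 st (p * p * 85 + 6) s1" "agree (mods ?c1) st s1"
    "\<forall>i j. rarr s1 ''_F'' i j = (if i < k \<and> j < k then rarr st (CHR ''Y'' # X) i j else rarr st ''_F'' i j)" by (rule runsE)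
  have st1: "store k r X s1 (\<lambda>i l. U $$ (i,l))" using store store_agree[OF s1(2)] by (simp add: store_names_def)
  have k1: "nvar s1 ''k'' = k" using agreeD[OF s1(2)] k by simp
  obtain s2 where s2: "run svd (transform X) s1 (k ^ 3 * 2000) s2" "agree (mods (transform X)) s1 s2"
    "store k r X s2 (\<lambda>i l. \<Sum>j<k. U $$ (i,j) * rarr s1 ''_F'' j l)" by (rule runsE[OF runs_transform[OF svd st1 k1 k(2)]])
  define R1 where "R1 = (\<lambda>i l. \<Sum>j<k. U $$ (i,j) * rarr st (CHR ''Y'' # X) j l)"
  have st2: "store k r X s2 R1" by (rule store_cong[OF s2(3)]) (use s1(3) in \<open>simp add: R1_def\<close>)
  have a2: "agree ({''_i'', ''_j'', ''_l'', ''_a'', ''_M'', ''_A'', ''_S'', ''_B'', ''_o'', ''_v'', ''_u'', ''_g'', ''_F''} \<union> store_names X) st s2"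
    by (rule agree_trans[OF s1(2) s2(2)]) (auto simp: mods_transform store_names_def)
  have h2: "holds_sparse L es s2" using es(2) holds_sparse_agree[OF a2] Lx by simp
  let ?n = "NAssign ''_r'' (NRead L (NVar ''_e'') (NLit 0))"
  let ?f = "Sum_Fill ''_p'' ''_c1'' ''k'' ''_n'' (RMul (RRead (CHR ''z'' # X) (NVar ''_e'') (NVar ''_l'')) (RRead (CHR ''Y'' # X) (NVar ''_l'') (NVar ''_j'')))"
  let ?body = "Seq ?n (Seq ?f (put X))"
  \<comment> \<open>A row listed several times is assigned the same value each time, so only the set
    of rows met so far matters.\<close>
  define I where "I = (\<lambda>m s'. store k r X s' (\<lambda>i l. if \<exists>l'<m. fst (es ! l') = i then (Z * Y) $$ (i,l) else R1 i l))"
  have "runs svd (For ''_e'' L ?body) s2 (N * ((4 + ((1 * p ^ 2 * 80 + 6) + k ^ 2 * 200)) + 8) + 6) (I N)"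
  proof (rule runs_For[where n = N and I = I], goal_cases)
    case 5
    have "store k r X (set_nvar ''_e'' 0 s2) R1" using st2 store_agree[of "{''_e''}" s2 "set_nvar ''_e'' 0 s2" X k r]
      by (simp add: agree_def store_names_def)
    thus ?case using agreeD[OF a2] n by (simp add: I_def store_names_def)
  next
    case (6 m s3)
    have a3: "agree (insert ''_e'' (mods ?body) \<union> ({''_i'', ''_j'', ''_l'', ''_a'', ''_M'', ''_A'', ''_S'', ''_B'', ''_o'', ''_v'', ''_u'', ''_g'', ''_F''} \<union> store_names X)) st s3"
      by (rule agree_trans[OF a2 6(3)]) auto
    have f3: "narr s3 L m 0 = fst (es ! m)" "nvar s3 ''k'' = k" "nvar s3 ''_n'' = p" "nvar s3 ''_c1'' = 1"
      "rarr s3 (CHR ''z'' # X) = rarr st (CHR ''z'' # X)" "rarr s3 (CHR ''Y'' # X) = rarr st (CHR ''Y'' # X)"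
    proof -
      have "L \<notin> insert ''_e'' (mods ?body)" using Lx by (auto simp: mods_put store_names_def)
      from agreeD(3)[OF 6(3) this] h2 6(1) show "narr s3 L m 0 = fst (es ! m)" by (simp add: holds_sparse_def N_def)
      show "nvar s3 ''k'' = k" "nvar s3 ''_n'' = p" "nvar s3 ''_c1'' = 1" "rarr s3 (CHR ''z'' # X) = rarr st (CHR ''z'' # X)" "rarr s3 (CHR ''Y'' # X) = rarr st (CHR ''Y'' # X)"
        using agreeD[OF a3] k n by (simp_all add: mods_put store_names_def p_def)
    qed
    define i where "i = fst (es ! m)"
    have i: "i < r" using ei[OF 6(1)] by (simp add: i_def)
    define s4 where "s4 = effect ?n s3"
    have r4: "run svd ?n s3 4 s4" unfolding s4_def by (rule run_straight) auto
    have a4: "agree {''_r''} s3 s4" by (simp add: s4_def agree_def)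
    have f4: "nvar s4 ''_r'' = i" "nvar s4 ''k'' = k" "nvar s4 ''_n'' = p" "nvar s4 ''_c1'' = 1" "rarr s4 = rarr s3" "nvar s4 ''_e'' = m"
      using f3 6(4) by (simp_all add: s4_def i_def)
    have "runs svd ?f s4 (1 * p ^ 2 * 80 + 6) (\<lambda>s'. \<forall>a b. rarr s' ''_p'' a b = (if a < 1 \<and> b < k then
        \<Sum>l<p. Z $$ (i,l) * rarr st (CHR ''Y'' # X) l b else rarr s4 ''_p'' a b))"
    proof (rule runs_Sum_Fill, goal_cases)
      case (13 a b l s')
      have "rarr st (CHR ''z'' # X) m l = Z $$ (i,l)" using z[of m l] 6(1) 13(3) by (simp add: Z_def i_def N_def p_def)
      thus ?case using agreeD[OF 13(4)] f4 f3 13 by simp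
    qed (use f4 p in auto)
    then obtain s5 where s5: "run svd ?f s4 (1 * p ^ 2 * 80 + 6) s5" "agree (mods ?f) s4 s5"
      "\<forall>a b. rarr s5 ''_p'' a b = (if a < 1 \<and> b < k then \<Sum>l<p. Z $$ (i,l) * rarr st (CHR ''Y'' # X) l b else rarr s4 ''_p'' a b)" by (rule runsE)
    have a5: "agree {''_r'', ''_i'', ''_j'', ''_l'', ''_a'', ''_p''} s3 s5" by (rule agree_trans[OF a4 s5(2)]) auto
    define Rm where "Rm = (\<lambda>i l. if \<exists>l'<m. fst (es ! l') = i then (Z * Y) $$ (i,l) else R1 i l)"
    have st5: "store k r X s5 Rm"
      using 6(2) store_agree[OF a5, of X k r Rm] by (simp add: I_def store_names_def Rm_def)
    have f5: "nvar s5 ''k'' = k" "nvar s5 ''_r'' = i" using agreeD[OF s5(2)] f4 by auto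
    have p5: "rarr s5 ''_p'' 0 b = (Z * Y) $$ (i,b)" if "b < k" for b using s5(3) ZY[OF i that] that by simp
    have "runs svd (put X) s5 (k ^ 2 * 200) (\<lambda>s'. store k (max r (Suc i)) X s' (Rm(i := rarr s5 ''_p'' 0)))"
      by (rule runs_put[OF st5 f5(1) k(2) f5(2)]) (use i in simp)
    hence r5: "runs svd (put X) s5 (k ^ 2 * 200) (\<lambda>s'. I (Suc m) (set_nvar ''_e'' (Suc m) s'))"
    proof (rule runs_weaken)
      fix s' assume st': "store k (max r (Suc i)) X s' (Rm(i := rarr s5 ''_p'' 0))" and a': "agree (mods (put X)) s5 s'"
      have mx: "max r (Suc i) = r" using i by simp
      have "store k r X s' (\<lambda>i l. if \<exists>l'<Suc m. fst (es ! l') = i then (Z * Y) $$ (i,l) else R1 i l)"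
        by (rule store_cong[OF st'[unfolded mx]]) (auto simp: Rm_def p5 less_Suc_eq i_def[symmetric])
      hence "store k r X (set_nvar ''_e'' (Suc m) s') (\<lambda>i l. if \<exists>l'<Suc m. fst (es ! l') = i then (Z * Y) $$ (i,l) else R1 i l)"
        using store_agree[of "{''_e''}" s' "set_nvar ''_e'' (Suc m) s'" X k r] by (simp add: agree_def store_names_def)
      thus "I (Suc m) (set_nvar ''_e'' (Suc m) s')" by (simp add: I_def)
    qed simp
    show ?case by (rule run_runs_Seq[OF r4 run_runs_Seq[OF s5(1) r5]])
  qed (use h2 Lx in \<open>auto simp: holds_sparse_def N_def mods_put store_names_def\<close>)
  hence r3: "runs svd (For ''_e'' L ?body) s2 (N * ((4 + ((1 * p ^ 2 * 80 + 6) + k ^ 2 * 200)) + 8) + 6) (\<lambda>s'. store k r X s' (\<lambda>i l. (Z * Y) $$ (i,l)))"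
  proof (rule runs_weaken)
    fix s' assume IN: "I N s'"
    hence IN: "store k r X s' (\<lambda>i l. if \<exists>l'<N. fst (es ! l') = i then (Z * Y) $$ (i,l) else R1 i l)" by (simp add: I_def)
    show "store k r X s' (\<lambda>i l. (Z * Y) $$ (i,l))"
    proof (rule store_cong[OF IN])
      fix i l assume il: "i < r" "l < k"
      \<comment> \<open>A row that does not occur in the list is a zero row of \<open>D\<close>,
        which leaves only the first \<open>k\<close> rows of \<open>Y\<close> in the
        product.\<close>
      have "(Z * Y) $$ (i,l) = R1 i l" if no: "\<not> (\<exists>l'<N. fst (es ! l') = i)"
      proof -
        have D0: "D $$ (i,j) = 0" if j: "j < s" for j
        proof (rule ccontr)
          assume nz: "D $$ (i,j) \<noteq> 0"
          obtain l' where "l' < length es" "es ! l' = (i, j, D $$ (i,j))"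
            by (rule sparse_nth[OF es(1) _ _ nz]) (use il j D in auto)
          thus False using no by (auto simp: N_def)
        qed
        have "(\<Sum>j<p. Z $$ (i,j) * rarr st (CHR ''Y'' # X) j l) = R1 i l"
          unfolding p_def sum_lessThan_add R1_def Z_def using il D0
          by (simp add: append_cols_index(2)[OF U D])
        thus ?thesis using ZY[OF il] by simp
      qed
      thus "(Z * Y) $$ (i,l) = (if \<exists>l'<N. fst (es ! l') = i then (Z * Y) $$ (i,l) else R1 i l)" by auto
    qed
  qed simp
  have bound: "p * p * 85 + 6 + (k ^ 3 * 2000 + (N * ((4 + ((1 * p ^ 2 * 80 + 6) + k ^ 2 * 200)) + 8) + 6)) \<le> N * p ^ 2 * 500 + p ^ 3 * 2200"
  proof -
    have 1: "p * p \<le> p ^ 3" "1 \<le> p ^ 3" using p by (auto simp: power3_eq_cube)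
    have 2: "k ^ 3 \<le> p ^ 3" "k ^ 2 \<le> p ^ 2" "1 \<le> p ^ 2" using p by (auto intro: power_mono)
    have "\<And>P Q. Q \<le> P \<Longrightarrow> 1 \<le> P \<Longrightarrow> (4 + ((1 * P * 80 + 6) + Q * 200)) + 8 \<le> P * (500 :: nat)" by simp
    from this[OF 2(2,3)] have 3: "N * ((4 + ((1 * p ^ 2 * 80 + 6) + k ^ 2 * 200)) + 8) \<le> N * (p ^ 2 * 500)" by (rule mult_le_mono2)
    have "\<And>P Q R T V :: nat. Q \<le> P \<Longrightarrow> 1 \<le> P \<Longrightarrow> R \<le> P \<Longrightarrow> T \<le> V \<Longrightarrow> Q * 85 + 6 + (R * 2000 + (T + 6)) \<le> V + P * 2200" by simp
    from this[OF 1 2(1) 3[folded mult.assoc]] show ?thesis .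
  qed
  show ?thesis unfolding update_rows_def seq.simps N_def[symmetric] p_def[symmetric] Z_def[symmetric] Y_def[symmetric]
    by (rule runs_mono[OF run_runs_Seq[OF s1(1) run_runs_Seq[OF s2(1) r3]] bound])
qed

section \<open>The update of the whole triple\<close>

definition represents :: "nat \<Rightarrow> state \<Rightarrow> real mat \<Rightarrow> real mat \<Rightarrow> real mat \<Rightarrow> bool" where
  "represents k st U S V \<longleftrightarrow> svd_triple k (dim_row U) (dim_row V) U S V \<and>
     nvar st ''k'' = k \<and> nvar st ''m'' = dim_row U \<and> nvar st ''n'' = dim_row V \<and>
     store k (dim_row U) ''U'' st (\<lambda>i l. U $$ (i,l)) \<and> store k (dim_row V) ''V'' st (\<lambda>i l. V $$ (i,l)) \<and>
     read_block ''Sigma'' k k st = S"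

text \<open>As the middle factor is diagonal, \<open>_M1\<close> is a single sum over
  \<open>_l\<close> and takes one cubic pass; the diagonal is kept as the column \<open>_K\<close>.
  \<open>Sigma\<close> is overwritten last, whereas its old values enter through
  \<open>_K\<close>.\<close>

definition low_rank_update :: com where
  "low_rank_update = seq [
     Seq (NAssign ''_n'' (NAdd (NVar ''k'') (NVar ''s''))) (NAssign ''_c1'' (NLit 1)),
     gram ''U'' ''D'',
     gram ''V'' ''E'',
     Fill ''_K'' ''_n'' ''_c1'' (If (NLess (NVar ''_i'') (NVar ''k'')) (RAssign ''_a'' (RRead ''Sigma'' (NVar ''_i'') (NVar ''_i'')))
       (RAssign ''_a'' (RLit 1))) (RVar ''_a''),
     Sum_Fill ''_M1'' ''_n'' ''_n'' ''_n''
       (RMul (RMul (RMul (RSqrt (RRead ''GU'' (NVar ''_i'') (NVar ''_i''))) (RRead ''PU'' (NVar ''_l'') (NVar ''_i'')))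
            (RRead ''_K'' (NVar ''_l'') (NLit 0)))
         (RMul (RSqrt (RRead ''GV'' (NVar ''_j'') (NVar ''_j''))) (RRead ''PV'' (NVar ''_l'') (NVar ''_j'')))),
     SVD (NVar ''_n'') ''_M1'' ''_A1'' ''_S1'' ''_B1'',
     transfer_factor ''U'' ''_A1'',
     transfer_factor ''V'' ''_B1'',
     update_rows ''U'' ''D'',
     update_rows ''V'' ''E'',
     Fill ''Sigma'' ''k'' ''k'' Skip (RRead ''_S1'' (NVar ''_i'') (NVar ''_j''))]"

text \<open>The stages contribute 2100 per nonzero entry times \<open>p ^ 2\<close>, and less than
  6700 times \<open>p ^ 3\<close>; the constant 7000 dominates both.\<close>

lemma runs_low_rank_update:
  assumes svd: "valid_svd_routine svd" and rep: "represents k st U S V" and k: "0 < k" and s: "nvar st ''s'' = s"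
    and ds: "is_sparse_form ds D" "holds_sparse ''D'' ds st" and D: "D \<in> carrier_mat (dim_row U) s"
    and es: "is_sparse_form es E" "holds_sparse ''E'' es st" and E: "E \<in> carrier_mat (dim_row V) s"
  shows "runs svd low_rank_update st (7000 * ((nnz D + nnz E) * (s + k) ^ 2 + (s + k) ^ 3))
    (\<lambda>s'. \<exists>U' S' V'. is_truncated_svd k (U * S * V\<^sup>T + D * E\<^sup>T) U' S' V' \<and> represents k s' U' S' V')"
proof -
  define p where "p = k + s"
  define m where "m = dim_row U"
  define n where "n = dim_row V"
  have p: "0 < p" "k \<le> p" using k by (auto simp: p_def)
  have triple: "svd_triple k m n U S V" and r0: "nvar st ''k'' = k" "nvar st ''m'' = m" "nvar st ''n'' = n"
    and sU: "store k m ''U'' st (\<lambda>i l. U $$ (i,l))" and sV: "store k n ''V'' st (\<lambda>i l. V $$ (i,l))"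
    and Sig: "read_block ''Sigma'' k k st = S"
    using rep by (auto simp: represents_def m_def n_def)
  have U: "U \<in> carrier_mat m k" "U\<^sup>T * U = 1\<^sub>m k" and V: "V \<in> carrier_mat n k" "V\<^sup>T * V = 1\<^sub>m k"
    using triple by (auto simp: svd_triple_def)
  have D': "D \<in> carrier_mat m s" and E': "E \<in> carrier_mat n s" using D E by (auto simp: m_def n_def)
  define ZU where "ZU = append_cols U D"
  define ZV where "ZV = append_cols V E"
  have ZU: "ZU \<in> carrier_mat m p" and ZV: "ZV \<in> carrier_mat n p"
    using append_cols_index(1)[OF U(1) D'] append_cols_index(1)[OF V(1) E'] by (auto simp: ZU_def ZV_def p_def)
  let ?c1 = "Seq (NAssign ''_n'' (NAdd (NVar ''k'') (NVar ''s''))) (NAssign ''_c1'' (NLit 1))"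
  define s1 where "s1 = effect ?c1 st"
  have r1: "run svd ?c1 st 6 s1" unfolding s1_def by (rule run_straight) auto
  have a1: "agree {''_n'', ''_c1''} st s1" by (auto simp: s1_def agree_def)
  have v1: "nvar s1 ''_n'' = k + s" "nvar s1 ''_c1'' = 1" "nvar s1 ''k'' = k" "nvar s1 ''s'' = s"
    using r0 s by (auto simp: s1_def)
  have sU1: "store k m ''U'' s1 (\<lambda>i l. U $$ (i,l))" and sV1: "store k n ''V'' s1 (\<lambda>i l. V $$ (i,l))"
    using sU sV store_agree[OF a1] by (simp_all add: store_names_def)
  have d1: "holds_sparse ''D'' ds s1" "holds_sparse ''E'' es s1" using ds(2) es(2) holds_sparse_agree[OF a1] by simp_all
  obtain s2 B2 where s2: "run svd (gram ''U'' ''D'') s1 (length ds * p ^ 2 * 1600 + p ^ 3 * 300) s2"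
    "agree (mods (gram ''U'' ''D'')) s1 s2"
    "is_svd (ZU\<^sup>T * ZU) (read_block ''PU'' p p s2) (read_block ''GU'' p p s2) B2"
    "\<forall>l<length ds. \<forall>j<p. rarr s2 ''zU'' l j = ZU $$ (fst (ds ! l), j)"
    by (rule runsE[OF runs_gram[OF svd _ sU1 v1(3) k v1(4,1) ds(1) d1(1) D' U], folded p_def ZU_def]) auto
  note a2 = agreeD[OF s2(2), unfolded mods_gram]
  have v2: "nvar s2 ''_n'' = k + s" "nvar s2 ''_c1'' = 1" "nvar s2 ''k'' = k" "nvar s2 ''s'' = s"
    by (simp_all add: a2 v1)
  have sU2: "store k m ''U'' s2 (\<lambda>i l. U $$ (i,l))" and sV2: "store k n ''V'' s2 (\<lambda>i l. V $$ (i,l))"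
    using sU1 sV1 store_agree[OF s2(2)] by (simp_all add: mods_gram store_names_def)
  have d2: "holds_sparse ''D'' ds s2" "holds_sparse ''E'' es s2" using d1 holds_sparse_agree[OF s2(2)] by (simp_all add: mods_gram)
  obtain s3 B3 where s3: "run svd (gram ''V'' ''E'') s2 (length es * p ^ 2 * 1600 + p ^ 3 * 300) s3"
    "agree (mods (gram ''V'' ''E'')) s2 s3"
    "is_svd (ZV\<^sup>T * ZV) (read_block ''PV'' p p s3) (read_block ''GV'' p p s3) B3"
    "\<forall>l<length es. \<forall>j<p. rarr s3 ''zV'' l j = ZV $$ (fst (es ! l), j)"
    by (rule runsE[OF runs_gram[OF svd _ sV2 v2(3) k v2(4,1) es(1) d2(2) E' V], folded p_def ZV_def]) auto
  note a3 = agreeD[OF s3(2), unfolded mods_gram]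
  have v3: "nvar s3 ''_n'' = p" "nvar s3 ''_c1'' = 1" "nvar s3 ''k'' = k" "nvar s3 ''m'' = m" "nvar s3 ''n'' = n"
    "rarr s3 ''Sigma'' = rarr st ''Sigma''"
    by (simp_all add: a3 v2 p_def) (simp_all add: a2 agreeD[OF a1] r0)
  have sU3: "store k m ''U'' s3 (\<lambda>i l. U $$ (i,l))" and sV3: "store k n ''V'' s3 (\<lambda>i l. V $$ (i,l))"
    using sU2 sV2 store_agree[OF s3(2)] by (simp_all add: mods_gram store_names_def)
  have d3: "holds_sparse ''D'' ds s3" "holds_sparse ''E'' es s3" using d2 holds_sparse_agree[OF s3(2)] by (simp_all add: mods_gram)
  have z3: "rarr s3 ''zU'' = rarr s2 ''zU''" "rarr s3 ''PU'' = rarr s2 ''PU''" "rarr s3 ''GU'' = rarr s2 ''GU''"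
    by (simp_all add: a3)
  define AU where "AU = read_block ''PU'' p p s3"
  define AV where "AV = read_block ''PV'' p p s3"
  define su where "su = (\<lambda>i. rarr s3 ''GU'' i i)"
  define sv where "sv = (\<lambda>i. rarr s3 ''GV'' i i)"
  have bU: "read_block ''PU'' p p s2 = AU" "read_block ''GU'' p p s2 = read_block ''GU'' p p s3"
    by (simp_all add: AU_def read_block_def z3)
  have ZZ: "ZU\<^sup>T * ZU \<in> carrier_mat p p" "ZV\<^sup>T * ZV \<in> carrier_mat p p" using ZU ZV by auto
  have GU: "read_block ''GU'' p p s3 = dg p su"
  proof -
    have "read_block ''GU'' p p s3 = dg p (\<lambda>i. read_block ''GU'' p p s3 $$ (i,i))"
      using is_svd_square(7)[OF s2(3) ZZ(1)] unfolding bU .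
    also have "\<dots> = dg p su" by (rule dg_cong) (simp add: su_def)
    finally show ?thesis .
  qed
  have GV: "read_block ''GV'' p p s3 = dg p sv"
  proof -
    have "read_block ''GV'' p p s3 = dg p (\<lambda>i. read_block ''GV'' p p s3 $$ (i,i))"
      by (rule is_svd_square(7)[OF s3(3) ZZ(2)])
    also have "\<dots> = dg p sv" by (rule dg_cong) (simp add: sv_def)
    finally show ?thesis .
  qed
  let ?c4 = "Fill ''_K'' ''_n'' ''_c1'' (If (NLess (NVar ''_i'') (NVar ''k'')) (RAssign ''_a'' (RRead ''Sigma'' (NVar ''_i'') (NVar ''_i'')))
       (RAssign ''_a'' (RLit 1))) (RVar ''_a'')"
  define K where "K = (\<lambda>i. if i < k then S $$ (i,i) else 1)"
  have Sii: "rarr st ''Sigma'' i i = S $$ (i,i)" if "i < k" for i unfolding Sig[symmetric] using that by simp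
  have "runs svd ?c4 s3 (p * p * 85 + 6) (\<lambda>s'. \<forall>i j. rarr s' ''_K'' i j = (if i < p \<and> j < 1 then K i else rarr s3 ''_K'' i j))"
  proof (rule runs_Fill_straight, goal_cases)
    case (13 i j s')
    have "nvar s' ''k'' = k" "rarr s' ''Sigma'' = rarr st ''Sigma''" using agreeD[OF 13(3)] v3 by auto
    thus ?case using 13 Sii by (auto simp: K_def)
  qed (use v3 p in auto)
  then obtain s4 where s4: "run svd ?c4 s3 (p * p * 85 + 6) s4" "agree (mods ?c4) s3 s4"
    "\<forall>i j. rarr s4 ''_K'' i j = (if i < p \<and> j < 1 then K i else rarr s3 ''_K'' i j)" by (rule runsE)
  let ?e5 = "RMul (RMul (RMul (RSqrt (RRead ''GU'' (NVar ''_i'') (NVar ''_i''))) (RRead ''PU'' (NVar ''_l'') (NVar ''_i'')))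
            (RRead ''_K'' (NVar ''_l'') (NLit 0)))
         (RMul (RSqrt (RRead ''GV'' (NVar ''_j'') (NVar ''_j''))) (RRead ''PV'' (NVar ''_l'') (NVar ''_j'')))"
  let ?c5 = "Sum_Fill ''_M1'' ''_n'' ''_n'' ''_n'' ?e5"
  define M where "M = (dg p (\<lambda>i. sqrt (su i)) * AU\<^sup>T) * (dg p K * (dg p (\<lambda>i. sqrt (sv i)) * AV\<^sup>T)\<^sup>T)"
  have AUd: "dim_row AU = p" "dim_col AU = p" "dim_row AV = p" "dim_col AV = p" by (simp_all add: AU_def AV_def)
  have M: "M \<in> carrier_mat p p" using AUd by (auto simp: M_def intro!: carrier_matI)
  have Mi: "M $$ (i,j) = (\<Sum>l<p. sqrt (su i) * rarr s3 ''PU'' l i * K l * (sqrt (sv j) * rarr s3 ''PV'' l j))"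
    if "i < p" "j < p" for i j
    unfolding M_def using that AUd
    by (subst mult_mat_index) (auto simp: dg_mult_index AU_def AV_def intro!: sum.cong)
  have "runs svd ?c5 s4 (p * p ^ 2 * 80 + 6) (\<lambda>s'. \<forall>i j. rarr s' ''_M1'' i j = (if i < p \<and> j < p then
      \<Sum>l<p. sqrt (su i) * rarr s3 ''PU'' l i * K l * (sqrt (sv j) * rarr s3 ''PV'' l j) else rarr s4 ''_M1'' i j))"
  proof (rule runs_Sum_Fill, goal_cases)
    case (13 i j l s')
    have "rarr s' ''PU'' = rarr s3 ''PU''" "rarr s' ''PV'' = rarr s3 ''PV''" "rarr s' ''GU'' = rarr s3 ''GU''" "rarr s' ''GV'' = rarr s3 ''GV''"
      "rarr s' ''_K'' l 0 = K l"
      using agreeD[OF 13(4)] agreeD[OF s4(2)] s4(3) 13(3) by auto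
    thus ?case using 13 by (simp add: su_def sv_def)
  qed (use agreeD[OF s4(2)] v3 p in auto)
  then obtain s5 where s5: "run svd ?c5 s4 (p * p ^ 2 * 80 + 6) s5" "agree (mods ?c5) s4 s5"
    "\<forall>i j. rarr s5 ''_M1'' i j = (if i < p \<and> j < p then
      \<Sum>l<p. sqrt (su i) * rarr s3 ''PU'' l i * K l * (sqrt (sv j) * rarr s3 ''PV'' l j) else rarr s4 ''_M1'' i j)" by (rule runsE)
  have M5: "read_block ''_M1'' p p s5 = M" by (rule read_block_eqI[OF M]) (use s5(3) Mi in simp)
  have a5: "agree {''_K'', ''_i'', ''_j'', ''_a'', ''_l'', ''_M1''} s3 s5" by (rule agree_trans[OF s4(2) s5(2)]) auto
  let ?c6 = "SVD (NVar ''_n'') ''_M1'' ''_A1'' ''_S1'' ''_B1''"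
  have "runs svd ?c6 s5 (1 + ncost (NVar ''_n'') + p ^ 3) (\<lambda>s'. is_svd (read_block ''_M1'' p p s5) (read_block ''_A1'' p p s')
      (read_block ''_S1'' p p s') (read_block ''_B1'' p p s'))"
    by (rule runs_SVD[OF svd]) (use agreeD[OF a5] v3 in auto)
  then obtain s6 where s6: "run svd ?c6 s5 (1 + ncost (NVar ''_n'') + p ^ 3) s6" "agree (mods ?c6) s5 s6"
    "is_svd (read_block ''_M1'' p p s5) (read_block ''_A1'' p p s6) (read_block ''_S1'' p p s6) (read_block ''_B1'' p p s6)" by (rule runsE)
  have a6: "agree {''_K'', ''_i'', ''_j'', ''_a'', ''_l'', ''_M1'', ''_A1'', ''_S1'', ''_B1''} s3 s6" by (rule agree_trans[OF a5 s6(2)]) auto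
  define A where "A = read_block ''_A1'' p p s6"
  define B where "B = read_block ''_B1'' p p s6"
  define \<sigma> where "\<sigma> = (\<lambda>i. rarr s6 ''_S1'' i i)"
  note svdM0 = s6(3)[unfolded M5]
  have S6: "read_block ''_S1'' p p s6 = dg p \<sigma>"
  proof -
    have "read_block ''_S1'' p p s6 = dg p (\<lambda>i. read_block ''_S1'' p p s6 $$ (i,i))"
      by (rule is_svd_square(7)[OF svdM0 M])
    also have "\<dots> = dg p \<sigma>" by (rule dg_cong) (simp add: \<sigma>_def)
    finally show ?thesis .
  qed
  have svdM: "is_svd M A (dg p \<sigma>) B" using svdM0 unfolding S6 A_def B_def .
  have \<sigma>0: "0 \<le> \<sigma> i" if "i < p" for i using is_svd_square(9)[OF svdM M that] that by (simp add: dg_index)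
  have v6: "nvar s6 ''_n'' = p" "nvar s6 ''_c1'' = 1" "nvar s6 ''k'' = k" using agreeD[OF a6] v3 by auto
  have GU6: "read_block ''GU'' p p s6 = dg p su" "read_block ''PU'' p p s6 = AU" "read_block ''GV'' p p s6 = dg p sv" "read_block ''PV'' p p s6 = AV"
    using GU GV read_block_agree[OF a6] by (simp_all add: AU_def AV_def)
  obtain s7 AU' SU' BU' where s7: "run svd (transfer_factor ''U'' ''_A1'') s6 (p ^ 3 * 700) s7" "agree (mods (transfer_factor ''U'' ''_A1'')) s6 s7"
    "is_svd (dg p (\<lambda>i. su i / su i) - A * (dg p (\<lambda>i. \<sigma> i / \<sigma> i) * A\<^sup>T)) AU' SU' BU'"
    "read_block ''YU'' p k s7 = AU * dg p (\<lambda>i. 1 / sqrt (su i)) * mixed_cols p k \<sigma> A AU'"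
  proof (rule runsE[OF runs_transfer_factor[OF svd, of "''_A1''" s6 k p "''U''" su \<sigma>]])
    fix s7 assume "\<exists>A' S' B'. is_svd (dg p (\<lambda>i. su i / su i) - read_block ''_A1'' p p s6 * (dg p (\<lambda>i. \<sigma> i / \<sigma> i) * (read_block ''_A1'' p p s6)\<^sup>T)) A' S' B' \<and>
       read_block ''YU'' p k s7 = read_block ''PU'' p p s6 * dg p (\<lambda>i. 1 / sqrt (su i)) * mixed_cols p k \<sigma> (read_block ''_A1'' p p s6) A'"
      "run svd (transfer_factor ''U'' ''_A1'') s6 (p ^ 3 * 700) s7" "agree (mods (transfer_factor ''U'' ''_A1'')) s6 s7"
    thus thesis using that unfolding A_def[symmetric] GU6 by blast
  qed (use v6 k p GU6 \<sigma>0 in \<open>auto simp: \<sigma>_def\<close>)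
  note a7 = agreeD[OF s7(2), unfolded mods_transfer_factor]
  have v7: "nvar s7 ''_n'' = p" "nvar s7 ''_c1'' = 1" "nvar s7 ''k'' = k" "rarr s7 ''_S1'' = rarr s6 ''_S1''" by (simp_all add: a7 v6)
  have B7: "read_block ''_B1'' p p s7 = B" "read_block ''GV'' p p s7 = dg p sv" "read_block ''PV'' p p s7 = AV"
    using GU6 by (simp_all add: B_def read_block_def a7)
  obtain s8 AV' SV' BV' where s8: "run svd (transfer_factor ''V'' ''_B1'') s7 (p ^ 3 * 700) s8" "agree (mods (transfer_factor ''V'' ''_B1'')) s7 s8"
    "is_svd (dg p (\<lambda>i. sv i / sv i) - B * (dg p (\<lambda>i. \<sigma> i / \<sigma> i) * B\<^sup>T)) AV' SV' BV'"
    "read_block ''YV'' p k s8 = AV * dg p (\<lambda>i. 1 / sqrt (sv i)) * mixed_cols p k \<sigma> B AV'"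
  proof (rule runsE[OF runs_transfer_factor[OF svd, of "''_B1''" s7 k p "''V''" sv \<sigma>]])
    fix s8 assume "\<exists>A' S' B'. is_svd (dg p (\<lambda>i. sv i / sv i) - read_block ''_B1'' p p s7 * (dg p (\<lambda>i. \<sigma> i / \<sigma> i) * (read_block ''_B1'' p p s7)\<^sup>T)) A' S' B' \<and>
       read_block ''YV'' p k s8 = read_block ''PV'' p p s7 * dg p (\<lambda>i. 1 / sqrt (sv i)) * mixed_cols p k \<sigma> (read_block ''_B1'' p p s7) A'"
      "run svd (transfer_factor ''V'' ''_B1'') s7 (p ^ 3 * 700) s8" "agree (mods (transfer_factor ''V'' ''_B1'')) s7 s8"
    thus thesis using that unfolding B7 by blast
  qed (use v7 k p B7 \<sigma>0 in \<open>auto simp: \<sigma>_def\<close>)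
  note a8 = agreeD[OF s8(2), unfolded mods_transfer_factor]
  have a38: "agree ({''_K'', ''_i'', ''_j'', ''_a'', ''_l'', ''_M1'', ''_A1'', ''_S1'', ''_B1''} \<union> mods (transfer_factor ''U'' ''_A1'') \<union> mods (transfer_factor ''V'' ''_B1'')) s3 s8"
    by (rule agree_trans[OF agree_trans[OF a6 s7(2) subset_refl] s8(2)]) auto
  note a38' = agreeD[OF a38, unfolded mods_transfer_factor]
  have v8: "nvar s8 ''_n'' = k + s" "nvar s8 ''_c1'' = 1" "nvar s8 ''k'' = k" "nvar s8 ''m'' = m" "nvar s8 ''n'' = n"
    "rarr s8 ''zU'' = rarr s3 ''zU''" "rarr s8 ''zV'' = rarr s3 ''zV''" "rarr s8 ''_S1'' = rarr s6 ''_S1''"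
    "rarr s8 ''YU'' = rarr s7 ''YU''"
    by (simp_all add: a38' v3 p_def) (simp_all add: a8 v7)
  have sU8: "store k m ''U'' s8 (\<lambda>i l. U $$ (i,l))" and sV8: "store k n ''V'' s8 (\<lambda>i l. V $$ (i,l))"
    using sU3 sV3 store_agree[OF a38] by (simp_all add: mods_transfer_factor store_names_def)
  have d8: "holds_sparse ''D'' ds s8" "holds_sparse ''E'' es s8" using d3 holds_sparse_agree[OF a38] by (simp_all add: mods_transfer_factor)
  define YU where "YU = AU * dg p (\<lambda>i. 1 / sqrt (su i)) * mixed_cols p k \<sigma> A AU'"
  define YV where "YV = AV * dg p (\<lambda>i. 1 / sqrt (sv i)) * mixed_cols p k \<sigma> B AV'"
  have YU8: "read_block ''YU'' p k s8 = YU" using s7(4) by (simp add: read_block_def v8 YU_def)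
  have YV8: "read_block ''YV'' p k s8 = YV" using s8(4) by (simp add: YV_def)
  obtain s9 where s9: "run svd (update_rows ''U'' ''D'') s8 (length ds * p ^ 2 * 500 + p ^ 3 * 2200) s9" "agree (mods (update_rows ''U'' ''D'')) s8 s9"
    "store k m ''U'' s9 (\<lambda>i l. (ZU * YU) $$ (i,l))"
    using runs_update_rows[OF svd _ sU8 v8(3) k v8(1,2) ds(1) d8(1) D' U(1), folded p_def ZU_def, unfolded YU8]
      s2(4) z3 v8 by (auto elim!: runsE)
  note a9 = agreeD[OF s9(2), unfolded mods_update_rows store_names_def]
  have v9: "nvar s9 ''_n'' = k + s" "nvar s9 ''_c1'' = 1" "nvar s9 ''k'' = k" "nvar s9 ''m'' = m" "nvar s9 ''n'' = n"
    "rarr s9 ''zV'' = rarr s3 ''zV''" "rarr s9 ''_S1'' = rarr s6 ''_S1''" "rarr s9 ''YV'' = rarr s8 ''YV''"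
    by (simp_all add: a9 v8)
  have sV9: "store k n ''V'' s9 (\<lambda>i l. V $$ (i,l))"
    using sV8 store_agree[OF s9(2)] by (simp add: mods_update_rows store_names_def)
  have d9: "holds_sparse ''E'' es s9" using d8 holds_sparse_agree[OF s9(2)] by (simp add: mods_update_rows store_names_def)
  have YV9: "read_block ''YV'' p k s9 = YV" using YV8 by (simp add: read_block_def v9)
  obtain s10 where s10: "run svd (update_rows ''V'' ''E'') s9 (length es * p ^ 2 * 500 + p ^ 3 * 2200) s10" "agree (mods (update_rows ''V'' ''E'')) s9 s10"
    "store k n ''V'' s10 (\<lambda>i l. (ZV * YV) $$ (i,l))"
    using runs_update_rows[OF svd _ sV9 v9(3) k v9(1,2) es(1) d9 E' V(1), folded p_def ZV_def, unfolded YV9]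
      s3(4) v9 by (auto elim!: runsE)
  note a10 = agreeD[OF s10(2), unfolded mods_update_rows store_names_def]
  have v10: "nvar s10 ''k'' = k" "nvar s10 ''m'' = m" "nvar s10 ''n'' = n" "rarr s10 ''_S1'' = rarr s6 ''_S1''"
    by (simp_all add: a10 v9)
  have sU10: "store k m ''U'' s10 (\<lambda>i l. (ZU * YU) $$ (i,l))"
    using s9(3) store_agree[OF s10(2)] by (simp add: mods_update_rows store_names_def)
  let ?c11 = "Fill ''Sigma'' ''k'' ''k'' Skip (RRead ''_S1'' (NVar ''_i'') (NVar ''_j''))"
  have "runs svd ?c11 s10 (p * p * 85 + 6) (\<lambda>s'. \<forall>i j. rarr s' ''Sigma'' i j = (if i < k \<and> j < k then rarr s6 ''_S1'' i j else rarr s10 ''Sigma'' i j))"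
  proof (rule runs_Fill_straight, goal_cases)
    case (13 i j s')
    thus ?case using agreeD[OF 13(3)] v10 by simp
  qed (use v10 p in auto)
  then obtain s11 where s11: "run svd ?c11 s10 (p * p * 85 + 6) s11" "agree (mods ?c11) s10 s11"
    "\<forall>i j. rarr s11 ''Sigma'' i j = (if i < k \<and> j < k then rarr s6 ''_S1'' i j else rarr s10 ''Sigma'' i j)" by (rule runsE)
  have trunc: "is_truncated_svd k (U * S * V\<^sup>T + D * E\<^sup>T) (ZU * YU) (dg k \<sigma>) (ZV * YV)"
    unfolding ZU_def ZV_def YU_def YV_def
  proof (rule low_rank_update_svd[OF triple D' E' p_def])
    show "is_svd ((append_cols U D)\<^sup>T * append_cols U D) AU (dg p su) B2"
      using s2(3) unfolding bU GU ZU_def .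
    show "is_svd ((append_cols V E)\<^sup>T * append_cols V E) AV (dg p sv) B3"
      using s3(3) unfolding GV ZV_def AV_def .
    show "is_svd (dg p (\<lambda>i. sqrt (su i)) * AU\<^sup>T * (dg p (\<lambda>i. if i < k then S $$ (i, i) else 1) * (dg p (\<lambda>i. sqrt (sv i)) * AV\<^sup>T)\<^sup>T)) A (dg p \<sigma>) B"
      using svdM unfolding M_def K_def .
  qed (fact s7(3) s8(3))+
  have dims: "dim_row (U * S * V\<^sup>T + D * E\<^sup>T) = m" "dim_col (U * S * V\<^sup>T + D * E\<^sup>T) = n" "dim_row (ZU * YU) = m" "dim_row (ZV * YV) = n"
    using D' E' ZU ZV by auto
  have "represents k s11 (ZU * YU) (dg k \<sigma>) (ZV * YV)"
    unfolding represents_def dims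
  proof (intro conjI)
    show "svd_triple k m n (ZU * YU) (dg k \<sigma>) (ZV * YV)" using is_truncated_svd_imp_svd_triple[OF trunc] unfolding dims .
    show "nvar s11 ''k'' = k" "nvar s11 ''m'' = m" "nvar s11 ''n'' = n" using agreeD[OF s11(2)] v10 by auto
    show "store k m ''U'' s11 (\<lambda>i l. (ZU * YU) $$ (i,l))" using sU10 store_agree[OF s11(2)] by (simp add: store_names_def)
    show "store k n ''V'' s11 (\<lambda>i l. (ZV * YV) $$ (i,l))" using s10(3) store_agree[OF s11(2)] by (simp add: store_names_def)
    show "read_block ''Sigma'' k k s11 = dg k \<sigma>"
    proof (rule read_block_eqI)
      fix i j assume ij: "i < k" "j < k"
      have "read_block ''_S1'' p p s6 $$ (i,j) = dg p \<sigma> $$ (i,j)" unfolding S6 ..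
      thus "rarr s11 ''Sigma'' i j = dg k \<sigma> $$ (i,j)" using s11(3) ij p by (simp add: dg_index)
    qed (auto intro!: carrier_matI)
  qed
  hence post: "\<exists>U' S' V'. is_truncated_svd k (U * S * V\<^sup>T + D * E\<^sup>T) U' S' V' \<and> represents k s11 U' S' V'" using trunc by blast
  have bound: "6 + ((length ds * p ^ 2 * 1600 + p ^ 3 * 300) + ((length es * p ^ 2 * 1600 + p ^ 3 * 300) + ((p * p * 85 + 6) + ((p * p ^ 2 * 80 + 6) +
     ((1 + ncost (NVar ''_n'') + p ^ 3) + (p ^ 3 * 700 + (p ^ 3 * 700 + ((length ds * p ^ 2 * 500 + p ^ 3 * 2200) + ((length es * p ^ 2 * 500 + p ^ 3 * 2200) + (p * p * 85 + 6))))))))))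
     \<le> 7000 * ((nnz D + nnz E) * (s + k) ^ 2 + (s + k) ^ 3)"
  proof -
    have 1: "p * p \<le> p ^ 3" "1 \<le> p ^ 3" using p by (auto simp: power3_eq_cube)
    have 2: "p * p ^ 2 = p ^ 3" by (simp add: power2_eq_square power3_eq_cube)
    have 3: "nnz D = length ds" "nnz E = length es" "s + k = p" using sparse_length[OF ds(1)] sparse_length[OF es(1)] by (auto simp: p_def)
    have "\<And>P Q x y :: nat. Q \<le> P \<Longrightarrow> 1 \<le> P \<Longrightarrow> 6 + ((x * 1600 + P * 300) + ((y * 1600 + P * 300) + ((Q * 85 + 6) + ((P * 80 + 6) +
     ((1 + ncost (NVar ''_n'') + P) + (P * 700 + (P * 700 + ((x * 500 + P * 2200) + ((y * 500 + P * 2200) + (Q * 85 + 6))))))))))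
     \<le> 7000 * ((x + y) + P)" by simp
    from this[OF 1] show ?thesis unfolding 2 3 add_mult_distrib .
  qed
  show ?thesis unfolding low_rank_update_def seq.simps
    by (rule runsI[OF run_Seq[OF r1 run_Seq[OF s2(1) run_Seq[OF s3(1) run_Seq[OF s4(1) run_Seq[OF s5(1) run_Seq[OF s6(1)
      run_Seq[OF s7(1) run_Seq[OF s8(1) run_Seq[OF s9(1) run_Seq[OF s10(1) s11(1)]]]]]]]]]]]) (fact bound post)+
qed

section \<open>The operations\<close>

definition unit_embedding :: "nat \<Rightarrow> nat \<Rightarrow> real mat" where
  "unit_embedding r s = mat (r + s) s (\<lambda>(i,j). if i = r + j then 1 else 0)"

definition unit_embedding_list :: "nat \<Rightarrow> nat \<Rightarrow> sparse" where
  "unit_embedding_list r s = map (\<lambda>i. (r + i, i, 1)) [0..<s]"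

definition pad_rows :: "nat \<Rightarrow> real mat \<Rightarrow> real mat" where
  "pad_rows s U = mat (dim_row U + s) (dim_col U) (\<lambda>(i,j). if i < dim_row U then U $$ (i,j) else 0)"

lemma unit_embedding_list_sparse: "is_sparse_form (unit_embedding_list r s) (unit_embedding r s)"
proof -
  have "set (unit_embedding_list r s) = {(i, j, unit_embedding r s $$ (i,j)) | i j. i < dim_row (unit_embedding r s) \<and> j < dim_col (unit_embedding r s) \<and> unit_embedding r s $$ (i,j) \<noteq> 0}"
    by (auto simp: unit_embedding_list_def unit_embedding_def split: if_splits)
  thus ?thesis by (auto simp: is_sparse_form_def unit_embedding_list_def distinct_map inj_on_def)
qed

lemma length_unit_embedding_list [simp]: "length (unit_embedding_list r s) = s"
  by (simp add: unit_embedding_list_def)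

lemma nnz_unit_embedding: "nnz (unit_embedding r s) = s"
  using sparse_length[OF unit_embedding_list_sparse, of r s] by simp

lemma swap_sparse:
  assumes "is_sparse_form es X"
  shows "is_sparse_form (map (\<lambda>(i,j,x). (j,i,x)) es) (X\<^sup>T)"
proof -
  have "inj_on (\<lambda>(i,j,x). (j,i,x :: real)) (set es)" by (auto simp: inj_on_def)
  moreover have "(\<lambda>(i,j,x). (j,i,x)) ` set es = {(i, j, X\<^sup>T $$ (i,j)) | i j. i < dim_row X\<^sup>T \<and> j < dim_col X\<^sup>T \<and> X\<^sup>T $$ (i,j) \<noteq> 0}"
  proof -
    have S: "set es = {(i, j, X $$ (i,j)) | i j. i < dim_row X \<and> j < dim_col X \<and> X $$ (i,j) \<noteq> 0}"
      using assms by (simp add: is_sparse_form_def)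
    show ?thesis unfolding S
    proof (intro equalityI subsetI)
      fix a assume "a \<in> {(i, j, X\<^sup>T $$ (i,j)) | i j. i < dim_row X\<^sup>T \<and> j < dim_col X\<^sup>T \<and> X\<^sup>T $$ (i,j) \<noteq> 0}"
      then obtain i j where a: "a = (i, j, X $$ (j,i))" "j < dim_row X" "i < dim_col X" "X $$ (j,i) \<noteq> 0" by auto
      thus "a \<in> (\<lambda>(i,j,x). (j,i,x)) ` {(i, j, X $$ (i,j)) | i j. i < dim_row X \<and> j < dim_col X \<and> X $$ (i,j) \<noteq> 0}"
        by (intro image_eqI[of _ _ "(j, i, X $$ (j,i))"]) auto
    qed auto
  qed
  ultimately show ?thesis using assms by (auto simp: is_sparse_form_def distinct_map)
qed

lemma pad_rows_orthonormal:
  assumes "U \<in> carrier_mat m k" "U\<^sup>T * U = 1\<^sub>m k"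
  shows "pad_rows s U \<in> carrier_mat (m + s) k" "(pad_rows s U)\<^sup>T * pad_rows s U = 1\<^sub>m k"
proof -
  show c: "pad_rows s U \<in> carrier_mat (m + s) k" using assms(1) by (simp add: pad_rows_def)
  show "(pad_rows s U)\<^sup>T * pad_rows s U = 1\<^sub>m k"
    unfolding orthonormal_iff[OF c] sum_lessThan_add
    using orthonormal_iff[THEN iffD1, OF assms] assms(1) by (simp add: pad_rows_def)
qed

text \<open>The embedding selects row \<open>l\<close> of \<open>E\<close> for position
  \<open>m + l\<close> and contributes nothing above, exactly where the padded factor is zero and
  nonzero respectively.\<close>

lemma pad_rows_mult:
  assumes U: "U \<in> carrier_mat m k" and B: "B \<in> carrier_mat k n" and E: "E \<in> carrier_mat s n"
  shows "pad_rows s U * B + unit_embedding m s * E = (U * B) @\<^sub>r E"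
proof (rule eq_matI)
  fix i j assume "i < dim_row ((U * B) @\<^sub>r E)" "j < dim_col ((U * B) @\<^sub>r E)"
  hence ij: "i < m + s" "j < n" using U B E by (auto simp: append_rows_def)
  have r: "((U * B) @\<^sub>r E) $$ (i,j) = (if i < m then (U * B) $$ (i,j) else E $$ (i - m, j))"
    using ij U B E by (auto simp: append_rows_def)
  have p: "(pad_rows s U * B) $$ (i,j) = (if i < m then (U * B) $$ (i,j) else 0)"
    using ij U B by (simp add: mult_mat_index pad_rows_def)
  have e: "(unit_embedding m s * E) $$ (i,j) = (if i < m then 0 else E $$ (i - m, j))"
  proof -
    have "(unit_embedding m s * E) $$ (i,j) = (\<Sum>l<s. if l = i - m \<and> m \<le> i then E $$ (l,j) else 0)"
      using ij E by (simp add: mult_mat_index unit_embedding_def) (intro sum.cong; auto)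
    also have "\<dots> = (if i < m then 0 else E $$ (i - m, j))" using ij by auto
    finally show ?thesis .
  qed
  show "(pad_rows s U * B + unit_embedding m s * E) $$ (i,j) = ((U * B) @\<^sub>r E) $$ (i,j)"
    using ij U B E p e r by (simp add: pad_rows_def unit_embedding_def)
qed (use U B E in \<open>auto simp: append_rows_def pad_rows_def unit_embedding_def\<close>)

lemma append_cols_transpose:
  assumes "A \<in> carrier_mat m n" "B \<in> carrier_mat m s"
  shows "(A\<^sup>T @\<^sub>r B\<^sup>T)\<^sup>T = append_cols A B"
  using assms by (intro eq_matI) (auto simp: append_rows_def append_cols_def)

text \<open>The list of the unit embedding is written alongside the zero rows. The register
  \<open>m\<close> grows only after the loop, because the positions of the new rows are computed
  from its old value.\<close>

definition pad :: "string \<Rightarrow> string \<Rightarrow> string \<Rightarrow> com" where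
  "pad X m L = seq [
     For ''_j'' ''k'' (RWrite ''_p'' (NLit 0) (NVar ''_j'') (RLit 0)),
     For ''_e'' ''s'' (seq [
       Seq (NAssign ''_r'' (NAdd (NVar m) (NVar ''_e'')))
         (Seq (NWrite L (NVar ''_e'') (NLit 0) (NVar ''_r'')) (Seq (NWrite L (NVar ''_e'') (NLit 1) (NVar ''_e'')) (RWrite L (NVar ''_e'') (NLit 0) (RLit 1)))),
       put X]),
     Seq (NAssign m (NAdd (NVar m) (NVar ''s''))) (NAssign L (NVar ''s''))]"

lemma mods_pad: "mods (pad X m L) = {''_j'', ''_p'', ''_e'', ''_r'', L, m, ''_1'', ''_i'', ''_l'', ''_a'', ''_q'', CHR ''x'' # X, CHR ''t'' # X}"
  by (auto simp: pad_def mods_put)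

lemma runs_pad:
  assumes mL: "(m, L) = (''m'', ''D'') \<or> (m, L) = (''n'', ''E'')"
    and store: "store k r X st (\<lambda>i l. U $$ (i,l))" and U: "U \<in> carrier_mat r k"
    and k: "nvar st ''k'' = k" "0 < k" and s: "nvar st ''s'' = s" and r: "nvar st m = r"
  shows "runs svd (pad X m L) st ((s + k) ^ 3 * 300)
    (\<lambda>s'. store k (r + s) X s' (\<lambda>i l. pad_rows s U $$ (i,l)) \<and> nvar s' m = r + s \<and> holds_sparse L (unit_embedding_list r s) s')"
proof -
  have Lx: "L \<noteq> CHR ''_'' # x" "L \<notin> store_names X" "CHR ''_'' # x \<noteq> L" "L \<noteq> ''k''" "L \<noteq> ''s''" "''k'' \<noteq> L" "''s'' \<noteq> L" "L \<noteq> m" "m \<noteq> L"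
    "m \<noteq> CHR ''_'' # x" "m \<notin> store_names X" "CHR ''_'' # x \<noteq> m" for x using mL by (auto simp: store_names_def)
  have Ls: "L \<noteq> CHR ''x'' # X" "L \<noteq> CHR ''t'' # X" "m \<noteq> CHR ''x'' # X" "m \<noteq> CHR ''t'' # X" using Lx by (auto simp: store_names_def)
  let ?c1 = "For ''_j'' ''k'' (RWrite ''_p'' (NLit 0) (NVar ''_j'') (RLit 0))"
  have "runs svd ?c1 st (k * (10 + 8) + 6) (\<lambda>s'. \<forall>l<k. rarr s' ''_p'' 0 l = 0)"
  proof (rule runs_For[where n = k and I = "\<lambda>q s'. \<forall>l<q. rarr s' ''_p'' 0 l = 0"], goal_cases)
    case (6 q s')
    thus ?case by (intro runs_straight) (auto simp: set_cell_def less_Suc_eq)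
  qed (use k in auto)
  then obtain s1 where s1: "run svd ?c1 st (k * (10 + 8) + 6) s1" "agree (mods ?c1) st s1" "\<forall>l<k. rarr s1 ''_p'' 0 l = 0" by (rule runsE)
  note a1 = agreeD[OF s1(2)]
  have v1: "nvar s1 ''k'' = k" "nvar s1 ''s'' = s" "nvar s1 m = r" using a1 k s r Lx by auto
  have st1: "store k r X s1 (\<lambda>i l. pad_rows s U $$ (i,l))"
  proof (rule store_cong)
    show "store k r X s1 (\<lambda>i l. U $$ (i,l))" using store store_agree[OF s1(2)] by (simp add: store_names_def)
  qed (use U in \<open>auto simp: pad_rows_def\<close>)
  let ?w = "Seq (NAssign ''_r'' (NAdd (NVar m) (NVar ''_e'')))
         (Seq (NWrite L (NVar ''_e'') (NLit 0) (NVar ''_r'')) (Seq (NWrite L (NVar ''_e'') (NLit 1) (NVar ''_e'')) (RWrite L (NVar ''_e'') (NLit 0) (RLit 1))))"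
  let ?c2 = "For ''_e'' ''s'' (Seq ?w (put X))"
  define I where "I = (\<lambda>q s'. store k (r + q) X s' (\<lambda>i l. pad_rows s U $$ (i,l)) \<and> (\<forall>l<q. narr s' L l 0 = r + l \<and> narr s' L l 1 = l \<and> rarr s' L l 0 = 1))"
  have I_set: "I q (set_nvar ''_e'' v s') \<longleftrightarrow> I q s'" for q v s'
    using store_agree[of "{''_e''}" s' "set_nvar ''_e'' v s'" X] by (simp add: I_def agree_def store_names_def)
  have "runs svd ?c2 s1 (s * ((20 + k ^ 2 * 200) + 8) + 6) (I s)"
  proof (rule runs_For[where n = s and I = I], goal_cases)
    case 5 show ?case unfolding I_set using st1 by (simp add: I_def)
  next
    case (6 q s2)
    have f2: "nvar s2 m = r" "nvar s2 ''k'' = k" "rarr s2 ''_p'' = rarr s1 ''_p''"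
      using agreeD[OF 6(3)] v1 Lx Ls by (auto simp: mods_put)
    define s3 where "s3 = effect ?w s2"
    have r3: "run svd ?w s2 20 s3" unfolding s3_def by (rule run_straight) auto
    have a3: "agree {''_r'', L} s2 s3" by (auto simp: s3_def agree_def set_cell_def)
    have f3: "nvar s3 ''_r'' = r + q" "nvar s3 ''k'' = k" "rarr s3 ''_p'' = rarr s1 ''_p''"
      "\<forall>l<Suc q. narr s3 L l 0 = r + l \<and> narr s3 L l 1 = l \<and> rarr s3 L l 0 = 1"
      using f2 6(2,4) Lx by (auto simp: s3_def set_cell_def I_def less_Suc_eq)
    have st3: "store k (r + q) X s3 (\<lambda>i l. pad_rows s U $$ (i,l))"
      using 6(2) store_agree[OF a3, of X] Lx by (simp add: I_def store_names_def)
    have "runs svd (put X) s3 (k ^ 2 * 200) (\<lambda>s'. store k (max (r + q) (Suc (r + q))) X s' ((\<lambda>i l. pad_rows s U $$ (i,l))(r + q := rarr s3 ''_p'' 0)))"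
      by (rule runs_put[OF st3 f3(2) k(2) f3(1)]) simp
    hence "runs svd (put X) s3 (k ^ 2 * 200) (\<lambda>s'. I (Suc q) (set_nvar ''_e'' (Suc q) s'))"
    proof (rule runs_weaken)
      fix s' assume st': "store k (max (r + q) (Suc (r + q))) X s' ((\<lambda>i l. pad_rows s U $$ (i,l))(r + q := rarr s3 ''_p'' 0))"
        and a': "agree (mods (put X)) s3 s'"
      have mx: "max (r + q) (Suc (r + q)) = r + Suc q" by simp
      have "store k (r + Suc q) X s' (\<lambda>i l. pad_rows s U $$ (i,l))"
        by (rule store_cong[OF st'[unfolded mx]]) (use U s1(3) f3(3) 6(1) in \<open>auto simp: pad_rows_def\<close>)
      moreover have "narr s' L = narr s3 L" "rarr s' L = rarr s3 L"
        using agreeD[OF a', of L] Lx Ls by (auto simp: mods_put)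
      ultimately show "I (Suc q) (set_nvar ''_e'' (Suc q) s')" unfolding I_set using f3(4) by (simp add: I_def)
    qed simp
    from run_runs_Seq[OF r3 this] show ?case .
  qed (use v1 Lx in \<open>auto simp: mods_put\<close>)
  then obtain s2 where s2: "run svd ?c2 s1 (s * ((20 + k ^ 2 * 200) + 8) + 6) s2" "agree (mods ?c2) s1 s2" "I s s2" by (rule runsE)
  have v2: "nvar s2 ''s'' = s" "nvar s2 m = r" using agreeD[OF s2(2)] v1 Lx Ls by (auto simp: mods_put)
  let ?c3 = "Seq (NAssign m (NAdd (NVar m) (NVar ''s''))) (NAssign L (NVar ''s''))"
  define s3 where "s3 = effect ?c3 s2"
  have r3: "run svd ?c3 s2 10 s3" unfolding s3_def by (rule run_straight) auto
  have a3: "agree {m, L} s2 s3" by (auto simp: s3_def agree_def)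
  have "store k (r + s) X s3 (\<lambda>i l. pad_rows s U $$ (i,l))"
    using s2(3) store_agree[OF a3, of X] Lx by (simp add: I_def)
  moreover have "nvar s3 m = r + s" "holds_sparse L (unit_embedding_list r s) s3"
    using v2 Lx s2(3) mL by (auto simp: s3_def holds_sparse_def unit_embedding_list_def I_def)
  moreover have "(k * (10 + 8) + 6) + ((s * ((20 + k ^ 2 * 200) + 8) + 6) + 10) \<le> (s + k) ^ 3 * 300"
  proof -
    define p where "p = s + k"
    have "p \<le> p ^ 3" by (rule self_le_power) (use k in \<open>auto simp: p_def\<close>)
    hence p: "k ^ 2 \<le> p ^ 2" "s \<le> p" "1 \<le> p ^ 2" "1 \<le> p ^ 3" "k \<le> p ^ 3"
      using k by (auto simp: p_def power_mono)
    have "\<And>P Q :: nat. Q \<le> P \<Longrightarrow> 1 \<le> P \<Longrightarrow> (20 + Q * 200) + 8 \<le> P * 228" by simp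
    from this[OF p(1,3)] have "s * ((20 + k ^ 2 * 200) + 8) \<le> p * (p ^ 2 * 228)" by (rule mult_le_mono[OF p(2)])
    also have "\<dots> = p ^ 3 * 228" by (simp add: power2_eq_square power3_eq_cube)
    finally have 1: "s * ((20 + k ^ 2 * 200) + 8) \<le> p ^ 3 * 228" .
    have "\<And>P T :: nat. T \<le> P * 228 \<Longrightarrow> 1 \<le> P \<Longrightarrow> k \<le> P \<Longrightarrow> (k * (10 + 8) + 6) + ((T + 6) + 10) \<le> P * 300" by simp
    from this[OF 1 p(4,5)] show ?thesis unfolding p_def .
  qed
  ultimately show ?thesis unfolding pad_def seq.simps
    by (intro runsI[OF run_Seq[OF s1(1) run_Seq[OF s2(1) r3]]]) auto
qed

text \<open>Added rows play the role of the transposed right factor, so row and column indices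
  change places. The loop bound is copied to \<open>_f\<close> because the frame does not separate
  the register \<open>E\<close> from the array \<open>E\<close>, which the body writes.\<close>

definition swap_list :: com where
  "swap_list = Seq (NAssign ''_f'' (NVar ''E'')) (For ''_e'' ''_f'' (Seq (NAssign ''_w'' (NRead ''E'' (NVar ''_e'') (NLit 0)))
     (Seq (NWrite ''E'' (NVar ''_e'') (NLit 0) (NRead ''E'' (NVar ''_e'') (NLit 1))) (NWrite ''E'' (NVar ''_e'') (NLit 1) (NVar ''_w'')))))"

lemma runs_swap_list:
  assumes "holds_sparse ''E'' es st"
  shows "runs svd swap_list st (length es * 28 + 8) (holds_sparse ''E'' (map (\<lambda>(i,j,x). (j,i,x)) es))"
proof -
  define N where "N = length es"
  have h: "nvar st ''E'' = N" "\<And>l. l < N \<Longrightarrow> narr st ''E'' l 0 = fst (es ! l) \<and> narr st ''E'' l 1 = fst (snd (es ! l)) \<and> rarr st ''E'' l 0 = snd (snd (es ! l))"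
    using assms by (auto simp: holds_sparse_def N_def)
  define s1 where "s1 = effect (NAssign ''_f'' (NVar ''E'')) st"
  have r1: "run svd (NAssign ''_f'' (NVar ''E'')) st 2 s1" unfolding s1_def by (rule run_straight) auto
  have s1: "nvar s1 ''_f'' = N" "nvar s1 ''E'' = N" "narr s1 = narr st" "rarr s1 = rarr st" using h by (auto simp: s1_def)
  let ?b = "Seq (NAssign ''_w'' (NRead ''E'' (NVar ''_e'') (NLit 0)))
     (Seq (NWrite ''E'' (NVar ''_e'') (NLit 0) (NRead ''E'' (NVar ''_e'') (NLit 1))) (NWrite ''E'' (NVar ''_e'') (NLit 1) (NVar ''_w'')))"
  have "runs svd (For ''_e'' ''_f'' ?b) s1 (N * (20 + 8) + 6) (\<lambda>s'. nvar s' ''E'' = N \<and> rarr s' ''E'' = rarr st ''E'' \<and>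
     (\<forall>l<N. narr s' ''E'' l 0 = (if l < N then fst (snd (es ! l)) else fst (es ! l)) \<and>
            narr s' ''E'' l 1 = (if l < N then fst (es ! l) else fst (snd (es ! l)))))"
  proof (rule runs_For[where n = N and I = "\<lambda>q s'. nvar s' ''E'' = N \<and> rarr s' ''E'' = rarr st ''E'' \<and>
     (\<forall>l<N. narr s' ''E'' l 0 = (if l < q then fst (snd (es ! l)) else fst (es ! l)) \<and>
            narr s' ''E'' l 1 = (if l < q then fst (es ! l) else fst (snd (es ! l))))"], goal_cases)
    case (6 q s')
    show ?case by (rule runs_straight) (use 6 in \<open>auto simp: set_cell_def less_Suc_eq\<close>)
  qed (use h s1 in auto)
  hence "runs svd (For ''_e'' ''_f'' ?b) s1 (N * (20 + 8) + 6) (holds_sparse ''E'' (map (\<lambda>(i,j,x). (j,i,x)) es))"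
    by (rule runs_weaken) (use h in \<open>auto simp: holds_sparse_def N_def split: prod.splits\<close>)
  from run_runs_Seq[OF r1 this] show ?thesis unfolding swap_list_def by (rule runs_mono) (simp add: N_def)
qed

text \<open>Added columns become the left factor \<open>D\<close>; this frees \<open>E\<close> for
  the unit embedding.\<close>

definition copy_list :: com where
  "copy_list = Seq (For ''_e'' ''E'' (Seq (NWrite ''D'' (NVar ''_e'') (NLit 0) (NRead ''E'' (NVar ''_e'') (NLit 0)))
     (Seq (NWrite ''D'' (NVar ''_e'') (NLit 1) (NRead ''E'' (NVar ''_e'') (NLit 1)))
       (RWrite ''D'' (NVar ''_e'') (NLit 0) (RRead ''E'' (NVar ''_e'') (NLit 0)))))) (NAssign ''D'' (NVar ''E''))"

lemma runs_copy_list: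
  assumes "holds_sparse ''E'' es st"
  shows "runs svd copy_list st (length es * 38 + 8) (holds_sparse ''D'' es)"
proof -
  define N where "N = length es"
  let ?b = "Seq (NWrite ''D'' (NVar ''_e'') (NLit 0) (NRead ''E'' (NVar ''_e'') (NLit 0)))
     (Seq (NWrite ''D'' (NVar ''_e'') (NLit 1) (NRead ''E'' (NVar ''_e'') (NLit 1)))
       (RWrite ''D'' (NVar ''_e'') (NLit 0) (RRead ''E'' (NVar ''_e'') (NLit 0))))"
  have h: "nvar st ''E'' = N" "\<And>l. l < N \<Longrightarrow> narr st ''E'' l 0 = fst (es ! l) \<and> narr st ''E'' l 1 = fst (snd (es ! l)) \<and> rarr st ''E'' l 0 = snd (snd (es ! l))"
    using assms by (auto simp: holds_sparse_def N_def)
  have "runs svd (For ''_e'' ''E'' ?b) st (N * (30 + 8) + 6) (\<lambda>s'.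
     \<forall>l<N. narr s' ''D'' l 0 = fst (es ! l) \<and> narr s' ''D'' l 1 = fst (snd (es ! l)) \<and> rarr s' ''D'' l 0 = snd (snd (es ! l)))"
  proof (rule runs_For[where n = N and I = "\<lambda>q s'.
     \<forall>l<q. narr s' ''D'' l 0 = fst (es ! l) \<and> narr s' ''D'' l 1 = fst (snd (es ! l)) \<and> rarr s' ''D'' l 0 = snd (snd (es ! l))"], goal_cases)
    case (6 q s')
    have "narr s' ''E'' = narr st ''E''" "rarr s' ''E'' = rarr st ''E''" using agreeD[OF 6(3)] by auto
    thus ?case by (intro runs_straight) (use 6(2,4) h(2)[OF 6(1)] in \<open>auto simp: set_cell_def less_Suc_eq\<close>)
  qed (use h in auto)
  then obtain s1 where s1: "run svd (For ''_e'' ''E'' ?b) st (N * (30 + 8) + 6) s1" "agree (mods (For ''_e'' ''E'' ?b)) st s1"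
    "\<forall>l<N. narr s1 ''D'' l 0 = fst (es ! l) \<and> narr s1 ''D'' l 1 = fst (snd (es ! l)) \<and> rarr s1 ''D'' l 0 = snd (snd (es ! l))" by (rule runsE)
  have "runs svd (NAssign ''D'' (NVar ''E'')) s1 2 (holds_sparse ''D'' es)"
    by (rule runs_straight) (use s1(3) agreeD[OF s1(2)] h(1) in \<open>auto simp: holds_sparse_def N_def\<close>)
  from run_runs_Seq[OF s1(1) this] show ?thesis unfolding copy_list_def by (rule runs_mono) (simp add: N_def)
qed

definition add_rows_program :: com where
  "add_rows_program = seq [swap_list, pad ''U'' ''m'' ''D'', low_rank_update]"

definition add_cols_program :: com where
  "add_cols_program = seq [copy_list, pad ''V'' ''n'' ''E'', low_rank_update]"

lemma agree_load: "agree {x} st (load_sparse x es st)" "agree {x} st (set_nvar x v st)"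
  by (auto simp: agree_def load_sparse_def)

lemma holds_load: "holds_sparse x es (load_sparse x es st)"
  by (auto simp: holds_sparse_def load_sparse_def)

lemma represents_agree:
  assumes "represents k st U S V" "agree Y st st'" "(store_names ''U'' \<union> store_names ''V'' \<union> {''k'', ''m'', ''n'', ''Sigma''}) \<inter> Y = {}"
  shows "represents k st' U S V"
proof -
  have n: "''k'' \<notin> Y" "''m'' \<notin> Y" "''n'' \<notin> Y" "''Sigma'' \<notin> Y" "store_names ''U'' \<inter> Y = {}" "store_names ''V'' \<inter> Y = {}"
    using assms(3) by auto
  show ?thesis using assms(1) unfolding represents_def
    by (simp add: agreeD(1)[OF assms(2)] n store_agree[OF assms(2)] read_block_agree[OF assms(2)])
qed

text \<open>Zero rows leave all inner products of columns unchanged, so the padded triple is again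
  one from which the low-rank update may start.\<close>

lemma svd_triple_pad:
  assumes "svd_triple k m n U S V"
  shows "svd_triple k (m + s) n (pad_rows s U) S V" "svd_triple k m (n + s) U S (pad_rows s V)"
  using assms pad_rows_orthonormal[of U m k s] pad_rows_orthonormal[of V n k s] by (auto simp: svd_triple_def)

text \<open>The unit embedding adds at most \<open>p\<close> nonzero entries and thereby doubles the
  cubic part to 14000; padding adds 300, and rearranging the list fits into the rest of
  15000.\<close>

lemma bound_nnz:
  fixes N p :: nat
  assumes "0 < p" "a \<le> 50" "b \<le> 50"
  shows "(N * a + b) + (p ^ 3 * 300 + 7000 * ((p + N) * p ^ 2 + p ^ 3)) \<le> 15000 * (N * p ^ 2 + p ^ 3)"
proof -
  have 1: "1 \<le> p ^ 3" "1 \<le> p ^ 2" using assms by auto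
  have 2: "(p + N) * p ^ 2 = p ^ 3 + N * p ^ 2" by (simp add: power2_eq_square power3_eq_cube algebra_simps)
  have "N * a \<le> N * (p ^ 2 * 50)" using assms(2) 1(2) mult_le_mono[of 1 "p ^ 2" 50 50] by (intro mult_le_mono2) simp
  hence 3: "N * a \<le> (N * p ^ 2) * 50" by simp
  have "\<And>P Q T. T \<le> Q * 50 \<Longrightarrow> 1 \<le> P \<Longrightarrow> (T + b) + (P * 300 + 7000 * ((P + Q) + P)) \<le> 15000 * (Q + P)"
    using assms(3) by simp
  from this[OF 3 1(1)] show ?thesis unfolding 2 .
qed

lemma runs_add_rows:
  assumes svd: "valid_svd_routine svd" and k: "0 < k" and rep: "represents k st U S V"
    and E: "E \<in> carrier_mat s (dim_row V)" and es: "is_sparse_form es E"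
  shows "runs svd add_rows_program (set_nvar ''s'' s (load_sparse ''E'' es st)) (15000 * (nnz E * (s + k) ^ 2 + (s + k) ^ 3))
    (\<lambda>s'. \<exists>U' S' V'. is_truncated_svd k ((U * S * V\<^sup>T) @\<^sub>r E) U' S' V' \<and> represents k s' U' S' V')"
proof -
  define m where "m = dim_row U"
  define n where "n = dim_row V"
  define st0 where "st0 = set_nvar ''s'' s (load_sparse ''E'' es st)"
  let ?es = "map (\<lambda>(i,j,x). (j,i,x)) es"
  have a0: "agree {''E'', ''s''} st st0" unfolding st0_def by (rule agree_trans[OF agree_load]) auto
  have rep0: "represents k st0 U S V" by (rule represents_agree[OF rep a0]) (auto simp: store_names_def)
  have h0: "holds_sparse ''E'' es st0" unfolding st0_def
    using holds_load[of "''E''" es st] holds_sparse_agree[OF agree_load(2)] by simp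
  have s0: "nvar st0 ''s'' = s" by (simp add: st0_def)
  obtain s1 where s1: "run svd swap_list st0 (length es * 28 + 8) s1" "agree (mods swap_list) st0 s1" "holds_sparse ''E'' ?es s1"
    by (rule runsE[OF runs_swap_list[OF h0]])
  have a1: "agree {''_f'', ''_e'', ''_w'', ''E''} st0 s1" using s1(2) by (rule agree_mono) (auto simp: swap_list_def)
  have rep1: "represents k s1 U S V" by (rule represents_agree[OF rep0 a1]) (auto simp: store_names_def)
  have v1: "nvar s1 ''s'' = s" using agreeD[OF a1] s0 by simp
  have t1: "svd_triple k m n U S V" "nvar s1 ''k'' = k" "nvar s1 ''m'' = m" "store k m ''U'' s1 (\<lambda>i l. U $$ (i,l))"
    "nvar s1 ''n'' = n" "store k n ''V'' s1 (\<lambda>i l. V $$ (i,l))" "read_block ''Sigma'' k k s1 = S"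
    using rep1 by (auto simp: represents_def m_def n_def)
  have U: "U \<in> carrier_mat m k" and V: "V \<in> carrier_mat n k" and S: "S \<in> carrier_mat k k" using t1(1) by (auto simp: svd_triple_def)
  obtain s2 where s2: "run svd (pad ''U'' ''m'' ''D'') s1 ((s + k) ^ 3 * 300) s2" "agree (mods (pad ''U'' ''m'' ''D'')) s1 s2"
    "store k (m + s) ''U'' s2 (\<lambda>i l. pad_rows s U $$ (i,l))" "nvar s2 ''m'' = m + s" "holds_sparse ''D'' (unit_embedding_list m s) s2"
    by (rule runsE[OF runs_pad[OF _ t1(4) U t1(2) k v1 t1(3), of "''D''"]]) auto
  note a2 = agreeD[OF s2(2), unfolded mods_pad]
  have rd: "dim_row (pad_rows s U) = m + s" using U by (simp add: pad_rows_def)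
  have rep2: "represents k s2 (pad_rows s U) S V"
    unfolding represents_def rd n_def[symmetric]
    using svd_triple_pad(1)[OF t1(1)] s2(3,4) t1 a2 store_agree[OF s2(2), of "''V''"] read_block_agree[OF s2(2), of "''Sigma''"]
    by (simp add: mods_pad store_names_def)
  have h2: "holds_sparse ''E'' ?es s2" using s1(3) holds_sparse_agree[OF s2(2)] by (simp add: mods_pad)
  have D2: "unit_embedding m s \<in> carrier_mat (dim_row (pad_rows s U)) s" unfolding rd by (simp add: unit_embedding_def)
  have E2: "E\<^sup>T \<in> carrier_mat (dim_row V) s" using E by simp
  have v2: "nvar s2 ''s'' = s" using a2 v1 by simp
  have eq: "pad_rows s U * S * V\<^sup>T + unit_embedding m s * (E\<^sup>T)\<^sup>T = (U * S * V\<^sup>T) @\<^sub>r E"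
  proof -
    have c: "pad_rows s U \<in> carrier_mat (m + s) k" and VT: "V\<^sup>T \<in> carrier_mat k n"
      using U V by (auto simp: pad_rows_def)
    have e: "pad_rows s U * S * V\<^sup>T = pad_rows s U * (S * V\<^sup>T)" "U * S * V\<^sup>T = U * (S * V\<^sup>T)"
      by (rule assoc_mult_mat[OF c S VT], rule assoc_mult_mat[OF U S VT])
    have "S * V\<^sup>T \<in> carrier_mat k n" "E \<in> carrier_mat s n"
      using mult_carrier_mat[OF S(1) VT] E unfolding n_def[symmetric] by blast+
    from pad_rows_mult[OF U this] show ?thesis unfolding e transpose_transpose .
  qed
  have nz: "nnz (E\<^sup>T) = nnz E"
    using sparse_length[OF swap_sparse[OF es]] sparse_length[OF es] by simp
  have main: "runs svd low_rank_update s2 (7000 * ((s + nnz E) * (s + k) ^ 2 + (s + k) ^ 3))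
    (\<lambda>s'. \<exists>U' S' V'. is_truncated_svd k ((U * S * V\<^sup>T) @\<^sub>r E) U' S' V' \<and> represents k s' U' S' V')"
    using runs_low_rank_update[OF svd rep2 k v2 unit_embedding_list_sparse s2(5) D2 swap_sparse[OF es] h2 E2]
    unfolding eq nz nnz_unit_embedding .
  have b: "(length es * 28 + 8) + ((s + k) ^ 3 * 300 + 7000 * ((s + nnz E) * (s + k) ^ 2 + (s + k) ^ 3)) \<le> 15000 * (nnz E * (s + k) ^ 2 + (s + k) ^ 3)"
  proof -
    have "7000 * ((s + nnz E) * (s + k) ^ 2 + (s + k) ^ 3) \<le> 7000 * (((s + k) + nnz E) * (s + k) ^ 2 + (s + k) ^ 3)" by simp
    hence "(nnz E * 28 + 8) + ((s + k) ^ 3 * 300 + 7000 * ((s + nnz E) * (s + k) ^ 2 + (s + k) ^ 3))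
      \<le> (nnz E * 28 + 8) + ((s + k) ^ 3 * 300 + 7000 * (((s + k) + nnz E) * (s + k) ^ 2 + (s + k) ^ 3))"
      by (intro add_left_mono)
    also have "\<dots> \<le> 15000 * (nnz E * (s + k) ^ 2 + (s + k) ^ 3)" by (rule bound_nnz) (use k in auto)
    finally show ?thesis unfolding sparse_length[OF es] .
  qed
  show ?thesis unfolding add_rows_program_def seq.simps st0_def[symmetric]
    by (rule runs_mono[OF run_runs_Seq[OF s1(1) run_runs_Seq[OF s2(1) main]] b])
qed

lemma runs_add_cols:
  assumes svd: "valid_svd_routine svd" and k: "0 < k" and rep: "represents k st U S V"
    and E: "E \<in> carrier_mat (dim_row U) s" and es: "is_sparse_form es E"
  shows "runs svd add_cols_program (set_nvar ''s'' s (load_sparse ''E'' es st)) (15000 * (nnz E * (s + k) ^ 2 + (s + k) ^ 3))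
    (\<lambda>s'. \<exists>U' S' V'. is_truncated_svd k (append_cols (U * S * V\<^sup>T) E) U' S' V' \<and> represents k s' U' S' V')"
proof -
  define m where "m = dim_row U"
  define n where "n = dim_row V"
  define st0 where "st0 = set_nvar ''s'' s (load_sparse ''E'' es st)"
  have a0: "agree {''E'', ''s''} st st0" unfolding st0_def by (rule agree_trans[OF agree_load]) auto
  have rep0: "represents k st0 U S V" by (rule represents_agree[OF rep a0]) (auto simp: store_names_def)
  have h0: "holds_sparse ''E'' es st0" unfolding st0_def
    using holds_load[of "''E''" es st] holds_sparse_agree[OF agree_load(2)] by simp
  have s0: "nvar st0 ''s'' = s" by (simp add: st0_def)
  obtain s1 where s1: "run svd copy_list st0 (length es * 38 + 8) s1" "agree (mods copy_list) st0 s1" "holds_sparse ''D'' es s1"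
    by (rule runsE[OF runs_copy_list[OF h0]])
  have a1: "agree {''_e'', ''D''} st0 s1" using s1(2) by (rule agree_mono) (auto simp: copy_list_def)
  have rep1: "represents k s1 U S V" by (rule represents_agree[OF rep0 a1]) (auto simp: store_names_def)
  have v1: "nvar s1 ''s'' = s" using agreeD[OF a1] s0 by simp
  have t1: "svd_triple k m n U S V" "nvar s1 ''k'' = k" "nvar s1 ''m'' = m" "store k m ''U'' s1 (\<lambda>i l. U $$ (i,l))"
    "nvar s1 ''n'' = n" "store k n ''V'' s1 (\<lambda>i l. V $$ (i,l))" "read_block ''Sigma'' k k s1 = S"
    using rep1 by (auto simp: represents_def m_def n_def)
  have U: "U \<in> carrier_mat m k" and V: "V \<in> carrier_mat n k" and S: "S \<in> carrier_mat k k" "S\<^sup>T = S"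
  proof -
    show "U \<in> carrier_mat m k" "V \<in> carrier_mat n k" "S \<in> carrier_mat k k" using t1(1) by (auto simp: svd_triple_def)
    thus "S\<^sup>T = S" using t1(1) diagonal_mat_dg[of S k] dg_transpose by (metis svd_triple_def)
  qed
  obtain s2 where s2: "run svd (pad ''V'' ''n'' ''E'') s1 ((s + k) ^ 3 * 300) s2" "agree (mods (pad ''V'' ''n'' ''E'')) s1 s2"
    "store k (n + s) ''V'' s2 (\<lambda>i l. pad_rows s V $$ (i,l))" "nvar s2 ''n'' = n + s" "holds_sparse ''E'' (unit_embedding_list n s) s2"
    by (rule runsE[OF runs_pad[OF _ t1(6) V t1(2) k v1 t1(5), of "''E''"]]) auto
  note a2 = agreeD[OF s2(2), unfolded mods_pad]
  have rd: "dim_row (pad_rows s V) = n + s" using V by (simp add: pad_rows_def)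
  have rep2: "represents k s2 U S (pad_rows s V)"
    unfolding represents_def rd m_def[symmetric]
    using svd_triple_pad(2)[OF t1(1)] s2(3,4) t1 a2 store_agree[OF s2(2), of "''U''"] read_block_agree[OF s2(2), of "''Sigma''"]
    by (simp add: mods_pad store_names_def)
  have h2: "holds_sparse ''D'' es s2" using s1(3) holds_sparse_agree[OF s2(2)] by (simp add: mods_pad)
  have E2: "unit_embedding n s \<in> carrier_mat (dim_row (pad_rows s V)) s" unfolding rd by (simp add: unit_embedding_def)
  have v2: "nvar s2 ''s'' = s" using a2 v1 by simp
  \<comment> \<open>Since \<open>S\<close> is symmetric, transposing turns this into the statement
    about appended rows.\<close>
  have eq: "U * S * (pad_rows s V)\<^sup>T + E * (unit_embedding n s)\<^sup>T = append_cols (U * S * V\<^sup>T) E"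
  proof -
    have c: "pad_rows s V \<in> carrier_mat (n + s) k" "unit_embedding n s \<in> carrier_mat (n + s) s" using V by (auto simp: pad_rows_def unit_embedding_def)
    have E': "E \<in> carrier_mat m s" using E unfolding m_def .
    have "(U * S * (pad_rows s V)\<^sup>T + E * (unit_embedding n s)\<^sup>T)\<^sup>T = (U * S * (pad_rows s V)\<^sup>T)\<^sup>T + (E * (unit_embedding n s)\<^sup>T)\<^sup>T"
      by (rule transpose_add[of _ m "n + s"]) (use c U S E' in auto)
    also have "\<dots> = pad_rows s V * (S * U\<^sup>T) + unit_embedding n s * E\<^sup>T"
      using c U S E' by (simp add: mat_simps)
    also have "\<dots> = (V * (S * U\<^sup>T)) @\<^sub>r E\<^sup>T"
      by (rule pad_rows_mult[OF V]) (use U S E' in auto)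
    also have "V * (S * U\<^sup>T) = (U * S * V\<^sup>T)\<^sup>T" using U S V by (simp add: mat_simps)
    finally have "(U * S * (pad_rows s V)\<^sup>T + E * (unit_embedding n s)\<^sup>T) = ((U * S * V\<^sup>T)\<^sup>T @\<^sub>r E\<^sup>T)\<^sup>T"
      by (metis transpose_transpose)
    moreover have "U * S * V\<^sup>T \<in> carrier_mat m n" using U V by (intro carrier_matI) simp_all
    ultimately show ?thesis using append_cols_transpose[of "U * S * V\<^sup>T" m n E s] E' by simp
  qed
  have main: "runs svd low_rank_update s2 (7000 * ((nnz E + s) * (s + k) ^ 2 + (s + k) ^ 3))
    (\<lambda>s'. \<exists>U' S' V'. is_truncated_svd k (append_cols (U * S * V\<^sup>T) E) U' S' V' \<and> represents k s' U' S' V')"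
    using runs_low_rank_update[OF svd rep2 k v2 es h2 E unit_embedding_list_sparse s2(5) E2]
    unfolding eq nnz_unit_embedding .
  have b: "(length es * 38 + 8) + ((s + k) ^ 3 * 300 + 7000 * ((nnz E + s) * (s + k) ^ 2 + (s + k) ^ 3)) \<le> 15000 * (nnz E * (s + k) ^ 2 + (s + k) ^ 3)"
  proof -
    have "7000 * ((nnz E + s) * (s + k) ^ 2 + (s + k) ^ 3) \<le> 7000 * (((s + k) + nnz E) * (s + k) ^ 2 + (s + k) ^ 3)" by simp
    hence "(nnz E * 38 + 8) + ((s + k) ^ 3 * 300 + 7000 * ((nnz E + s) * (s + k) ^ 2 + (s + k) ^ 3))
      \<le> (nnz E * 38 + 8) + ((s + k) ^ 3 * 300 + 7000 * (((s + k) + nnz E) * (s + k) ^ 2 + (s + k) ^ 3))"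
      by (intro add_left_mono)
    also have "\<dots> \<le> 15000 * (nnz E * (s + k) ^ 2 + (s + k) ^ 3)" by (rule bound_nnz) (use k in auto)
    finally show ?thesis unfolding sparse_length[OF es] .
  qed
  show ?thesis unfolding add_cols_program_def seq.simps st0_def[symmetric]
    by (rule runs_mono[OF run_runs_Seq[OF s1(1) run_runs_Seq[OF s2(1) main]] b])
qed

section \<open>Queries\<close>

definition query :: "string \<Rightarrow> com" where
  "query X = Seq (NAssign ''_r'' (NVar ''i'')) (get X)"

lemma runs_query:
  assumes k: "0 < k" and rep: "represents k st U S V" and X: "X = ''U'' \<and> Z = U \<or> X = ''V'' \<and> Z = V" and i: "i < dim_row Z"
  shows "runs svd (query X) (set_nvar ''i'' i st) (15000 * k ^ 2)
    (\<lambda>s'. query_answer k s' = (row Z i, S) \<and> represents k s' U S V)"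
proof -
  define st0 where "st0 = set_nvar ''i'' i st"
  define s1 where "s1 = effect (NAssign ''_r'' (NVar ''i'')) st0"
  have r1: "run svd (NAssign ''_r'' (NVar ''i'')) st0 2 s1" unfolding s1_def by (rule run_straight) auto
  have a1: "agree {''i'', ''_r''} st s1" by (auto simp: s1_def st0_def agree_def)
  have rep1: "represents k s1 U S V" by (rule represents_agree[OF rep a1]) (auto simp: store_names_def)
  have st1: "store k (dim_row Z) X s1 (\<lambda>i l. Z $$ (i,l))" and k1: "nvar s1 ''k'' = k" and i1: "nvar s1 ''_r'' = i"
    and Zk: "dim_col Z = k"
    using rep1 X by (auto simp: represents_def s1_def st0_def svd_triple_def)
  have "runs svd (get X) s1 (k ^ 2 * 1000) (\<lambda>s'. query_answer k s' = (row Z i, S) \<and> represents k s' U S V)"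
  proof (rule runs_weaken[OF runs_get[OF st1 k1 k i1 i]])
    fix s' assume r: "\<forall>l<k. rarr s' ''row'' 0 l = Z $$ (i,l)" and a: "agree (mods (get X)) s1 s'"
    have rep': "represents k s' U S V" by (rule represents_agree[OF rep1 a]) (auto simp: mods_get store_names_def)
    have "row (read_block ''row'' 1 k s') 0 = row Z i"
      using r Zk i by (intro eq_vecI) auto
    thus "query_answer k s' = (row Z i, S) \<and> represents k s' U S V"
      using rep' by (simp add: query_answer_def represents_def)
  qed simp
  from run_runs_Seq[OF r1 this] have "runs svd (query X) st0 (2 + k ^ 2 * 1000) (\<lambda>s'. query_answer k s' = (row Z i, S) \<and> represents k s' U S V)"
    by (simp add: query_def)
  moreover have "1 \<le> k ^ 2" using k by simp
  ultimately show ?thesis unfolding st0_def by (elim runs_mono) simp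
qed

section \<open>Starting from a given triple\<close>

definition identity_block :: "string \<Rightarrow> com" where
  "identity_block a = Fill a ''k'' ''k'' (If (BAnd (BNot (NLess (NVar ''_i'') (NVar ''_j''))) (BNot (NLess (NVar ''_j'') (NVar ''_i''))))
             (RAssign ''_a'' (RLit 1)) (RAssign ''_a'' (RLit 0))) (RVar ''_a'')"

definition start_store :: "string \<Rightarrow> string \<Rightarrow> com" where
  "start_store X m = seq [Fill (CHR ''x'' # X) m ''k'' Skip (RRead X (NVar ''_i'') (NVar ''_j'')),
     identity_block (CHR ''W'' # X), identity_block (CHR ''w'' # X)]"

lemma mods_start_store: "mods (start_store X m) = {''_i'', ''_j'', ''_a'', CHR ''x'' # X, CHR ''W'' # X, CHR ''w'' # X}"
  by (auto simp: start_store_def identity_block_def)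

lemma runs_identity_block:
  assumes "nvar st ''k'' = k" "0 < k" "a \<notin> {''_i'', ''_j'', ''_l'', ''_a'', ''k''}"
  shows "runs svd (identity_block a) st (k * k * 85 + 6)
    (\<lambda>s'. \<forall>i j. rarr s' a i j = (if i < k \<and> j < k then if i = j then 1 else 0 else rarr st a i j))"
  unfolding identity_block_def by (rule runs_Fill_straight) (use assms in auto)

text \<open>Zeros in \<open>T\<close>, \<open>b\<close>, \<open>h\<close> and \<open>t\<close>
  already encode an empty history with every row stamped at time 0, so only the coordinates and the
  two identity matrices have to be written. No time bound is claimed for the start.\<close>

lemma runs_start_store:
  assumes m: "nvar st m = r" "m \<in> {''m'', ''n''}" and k: "nvar st ''k'' = k" "0 < k"
    and X: "X \<in> {''U'', ''V''}" and U: "\<And>i l. i < r \<Longrightarrow> l < k \<Longrightarrow> rarr st X i l = U $$ (i,l)"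
    and z: "nvar st (CHR ''T'' # X) = 0" "\<And>i j. narr st (CHR ''b'' # X) i j = 0" "\<And>i j. narr st (CHR ''h'' # X) i j = 0"
      "\<And>i j. narr st (CHR ''t'' # X) i j = 0"
  shows "\<exists>B. runs svd (start_store X m) st B (\<lambda>s'. store k r X s' (\<lambda>i l. U $$ (i,l)))"
proof -
  let ?c1 = "Fill (CHR ''x'' # X) m ''k'' Skip (RRead X (NVar ''_i'') (NVar ''_j''))"
  have Xn: "X \<noteq> CHR ''_'' # x" "CHR ''_'' # x \<noteq> X" "m \<noteq> CHR ''_'' # x" "CHR ''_'' # x \<noteq> m" "m \<noteq> CHR ''x'' # X" "m \<noteq> CHR ''W'' # X" for x using X m by auto
  have "runs svd ?c1 st (r * k * 85 + 6) (\<lambda>s'. \<forall>i j. rarr s' (CHR ''x'' # X) i j = (if i < r \<and> j < k then rarr st X i j else rarr st (CHR ''x'' # X) i j))"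
  proof (rule runs_Fill_straight, goal_cases)
    case (13 i j s)
    thus ?case using agreeD[OF 13(3)] Xn by simp
  qed (use m k Xn in auto)
  then obtain s1 where s1: "run svd ?c1 st (r * k * 85 + 6) s1" "agree (mods ?c1) st s1"
    "\<forall>i j. rarr s1 (CHR ''x'' # X) i j = (if i < r \<and> j < k then rarr st X i j else rarr st (CHR ''x'' # X) i j)" by (rule runsE)
  have k1: "nvar s1 ''k'' = k" using agreeD[OF s1(2)] k by simp
  obtain s2 where s2: "run svd (identity_block (CHR ''W'' # X)) s1 (k * k * 85 + 6) s2" "agree (mods (identity_block (CHR ''W'' # X))) s1 s2"
    "\<forall>i j. rarr s2 (CHR ''W'' # X) i j = (if i < k \<and> j < k then if i = j then 1 else 0 else rarr s1 (CHR ''W'' # X) i j)"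
    by (rule runsE[OF runs_identity_block[OF k1 k(2), of "CHR ''W'' # X"]]) auto
  have k2: "nvar s2 ''k'' = k" using agreeD[OF s2(2)] k1 by (simp add: identity_block_def)
  obtain s3 where s3: "run svd (identity_block (CHR ''w'' # X)) s2 (k * k * 85 + 6) s3" "agree (mods (identity_block (CHR ''w'' # X))) s2 s3"
    "\<forall>i j. rarr s3 (CHR ''w'' # X) i j = (if i < k \<and> j < k then if i = j then 1 else 0 else rarr s2 (CHR ''w'' # X) i j)"
    by (rule runsE[OF runs_identity_block[OF k2 k(2), of "CHR ''w'' # X"]]) auto
  have a3: "agree (mods (start_store X m)) st s3"
    by (rule agree_trans[OF agree_trans[OF s1(2) s2(2) subset_refl] s3(2)]) (auto simp: mods_start_store identity_block_def)
  note a3' = agreeD[OF a3, unfolded mods_start_store]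
  have x3: "rarr s3 (CHR ''x'' # X) = rarr s1 (CHR ''x'' # X)" "rarr s3 (CHR ''W'' # X) = rarr s2 (CHR ''W'' # X)"
    using agreeD[OF s2(2)] agreeD[OF s3(2)] by (auto simp: identity_block_def)
  have "store k r X s3 (\<lambda>i l. U $$ (i,l))"
    unfolding store_def store_history_def Let_def history_def next_pointers_def
  proof (intro conjI allI impI)
    fix i j assume ij: "i < k" "j < k"
    have "(\<Sum>l<k. rarr s3 (CHR ''w'' # X) i l * rarr s3 (CHR ''W'' # X) l j) = (\<Sum>l<k. if l = i then if i = j then 1 else 0 else 0)"
      using s3(3) s2(3) x3 ij by (intro sum.cong) auto
    thus "(\<Sum>l<k. rarr s3 (CHR ''w'' # X) i l * rarr s3 (CHR ''W'' # X) l j) = (if i = j then 1 else 0)" using ij by simp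
  next
    fix i l assume il: "i < r" "l < k"
    have "(\<Sum>j<k. rarr s3 (CHR ''x'' # X) i j * rarr s3 (CHR ''W'' # X) j l) = (\<Sum>j<k. if j = l then U $$ (i,l) else 0)"
      using s1(3) s2(3) x3 il U by (intro sum.cong) auto
    thus "U $$ (i, l) = (\<Sum>j<k. replay (\<lambda>e. narr s3 (CHR ''c'' # X) e 0) (rarr s3 (CHR ''y'' # X)) (narr s3 (CHR ''t'' # X) i 0)
              (nvar s3 (CHR ''T'' # X)) (rarr s3 (CHR ''x'' # X) i) j * rarr s3 (CHR ''W'' # X) j l)"
      using il z(1) by (simp add: a3')
  qed (use z in \<open>auto simp: a3'\<close>)
  with run_Seq[OF s1(1) run_Seq[OF s2(1) s3(1)]] show ?thesis
    unfolding start_store_def seq.simps by (intro exI runsI) auto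
qed

definition start_program :: com where
  "start_program = Seq (start_store ''U'' ''m'') (start_store ''V'' ''n'')"

lemma runs_start:
  assumes k: "0 < k" and tr: "svd_triple k m n U S V"
  shows "\<exists>B. runs svd start_program (start_state k m n U S V) B (\<lambda>s'. represents k s' U S V)"
proof -
  define st where "st = start_state k m n U S V"
  have dims: "dim_row U = m" "dim_col U = k" "dim_row V = n" "dim_col V = k" "dim_row S = k" "dim_col S = k"
    using tr by (auto simp: svd_triple_def)
  have n0: "nvar st x = (if x = ''k'' then k else if x = ''m'' then m else if x = ''n'' then n else 0)" for x
    by (simp add: st_def start_state_def write_block_def blank_state_def)
  have a0: "narr st x i j = 0" for x i j
    by (simp add: st_def start_state_def write_block_def blank_state_def)
  have U0: "rarr st ''U'' i l = U $$ (i,l)" if "i < m" "l < k" for i l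
    using that dims by (simp add: st_def start_state_def write_block_def)
  have V0: "rarr st ''V'' i l = V $$ (i,l)" if "i < n" "l < k" for i l
    using that dims by (simp add: st_def start_state_def write_block_def)
  have S0: "read_block ''Sigma'' k k st = S"
    using dims by (intro read_block_eqI carrier_matI) (simp_all add: st_def start_state_def write_block_def)
  obtain B1 where "runs svd (start_store ''U'' ''m'') st B1 (\<lambda>s'. store k m ''U'' s' (\<lambda>i l. U $$ (i,l)))"
    using runs_start_store[of st "''m''" m k "''U''" U svd] n0 a0 U0 k by auto
  then obtain s1 where s1: "run svd (start_store ''U'' ''m'') st B1 s1" "agree (mods (start_store ''U'' ''m'')) st s1"
    "store k m ''U'' s1 (\<lambda>i l. U $$ (i,l))" by (rule runsE)
  note a1 = agreeD[OF s1(2), unfolded mods_start_store]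
  have "\<exists>B. runs svd (start_store ''V'' ''n'') s1 B (\<lambda>s'. store k n ''V'' s' (\<lambda>i l. V $$ (i,l)))"
    by (rule runs_start_store) (simp_all add: a1 n0 a0 V0 k)
  then obtain B2 where "runs svd (start_store ''V'' ''n'') s1 B2 (\<lambda>s'. store k n ''V'' s' (\<lambda>i l. V $$ (i,l)))" ..
  then obtain s2 where s2: "run svd (start_store ''V'' ''n'') s1 B2 s2" "agree (mods (start_store ''V'' ''n'')) s1 s2"
    "store k n ''V'' s2 (\<lambda>i l. V $$ (i,l))" by (rule runsE)
  note a2 = agreeD[OF s2(2), unfolded mods_start_store]
  have "represents k s2 U S V"
    unfolding represents_def dims
  proof (intro conjI)
    show "svd_triple k m n U S V" by (rule tr)
    show "nvar s2 ''k'' = k" "nvar s2 ''m'' = m" "nvar s2 ''n'' = n" by (simp_all add: a2 a1 n0)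
    show "store k m ''U'' s2 (\<lambda>i l. U $$ (i,l))" using s1(3) store_agree[OF s2(2)] by (simp add: mods_start_store store_names_def)
    show "store k n ''V'' s2 (\<lambda>i l. V $$ (i,l))" by (rule s2(3))
    have "read_block ''Sigma'' k k s2 = read_block ''Sigma'' k k st" by (simp add: read_block_def a2 a1)
    thus "read_block ''Sigma'' k k s2 = S" using S0 by simp
  qed
  with run_Seq[OF s1(1) s2(1)] show ?thesis unfolding start_program_def st_def[symmetric]
    by (intro exI runsI) auto
qed

text \<open>Neither the programs nor the constant depend on \<open>k\<close> or on the SVD routine;
  only the representation relation mentions \<open>k\<close>, which the programs read from a
  register.\<close>

lemma data_structure:
  assumes svd: "valid_svd_routine svd" and k: "0 < k"
  shows "implements_start svd k (represents k) start_program" "implements_add_rows svd 15000 k (represents k) add_rows_program"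
    "implements_add_cols svd 15000 k (represents k) add_cols_program" "implements_update_weights svd 15000 k (represents k) low_rank_update"
    "implements_query_U svd 15000 k (represents k) (query ''U'')" "implements_query_V svd 15000 k (represents k) (query ''V'')"
proof -
  show "implements_start svd k (represents k) start_program"
    using runs_start[OF k] unfolding implements_start_def runs_def by blast
  show "implements_add_rows svd 15000 k (represents k) add_rows_program"
    using runs_add_rows[OF svd k] unfolding implements_add_rows_def runs_def by metis
  show "implements_add_cols svd 15000 k (represents k) add_cols_program"
    using runs_add_cols[OF svd k] unfolding implements_add_cols_def runs_def by metis
  show "implements_update_weights svd 15000 k (represents k) low_rank_update"
    unfolding implements_update_weights_def
  proof (intro allI impI, elim conjE)
    fix st U S V s D ds E es
    assume rep: "represents k st U S V" and D: "D \<in> carrier_mat (dim_row U) s" "is_sparse_form ds D"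
      and E: "E \<in> carrier_mat (dim_row V) s" "is_sparse_form es E"
    define st0 where "st0 = set_nvar ''s'' s (load_sparse ''D'' ds (load_sparse ''E'' es st))"
    have a1: "agree {''D''} (load_sparse ''E'' es st) (load_sparse ''D'' ds (load_sparse ''E'' es st))"
      and a2: "agree {''s''} (load_sparse ''D'' ds (load_sparse ''E'' es st)) st0"
      unfolding st0_def by (rule agree_load)+
    have a3: "agree {''E'', ''D'', ''s''} st st0"
      by (rule agree_trans[OF agree_trans[OF agree_load(1) a1 subset_refl] a2]) auto
    have rep0: "represents k st0 U S V" by (rule represents_agree[OF rep a3]) (auto simp: store_names_def)
    have h: "holds_sparse ''D'' ds st0" "holds_sparse ''E'' es st0"
      using holds_load holds_sparse_agree[OF a1, of "''E''" es] holds_sparse_agree[OF a2, of "''E''" es] holds_sparse_agree[OF a2, of "''D''" ds]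
      by auto
    have s0: "nvar st0 ''s'' = s" by (simp add: st0_def)
    from runs_low_rank_update[OF svd rep0 k s0 D(2) h(1) D(1) E(2) h(2) E(1)]
    have "runs svd low_rank_update st0 (15000 * ((nnz D + nnz E) * (s + k)\<^sup>2 + (s + k) ^ 3))
      (\<lambda>s'. \<exists>U' S' V'. is_truncated_svd k (U * S * V\<^sup>T + D * E\<^sup>T) U' S' V' \<and> represents k s' U' S' V')"
      by (rule runs_mono) simp
    thus "\<exists>t st' U' S' V'. exec svd low_rank_update (set_nvar ''s'' s (load_sparse ''D'' ds (load_sparse ''E'' es st))) t st' \<and>
          t \<le> 15000 * ((nnz D + nnz E) * (s + k)\<^sup>2 + (s + k) ^ 3) \<and>
          is_truncated_svd k (U * S * V\<^sup>T + D * E\<^sup>T) U' S' V' \<and> represents k st' U' S' V'"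
      unfolding runs_def st0_def by blast
  qed
  show "implements_query_U svd 15000 k (represents k) (query ''U'')"
    using runs_query[OF k, of _ _ _ _ "''U''"] unfolding implements_query_U_def runs_def by blast
  show "implements_query_V svd 15000 k (represents k) (query ''V'')"
    using runs_query[OF k, of _ _ _ _ "''V''"] unfolding implements_query_V_def runs_def by blast
qed

theorem theorem1:
  shows "\<exists>(start :: com) (add_rows :: com) (add_cols :: com) (update_weights :: com)
           (query_U :: com) (query_V :: com) (C :: nat).
    \<forall>(svd :: svd_routine) (k :: nat). valid_svd_routine svd \<longrightarrow> 0 < k \<longrightarrow>
      (\<exists>Rep :: state \<Rightarrow> real mat \<Rightarrow> real mat \<Rightarrow> real mat \<Rightarrow> bool.
         implements_start svd k Rep start \<and>
         implements_add_rows svd C k Rep add_rows \<and>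
         implements_add_cols svd C k Rep add_cols \<and>
         implements_update_weights svd C k Rep update_weights \<and>
         implements_query_U svd C k Rep query_U \<and>
         implements_query_V svd C k Rep query_V)"
proof (rule exI[of _ start_program], rule exI[of _ add_rows_program], rule exI[of _ add_cols_program],
    rule exI[of _ low_rank_update], rule exI[of _ "query ''U''"], rule exI[of _ "query ''V''"],
    rule exI[of _ 15000], intro allI impI)
  fix svd :: svd_routine and k :: nat
  assume "valid_svd_routine svd" "0 < k"
  from data_structure[OF this] show "\<exists>Rep. implements_start svd k Rep start_program \<and>
      implements_add_rows svd 15000 k Rep add_rows_program \<and>
      implements_add_cols svd 15000 k Rep add_cols_program \<and>
      implements_update_weights svd 15000 k Rep low_rank_update \<and>
      implements_query_U svd 15000 k Rep (query ''U'') \<and>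
      implements_query_V svd 15000 k Rep (query ''V'')"
    by blast
qed

end
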